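(* Let $N\ge 2$ and $m>0$, and let $f\in C^1(\mathbb{R})$ with $f(t)=0$ for $t<0$. Suppose that $\lim_{t\to 0}\frac{f(t)}{t}=0$ and that $\lim_{t\to\infty}\frac{f(t)}{t^{p}}=0$ for some $p\in\left(1,\frac{N+1}{N-1}\right)$. Then any solution $v$ (in the weak sense, $v\in H^1(\mathbb{R}^{N+1}_+)$) of the problem $$-\Delta v+m^2v=0\ \text{ in }\mathbb{R}^{N+1}_+,\qquad -\frac{\partial v}{\partial x}(0,y)=f(v(0,y)),\quad y\in\mathbb{R}^N,$$ satisfies $$v\in C^{1,\alpha}(\mathbb{R}^{N+1}_+)\cap C^2(\mathbb{R}^{N+1}_+)$$ and therefore is a classical solution of this problem.
   Context: Points of $\mathbb{R}^{N+1}_+=(0,\infty)\times\mathbb{R}^N$ are written $(x,y)$ with $x\in(0,\infty)$ and $y\in\mathbb{R}^N$. $H^1(\mathbb{R}^{N+1}_+)$ is the space of $u\in L^2(\mathbb{R}^{N+1}_+)$ with $\iint_{\mathbb{R}^{N+1}_+}|\nabla u|^2\,dx\,dy<\infty$, and $\gamma:H^1(\mathbb{R}^{N+1}_+)\to H^{1/2}(\mathbb{R}^N)$ denotes the trace operator on $\{x=0\}$ (the trace of $v$ is also written $v(0,\cdot)$). A weak solution is a function $v\in H^1(\mathbb{R}^{N+1}_+)$ with $\iint_{\mathbb{R}^{N+1}_+}[\nabla v\cdot\nabla\varphi+m^2v\varphi]\,dx\,dy=\int_{\mathbb{R}^N}f(\gamma(v))\gamma(\varphi)\,dy$ for all $\varphi\in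 H^1(\mathbb{R}^{N+1}_+)$. $C^{1,\alpha}$ denotes the Hölder space of $C^1$ functions whose first derivatives are Hölder continuous with exponent $\alpha\in(0,1)$; the statement does not quantify $\alpha$ further. *)

theory Defs
  imports "HOL-Analysis.Analysis"
begin

text \<open>Points of the half space are pairs \<open>(x, y)\<close> with \<open>x :: real\<close> and \<open>y :: real^'n\<close>, so that
  \<open>N = CARD('n)\<close>. The product type carries the Euclidean inner product and its Lebesgue measure
  is the product measure.\<close>

definition half_space :: "(real \<times> (real ^ 'n)) set" where
  "half_space = {0<..} \<times> UNIV"

definition closed_half_space :: "(real \<times> (real ^ 'n)) set" where
  "closed_half_space = {0..} \<times> UNIV"


section \<open>Spaces of differentiable functions\<close>

text \<open>Meant for open \<open>S\<close> only: the derivatives are unrestricted (\<open>at z\<close>, not \<open>at z within S\<close>).\<close>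

fun Ck_on :: "nat \<Rightarrow> ('a::euclidean_space \<Rightarrow> real) \<Rightarrow> 'a set \<Rightarrow> bool" where
  "Ck_on 0 u S \<longleftrightarrow> continuous_on S u"
| "Ck_on (Suc k) u S \<longleftrightarrow> (\<forall>z\<in>S. u differentiable (at z)) \<and>
     (\<forall>h. Ck_on k (\<lambda>z. frechet_derivative u (at z) h) S)"

definition gradient :: "('a::euclidean_space \<Rightarrow> real) \<Rightarrow> 'a \<Rightarrow> 'a" where
  "gradient u z = (\<Sum>b\<in>Basis. frechet_derivative u (at z) b *\<^sub>R b)"

definition laplacian :: "('a::euclidean_space \<Rightarrow> real) \<Rightarrow> 'a \<Rightarrow> real" where
  "laplacian u z =
     (\<Sum>b\<in>Basis. frechet_derivative (\<lambda>z'. frechet_derivative u (at z') b) (at z) b)"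

text \<open>Derivatives relative to \<open>S\<close>, so that \<open>C1_gradient_on closed_half_space u G\<close> means \<open>C\<^sup>1\<close>
  up to the boundary. On both half spaces the relative gradient is unique.\<close>

definition C1_gradient_on ::
    "'a::euclidean_space set \<Rightarrow> ('a \<Rightarrow> real) \<Rightarrow> ('a \<Rightarrow> 'a) \<Rightarrow> bool" where
  "C1_gradient_on S u G \<longleftrightarrow>
     (\<forall>z\<in>S. (u has_derivative (\<lambda>h. G z \<bullet> h)) (at z within S)) \<and> continuous_on S G"

text \<open>The Hoelder constant is uniform on all of \<open>S\<close>.\<close>

definition C1_holder_on :: "real \<Rightarrow> ('a::euclidean_space \<Rightarrow> real) \<Rightarrow> 'a set \<Rightarrow> bool" where
  "C1_holder_on \<alpha> u S \<longleftrightarrow>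
     (\<exists>G. C1_gradient_on S u G \<and>
       (\<exists>C. \<forall>z\<in>S. \<forall>z'\<in>S. norm (G z - G z') \<le> C * dist z z' powr \<alpha>))"

definition test_function :: "'a::euclidean_space set \<Rightarrow> ('a \<Rightarrow> real) \<Rightarrow> bool" where
  "test_function S \<phi> \<longleftrightarrow>
     (\<forall>k. Ck_on k \<phi> UNIV) \<and> (\<exists>K. compact K \<and> K \<subseteq> S \<and> (\<forall>z. z \<notin> K \<longrightarrow> \<phi> z = 0))"


section \<open>Sobolev space and trace\<close>

definition square_integrable_on ::
    "'a::euclidean_space set \<Rightarrow> ('a \<Rightarrow> 'b::euclidean_space) \<Rightarrow> bool" where
  "square_integrable_on S u \<longleftrightarrow>
     u \<in> borel_measurable (lebesgue_on S) \<and> integrable (lebesgue_on S) (\<lambda>z. (norm (u z))\<^sup>2)"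

text \<open>\<open>u \<in> H\<^sup>1(S)\<close> with weak gradient \<open>G\<close>; elements of Sobolev spaces are represented by functions,
  and \<open>G\<close> is determined up to null sets.\<close>

definition H1_gradient ::
    "'a::euclidean_space set \<Rightarrow> ('a \<Rightarrow> real) \<Rightarrow> ('a \<Rightarrow> 'a) \<Rightarrow> bool" where
  "H1_gradient S u G \<longleftrightarrow>
     square_integrable_on S u \<and> square_integrable_on S G \<and>
     (\<forall>\<phi>. test_function S \<phi> \<longrightarrow>
       (\<forall>b\<in>Basis. (LINT z|lebesgue_on S. u z * (gradient \<phi> z \<bullet> b))
                 = - (LINT z|lebesgue_on S. (G z \<bullet> b) * \<phi> z)))"

definition H1 :: "'a::euclidean_space set \<Rightarrow> ('a \<Rightarrow> real) set" where
  "H1 S = {u. \<exists>G. H1_gradient S u G}"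

text \<open>The graph of the trace operator \<open>\<gamma>\<close>, i.e. of the continuous extension of
  \<open>\<phi> \<mapsto> \<phi>(0,\<cdot>)\<close> from restrictions of \<open>C\<^sub>c\<^sup>\<infinity>\<close> functions on the whole space, which are dense in
  \<open>H\<^sup>1(half_space)\<close>. Convergence of the boundary values is taken in \<open>L\<^sup>2\<close>, into which \<open>H\<^sup>1\<^sup>/\<^sup>2\<close>
  embeds; this already determines the trace (up to null sets).\<close>

definition has_trace ::
    "(real \<times> (real ^ 'n) \<Rightarrow> real) \<Rightarrow> (real ^ 'n \<Rightarrow> real) \<Rightarrow> bool" where
  "has_trace u g \<longleftrightarrow>
     square_integrable_on UNIV g \<and>
     (\<exists>G \<phi>. H1_gradient half_space u G \<and> (\<forall>k::nat. test_function UNIV (\<phi> k)) \<and>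
       (\<lambda>k. LINT z|lebesgue_on half_space.
          (u z - \<phi> k z)\<^sup>2 + (norm (G z - gradient (\<phi> k) z))\<^sup>2) \<longlonglongrightarrow> 0 \<and>
       (\<lambda>k. LINT y|lebesgue. (g y - \<phi> k (0, y))\<^sup>2) \<longlonglongrightarrow> 0)"


section \<open>The boundary value problem\<close>

text \<open>The weak gradients and traces of \<open>v\<close> and \<open>\<phi>\<close> exist and are unique up to null sets, so the
  choice of quantifiers for them is immaterial.\<close>

definition weak_solution ::
    "real \<Rightarrow> (real \<Rightarrow> real) \<Rightarrow> (real \<times> (real ^ 'n) \<Rightarrow> real) \<Rightarrow> bool" where
  "weak_solution m f v \<longleftrightarrow>
     (\<exists>Gv tv. H1_gradient half_space v Gv \<and> has_trace v tv \<and>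
       (\<forall>\<phi>\<in>H1 half_space. \<forall>G\<phi> t\<phi>. H1_gradient half_space \<phi> G\<phi> \<longrightarrow> has_trace \<phi> t\<phi> \<longrightarrow>
          (LINT z|lebesgue_on half_space. Gv z \<bullet> G\<phi> z + m\<^sup>2 * v z * \<phi> z)
        = (LINT y|lebesgue. f (tv y) * t\<phi> y)))"

definition classical_solution ::
    "real \<Rightarrow> (real \<Rightarrow> real) \<Rightarrow> (real \<times> (real ^ 'n) \<Rightarrow> real) \<Rightarrow> bool" where
  "classical_solution m f w \<longleftrightarrow>
     Ck_on 2 w half_space \<and> (\<exists>G. C1_gradient_on closed_half_space w G) \<and>
     (\<forall>z\<in>half_space. - laplacian w z + m\<^sup>2 * w z = 0) \<and>
     (\<forall>y. ((\<lambda>x. w (x, y)) has_real_derivative - f (w (0, y))) (at_right 0))"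

end

theory Submission
 imports Defs "HOL-Probability.Probability" "HOL-Real_Asymp.Real_Asymp"
begin

text \<open>
 Put \<open>q = m\<^sup>2 / 4\<close>. The operator \<open>m\<^sup>2 - \<Delta>\<close> on the whole space has an explicit positive fundamental
 solution, the Bessel kernel \<open>bessel q\<close>, obtained by integrating the heat kernel in time. A weak
 solution turns out to be the single layer potential with this kernel whose density is the nonlinearity
 evaluated at the trace; the regularity of the solution is then read off from that formula.

 \<^emph>\<open>Representation.\<close> For a test function \<open>\<psi>\<close> supported in the open half space, convolve the kernel
 with the even reflection of \<open>\<psi>\<close>. The result \<open>w\<close> is smooth, lies in \<open>H\<^sup>1\<close>, satisfies
 \<open>m\<^sup>2 w - \<Delta> w = \<psi>\<close> in the half space and has vanishing normal derivative on the boundary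
 (\<open>bessel_conv_inverse\<close>, \<open>bessel_conv_normal_derivative_zero\<close>). Inserting \<open>w\<close> in the weak formulation
 gives \<open>\<integral> v \<psi> = \<integral> f(u) w(0, \<cdot>)\<close> with \<open>u\<close> the trace of \<open>v\<close>. By Fubini the right hand side is the
 integral of \<open>\<psi>\<close> against \<open>2 * layer (bessel q) (f \<circ> u)\<close>, so \<open>v\<close> equals this potential almost everywhere
 (\<open>single_layer_representation\<close>). The potential converges because \<open>f(u)\<close> is bounded by a constant plus
 an integrable function, which rests on the trace embedding below. Since the trace is the \<open>L\<^sup>2\<close> limit
 of \<open>v\<close> on slices close to the boundary, \<open>u\<close> itself is almost everywhere the boundary value of the
 potential (\<open>trace_eq_layer\<close>): \<open>u\<close> solves a convolution equation \<open>u = G * f(u)\<close> on the boundary with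
 \<open>G = slice_ker q\<close>, which behaves like \<open>\<bar>y\<bar>\<^sup>1\<^sup>-\<^sup>N\<close> at the origin and decays exponentially.

 \<^emph>\<open>Boundedness.\<close> The trace lies in \<open>L\<^sup>Q\<close> for all \<open>2 \<le> Q < 2N/(N-1)\<close> (\<open>trace_embedding\<close>), and
 the growth exponent \<open>p < (N+1)/(N-1)\<close> is exactly what allows a choice of \<open>Q > N (p-1)\<close> in that range.
 Writing \<open>\<bar>u\<bar>\<^sup>p = \<bar>u\<bar>\<^sup>Q \<cdot> \<bar>u\<bar>\<^sup>p\<^sup>-\<^sup>Q\<close> and applying Jensen's inequality with exponent \<open>\<sigma> = Q / (Q - p + 1)\<close>
 makes the nonlinear equation a linear inequality \<open>U \<le> H * U\<close> for \<open>U = \<bar>u\<bar>\<^sup>\<sigma>\<close> with an integrable kernel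
 \<open>H\<close>: the condition \<open>Q > N (p-1)\<close> says that \<open>G\<^sup>\<sigma>\<close> is integrable. Such an inequality forces \<open>U\<close> to
 be bounded, because \<open>H\<close> is a bounded kernel plus one of mass at most \<open>1/2\<close>
 (\<open>bounded_of_convolution_inequality\<close>, \<open>trace_bounded\<close>).

 \<^emph>\<open>Regularity.\<close> All derivatives of the kernel are estimated by the family \<open>theta\<close>, whose
 integrals over slices parallel to the boundary are explicit. For a bounded density the gradient of
 the potential is \<open>O(x\<^sup>\<beta>\<^sup>-\<^sup>1)\<close> at height \<open>x\<close> for every \<open>\<beta> < 1\<close>, so the potential is Hoelder
 continuous (\<open>Hoelder_of_derivative_bound\<close>). Hence \<open>u\<close>, and with it \<open>f(u)\<close>, is Hoelder continuous for
 every exponent below one. Subtracting the value of the density at the foot of the point gains a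
 factor that makes the second derivatives \<open>O(x\<^sup>\<beta>\<^sup>-\<^sup>1)\<close> as well; thus the gradient is Hoelder continuous
 and extends to the boundary (\<open>layer_radial1_Hoelder\<close>, \<open>C1_up_to_boundary\<close>). The equation holds because
 the kernel solves it away from the origin (\<open>radial2_trace\<close>), and the boundary condition is the jump
 relation \<open>normal_derivative_limit\<close>.
\<close>

section \<open>Integration tools\<close>

text \<open>Nearly every integral below is with respect to Lebesgue measure; these notations suppress the
 measure. The variant \<open>\<integral>\<^sub>+\<close> integrates a real function, read as an extended nonnegative one.\<close>

abbreviation nn_lborel :: "('a::euclidean_space \<Rightarrow> real) \<Rightarrow> ennreal" (binder "\<integral>\<^sub>+" 10)
 where "nn_lborel f \<equiv> nn_integral lborel (\<lambda>x. ennreal (f x))"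

abbreviation lborel_nn_integral :: "('a::euclidean_space \<Rightarrow> ennreal) \<Rightarrow> ennreal" (binder "\<integral>\<^sup>+" 10)
 where "lborel_nn_integral f \<equiv> nn_integral lborel f"

abbreviation lborel_integral :: "('a::euclidean_space \<Rightarrow> 'b::{banach, second_countable_topology}) \<Rightarrow> 'b" (binder "\<integral>" 10)
 where "lborel_integral f \<equiv> integral\<^sup>L lborel f"

abbreviation Borel :: "('a::topological_space \<Rightarrow> 'b::topological_space) set"
 where "Borel \<equiv> borel_measurable borel"

abbreviation L1 :: "('a::euclidean_space \<Rightarrow> 'b::{banach, second_countable_topology}) \<Rightarrow> bool"
 where "L1 f \<equiv> integrable lborel f"

text \<open>Jensen's inequality with a weight of mass at most \<open>A\<close>. The constant \<open>2\<^sup>r\<close>, which is not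
 optimal, allows an elementary proof for integrals that may be infinite: with \<open>l = X / (2A)\<close> the
 part where \<open>g \<le> l\<close> contributes at most half of \<open>X\<close>, and elsewhere \<open>g \<le> l\<^sup>1\<^sup>-\<^sup>r g\<^sup>r\<close>.\<close>

lemma nn_integral_weighted_Jensen:
 fixes w g :: "'a \<Rightarrow> real"
 assumes [measurable]: "w \<in> borel_measurable M" "g \<in> borel_measurable M"
  and w: "\<And>t. t \<in> space M \<Longrightarrow> 0 \<le> w t" and g: "\<And>t. t \<in> space M \<Longrightarrow> 0 \<le> g t"
  and A: "(\<integral>\<^sup>+t. ennreal (w t) \<partial>M) \<le> ennreal A" "0 < A"
  and X: "0 \<le> X" "ennreal X \<le> (\<integral>\<^sup>+t. ennreal (w t * g t) \<partial>M)" and r: "1 \<le> r"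
 shows "ennreal (X powr r) \<le> ennreal (2 powr r * A powr (r - 1)) * (\<integral>\<^sup>+t. ennreal (w t * g t powr r) \<partial>M)"
proof (cases "X = 0")
 case False
 then have X0: "X > 0" using X by simp
 define l where "l = X / (2 * A)"
 have l: "l > 0" using X0 A by (simp add: l_def)
 define c where "c = l powr (1 - r)"
 have c: "c > 0" using l by (simp add: c_def)
 let ?B = "\<integral>\<^sup>+t. ennreal (w t * g t powr r) \<partial>M"
 have pt: "x \<le> l + c * x powr r" if "x \<ge> 0" for x
 proof (cases "x \<le> l")
  case True then show ?thesis using c by (simp add: add_increasing2)
 next
  case F: False
  have "1 \<le> (x / l) powr (r - 1)"
   using F l r by (intro ge_one_powr_ge_zero) auto
  moreover have "c * x powr r = x * (x / l) powr (r - 1)"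
  proof -
   have "x powr r = x * x powr (r - 1)" using F l powr_mult_base[of x "r - 1"] by simp
   moreover have "c = inverse (l powr (r - 1))" by (simp add: c_def powr_minus[symmetric])
   moreover have "(x / l) powr (r - 1) = x powr (r - 1) * inverse (l powr (r - 1))"
    using F l powr_divide[of x l "r - 1"] by (simp add: divide_inverse)
   ultimately show ?thesis by simp
  qed
  moreover have "x * 1 \<le> x * (x / l) powr (r - 1)"
   using that calculation(1) by (intro mult_left_mono) auto
  ultimately show ?thesis using l by simp
 qed
 have "ennreal X \<le> (\<integral>\<^sup>+t. ennreal (w t * g t) \<partial>M)" by fact
 also have "\<dots> \<le> (\<integral>\<^sup>+t. ennreal l * ennreal (w t) + ennreal c * ennreal (w t * g t powr r) \<partial>M)"
 proof (rule nn_integral_mono)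
  fix t assume t: "t \<in> space M"
  have "w t * g t \<le> w t * (l + c * g t powr r)"
   using w[OF t] pt[OF g[OF t]] by (intro mult_left_mono)
  then show "ennreal (w t * g t) \<le> ennreal l * ennreal (w t) + ennreal c * ennreal (w t * g t powr r)"
   using w[OF t] l c
   by (auto simp add: ennreal_mult[symmetric] algebra_simps simp flip: ennreal_plus intro!: ennreal_leI)
 qed
 also have "\<dots> = ennreal l * (\<integral>\<^sup>+t. ennreal (w t) \<partial>M) + ennreal c * ?B"
  by (simp add: nn_integral_add nn_integral_cmult)
 also have "\<dots> \<le> ennreal l * ennreal A + ennreal c * ?B"
  by (intro add_mono mult_left_mono A) auto
 also have "ennreal l * ennreal A = ennreal (X / 2)"
  using l A by (simp add: ennreal_mult[symmetric] l_def)
 finally have *: "ennreal X \<le> ennreal (X / 2) + ennreal c * ?B" .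
 have "ennreal (X / 2) \<le> ennreal c * ?B"
 proof (cases "ennreal c * ?B")
  case (real b)
  then show ?thesis using * X0 by (auto simp flip: ennreal_plus)
 qed auto
 (* k is the factor with k * (X / 2) = X powr r and k * c = 2 powr r * A powr (r - 1). *)
 moreover define k where "k = 2 * l powr (r - 1) * A powr (r - 1) * 2 powr (r - 1)"
 ultimately have "ennreal k * ennreal (X / 2) \<le> ennreal k * (ennreal c * ?B)"
  by (intro mult_left_mono) auto
 moreover have k0: "k \<ge> 0" by (simp add: k_def)
 moreover have "k * (X / 2) = X powr r"
 proof -
  have "l powr (r - 1) * A powr (r - 1) * 2 powr (r - 1) = (l * A * 2) powr (r - 1)"
   using l A by (simp add: powr_mult)
  also have "l * A * 2 = X" using A by (simp add: l_def)
  finally have "k * (X / 2) = X * X powr (r - 1)" by (simp add: k_def)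
  then show ?thesis using X0 powr_mult_base[of X "r - 1"] by simp
 qed
 moreover have "k * c = 2 powr r * A powr (r - 1)"
 proof -
  have "c * l powr (r - 1) = 1" using l by (simp add: c_def powr_add[symmetric])
  moreover have "2 * 2 powr (r - 1) = (2::real) powr r" using powr_mult_base[of 2 "r - 1"] by simp
  ultimately show ?thesis by (simp add: k_def mult_ac) (metis mult.assoc mult.commute mult.right_neutral)
 qed
 ultimately show ?thesis using c X by (simp add: mult.assoc[symmetric] ennreal_mult[symmetric])
qed (use r in auto)

lemma integrable_bound_pointwise:
 fixes f :: "'a \<Rightarrow> 'b::{banach, second_countable_topology}"
 assumes "integrable M g" "f \<in> borel_measurable M" "\<And>x. norm (f x) \<le> g x"
 shows "integrable M f"
 using assms(1,2) by (rule Bochner_Integration.integrable_bound) (use assms(3) in \<open>auto intro: order_trans[OF _ abs_ge_self]\<close>)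

lemma nn_integral_le_cmult:
 assumes "g \<in> borel_measurable M" "0 \<le> C" "\<And>x. x \<in> space M \<Longrightarrow> f x \<le> C * g x"
 shows "(\<integral>\<^sup>+x. ennreal (f x) \<partial>M) \<le> ennreal C * (\<integral>\<^sup>+x. ennreal (g x) \<partial>M)"
proof -
 have "(\<integral>\<^sup>+x. ennreal (f x) \<partial>M) \<le> (\<integral>\<^sup>+x. ennreal C * ennreal (g x) \<partial>M)"
  using assms by (intro nn_integral_mono) (simp add: ennreal_mult'[symmetric] ennreal_leI)
 then show ?thesis using assms(1) by (simp add: nn_integral_cmult)
qed

lemma
 fixes f :: "'a::euclidean_space \<times> 'b::euclidean_space \<Rightarrow> ennreal"
 assumes "f \<in> Borel"
 shows nn_integral_lborel_fst: "(\<integral>\<^sup>+z. f z) = (\<integral>\<^sup>+x. \<integral>\<^sup>+y. f (x, y) \<partial>lborel)"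
  and nn_integral_lborel_snd: "(\<integral>\<^sup>+z. f z) = (\<integral>\<^sup>+y. \<integral>\<^sup>+x. f (x, y) \<partial>lborel)"
 using lborel.nn_integral_fst[of f lborel] lborel_pair.nn_integral_snd[of f] assms by (simp_all add: lborel_prod)

lemma has_real_derivative_along_line:
 assumes "(F has_derivative (\<lambda>h. G \<bullet> h)) (at (a + t *\<^sub>R b))"
 shows "((\<lambda>t. F (a + t *\<^sub>R b)) has_real_derivative G \<bullet> b) (at t)"
proof -
 have "((\<lambda>t. a + t *\<^sub>R b) has_derivative (\<lambda>h. h *\<^sub>R b)) (at t)" by (auto intro!: derivative_eq_intros)
 note has_derivative_compose[OF this assms]
 moreover have "(\<lambda>h. G \<bullet> (h *\<^sub>R b)) = (*) (G \<bullet> b)" by (simp add: fun_eq_iff)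
 ultimately show ?thesis by (simp only: has_field_derivative_def)
qed

text \<open>Differentiation under the integral sign. The mean value inequality turns the bound \<open>D\<close> for the
 derivatives into the bound \<open>2 * D\<close> for the remainders of the difference quotients, to which
 dominated convergence applies.\<close>

lemma has_derivative_integral_dominated:
 fixes F :: "'a::euclidean_space \<Rightarrow> 'b \<Rightarrow> real" and F' :: "'a \<Rightarrow> 'b \<Rightarrow> 'a"
 assumes U: "open U" "x0 \<in> U"
  and int: "\<And>x. x \<in> U \<Longrightarrow> integrable M (F x)"
  and meas: "F' x0 \<in> borel_measurable M"
  and der: "\<And>x t. x \<in> U \<Longrightarrow> t \<in> space M \<Longrightarrow> ((\<lambda>x. F x t) has_derivative (\<lambda>h. F' x t \<bullet> h)) (at x)"
  and bnd: "\<And>x t. x \<in> U \<Longrightarrow> t \<in> space M \<Longrightarrow> norm (F' x t) \<le> D t"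
  and D: "integrable M D"
 shows "((\<lambda>x. \<integral>t. F x t \<partial>M) has_derivative (\<lambda>h. (\<integral>t. F' x0 t \<partial>M) \<bullet> h)) (at x0)"
proof -
 obtain e where e: "e > 0" "ball x0 e \<subseteq> U" using U open_contains_ball by blast
 have iF': "integrable M (F' x0)"
  by (rule Bochner_Integration.integrable_bound[OF D meas]) (use bnd U in fastforce)
 let ?J = "\<lambda>x. \<integral>t. F x t \<partial>M" and ?J' = "\<integral>t. F' x0 t \<partial>M"
 have lip: "\<bar>F x t - F x0 t\<bar> \<le> D t * norm (x - x0)" if x: "x \<in> ball x0 e" and t: "t \<in> space M" for x t
 proof -
  have "norm (F x t - F x0 t) \<le> D t * norm (x - x0)"
  proof (rule differentiable_bound[where S="ball x0 e" and f'="\<lambda>x h. F' x t \<bullet> h"])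
   show "((\<lambda>x. F x t) has_derivative (\<bullet>) (F' x t)) (at x within ball x0 e)" if "x \<in> ball x0 e" for x
    using der[of x t] that e t by (meson has_derivative_at_withinI subsetD)
   show "onorm ((\<bullet>) (F' x t)) \<le> D t" if "x \<in> ball x0 e" for x
   proof (rule onorm_le)
    fix h
    have "norm (F' x t \<bullet> h) \<le> norm (F' x t) * norm h" by (rule Cauchy_Schwarz_ineq2[unfolded real_norm_def[symmetric]])
    also have "\<dots> \<le> D t * norm h" using bnd[of x t] that e t by (intro mult_right_mono) auto
    finally show "norm (F' x t \<bullet> h) \<le> D t * norm h" .
   qed
  qed (use x e in auto)
  then show ?thesis by simp
 qed
 have "(\<lambda>h. norm (?J (x0 + h) - ?J x0 - ?J' \<bullet> h) / norm h) \<midarrow>0\<rightarrow> 0"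
  unfolding tendsto_at_iff_sequentially
 proof (intro allI impI)
  fix X :: "nat \<Rightarrow> 'a" assume X0: "\<forall>i. X i \<in> UNIV - {0}" and X: "X \<longlonglongrightarrow> 0"
  have "\<forall>\<^sub>F i in sequentially. dist (X i) 0 < e" using X e by (metis tendstoD)
  then obtain n0 where n0: "\<And>i. i \<ge> n0 \<Longrightarrow> norm (X i) < e" by (auto simp: eventually_sequentially)
  define Y where "Y i = X (i + n0)" for i
  have "Y \<longlonglongrightarrow> 0" unfolding Y_def using X by (rule LIMSEQ_ignore_initial_segment)
  then have Y: "Y \<longlonglongrightarrow> 0" "\<And>i. norm (Y i) < e" "\<And>i. Y i \<noteq> 0"
   using X0 n0 by (auto simp: Y_def)
  have mem: "x0 + Y i \<in> ball x0 e" for i using Y(2)[of i] by (simp add: dist_norm)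
  define s where "s i t = (F (x0 + Y i) t - F x0 t - F' x0 t \<bullet> Y i) / norm (Y i)" for i t
  have "(\<lambda>i. \<integral>t. s i t \<partial>M) \<longlonglongrightarrow> (\<integral>t. 0 \<partial>M)"
  proof (rule integral_dominated_convergence[where w="\<lambda>t. 2 * D t"])
   show "(\<lambda>t. 0::real) \<in> borel_measurable M" by simp
   show "s i \<in> borel_measurable M" for i
    unfolding s_def using int[of "x0 + Y i"] int[of x0] meas mem[of i] e U
    by (intro borel_measurable_divide borel_measurable_diff borel_measurable_inner) (auto dest: borel_measurable_integrable)
   show "integrable M (\<lambda>t. 2 * D t)" using D by simp
   show "AE t in M. (\<lambda>i. s i t) \<longlonglongrightarrow> 0"
   proof (rule AE_I2)
    fix t assume t: "t \<in> space M"
    have "(\<lambda>h. norm (F (x0 + h) t - F x0 t - F' x0 t \<bullet> h) / norm h) \<midarrow>0\<rightarrow> 0"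
     using der[OF U(2) t] by (simp add: has_derivative_at)
    then have "(\<lambda>i. norm (F (x0 + Y i) t - F x0 t - F' x0 t \<bullet> Y i) / norm (Y i)) \<longlonglongrightarrow> 0"
     unfolding tendsto_at_iff_sequentially using Y by (auto simp: o_def)
    then have "(\<lambda>i. norm (s i t)) \<longlonglongrightarrow> 0" by (simp add: s_def)
    then show "(\<lambda>i. s i t) \<longlonglongrightarrow> 0" by (rule tendsto_norm_zero_cancel)
   qed
   show "AE t in M. norm (s i t) \<le> 2 * D t" for i
   proof (rule AE_I2)
    fix t assume t: "t \<in> space M"
    have "\<bar>F (x0 + Y i) t - F x0 t\<bar> \<le> D t * norm (Y i)" using lip[OF mem[of i] t] by simp
    moreover have "\<bar>F' x0 t \<bullet> Y i\<bar> \<le> D t * norm (Y i)"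
     using Cauchy_Schwarz_ineq2[of "F' x0 t" "Y i"] bnd[OF U(2) t] by (meson mult_right_mono norm_ge_zero order_trans)
    ultimately have "\<bar>F (x0 + Y i) t - F x0 t - F' x0 t \<bullet> Y i\<bar> \<le> 2 * D t * norm (Y i)" by linarith
    then show "norm (s i t) \<le> 2 * D t" using Y(3)[of i] by (simp add: s_def field_simps)
   qed
  qed
  moreover have "(\<integral>t. s i t \<partial>M) = (?J (x0 + Y i) - ?J x0 - ?J' \<bullet> Y i) / norm (Y i)" for i
   unfolding s_def using int[of "x0 + Y i"] int[of x0] iF' mem[of i] e U by (subst integral_divide_zero) auto
  ultimately have "(\<lambda>i. (?J (x0 + Y i) - ?J x0 - ?J' \<bullet> Y i) / norm (Y i)) \<longlonglongrightarrow> 0"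
   by simp
  then have "(\<lambda>i. norm ((?J (x0 + Y i) - ?J x0 - ?J' \<bullet> Y i) / norm (Y i))) \<longlonglongrightarrow> 0"
   by (rule tendsto_norm_zero)
  then show "((\<lambda>h. norm (?J (x0 + h) - ?J x0 - ?J' \<bullet> h) / norm h) \<circ> X) \<longlonglongrightarrow> 0"
   by - (rule LIMSEQ_offset[where k=n0], simp add: o_def Y_def)
 qed
 then show ?thesis by (simp add: has_derivative_at bounded_linear_inner_right)
qed

lemma isCont_integral_dominated:
 fixes F :: "'a::metric_space \<Rightarrow> 'b \<Rightarrow> real"
 assumes U: "open U" "x0 \<in> U"
  and meas: "\<And>x. x \<in> U \<Longrightarrow> F x \<in> borel_measurable M"
  and cont: "\<And>t. t \<in> space M \<Longrightarrow> isCont (\<lambda>x. F x t) x0"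
  and bnd: "\<And>x t. x \<in> U \<Longrightarrow> t \<in> space M \<Longrightarrow> \<bar>F x t\<bar> \<le> D t"
  and D: "integrable M D"
 shows "isCont (\<lambda>x. \<integral>t. F x t \<partial>M) x0"
 unfolding continuous_at_sequentially
proof (intro allI impI)
 fix X assume X: "X \<longlonglongrightarrow> x0"
 then have "\<forall>\<^sub>F i in sequentially. X i \<in> U" using U by (rule topological_tendstoD)
 then obtain n0 where n0: "\<And>i. i \<ge> n0 \<Longrightarrow> X i \<in> U" by (auto simp: eventually_sequentially)
 have "(\<lambda>i. \<integral>t. F (X (i + n0)) t \<partial>M) \<longlonglongrightarrow> (\<integral>t. F x0 t \<partial>M)"
 proof (rule integral_dominated_convergence[where w=D])
  show "AE t in M. (\<lambda>i. F (X (i + n0)) t) \<longlonglongrightarrow> F x0 t"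
  proof (rule AE_I2)
   fix t assume "t \<in> space M"
   from cont[OF this] X have "(\<lambda>i. F (X i) t) \<longlonglongrightarrow> F x0 t"
    unfolding continuous_at_sequentially by (auto simp: o_def)
   then show "(\<lambda>i. F (X (i + n0)) t) \<longlonglongrightarrow> F x0 t" by (rule LIMSEQ_ignore_initial_segment)
  qed
 qed (use U meas n0 bnd D in auto)
 then show "((\<lambda>x. \<integral>t. F x t \<partial>M) \<circ> X) \<longlonglongrightarrow> (\<integral>t. F x0 t \<partial>M)"
  by - (rule LIMSEQ_offset[where k=n0], simp add: o_def)
qed

section \<open>Functions of class \<open>C\<^sup>k\<close>\<close>

lemma Ck_on_SucD: "Ck_on (Suc k) u S \<Longrightarrow> Ck_on k u S"
proof (induction k arbitrary: u)
 case 0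
 then show ?case by (auto intro!: differentiable_imp_continuous_on simp: differentiable_on_def differentiable_at_withinI)
qed auto

lemma Ck_on_cong:
 assumes "open S" "\<And>z. z \<in> S \<Longrightarrow> f z = g z"
 shows "Ck_on k f S \<longleftrightarrow> Ck_on k g S"
 using assms(2)
proof (induction k arbitrary: f g)
 case (Suc k)
 have "(f has_derivative D) (at z) \<longleftrightarrow> (g has_derivative D) (at z)" if "z \<in> S" for z D
  using Suc.prems \<open>open S\<close> that has_derivative_transform_within_open[of f D z UNIV S g]
   has_derivative_transform_within_open[of g D z UNIV S f] by auto
 then have "f differentiable (at z) \<longleftrightarrow> g differentiable (at z)" "frechet_derivative f (at z) = frechet_derivative g (at z)"
  if "z \<in> S" for z using that by (auto simp: differentiable_def frechet_derivative_def)
 then show ?case using Suc.IH[of "\<lambda>z. frechet_derivative f (at z) _" "\<lambda>z. frechet_derivative g (at z) _"] by auto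
qed (auto intro: continuous_on_cong)


lemma Ck_on_SucI:
 assumes "open S" "\<And>z. z \<in> S \<Longrightarrow> (u has_derivative u' z) (at z)" "\<And>h. Ck_on k (\<lambda>z. u' z h) S"
 shows "Ck_on (Suc k) u S"
proof -
 have "Ck_on k (\<lambda>z. frechet_derivative u (at z) h) S" for h
  using assms(3)[of h] Ck_on_cong[OF assms(1), of "\<lambda>z. frechet_derivative u (at z) h" "\<lambda>z. u' z h"]
   frechet_derivative_at[OF assms(2)] by metis
 then show ?thesis using assms(2) by (auto simp: differentiable_def)
qed

lemma Ck_on_SucE:
 assumes "Ck_on (Suc k) u S" "z \<in> S"
 shows "(u has_derivative frechet_derivative u (at z)) (at z)"
 using assms frechet_derivative_works by auto

lemma Ck_on_const: "Ck_on k (\<lambda>_::'a::euclidean_space. c) S"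
 by (induction k arbitrary: c) auto

lemma Ck_on_add:
 assumes "open S" "Ck_on k u S" "Ck_on k v S"
 shows "Ck_on k (\<lambda>z. u z + v z) S"
 using assms(2,3)
proof (induction k arbitrary: u v)
 case (Suc k)
 show ?case
  by (rule Ck_on_SucI[OF \<open>open S\<close> has_derivative_add[OF Ck_on_SucE[OF Suc.prems(1)] Ck_on_SucE[OF Suc.prems(2)]]])
   (assumption, assumption, rule Suc.IH, use Suc.prems in auto)
qed (auto intro: continuous_on_add)

lemma Ck_on_mult:
 assumes "open S" "Ck_on k u S" "Ck_on k v S"
 shows "Ck_on k (\<lambda>z. u z * v z) S"
 using assms(2,3)
proof (induction k arbitrary: u v)
 case (Suc k)
 note c = Ck_on_SucD[OF Suc.prems(1)] Ck_on_SucD[OF Suc.prems(2)]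
 have "Ck_on k (\<lambda>z. u z * frechet_derivative v (at z) h + frechet_derivative u (at z) h * v z) S" for h
  by (rule Ck_on_add[OF \<open>open S\<close> Suc.IH[OF c(1)] Suc.IH[OF _ c(2)]]) (use Suc.prems in simp_all)
 then show ?case
  by (intro Ck_on_SucI[OF \<open>open S\<close> has_derivative_mult[OF Ck_on_SucE[OF Suc.prems(1)] Ck_on_SucE[OF Suc.prems(2)]]])
qed (auto intro: continuous_on_mult)

lemma Ck_on_prod:
 assumes "open S" "finite I" "\<And>i. i \<in> I \<Longrightarrow> Ck_on k (u i) S"
 shows "Ck_on k (\<lambda>z. \<Prod>i\<in>I. u i z) S"
 using assms(2,3) by (induction I rule: finite_induct) (auto intro!: Ck_on_const Ck_on_mult assms(1))

lemma Ck_on_affine: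
 fixes L :: "'a::euclidean_space \<Rightarrow> 'b::euclidean_space"
 assumes "bounded_linear L" "Ck_on k u UNIV"
 shows "Ck_on k (\<lambda>z. u (L z + w)) UNIV"
 using assms(2)
proof (induction k arbitrary: u)
 case 0
 have "continuous_on UNIV (\<lambda>z. L z + w)" using assms(1) by (intro continuous_intros linear_continuous_on)
 then show ?case using 0 continuous_on_compose2[of UNIV u UNIV "\<lambda>z. L z + w"] by simp
next
 case (Suc k)
 have d: "((\<lambda>z. u (L z + w)) has_derivative (\<lambda>h. frechet_derivative u (at (L z + w)) (L h))) (at z)" for z
 proof -
  have "((\<lambda>z. L z + w) has_derivative L) (at z)"
   using assms(1) by (auto intro!: derivative_eq_intros bounded_linear_imp_has_derivative)
  from has_derivative_compose[OF this Ck_on_SucE[OF Suc.prems]] show ?thesis by simp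
 qed
 show ?case by (rule Ck_on_SucI[OF open_UNIV d], rule Suc.IH) (use Suc.prems in auto)
qed

section \<open>Bump functions\<close>

text \<open>The functions \<open>p(1/t) exp(-1/t)\<close>, extended by zero to \<open>t \<le> 0\<close>, form a family closed under
 differentiation (\<open>flat_derivative\<close>); smoothness of all of them follows by induction on the order.\<close>

definition flat :: "real poly \<Rightarrow> real \<Rightarrow> real" where
 "flat p t = (if t > 0 then poly p (1 / t) * exp (- (1 / t)) else 0)"

lemma poly_exp_tendsto_0: "((\<lambda>x::real. poly p x * exp (- x)) \<longlongrightarrow> 0) at_top"
proof -
 have "((\<lambda>x::real. \<Sum>i\<le>degree p. coeff p i * (x ^ i / exp x)) \<longlongrightarrow> (\<Sum>i\<le>degree p. coeff p i * 0)) at_top"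
  by (intro tendsto_intros tendsto_power_div_exp_0)
 then show ?thesis by (simp add: poly_altdef exp_minus field_simps sum_distrib_left)
qed

lemma flat_derivative:
 "(flat p has_real_derivative flat ([:0,0,1:] * (p - pderiv p)) t) (at t)"
proof -
 consider "t > 0" | "t < 0" | "t = 0" by linarith
 then show ?thesis
 proof cases
  case 1
  have "((\<lambda>t. poly p (1/t) * exp (- (1/t))) has_real_derivative flat ([:0,0,1:] * (p - pderiv p)) t) (at t)"
   using 1 by (auto intro!: derivative_eq_intros DERIV_chain2[OF poly_DERIV] simp: flat_def field_simps power2_eq_square)
  then show ?thesis
   by (rule has_field_derivative_transform_within_open[where S="{0<..}"]) (use 1 in \<open>auto simp: flat_def\<close>)
 next
  case 2
  have "((\<lambda>t. 0) has_real_derivative flat ([:0,0,1:] * (p - pderiv p)) t) (at t)"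
   using 2 by (auto simp: flat_def)
  then show ?thesis
   by (rule has_field_derivative_transform_within_open[where S="{..<0}"]) (use 2 in \<open>auto simp: flat_def\<close>)
 next
  case 3
  have "((\<lambda>h. flat p h / h) \<longlongrightarrow> 0) (at_right 0)"
  proof -
   have "((\<lambda>h::real. poly (pCons 0 p) (inverse h) * exp (- inverse h)) \<longlongrightarrow> 0) (at_right 0)"
    using filterlim_compose[OF poly_exp_tendsto_0 filterlim_inverse_at_top_right] .
   then show ?thesis
    by (rule Lim_transform_eventually) (auto simp: eventually_at_filter flat_def field_simps)
  qed
  moreover have "((\<lambda>h. flat p h / h) \<longlongrightarrow> 0) (at_left 0)"
   by (rule Lim_transform_eventually[of "\<lambda>_. 0"]) (auto simp: eventually_at_filter flat_def)
  ultimately have "((\<lambda>h. flat p h / h) \<longlongrightarrow> 0) (at 0)" by (simp add: filterlim_at_split)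
  then show ?thesis using 3 by (simp add: DERIV_def flat_def)
 qed
qed

lemma Ck_on_inner: "Ck_on k (\<lambda>z. z \<bullet> b) UNIV"
proof (cases k)
 case (Suc j)
 have "((\<lambda>z. z \<bullet> b) has_derivative (\<lambda>h. h \<bullet> b)) (at z)" for z by (auto intro!: derivative_eq_intros)
 then show ?thesis unfolding Suc by (rule Ck_on_SucI[OF open_UNIV]) (rule Ck_on_const)
qed (auto intro!: continuous_intros)

lemma Ck_on_flat_compose:
 assumes "\<And>k. Ck_on k \<rho> UNIV"
 shows "Ck_on k (\<lambda>z. flat p (\<rho> z)) UNIV"
proof (induction k arbitrary: p)
 case 0
 have "continuous_on UNIV (flat p)"
  using flat_derivative by (metis DERIV_isCont continuous_at_imp_continuous_on)
 moreover have "continuous_on UNIV \<rho>" using assms[of 0] by simp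
 ultimately show ?case using continuous_on_compose2[of UNIV "flat p" UNIV \<rho>] by simp
next
 case (Suc k)
 note d = has_derivative_compose[OF Ck_on_SucE[OF assms UNIV_I] flat_derivative[unfolded has_field_derivative_def]]
 show ?case by (rule Ck_on_SucI[OF open_UNIV d]) (rule Ck_on_mult[OF open_UNIV Suc], use assms[of "Suc k"] in simp)
qed

lemma Ck_on_flat: "Ck_on k (\<lambda>z. flat p (c + z \<bullet> b)) UNIV"
 by (rule Ck_on_flat_compose) (rule Ck_on_add[OF open_UNIV Ck_on_const Ck_on_inner])

text \<open>As \<open>l\<close> grows the bumps increase to the indicator of the open box, so that integrals over boxes
 are limits of integrals against test functions.\<close>

definition box_bump :: "real \<Rightarrow> 'a::euclidean_space \<Rightarrow> 'a \<Rightarrow> 'a \<Rightarrow> real" where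
 "box_bump l a b z = (\<Prod>i\<in>Basis. flat 1 (l * (z \<bullet> i - a \<bullet> i)) * flat 1 (l * (b \<bullet> i - z \<bullet> i)))"

lemma flat1_bounds: "0 \<le> flat 1 t" "flat 1 t \<le> 1" by (auto simp: flat_def)

lemma Ck_on_box_bump: "Ck_on k (box_bump l a b) UNIV"
proof -
 have "box_bump l a b = (\<lambda>z. \<Prod>i\<in>Basis. flat 1 (- l * (a \<bullet> i) + z \<bullet> (l *\<^sub>R i)) * flat 1 (l * (b \<bullet> i) + z \<bullet> ((- l) *\<^sub>R i)))"
  by (auto simp: box_bump_def fun_eq_iff algebra_simps)
 then show ?thesis by (simp only:) (rule Ck_on_prod[OF open_UNIV finite_Basis Ck_on_mult[OF open_UNIV Ck_on_flat Ck_on_flat]])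
qed

lemma box_bump_bounds: "0 \<le> box_bump l a b z" "box_bump l a b z \<le> 1"
 unfolding box_bump_def
 by (auto intro!: prod_nonneg prod_le_1 mult_nonneg_nonneg mult_le_one flat1_bounds)

lemma box_bump_zero: "l > 0 \<Longrightarrow> z \<notin> box a b \<Longrightarrow> box_bump l a b z = 0"
 unfolding box_bump_def by (auto simp: mem_box flat_def zero_less_mult_iff intro!: prod_zero)

lemma box_bump_test: "l > 0 \<Longrightarrow> cbox a b \<subseteq> S \<Longrightarrow> test_function S (box_bump l a b)"
 unfolding test_function_def using Ck_on_box_bump box_bump_zero box_subset_cbox by (metis compact_cbox subsetD)

lemma box_bump_tendsto: "(\<lambda>j. box_bump (real (Suc j)) a b z) \<longlonglongrightarrow> indicator (box a b) z"
proof (cases "z \<in> box a b")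
 case True
 have *: "(\<lambda>j. flat 1 (real (Suc j) * t)) \<longlonglongrightarrow> 1" if "t > 0" for t
 proof -
  have "(\<lambda>j. exp (- (1 / (real (Suc j) * t)))) \<longlonglongrightarrow> exp (- 0)"
   by (intro tendsto_intros) (use that in real_asymp)
  then show ?thesis using that by (simp add: flat_def)
 qed
 have "(\<lambda>j. box_bump (real (Suc j)) a b z) \<longlonglongrightarrow> (\<Prod>i\<in>(Basis::'a set). 1 * 1)"
  unfolding box_bump_def using True by (intro tendsto_prod tendsto_mult *) (auto simp: mem_box)
 then show ?thesis using True by simp
qed (simp add: box_bump_zero)

section \<open>Test functions\<close>

lemma test_function_deriv:
 assumes "test_function S g"
 shows "(g has_derivative frechet_derivative g (at z)) (at z)"
 using assms Ck_on_SucE[of 0 g UNIV z] unfolding test_function_def by blast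

lemma gradient_inner:
 assumes "(g has_derivative g') (at z)"
 shows "gradient g z \<bullet> h = g' h"
proof -
 have g': "g' = frechet_derivative g (at z)" using assms by (rule frechet_derivative_at)
 have l: "linear g'" using assms has_derivative_linear by blast
 have "g' h = g' (\<Sum>b\<in>Basis. (h \<bullet> b) *\<^sub>R b)" by (simp add: euclidean_representation)
 also have "\<dots> = (\<Sum>b\<in>Basis. (h \<bullet> b) * g' b)" using l by (simp add: linear_sum linear_cmul)
 also have "\<dots> = gradient g z \<bullet> h" by (subst inner_commute) (simp add: gradient_def g' inner_sum_right mult.commute)
 finally show ?thesis by simp
qed

lemma test_function_gradient:
 assumes "test_function S g"
 shows "(g has_derivative (\<lambda>h. gradient g z \<bullet> h)) (at z)"
 using test_function_deriv[OF assms, of z] gradient_inner[OF test_function_deriv[OF assms, of z]] by simp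

lemma test_function_derivative:
 assumes "test_function S g"
 shows "test_function S (\<lambda>z. frechet_derivative g (at z) h)"
proof -
 obtain K where K: "compact K" "K \<subseteq> S" "\<And>z. z \<notin> K \<Longrightarrow> g z = 0" and C: "\<And>k. Ck_on k g UNIV"
  using assms unfolding test_function_def by blast
 have "frechet_derivative g (at z) h = 0" if "z \<notin> K" for z
 proof -
  have "(g has_derivative (\<lambda>h. 0)) (at z)"
   by (rule has_derivative_transform_within_open[where f="\<lambda>_. 0" and s="- K"])
    (use K that compact_imp_closed in auto)
  then show ?thesis using frechet_derivative_at by metis
 qed
 moreover have "Ck_on k (\<lambda>z. frechet_derivative g (at z) h) UNIV" for k using C[of "Suc k"] by simp
 ultimately show ?thesis using K unfolding test_function_def by blast
qed

lemma test_function_gradient_inner: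
 assumes "test_function S g"
 shows "test_function S (\<lambda>z. gradient g z \<bullet> h)"
 using test_function_derivative[OF assms, of h] gradient_inner[OF test_function_deriv[OF assms]] by simp

lemma test_function_continuous: "test_function S g \<Longrightarrow> continuous_on A g"
 unfolding test_function_def by (metis Ck_on.simps(1) continuous_on_subset subset_UNIV)

lemma test_function_measurable: "test_function S g \<Longrightarrow> g \<in> Borel"
 by (metis borel_measurable_continuous_onI test_function_continuous)

lemma test_function_gradient_continuous:
 assumes "test_function S g" shows "continuous_on A (gradient g)"
 unfolding gradient_def
 by (intro continuous_intros test_function_continuous[OF test_function_derivative[OF assms]])

lemma test_function_bounded:
 assumes "test_function S g"
 obtains B R where "B > 0" "R > 0" "\<And>z. \<bar>g z\<bar> \<le> B" "\<And>z. norm z > R \<Longrightarrow> g z = 0"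
  "\<And>z. \<bar>g z\<bar> \<le> B * indicator (cball 0 R) z"
proof -
 obtain K where K: "compact K" "\<And>z. z \<notin> K \<Longrightarrow> g z = 0"
  using assms unfolding test_function_def by blast
 obtain B where B: "\<And>z. z \<in> K \<Longrightarrow> \<bar>g z\<bar> \<le> B"
  using compact_imp_bounded[OF compact_continuous_image[OF test_function_continuous[OF assms] K(1)]]
  by (auto simp: bounded_iff)
 obtain R where R: "\<And>z. z \<in> K \<Longrightarrow> norm z \<le> R" using compact_imp_bounded[OF K(1)] by (auto simp: bounded_iff)
 have *: "\<bar>g z\<bar> \<le> \<bar>B\<bar> + 1" for z using B[of z] K(2)[of z] by (cases "z \<in> K") auto
 have **: "norm z > \<bar>R\<bar> + 1 \<Longrightarrow> g z = 0" for z using R[of z] K(2)[of z] by force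
 show ?thesis
  by (rule that[of "\<bar>B\<bar> + 1" "\<bar>R\<bar> + 1"]) (use * ** in \<open>auto simp: indicator_def not_le\<close>)
qed

lemma integrable_cball_const: "L1 (\<lambda>z. B * indicator (cball (0::'a::euclidean_space) R) z :: real)"
 using emeasure_bounded_finite[of "cball (0::'a) R"] by (intro integrable_mult_right integrable_real_indicator) auto

lemma test_function_integrable:
 assumes "test_function S g" shows "L1 g"
proof -
 obtain B R where B: "\<And>z. \<bar>g z\<bar> \<le> B * indicator (cball 0 R) z" by (rule test_function_bounded[OF assms], rule that)
 show ?thesis
  by (rule integrable_bound_pointwise[OF integrable_cball_const[of B R]])
   (use test_function_measurable[OF assms] B in auto)
qed

lemma test_function_subset: "test_function S g \<Longrightarrow> S \<subseteq> T \<Longrightarrow> test_function T g"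
 unfolding test_function_def by blast

lemma test_function_mult:
 assumes "test_function S g" "\<And>k. Ck_on k u UNIV"
 shows "test_function S (\<lambda>z. g z * u z)"
 using assms unfolding test_function_def by (auto intro!: Ck_on_mult)

lemma test_function_add:
 assumes "test_function S g" "test_function S f"
 shows "test_function S (\<lambda>z. g z + f z)"
proof -
 obtain K L where "compact K" "K \<subseteq> S" "\<And>z. z \<notin> K \<Longrightarrow> g z = 0" "compact L" "L \<subseteq> S" "\<And>z. z \<notin> L \<Longrightarrow> f z = 0"
  using assms unfolding test_function_def by metis
 then have "compact (K \<union> L) \<and> K \<union> L \<subseteq> S \<and> (\<forall>z. z \<notin> K \<union> L \<longrightarrow> g z + f z = 0)" by auto
 then show ?thesis using assms unfolding test_function_def by (auto intro!: Ck_on_add)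
qed


section \<open>Integration by parts\<close>

lemma
 fixes f :: "'a::euclidean_space \<Rightarrow> real" and t :: 'a
 assumes c: "c \<noteq> 0" and f[measurable]: "f \<in> Borel"
 shows integral_lborel_affine: "(\<integral>x. f x) = \<bar>c\<bar> ^ DIM('a) * (\<integral>x. f (t + c *\<^sub>R x))"
  and integrable_lborel_affine_iff: "L1 (\<lambda>x. f (t + c *\<^sub>R x)) \<longleftrightarrow> L1 f"
 using c
  apply (subst lborel_affine[OF c, of t], subst integral_density, simp_all add: integral_distr)
 apply (subst (2) lborel_affine[OF c, of t], subst integrable_density, simp_all add: integrable_distr_eq)
 done

lemma nn_integral_lborel_affine:
 fixes f :: "'a::euclidean_space \<Rightarrow> ennreal" and t :: 'a
 assumes c: "c \<noteq> 0" and f[measurable]: "f \<in> Borel"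
 shows "(\<integral>\<^sup>+x. f x) = ennreal (\<bar>c\<bar> ^ DIM('a)) * (\<integral>\<^sup>+x. f (t + c *\<^sub>R x))"
 by (subst lborel_affine[OF c, of t])
  (simp add: nn_integral_density nn_integral_distr nn_integral_cmult ennreal_power)

lemma
 fixes f :: "'a::euclidean_space \<Rightarrow> real" and c :: 'a
 assumes f: "f \<in> Borel"
 shows integral_lborel_translate: "(\<integral>z. f (z + c)) = (\<integral>z. f z)"
  and integral_lborel_reflect: "(\<integral>z. f (c - z)) = (\<integral>z. f z)"
  and integrable_lborel_translate: "L1 (\<lambda>z. f (z + c)) \<longleftrightarrow> L1 f"
  and integrable_lborel_reflect: "L1 (\<lambda>z. f (c - z)) \<longleftrightarrow> L1 f"
 using integral_lborel_affine[OF _ f, of 1 c] integral_lborel_affine[OF _ f, of "-1" c]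
  integrable_lborel_affine_iff[OF _ f, of 1 c] integrable_lborel_affine_iff[OF _ f, of "-1" c]
 by (simp_all add: add.commute)

lemma
 fixes f :: "'a::euclidean_space \<Rightarrow> ennreal" and c :: 'a
 assumes f: "f \<in> Borel"
 shows nn_integral_lborel_translate: "(\<integral>\<^sup>+z. f (z + c)) = (\<integral>\<^sup>+z. f z)"
  and nn_integral_lborel_reflect: "(\<integral>\<^sup>+z. f (c - z)) = (\<integral>\<^sup>+z. f z)"
 using nn_integral_lborel_affine[OF _ f, of 1 c] nn_integral_lborel_affine[OF _ f, of "-1" c]
 by (simp_all add: add.commute)

lemma continuous_bounded_on_cball:
 fixes f :: "'a::euclidean_space \<Rightarrow> 'b::real_normed_vector"
 assumes "continuous_on UNIV f"
 shows "\<exists>B. \<forall>z. norm z \<le> R \<longrightarrow> norm (f z) \<le> B"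
proof -
 have "bounded (f ` cball 0 R)"
  by (intro compact_imp_bounded compact_continuous_image continuous_on_subset[OF assms] compact_cball subset_UNIV)
 then obtain B where "\<forall>z\<in>cball 0 R. norm (f z) \<le> B" by (auto simp: bounded_iff)
 then show ?thesis by (intro exI[of _ B]) simp
qed

lemma derivative_zero_outside:
 fixes F :: "'a::euclidean_space \<Rightarrow> real"
 assumes F: "\<And>z. (F has_derivative (\<lambda>h. G z \<bullet> h)) (at z)" and R: "\<And>z. norm z > R \<Longrightarrow> F z = 0" and z: "norm z > R"
 shows "G z = 0"
proof -
 have "open {z. norm z > R}" by (intro open_Collect_less continuous_intros)
 then have "(F has_derivative (\<lambda>h. 0)) (at z)"
  using z R by - (rule has_derivative_transform_within_open[where f="\<lambda>_. 0" and s="{z. norm z > R}"], auto)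
 with F have "(\<lambda>h. G z \<bullet> h) = (\<lambda>h. 0)" by (rule has_derivative_unique)
 from fun_cong[OF this, of "G z"] show ?thesis by simp
qed

text \<open>Translation in the direction \<open>b\<close> preserves both \<open>A\<close> and Lebesgue measure, so \<open>\<integral>\<^sub>A F(z + t b)\<close>
 does not depend on \<open>t\<close>; the integral in question is its derivative at \<open>t = 0\<close>. It is used with the
 whole space and, for \<open>b\<close> tangential to the boundary, with the half space.\<close>

lemma integral_directional_derivative_invariant:
 fixes F :: "'a::euclidean_space \<Rightarrow> real"
 assumes F: "\<And>z. (F has_derivative (\<lambda>h. G z \<bullet> h)) (at z)" and G: "continuous_on UNIV G"
  and R: "\<And>z. norm z > R \<Longrightarrow> F z = 0"
  and A: "A \<in> sets borel" "\<And>z t. z + t *\<^sub>R b \<in> A \<longleftrightarrow> z \<in> A"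
 shows "(\<integral>z. indicator A z * (G z \<bullet> b)) = 0"
proof -
 have G0: "G z = 0" if "norm z > R" for z by (rule derivative_zero_outside[OF F R that])
 have cF: "continuous_on UNIV F" using F has_derivative_continuous continuous_at_imp_continuous_on by blast
 have mF[measurable]: "F \<in> Borel" using cF by (rule borel_measurable_continuous_onI)
 have mG[measurable]: "G \<in> Borel" using G by (rule borel_measurable_continuous_onI)
 note A(1)[measurable]
 obtain B where B: "\<And>z. z \<in> cball 0 R \<Longrightarrow> norm (G z) \<le> B"
  using continuous_bounded_on_cball[OF G, of R] by auto
 have B2: "norm (G z) \<le> \<bar>B\<bar>" for z using B[of z] G0[of z] by (cases "norm z \<le> R") auto
 obtain C where C: "\<And>z. z \<in> cball 0 R \<Longrightarrow> norm (F z) \<le> C"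
  using continuous_bounded_on_cball[OF cF, of R] by auto
 have iF: "L1 (\<lambda>z. indicator A z * F (z + c))" for c
 proof (rule integrable_bound_pointwise[OF integrable_cball_const[of "\<bar>C\<bar>" "R + norm c"]])
  fix z
  show "norm (indicator A z * F (z + c)) \<le> \<bar>C\<bar> * indicator (cball 0 (R + norm c)) z"
  proof (cases "norm (z + c) \<le> R")
   case True
   then have "norm z \<le> R + norm c" using norm_triangle_ineq4[of "z + c" c] by simp
   then show ?thesis using C[of "z + c"] True by (auto simp: indicator_def)
  qed (use R in \<open>auto simp: not_le\<close>)
 qed measurable
 have "((\<lambda>t::real. \<integral>z. indicator A z * F (z + t *\<^sub>R b) \<partial>lborel) has_derivative
   (\<lambda>h. (\<integral>z. (\<lambda>t z. indicator A z * (G (z + t *\<^sub>R b) \<bullet> b)) 0 z) \<bullet> h)) (at 0)"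
 proof (rule has_derivative_integral_dominated[where U="ball 0 1" and D="\<lambda>z. \<bar>B\<bar> * norm b * indicator (cball 0 (R + norm b)) z"])
  fix t :: real and z :: 'a assume t: "t \<in> ball 0 1"
  have "((\<lambda>t::real. F (z + t *\<^sub>R b)) has_derivative (\<lambda>h. G (z + t *\<^sub>R b) \<bullet> (h *\<^sub>R b))) (at t)"
   by (rule has_derivative_compose[where f="\<lambda>t. z + t *\<^sub>R b" and g=F, OF _ F]) (auto intro!: derivative_eq_intros)
  then have "((\<lambda>t::real. indicator A z * F (z + t *\<^sub>R b)) has_derivative (\<lambda>h. indicator A z * (G (z + t *\<^sub>R b) \<bullet> (h *\<^sub>R b)))) (at t)"
   by (rule has_derivative_mult_right)
  then show "((\<lambda>t. indicator A z * F (z + t *\<^sub>R b)) has_derivative (\<lambda>h. (indicator A z * (G (z + t *\<^sub>R b) \<bullet> b)) \<bullet> h)) (at t)"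
   by (simp add: mult_ac)
  show "norm (indicator A z * (G (z + t *\<^sub>R b) \<bullet> b)) \<le> \<bar>B\<bar> * norm b * indicator (cball 0 (R + norm b)) z"
  proof (cases "norm (z + t *\<^sub>R b) \<le> R")
   case True
   have "norm (t *\<^sub>R b) \<le> norm b" using t mult_right_mono[of "\<bar>t\<bar>" 1 "norm b"] by simp
   then have "norm z \<le> R + norm b" using norm_triangle_ineq4[of "z + t *\<^sub>R b" "t *\<^sub>R b"] True by simp
   moreover have "\<bar>G (z + t *\<^sub>R b) \<bullet> b\<bar> \<le> \<bar>B\<bar> * norm b"
    using Cauchy_Schwarz_ineq2[of "G (z + t *\<^sub>R b)" b] mult_right_mono[OF B2[of "z + t *\<^sub>R b"], of "norm b"] by simp
   ultimately show ?thesis by (auto simp: indicator_def)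
  qed (use G0 in \<open>auto simp: not_le\<close>)
 qed (use iF integrable_cball_const in auto)
 moreover have "(\<integral>z. indicator A z * F (z + t *\<^sub>R b)) = (\<integral>z. indicator A z * F z)" for t
 proof -
  have "(\<integral>z. indicator A z * F (z + t *\<^sub>R b)) = (\<integral>z. indicator A (z + t *\<^sub>R b) * F (z + t *\<^sub>R b))"
   using A(2) by (simp add: indicator_def)
  then show ?thesis by (simp add: integral_lborel_translate[of "\<lambda>z. indicator A z * F z" "t *\<^sub>R b"])
 qed
 ultimately have "((\<lambda>t::real. \<integral>z. indicator A z * F z \<partial>lborel) has_derivative
   (\<lambda>h. (\<integral>z. indicator A z * (G z \<bullet> b)) \<bullet> h)) (at 0)" by simp
 moreover have "((\<lambda>t::real. \<integral>z. indicator A z * F z \<partial>lborel) has_derivative (\<lambda>h. 0)) (at 0)" by simp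
 ultimately have "(\<lambda>h::real. (\<integral>z. indicator A z * (G z \<bullet> b)) \<bullet> h) = (\<lambda>h. 0)"
  by (rule has_derivative_unique)
 from fun_cong[OF this, of 1] show ?thesis by simp
qed

lemma half_space_borel [measurable]: "half_space \<in> sets borel"
 unfolding half_space_def by (intro borel_open open_Times) auto

lemma open_half_space: "open half_space"
 unfolding half_space_def by (intro open_Times) auto

lemma mem_half_space: "z \<in> half_space \<longleftrightarrow> fst z > 0"
 by (cases z) (auto simp: half_space_def)

lemma lborel_integral_prod_swap:
 fixes f :: "'a::euclidean_space \<times> 'b::euclidean_space \<Rightarrow> real"
 assumes "L1 f"
 shows "(\<integral>z. f z) = (\<integral>y. (\<integral>x. f (x, y)))"
 using lborel_pair.integral_snd[of "\<lambda>x y. f (x, y)"] assms by (simp add: lborel_prod)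

text \<open>In the remaining direction the fundamental theorem of calculus on each normal line produces
 the boundary term.\<close>

lemma integral_normal_derivative_half_space:
 fixes F :: "real \<times> (real^'n) \<Rightarrow> real"
 assumes F: "\<And>z. (F has_derivative (\<lambda>h. G z \<bullet> h)) (at z)" and G: "continuous_on UNIV G"
  and R: "\<And>z. norm z > R \<Longrightarrow> F z = 0"
 shows "(\<integral>z. indicator half_space z * (G z \<bullet> (1, 0))) = - (\<integral>y. F (0, y))"
proof -
 have G0: "G z = 0" if "norm z > R" for z by (rule derivative_zero_outside[OF F R that])
 have mG[measurable]: "G \<in> Borel" using G by (rule borel_measurable_continuous_onI)
 obtain B where B: "\<And>z. z \<in> cball 0 R \<Longrightarrow> norm (G z) \<le> B"
  using continuous_bounded_on_cball[OF G, of R] by auto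
 have i: "L1 (\<lambda>z. indicator half_space z * (G z \<bullet> (1, 0)))"
 proof (rule integrable_bound_pointwise[OF integrable_cball_const[of "\<bar>B\<bar>" "R"]])
  fix z
  have "\<bar>G z \<bullet> (1, 0)\<bar> \<le> norm (G z)"
   using Cauchy_Schwarz_ineq2[of "G z" "(1,0)"] by (simp add: norm_Pair)
  then show "norm (indicator half_space z * (G z \<bullet> (1, 0))) \<le> \<bar>B\<bar> * indicator (cball 0 R) z"
   using B[of z] G0[of z] by (cases "norm z \<le> R") (auto simp: indicator_def)
 qed measurable
 have inner: "(\<integral>x. indicator half_space (x, y) * (G (x, y) \<bullet> (1, 0))) = - F (0, y)" for y
 proof -
  define M where "M = \<bar>R\<bar> + 1"
  have big: "norm (x, y) > R" if "x \<ge> M" for x :: real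
   using norm_fst_le[of x y] that by (simp add: M_def)
  have "(\<integral>x. (G (x, y) \<bullet> (1, 0)) * indicator {0..M} x) = F (M, y) - F (0, y)"
  proof (rule integral_FTC_Icc_real)
   show "0 \<le> M" by (simp add: M_def)
   show "((\<lambda>x. F (x, y)) has_real_derivative G (x, y) \<bullet> (1, 0)) (at x)" for x
    using has_real_derivative_along_line[of F "G (x, y)" "(0, y)" x "(1, 0)"] F[of "(x, y)"] by simp
   show "isCont (\<lambda>x. G (x, y) \<bullet> (1, 0)) x" if "0 \<le> x" "x \<le> M" for x
   proof -
    have "continuous_on UNIV (\<lambda>x. G (x, y) \<bullet> (1, 0))"
     by (intro continuous_intros continuous_on_compose2[OF G]) auto
    then show ?thesis by (simp add: continuous_on_eq_continuous_at)
   qed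
  qed
  also have "F (M, y) = 0" using R[OF big] by simp
  also have "(\<integral>x. (G (x, y) \<bullet> (1, 0)) * indicator {0..M} x) =
    (\<integral>x. indicator half_space (x, y) * (G (x, y) \<bullet> (1, 0)))"
  proof (rule integral_cong_AE)
   show "AE x in lborel. (G (x, y) \<bullet> (1, 0)) * indicator {0..M} x = indicator half_space (x, y) * (G (x, y) \<bullet> (1, 0))"
    using AE_lborel_singleton[of "0::real"] by eventually_elim
     (use G0[OF big] in \<open>auto simp: indicator_def mem_half_space not_le\<close>)
  qed measurable
  finally show ?thesis by simp
 qed
 show ?thesis unfolding lborel_integral_prod_swap[OF i] inner by simp
qed

section \<open>The fundamental lemma of the calculus of variations\<close>

text \<open>The positive and the negative part of \<open>g\<close> are the densities of two finite measures that agree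
 on boxes, an intersection stable generator of the Borel sets; densities are unique almost
 everywhere.\<close>

lemma AE_zero_if_box_integrals_zero:
 fixes g :: "'a::euclidean_space \<Rightarrow> real"
 assumes g: "L1 g" and z: "\<And>l u. (\<integral>z. indicator (box l u) z * g z) = 0"
 shows "AE z in lborel. g z = 0"
proof -
 have [measurable]: "g \<in> Borel" using g by simp
 have ib: "L1 (\<lambda>z. indicator (box l u) z * g z)" for l u
  using integrable_mult_indicator[OF _ g, of "box l u"] by simp
 have box: "emeasure (density lborel (\<lambda>z. ennreal (g z))) (box l u) = emeasure (density lborel (\<lambda>z. ennreal (- g z))) (box l u)" for l u
 proof -
  have "ennreal (g z) * indicator (box l u) z = ennreal (indicator (box l u) z * g z)"
   "ennreal (- g z) * indicator (box l u) z = ennreal (- (indicator (box l u) z * g z))" for z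
   by (auto simp: indicator_def)
  then have *: "emeasure (density lborel (\<lambda>z. ennreal (g z))) (box l u) = (\<integral>\<^sub>+z. indicator (box l u) z * g z)"
   "emeasure (density lborel (\<lambda>z. ennreal (- g z))) (box l u) = (\<integral>\<^sub>+z. - (indicator (box l u) z * g z))"
   by (simp_all add: emeasure_density)
  from real_lebesgue_integral_def[OF ib] z
  have "enn2real (\<integral>\<^sub>+z. indicator (box l u) z * g z) = enn2real (\<integral>\<^sub>+z. - (indicator (box l u) z * g z))"
   by simp
  moreover have "(\<integral>\<^sub>+z. indicator (box l u) z * g z) \<noteq> \<infinity>" "(\<integral>\<^sub>+z. - (indicator (box l u) z * g z)) \<noteq> \<infinity>"
   using ib[of l u, unfolded real_integrable_def] by simp_all
  moreover have "a = b" if "enn2real a = enn2real b" "a \<noteq> \<infinity>" "b \<noteq> \<infinity>" for a b :: ennreal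
   using that by (cases a; cases b) auto
  ultimately show ?thesis unfolding * by blast
 qed
 have "density lborel (\<lambda>z. ennreal (g z)) = density lborel (\<lambda>z. ennreal (- g z))"
 proof (rule measure_eqI_generator_eq)
  let ?E = "range (\<lambda>(a, b). box a b::'a set)"
  show "Int_stable ?E" by (auto simp: Int_stable_def box_Int_box)
  show "?E \<subseteq> Pow UNIV" "sets (density lborel (\<lambda>z. ennreal (g z))) = sigma_sets UNIV ?E"
   "sets (density lborel (\<lambda>z. ennreal (- g z))) = sigma_sets UNIV ?E"
   by (simp_all add: borel_eq_box)
  let ?A = "\<lambda>n::nat. box (- (real n *\<^sub>R One)) (real n *\<^sub>R One) :: 'a set"
  show "range ?A \<subseteq> ?E" "(\<Union>i. ?A i) = UNIV" unfolding UN_box_eq_UNIV by auto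
  show "emeasure (density lborel (\<lambda>z. ennreal (g z))) (?A i) \<noteq> \<infinity>" for i
  proof -
   have "emeasure (density lborel (\<lambda>z. ennreal (g z))) (?A i) \<le> (\<integral>\<^sub>+z. g z)"
    by (auto simp: emeasure_density indicator_def intro!: nn_integral_mono)
   then show ?thesis using g real_integrable_def[of lborel g] by (metis infinity_ennreal_def neq_top_trans)
  qed
  show "emeasure (density lborel (\<lambda>z. ennreal (g z))) X = emeasure (density lborel (\<lambda>z. ennreal (- g z))) X"
   if "X \<in> ?E" for X using that box by auto
 qed
 then have "AE z in lborel. ennreal (g z) = ennreal (- g z)" by (subst sigma_finite_measure.density_unique_iff[OF lborel.sigma_finite_measure_axioms, symmetric]) auto
 then show ?thesis
 proof eventually_elim
  case (elim z)
  show ?case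
  proof (cases "g z \<ge> 0")
   case True
   then have "ennreal (g z) = 0" using elim by (simp add: ennreal_neg)
   then show ?thesis using True by simp
  next
   case False
   then have "ennreal (- g z) = 0" using elim by (simp add: ennreal_neg)
   then show ?thesis using False by (simp add: ennreal_eq_0_iff)
  qed
 qed
qed

text \<open>Bump functions approximate the indicator of a box by dominated convergence, so \<open>g\<close> has
 integral zero over every box whose closure lies in \<open>S\<close>. By Lindelof countably many such boxes
 cover \<open>S\<close>.\<close>

lemma fundamental_lemma:
 fixes g :: "'a::euclidean_space \<Rightarrow> real"
 assumes S: "open S" and [measurable]: "g \<in> Borel"
  and loc: "\<And>a b. cbox a b \<subseteq> S \<Longrightarrow> L1 (\<lambda>z. indicator (cbox a b) z * g z)"
  and test: "\<And>\<psi>. test_function S \<psi> \<Longrightarrow> (\<integral>z. \<psi> z * g z) = 0"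
 shows "AE z in lborel. z \<in> S \<longrightarrow> g z = 0"
proof -
 have zero: "(\<integral>z. indicator (box l u) z * g z) = 0" if S': "cbox l u \<subseteq> S" for l u
 proof -
  have "(\<lambda>j. \<integral>z. box_bump (real (Suc j)) l u z * g z \<partial>lborel) \<longlonglongrightarrow> (\<integral>z. indicator (box l u) z * g z)"
  proof (rule integral_dominated_convergence[where w="\<lambda>z. norm (indicator (cbox l u) z * g z)"])
   have [measurable]: "box_bump (real (Suc j)) l u \<in> Borel" for j
    using box_bump_test[of "real (Suc j)" l u UNIV] test_function_measurable by auto
   show "(\<lambda>z. box_bump (real (Suc j)) l u z * g z) \<in> borel_measurable lborel" for j by measurable
   show "AE z in lborel. (\<lambda>j. box_bump (real (Suc j)) l u z * g z) \<longlonglongrightarrow> indicator (box l u) z * g z"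
    by (intro AE_I2 tendsto_mult box_bump_tendsto tendsto_const)
   show "AE z in lborel. norm (box_bump (real (Suc j)) l u z * g z) \<le> norm (indicator (cbox l u) z * g z)" for j
   proof (rule AE_I2)
    fix z
    have "box_bump (real (Suc j)) l u z = 0" if "z \<notin> cbox l u"
     using box_bump_zero[of "real (Suc j)" z l u] that box_subset_cbox by auto
    then have "\<bar>box_bump (real (Suc j)) l u z\<bar> \<le> indicator (cbox l u) z"
     using box_bump_bounds[of "real (Suc j)" l u z] by (auto simp: indicator_def)
    then show "norm (box_bump (real (Suc j)) l u z * g z) \<le> norm (indicator (cbox l u) z * g z)"
     by (auto simp: abs_mult intro!: mult_right_mono)
   qed
  qed (use loc[OF S'] in simp_all)
  moreover have "(\<integral>z. box_bump (real (Suc j)) l u z * g z) = 0" for j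
   by (intro test box_bump_test S') simp
  ultimately have "(\<lambda>j::nat. 0) \<longlonglongrightarrow> (\<integral>z. indicator (box l u) z * g z)" by (simp only:)
  then show ?thesis by (simp add: LIMSEQ_const_iff)
 qed
 have local: "AE z in lborel. z \<in> box A B \<longrightarrow> g z = 0" if AB: "cbox A B \<subseteq> S" for A B
 proof -
  have "AE z in lborel. indicator (box A B) z * g z = 0"
  proof (rule AE_zero_if_box_integrals_zero)
   have "L1 (\<lambda>z. indicator (box A B) z *\<^sub>R (indicator (cbox A B) z * g z))"
    by (rule integrable_mult_indicator[OF _ loc[OF AB]]) simp
   then show "L1 (\<lambda>z. indicator (box A B) z * g z)"
    by (rule Bochner_Integration.integrable_cong[THEN iffD1, rotated -1]) (use box_subset_cbox in \<open>auto simp: indicator_def\<close>)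
   fix l u :: 'a
   obtain l' u' where lu: "box l u \<inter> box A B = box l' u'" unfolding box_Int_box by blast
   have "(\<integral>z. indicator (box l' u') z * g z) = 0"
   proof (cases "box l' u' = {}")
    case False
    have "cbox l' u' = closure (box l' u')" using False by simp
    also have "\<dots> \<subseteq> closure (box A B)" using lu by (intro closure_mono) auto
    also have "\<dots> \<subseteq> cbox A B" by (intro closure_minimal box_subset_cbox closed_cbox)
    finally show ?thesis using zero AB by blast
   qed simp
   moreover have "indicator (box l u) z * (indicator (box A B) z * g z) = indicator (box l' u') z * g z" for z
    unfolding lu[symmetric] by (auto simp: indicator_def)
   ultimately show "(\<integral>z. indicator (box l u) z * (indicator (box A B) z * g z)) = 0" by (simp only:)
  qed
  then show ?thesis by eventually_elim auto
 qed
 define \<F> where "\<F> = {box a b |a b. cbox a b \<subseteq> S}"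
 obtain \<F>' where F': "\<F>' \<subseteq> \<F>" "countable \<F>'" "\<Union>\<F>' = \<Union>\<F>"
  using Lindelof[of \<F>] by (auto simp: \<F>_def)
 have "S \<subseteq> \<Union>\<F>"
 proof
  fix x assume "x \<in> S"
  then obtain a b where "cbox a b \<subseteq> S" "x \<in> box a b" using open_contains_cbox[OF S] by metis
  then show "x \<in> \<Union>\<F>" by (auto simp: \<F>_def)
 qed
 have "AE z in lborel. \<forall>B\<in>\<F>'. z \<in> B \<longrightarrow> g z = 0"
  using F'(1,2) local by (subst AE_ball_countable) (auto simp: \<F>_def)
 then show ?thesis
 proof eventually_elim
  case (elim z)
  show ?case
  proof
   assume "z \<in> S"
   then have "z \<in> \<Union>\<F>'" using \<open>S \<subseteq> \<Union>\<F>\<close> F'(3) by (metis subsetD)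
   then obtain B where "B \<in> \<F>'" "z \<in> B" by (rule UnionE)
   then show "g z = 0" using elim by (metis)
  qed
 qed
qed

section \<open>Gaussian integrals\<close>

lemma gaussian_1:
 assumes "l > 0"
 shows "(\<integral>\<^sub>+x. exp (- l * x\<^sup>2)) = ennreal (sqrt (pi / l))"
proof -
 define \<sigma> where "\<sigma> = sqrt (1 / (2 * l))"
 have s: "2 * \<sigma>\<^sup>2 = 1 / l" "\<sigma> > 0" using assms by (auto simp: \<sigma>_def)
 have "normal_density 0 \<sigma> x = exp (- l * x\<^sup>2) / sqrt (pi / l)" for x
 proof -
  have "2 * pi * \<sigma>\<^sup>2 = pi * (2 * \<sigma>\<^sup>2)" by simp
  then have a: "2 * pi * \<sigma>\<^sup>2 = pi / l" using s(1) by simp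
  show ?thesis unfolding normal_density_def a s(1) using assms by (simp add: field_simps)
 qed
 then have "exp (- l * x\<^sup>2) = sqrt (pi / l) * normal_density 0 \<sigma> x" for x using assms by simp
 then have "(\<integral>\<^sub>+x. exp (- l * x\<^sup>2)) = (\<integral>\<^sub>+x. sqrt (pi / l) * normal_density 0 \<sigma> x)" by simp
 also have "\<dots> = ennreal (\<integral>x. sqrt (pi / l) * normal_density 0 \<sigma> x)"
  using s assms by (intro nn_integral_eq_integral integrable_mult_right) (auto simp: normal_density_nonneg)
 also have "\<dots> = ennreal (sqrt (pi / l))" using s by simp
 finally show ?thesis .
qed

text \<open>The Gaussian is a product over the coordinates.\<close>

lemma gaussian_nn_integral:
 assumes "l > 0"
 shows "(\<integral>\<^sub>+y. exp (- l * (norm (y::'a::euclidean_space))\<^sup>2)) = ennreal ((pi / l) powr (DIM('a) / 2))"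
proof -
 have "(\<integral>\<^sub>+y. exp (- l * (norm (y::'a))\<^sup>2)) = (\<integral>\<^sup>+y. (\<Prod>b\<in>Basis. ennreal (exp (- l * (y \<bullet> b)\<^sup>2))) \<partial>(lborel :: 'a measure))"
 proof (intro nn_integral_cong)
  fix y :: 'a
  have "(norm y)\<^sup>2 = (\<Sum>b\<in>Basis. (y \<bullet> b)\<^sup>2)"
   unfolding power2_norm_eq_inner by (subst euclidean_inner) (simp add: power2_eq_square)
  then have "exp (- l * (norm y)\<^sup>2) = (\<Prod>b\<in>Basis. exp (- l * (y \<bullet> b)\<^sup>2))"
   by (simp add: exp_sum[symmetric] sum_distrib_left sum_negf)
  then show "ennreal (exp (- l * (norm y)\<^sup>2)) = (\<Prod>b\<in>Basis. ennreal (exp (- l * (y \<bullet> b)\<^sup>2)))"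
   by (simp add: prod_ennreal)
 qed
 also have "\<dots> = (\<Prod>b\<in>(Basis::'a set). ennreal (sqrt (pi / l)))"
  by (subst nn_integral_lborel_prod) (simp_all add: gaussian_1[OF assms, simplified])
 also have "\<dots> = ennreal ((pi / l) powr (DIM('a) / 2))"
 proof -
  have "sqrt (pi / l) ^ DIM('a) = (pi / l) powr (DIM('a) / 2)"
   using assms by (simp add: powr_half_sqrt[symmetric] powr_power field_simps)
  moreover have "(0::real) \<le> sqrt (pi / l)" using assms by simp
  ultimately show ?thesis unfolding prod_constant by (simp only: ennreal_power)
 qed
 finally show ?thesis .
qed

lemma
 assumes "l > 0"
 shows gaussian_integrable: "L1 (\<lambda>y. exp (- l * (norm (y::'a::euclidean_space))\<^sup>2))"
  and gaussian_integral: "(\<integral>y. exp (- l * (norm (y::'a::euclidean_space))\<^sup>2)) = (pi / l) powr (DIM('a) / 2)"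
 using gaussian_nn_integral[OF assms, where 'a='a]
 by (auto intro!: integrableI_nn_integral_finite integral_eq_nn_integral[THEN trans])

section \<open>The radial profiles of the kernels\<close>

text \<open>Up to elementary factors \<open>theta q k r\<close> is the modified Bessel function \<open>(q/r)\<^bsup>(k-1)/4\<^esup>
 K\<^bsub>(k-1)/2\<^esub>(2 \<surd>(q r))\<close>. The parametrisation is adapted to the potential theory below: the argument
 \<open>r\<close> is a squared distance, differentiation in \<open>r\<close> raises \<open>k\<close> by two (\<open>theta_deriv\<close>), a factor
 \<open>r\<^sup>b\<close> lowers it by \<open>2 b\<close> (\<open>theta_absorb\<close>), and integration over a \<open>d\<close>-dimensional slice lowers it
 by \<open>d\<close> (\<open>theta_slice\<close>). All kernel estimates reduce to this bookkeeping.\<close>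

definition theta_ker :: "real \<Rightarrow> real \<Rightarrow> real \<Rightarrow> real \<Rightarrow> real" where
 "theta_ker q k r s = indicator {0<..} s * (s powr (- k) * exp (- q * s\<^sup>2 - r / s\<^sup>2))"

definition theta :: "real \<Rightarrow> real \<Rightarrow> real \<Rightarrow> real" where
 "theta q k r = (\<integral>s. theta_ker q k r s)"

lemma theta_ker_nonneg: "0 \<le> theta_ker q k r s" by (simp add: theta_ker_def)

lemma theta_nonneg: "0 \<le> theta q k r" by (simp add: theta_def theta_ker_nonneg)

lemma theta_ker_measurable [measurable]: "(\<lambda>(r, s). theta_ker q k r s) \<in> borel_measurable (borel \<Otimes>\<^sub>M borel)"
 unfolding theta_ker_def by measurable

lemma theta_ker_measurable1 [measurable]: "theta_ker q k r \<in> Borel"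
 unfolding theta_ker_def by measurable

lemma theta_measurable [measurable]: "theta q k \<in> Borel"
proof -
 have [measurable]: "(\<lambda>(r, s). theta_ker q k r s) \<in> borel_measurable (borel \<Otimes>\<^sub>M lborel)"
  using theta_ker_measurable by (simp cong: measurable_cong_sets sets_pair_measure_cong)
 show ?thesis unfolding theta_def[abs_def] by measurable
qed

lemma powr_exp_le:
 assumes "b \<ge> (0::real)"
 shows "\<exists>C>0. \<forall>x>0. x powr b * exp (- x) \<le> C * exp (- x / 2)"
proof (cases "b = 0")
 case True
 then show ?thesis by (intro exI[of _ 1]) auto
next
 case False
 with assms have b: "b > 0" by simp
 show ?thesis
 proof (intro exI[of _ "(2 * b) powr b"] conjI allI impI)
  fix x :: real assume x: "x > 0"
  have "x / (2 * b) \<le> exp (x / (2 * b))" using exp_ge_add_one_self[of "x / (2 * b)"] by linarith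
  then have "(x / (2 * b)) powr b \<le> exp (x / (2 * b)) powr b" using x b by (intro powr_mono2) auto
  also have "exp (x / (2 * b)) powr b = exp (x / 2)" using b by (simp add: powr_def)
  finally have "x powr b \<le> (2 * b) powr b * exp (x / 2)" using x b by (simp add: powr_divide field_simps)
  then have "x powr b * exp (- x) \<le> (2 * b) powr b * exp (x / 2) * exp (- x)" by (intro mult_right_mono) auto
  also have "\<dots> = (2 * b) powr b * exp (- x / 2)" by (simp add: mult.assoc exp_add[symmetric])
  finally show "x powr b * exp (- x) \<le> (2 * b) powr b * exp (- x / 2)" .
 qed (use b in auto)
qed

text \<open>With \<open>x = r / s\<^sup>2\<close> the power \<open>x\<^sup>b\<close> is absorbed by half of the factor \<open>exp (- x)\<close>.\<close>

lemma theta_ker_le: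
 assumes "b \<ge> 0"
 shows "\<exists>C>0. \<forall>q k r s. r > 0 \<longrightarrow> r powr b * theta_ker q k r s \<le> C * theta_ker q (k - 2 * b) (r / 2) s"
proof -
 obtain C where C: "C > 0" "\<And>x. x > 0 \<Longrightarrow> x powr b * exp (- x) \<le> C * exp (- x / 2)" using powr_exp_le[OF assms] by blast
 have "r powr b * theta_ker q k r s \<le> C * theta_ker q (k - 2 * b) (r / 2) s" if r: "r > 0" for q k r s
 proof (cases "s > 0")
  case s: True
  have "r powr b * theta_ker q k r s = (s powr (2 * b - k) * exp (- q * s\<^sup>2)) * ((r / s\<^sup>2) powr b * exp (- (r / s\<^sup>2)))"
  proof -
   have "(r / s\<^sup>2) powr b = r powr b / s powr (2 * b)"
    using r s powr_divide[of r "s\<^sup>2" b] by (simp add: powr_powr[symmetric] flip: powr_numeral)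
   moreover have "s powr (2 * b - k) = s powr (2 * b) * s powr (- k)" by (simp add: powr_add[symmetric])
   moreover have "exp (- q * s\<^sup>2 - r / s\<^sup>2) = exp (- q * s\<^sup>2) * exp (- (r / s\<^sup>2))"
    by (simp add: exp_add[symmetric])
   ultimately show ?thesis using s by (simp add: theta_ker_def)
  qed
  also have "\<dots> \<le> (s powr (2 * b - k) * exp (- q * s\<^sup>2)) * (C * exp (- (r / s\<^sup>2) / 2))"
   using C(2)[of "r / s\<^sup>2"] r s by (intro mult_left_mono) auto
  also have "\<dots> = C * theta_ker q (k - 2 * b) (r / 2) s"
  proof -
   have "exp (- q * s\<^sup>2 - r / 2 / s\<^sup>2) = exp (- q * s\<^sup>2) * exp (- (r / s\<^sup>2) / 2)"
    by (simp add: exp_add[symmetric])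
   then show ?thesis using s by (simp add: theta_ker_def)
  qed
  finally show ?thesis .
 qed (simp add: theta_ker_def)
 then show ?thesis using C(1) by blast
qed

lemma theta_ker_mono: "r \<le> r' \<Longrightarrow> theta_ker q k r' s \<le> theta_ker q k r s"
 by (auto simp: theta_ker_def indicator_def divide_right_mono intro!: mult_left_mono)

lemma theta_ker_integrable_0:
 assumes "q > 0" "k < 1"
 shows "L1 (theta_ker q k 0)"
proof -
 define e where "e = exp (1 / (4 * q))"
 have "(\<integral>\<^sub>+t. indicator {0..} t * (t powr ((1 - k) - 1) / exp t)) = ennreal (Gamma (1 - k))"
  using nn_integral_has_integral_lebesgue[OF _ Gamma_integral_real[of "1 - k"]] assms(2)
  by (simp add: nn_integral_completion)
 then have G: "L1 (\<lambda>t. indicator {0..} t * (t powr ((1 - k) - 1) / exp t))"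
  by (intro integrableI_nn_integral_finite) auto
 show ?thesis
 proof (rule Bochner_Integration.integrable_bound[OF integrable_mult_right[OF G, of e]])
  show "AE s in lborel. norm (theta_ker q k 0 s) \<le> norm (e * (indicator {0..} s * (s powr ((1 - k) - 1) / exp s)))"
  proof (rule AE_I2)
   fix s :: real
   have "0 \<le> (sqrt q * s - 1 / (2 * sqrt q))\<^sup>2" by simp
   also have "\<dots> = (sqrt q)\<^sup>2 * s\<^sup>2 - s + 1 / (4 * (sqrt q)\<^sup>2)"
    using assms(1) unfolding power2_diff by (simp add: power_mult_distrib power_divide)
   also have "\<dots> = q * s\<^sup>2 - s + 1 / (4 * q)" using assms(1) by simp
   finally have "exp (- (q * s\<^sup>2)) \<le> exp (1 / (4 * q) - s)" by simp
   then have "exp (- (q * s\<^sup>2)) \<le> e / exp s" by (simp add: e_def exp_diff)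
   then have "s powr - k * exp (- (q * s\<^sup>2)) \<le> s powr - k * (e / exp s)" by (intro mult_left_mono) auto
   then show "norm (theta_ker q k 0 s) \<le> norm (e * (indicator {0..} s * (s powr ((1 - k) - 1) / exp s)))"
    by (auto simp: theta_ker_def indicator_def e_def mult_ac)
  qed
 qed simp
qed

lemma theta_ker_integrable:
 assumes "q > 0" "r > 0"
 shows "L1 (theta_ker q k r)"
proof -
 define b where "b = max 0 (k / 2)"
 have b: "b \<ge> 0" "k - 2 * b < 1" by (auto simp: b_def)
 obtain C where C: "C > 0" "\<And>q k r s. r > 0 \<Longrightarrow> r powr b * theta_ker q k r s \<le> C * theta_ker q (k - 2 * b) (r / 2) s"
  using theta_ker_le[OF b(1)] by blast
 show ?thesis
 proof (rule Bochner_Integration.integrable_bound[OF integrable_mult_right[OF theta_ker_integrable_0[OF assms(1) b(2)], of "C / r powr b"]])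
  show "AE s in lborel. norm (theta_ker q k r s) \<le> norm (C / r powr b * theta_ker q (k - 2 * b) 0 s)"
  proof (rule AE_I2)
   fix s
   have "r powr b * theta_ker q k r s \<le> C * theta_ker q (k - 2 * b) (r / 2) s" using C(2) assms by blast
   also have "\<dots> \<le> C * theta_ker q (k - 2 * b) 0 s" using C(1) assms by (intro mult_left_mono theta_ker_mono) auto
   finally show "norm (theta_ker q k r s) \<le> norm (C / r powr b * theta_ker q (k - 2 * b) 0 s)"
    using C(1) assms by (simp add: theta_ker_nonneg field_simps)
  qed
 qed simp
qed

lemma theta_nn: "L1 (theta_ker q k r) \<Longrightarrow> ennreal (theta q k r) = (\<integral>\<^sub>+s. theta_ker q k r s)"
 unfolding theta_def by (subst nn_integral_eq_integral) (auto simp: theta_ker_nonneg)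

lemma theta_mono:
 assumes "q > 0" "r > 0 \<or> r = 0 \<and> k < 1" "r \<le> r'"
 shows "theta q k r' \<le> theta q k r"
proof -
 have "L1 (theta_ker q k r)" "L1 (theta_ker q k r')"
  using assms theta_ker_integrable[of q r k] theta_ker_integrable[of q r' k] theta_ker_integrable_0[of q k]
  by (cases "r = 0"; cases "r' = 0"; simp)+
 then show ?thesis unfolding theta_def using theta_ker_mono[OF assms(3)] by (intro integral_mono) auto
qed

lemma theta_absorb:
 assumes "q > 0" "b \<ge> 0"
 shows "\<exists>C>0. \<forall>k r. r > 0 \<longrightarrow> r powr b * theta q k r \<le> C * theta q (k - 2 * b) (r / 2)"
proof -
 obtain C where C: "C > 0" "\<And>q k r s. r > 0 \<Longrightarrow> r powr b * theta_ker q k r s \<le> C * theta_ker q (k - 2 * b) (r / 2) s"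
  using theta_ker_le[OF assms(2)] by blast
 have "r powr b * theta q k r \<le> C * theta q (k - 2 * b) (r / 2)" if r: "r > 0" for k r
 proof -
  have "(\<integral>s. r powr b * theta_ker q k r s) \<le> (\<integral>s. C * theta_ker q (k - 2 * b) (r / 2) s)"
   using C(2) r assms by (intro integral_mono integrable_mult_right theta_ker_integrable) auto
  then show ?thesis by (simp add: theta_def)
 qed
 then show ?thesis using C(1) by blast
qed

text \<open>The parameter \<open>b\<close> lowers the order to \<open>k - 2 b < 1\<close>, where the integral converges even for \<open>r
 = 0\<close>.\<close>

lemma theta_le_powr:
 assumes "q > 0" "b \<ge> 0" "2 * b > k - 1"
 shows "\<exists>C>0. \<forall>r>0. theta q k r \<le> C * r powr (- b)"
proof -
 obtain C where C: "C > 0" "\<And>k r. r > 0 \<Longrightarrow> r powr b * theta q k r \<le> C * theta q (k - 2 * b) (r / 2)"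
  using theta_absorb[OF assms(1,2)] by blast
 have "theta q k r \<le> (C * theta q (k - 2 * b) 0 + 1) * r powr (- b)" if r: "r > 0" for r
 proof -
  have "r powr b * theta q k r \<le> C * theta q (k - 2 * b) (r / 2)" using C(2) r by blast
  also have "\<dots> \<le> C * theta q (k - 2 * b) 0" using C(1) assms r by (intro mult_left_mono theta_mono) auto
  also have "\<dots> \<le> C * theta q (k - 2 * b) 0 + 1" by simp
  finally show ?thesis using r by (simp add: powr_minus field_simps)
 qed
 moreover have "C * theta q (k - 2 * b) 0 + 1 > 0" using C(1) theta_nonneg by (simp add: add_nonneg_pos)
 ultimately show ?thesis by blast
qed

lemma theta_deriv:
 assumes "q > 0" "r > 0"
 shows "(theta q k has_real_derivative - theta q (k + 2) r) (at r)"
proof -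
 have "((\<lambda>r. \<integral>s. theta_ker q k r s \<partial>lborel) has_derivative
   (\<lambda>h. (\<integral>s. (\<lambda>r s. - theta_ker q (k + 2) r s) r s) \<bullet> h)) (at r)"
 proof (rule has_derivative_integral_dominated[where U="{r/2<..}" and D="theta_ker q (k + 2) (r / 2)"])
  fix x s assume x: "x \<in> {r/2<..}"
  have "((\<lambda>x. theta_ker q k x s) has_real_derivative - theta_ker q (k + 2) x s) (at x)"
  proof (cases "s > 0")
   case True
   then have k2: "s powr (- (k + 2)) = s powr (- k) * (1 / s\<^sup>2)" by (simp add: powr_diff powr_minus field_simps)
   have "((\<lambda>x. exp (- q * s\<^sup>2 - x / s\<^sup>2)) has_real_derivative exp (- q * s\<^sup>2 - x / s\<^sup>2) * (- (1 / s\<^sup>2))) (at x)"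
   proof -
    have "((\<lambda>x. exp (a - x * c)) has_real_derivative exp (a - x * c) * (- c)) (at x)" for a c :: real
     by (auto intro!: derivative_eq_intros)
    from this[of "- q * s\<^sup>2" "1 / s\<^sup>2"] show ?thesis by simp
   qed
   from DERIV_cmult[OF this, of "s powr (- k)"] show ?thesis
    unfolding theta_ker_def k2 using True by (simp add: mult_ac)
  qed (simp add: theta_ker_def)
  then show "((\<lambda>x. theta_ker q k x s) has_derivative (\<lambda>h. - theta_ker q (k + 2) x s \<bullet> h)) (at x)"
   unfolding has_field_derivative_def inner_real_def .
  show "norm (- theta_ker q (k + 2) x s) \<le> theta_ker q (k + 2) (r / 2) s"
   using x theta_ker_mono[of "r/2" x q "k + 2" s] by (simp add: theta_ker_nonneg)
 qed (use assms in \<open>auto intro!: theta_ker_integrable\<close>)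
 then have "((\<lambda>r. \<integral>s. theta_ker q k r s \<partial>lborel) has_derivative (\<lambda>h. (- theta q (k + 2) r) * h)) (at r)"
  by (simp add: theta_def)
 then show ?thesis unfolding has_field_derivative_def theta_def[abs_def] .
qed

lemma theta_continuous: "q > 0 \<Longrightarrow> continuous_on {0<..} (theta q k)"
 using theta_deriv by (meson DERIV_isCont continuous_at_imp_continuous_on greaterThan_iff)


lemma integral_positive_axis_FTC:
 fixes F f :: "real \<Rightarrow> real"
 assumes d: "\<And>s. s > 0 \<Longrightarrow> (F has_real_derivative f s) (at s)" and c: "\<And>s. s > 0 \<Longrightarrow> isCont f s"
  and i: "L1 (\<lambda>s. indicator {0<..} s * f s)" and A: "(F \<longlongrightarrow> A) (at_right 0)" and B: "(F \<longlongrightarrow> B) at_top"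
 shows "(\<integral>s. indicator {0<..} s * f s) = B - A"
proof -
 have e: "indicator (einterval 0 \<infinity>) s *\<^sub>R f s = indicator {0<..} s * f s" for s
  by (auto simp: einterval_def indicator_def)
 have "(LBINT s=0..\<infinity>. f s) = B - A"
 proof (rule interval_integral_FTC_integrable)
  show "(F has_vector_derivative f x) (at x)" if "0 < ereal x" for x
   using d[of x] that by (simp add: has_real_derivative_iff_has_vector_derivative)
  show "set_integrable lborel (einterval 0 \<infinity>) f" using i by (simp only: set_integrable_def e)
  show "((F \<circ> real_of_ereal) \<longlongrightarrow> A) (at_right 0)" using A by (simp add: ereal_tendsto_simps1 zero_ereal_def)
  show "((F \<circ> real_of_ereal) \<longlongrightarrow> B) (at_left \<infinity>)" using B by (simp add: ereal_tendsto_simps1)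
 qed (use c in auto)
 moreover have "(0::ereal) \<le> \<infinity>" by simp
 ultimately show ?thesis by (simp only: interval_lebesgue_integral_def set_lebesgue_integral_def if_True e)
qed

text \<open>The recurrence of the Bessel functions: integrate the derivative of \<open>s\<^sup>-\<^sup>k exp (- q s\<^sup>2 - r /
 s\<^sup>2)\<close> over the positive axis. For the radial kernels it is equivalent to the differential
 equation.\<close>

lemma theta_recurrence:
 assumes q: "q > 0" and r: "r > 0"
 shows "k * theta q (k + 1) r + 2 * q * theta q (k - 1) r = 2 * r * theta q (k + 3) r"
proof -
 define F where "F s = s powr (- k) * exp (- q * s\<^sup>2 - r / s\<^sup>2)" for s :: real
 define f where "f s = - k * theta_ker q (k + 1) r s - 2 * q * theta_ker q (k - 1) r s + 2 * r * theta_ker q (k + 3) r s" for s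
 have F_der: "(F has_real_derivative f s) (at s)" if s: "s > 0" for s
 proof -
  have p: "s powr (- (k + 1)) = s powr (- k) / s" "s powr (- (k - 1)) = s powr (- k) * s"
   "s powr (- (k + 3)) = s powr (- k) / s ^ 3"
   using s by (simp_all add: powr_diff powr_minus powr_add field_simps powr_numeral)
  have 1: "((\<lambda>s. - q * s\<^sup>2 - r / s\<^sup>2) has_real_derivative (- 2 * q * s + 2 * r / s ^ 3)) (at s)"
   using s by (auto intro!: derivative_eq_intros simp: power2_eq_square power3_eq_cube field_simps)
  have 2: "((\<lambda>s. s powr (- k)) has_real_derivative - k * (s powr (- k) / s)) (at s)"
   using s by (auto intro!: derivative_eq_intros simp: powr_diff)
  have "(F has_real_derivative s powr (- k) * (exp (- q * s\<^sup>2 - r / s\<^sup>2) * (- 2 * q * s + 2 * r / s ^ 3)) +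
    - k * (s powr (- k) / s) * exp (- q * s\<^sup>2 - r / s\<^sup>2)) (at s)"
   unfolding F_def by (rule DERIV_mult'[OF 2 DERIV_chain2[OF DERIV_exp 1]])
  moreover have "s powr (- k) * (exp (- q * s\<^sup>2 - r / s\<^sup>2) * (- 2 * q * s + 2 * r / s ^ 3)) +
    - k * (s powr (- k) / s) * exp (- q * s\<^sup>2 - r / s\<^sup>2) = f s"
   unfolding f_def theta_ker_def p using s by (simp add: algebra_simps)
  ultimately show ?thesis by simp
 qed
 have int: "L1 (theta_ker q j r)" for j using q r by (rule theta_ker_integrable)
 have f: "indicator {0<..} s * f s = f s" for s by (auto simp: f_def theta_ker_def indicator_def)
 have "(\<integral>s. indicator {0<..} s * f s) = 0 - 0"
 proof (rule integral_positive_axis_FTC[OF F_der])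
  show "isCont f x" if "0 < x" for x
  proof -
   have "isCont (theta_ker q j r) x" for j
   proof -
    have "isCont (\<lambda>s. s powr (- j) * exp (- q * s\<^sup>2 - r / s\<^sup>2)) x"
     using that by (intro continuous_intros) auto
    moreover have ev: "\<forall>\<^sub>F s in nhds x. theta_ker q j r s = s powr (- j) * exp (- q * s\<^sup>2 - r / s\<^sup>2)"
     unfolding eventually_nhds using that by (intro exI[of _ "{0<..}"]) (auto simp: theta_ker_def)
    ultimately show ?thesis using isCont_cong[OF ev] by blast
   qed
   then show ?thesis unfolding f_def by (intro continuous_intros)
  qed
  show "L1 (\<lambda>s. indicator {0<..} s * f s)" unfolding f unfolding f_def
   by (intro Bochner_Integration.integrable_add Bochner_Integration.integrable_diff integrable_mult_right int)
  (* For large k the power s^(-k) is singular at 0; the factor exp (- r / s^2) removes any power of s, and b is chosen such that F s is O(s). *)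
  define b where "b = max 0 ((k + 1) / 2)"
  have "k + 1 \<le> 2 * b" by (auto simp: b_def max_def field_simps)
  then have "2 * b - k \<ge> 1" by linarith
  moreover have "b \<ge> 0" by (simp add: b_def)
  ultimately have b: "b \<ge> 0" "2 * b - k \<ge> 1" by blast+
  obtain C where C: "C > 0" "\<And>q k r s. r > 0 \<Longrightarrow> r powr b * theta_ker q k r s \<le> C * theta_ker q (k - 2 * b) (r / 2) s"
   using theta_ker_le[OF b(1)] by blast
  show "(F \<longlongrightarrow> 0) (at_right 0)"
  proof (rule tendsto_sandwich[of "\<lambda>_. 0"])
   show "\<forall>\<^sub>F s in at_right 0. 0 \<le> F s" by (simp add: F_def)
   have "F s \<le> C / r powr b * s" if s: "0 < s" "s < 1" for s
   proof -
    have "r powr b * F s \<le> C * theta_ker q (k - 2 * b) (r / 2) s"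
     using C(2)[OF r, of q k s] s by (simp add: F_def theta_ker_def)
    also have "\<dots> \<le> C * s powr 1"
    proof -
     have "s powr (2 * b - k) \<le> s powr 1" using s b by (intro powr_mono') auto
     moreover have "exp (- q * s\<^sup>2 - r / 2 / s\<^sup>2) \<le> 1"
     proof -
      have "0 \<le> q * s\<^sup>2" "0 \<le> r / 2 / s\<^sup>2" using q r by simp_all
      then have "- q * s\<^sup>2 - r / 2 / s\<^sup>2 \<le> 0" by linarith
      then show ?thesis by (simp only: exp_le_one_iff)
     qed
     ultimately have "s powr (2 * b - k) * exp (- q * s\<^sup>2 - r / 2 / s\<^sup>2) \<le> s powr 1 * 1"
      by (intro mult_mono) auto
     then show ?thesis using C(1) s by (simp add: theta_ker_def)
    qed
    finally show ?thesis using s r by (simp add: field_simps)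
   qed
   then show "\<forall>\<^sub>F s in at_right 0. F s \<le> C / r powr b * s"
    by (intro eventually_at_rightI[of 0 1]) auto
   show "((\<lambda>s. C / r powr b * s) \<longlongrightarrow> 0) (at_right 0)"
    by (rule tendsto_eq_rhs[OF tendsto_mult[OF tendsto_const tendsto_ident_at]]) simp
  qed simp
  show "(F \<longlongrightarrow> 0) at_top" unfolding F_def using q r by real_asymp
 qed
 moreover have "(\<integral>s. f s) = - k * theta q (k + 1) r - 2 * q * theta q (k - 1) r + 2 * r * theta q (k + 3) r"
  unfolding f_def theta_def using int by simp
 ultimately show ?thesis by (simp add: f)
qed

text \<open>In \<open>theta_ker\<close> the distance enters through the Gaussian \<open>exp (- l \<bar>y\<bar>\<^sup>2 / s\<^sup>2)\<close>, whose
 integral is proportional to \<open>s\<^sup>d\<close> with \<open>d\<close> the dimension; by Tonelli this power of \<open>s\<close> shifts the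
 parameter \<open>k\<close>.\<close>

lemma theta_slice_nn:
 fixes k :: real
 assumes q: "q > 0" and l: "l > 0" and r: "r > 0 \<or> r = 0 \<and> k - DIM('a) < 1"
 shows "(\<integral>\<^sub>+y. theta q k (r + l * (norm (y::'a::euclidean_space))\<^sup>2))
  = ennreal ((pi / l) powr (DIM('a) / 2) * theta q (k - DIM('a)) r)"
proof -
 have "(\<integral>\<^sub>+y. theta q k (r + l * (norm (y::'a))\<^sup>2))
  = (\<integral>\<^sup>+y. \<integral>\<^sup>+s. ennreal (theta_ker q k (r + l * (norm (y::'a))\<^sup>2) s) \<partial>lborel)"
 proof (rule nn_integral_cong_AE)
  have "AE y in lborel. y \<noteq> (0::'a)" by (rule AE_lborel_singleton)
  then show "AE y in lborel. ennreal (theta q k (r + l * (norm (y::'a))\<^sup>2)) = (\<integral>\<^sub>+s. theta_ker q k (r + l * (norm y)\<^sup>2) s)"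
  proof eventually_elim
   case (elim y)
   then have "r + l * (norm y)\<^sup>2 > 0" using r l by (intro add_nonneg_pos) auto
   then show ?case by (intro theta_nn theta_ker_integrable q)
  qed
 qed
 also have "\<dots> = (\<integral>\<^sup>+s. \<integral>\<^sup>+y. ennreal (theta_ker q k (r + l * (norm (y::'a))\<^sup>2) s) \<partial>lborel)"
  by (rule lborel_pair.Fubini'[symmetric]) (simp add: theta_ker_def)
 also have "\<dots> = (\<integral>\<^sup>+s. ennreal ((pi / l) powr (DIM('a) / 2)) * ennreal (theta_ker q (k - DIM('a)) r s))"
 proof (rule nn_integral_cong)
  fix s :: real
  show "(\<integral>\<^sub>+y. theta_ker q k (r + l * (norm (y::'a))\<^sup>2) s) = ennreal ((pi / l) powr (DIM('a) / 2)) * ennreal (theta_ker q (k - DIM('a)) r s)"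
  proof (cases "s > 0")
   case s: True
   have "theta_ker q k (r + l * (norm y)\<^sup>2) s = theta_ker q k r s * exp (- (l / s\<^sup>2) * (norm y)\<^sup>2)" for y :: 'a
    using s by (simp add: theta_ker_def exp_add[symmetric] add_divide_distrib algebra_simps)
   then have "(\<integral>\<^sub>+y. theta_ker q k (r + l * (norm (y::'a))\<^sup>2) s) =
     ennreal (theta_ker q k r s) * ennreal ((pi / (l / s\<^sup>2)) powr (DIM('a) / 2))"
    using s l by (simp add: ennreal_mult theta_ker_nonneg nn_integral_cmult gaussian_nn_integral[of "l / s\<^sup>2", simplified])
   also have "(pi / (l / s\<^sup>2)) powr (DIM('a) / 2) = (pi / l) powr (DIM('a) / 2) * s powr DIM('a)"
   proof -
    have "(pi / (l / s\<^sup>2)) powr (DIM('a) / 2) = ((pi / l) * s\<^sup>2) powr (DIM('a) / 2)" by simp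
    also have "\<dots> = (pi / l) powr (DIM('a) / 2) * (s\<^sup>2) powr (DIM('a) / 2)" by (rule powr_mult)
    also have "(s\<^sup>2) powr (DIM('a) / 2) = s powr DIM('a)"
     using s by (simp add: powr_powr flip: powr_numeral)
    finally show ?thesis .
   qed
   also have "ennreal (theta_ker q k r s) * ennreal ((pi / l) powr (DIM('a) / 2) * s powr DIM('a)) =
     ennreal ((pi / l) powr (DIM('a) / 2)) * ennreal (theta_ker q (k - DIM('a)) r s)"
   proof -
    have "s powr (real DIM('a) - k) = s powr DIM('a) * s powr (- k)" by (simp add: powr_add[symmetric])
    then show ?thesis using s by (simp add: ennreal_mult[symmetric] theta_ker_nonneg, simp add: theta_ker_def mult_ac)
   qed
   finally show ?thesis .
  qed (simp add: theta_ker_def)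
 qed
 also have "\<dots> = ennreal ((pi / l) powr (DIM('a) / 2)) * ennreal (theta q (k - DIM('a)) r)"
  using r q theta_ker_integrable[of q r "k - DIM('a)"] theta_ker_integrable_0[of q "k - DIM('a)"]
  by (subst theta_nn) (auto simp: nn_integral_cmult)
 finally show ?thesis by (simp add: ennreal_mult theta_nonneg)
qed

lemma
 fixes k :: real
 assumes q: "q > 0" and l: "l > 0" and r: "r > 0 \<or> r = 0 \<and> k - DIM('a) < 1"
 shows theta_slice_integrable: "L1 (\<lambda>y::'a::euclidean_space. theta q k (r + l * (norm y)\<^sup>2))"
  and theta_slice: "(\<integral>y. theta q k (r + l * (norm (y::'a))\<^sup>2)) = (pi / l) powr (DIM('a) / 2) * theta q (k - DIM('a)) r"
 using theta_slice_nn[OF assms]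
 by (auto intro!: integrableI_nn_integral_finite integral_eq_nn_integral[THEN trans] simp: theta_nonneg)

text \<open>The substitution \<open>t = - x / s\<close> turns \<open>x * theta q 2 (x\<^sup>2)\<close> into a Gaussian integral over the
 negative axis, perturbed by \<open>exp (- q x\<^sup>2 / t\<^sup>2)\<close>. This limit is the origin of the jump of the
 normal derivative of a single layer.\<close>

lemma theta_2_tendsto:
 assumes q: "q > 0"
 shows "((\<lambda>x. x * theta q 2 (x\<^sup>2)) \<longlongrightarrow> sqrt pi / 2) (at_right 0)"
proof -
 define f where "f x t = exp (- t\<^sup>2 - q * x\<^sup>2 / t\<^sup>2)" for x t :: real
 have subst: "x * theta q 2 (x\<^sup>2) = (\<integral>t. indicator {..<0} t * f x t)" if x: "x > 0" for x
 proof -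
  have fg: "f x (- x / s) * (x / s\<^sup>2) = x * (s powr (- 2) * exp (- q * s\<^sup>2 - x\<^sup>2 / s\<^sup>2))" if "s > 0" for s
   using that x by (simp add: f_def powr_minus powr_numeral power_divide field_simps)
  have eq: "(LBINT t=-\<infinity>..0. f x t) = (LBINT s=0..\<infinity>. f x (- x / s) * (x / s\<^sup>2))"
  proof (rule interval_integral_substitution_nonneg)
   show "DERIV (\<lambda>s. - x / s) s :> x / s\<^sup>2" if "0 < ereal s" for s
    using that by (auto intro!: derivative_eq_intros simp: power2_eq_square)
   show "isCont (f x) (- x / s)" if "0 < ereal s" for s
    unfolding f_def using that x by (intro continuous_intros) auto
   show "isCont (\<lambda>s. x / s\<^sup>2) s" if "0 < ereal s" for s using that by (intro continuous_intros) auto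
   have "((\<lambda>s. - x / s) \<longlongrightarrow> 0) at_top" using x by real_asymp
   then show "((ereal \<circ> (\<lambda>s. - x / s) \<circ> real_of_ereal) \<longlongrightarrow> 0) (at_left \<infinity>)"
    by (simp add: ereal_tendsto_simps zero_ereal_def)
   have "filterlim (\<lambda>s. - x / s) at_bot (at_right 0)" using x by real_asymp
   then show "((ereal \<circ> (\<lambda>s. - x / s) \<circ> real_of_ereal) \<longlongrightarrow> - \<infinity>) (at_right 0)"
    by (simp add: ereal_tendsto_simps zero_ereal_def)
   have "indicator (einterval 0 \<infinity>) s *\<^sub>R (f x (- x / s) * (x / s\<^sup>2)) = x * theta_ker q 2 (x\<^sup>2) s" for s
    using fg[of s] by (auto simp: theta_ker_def indicator_def einterval_def)
   then show "set_integrable lborel (einterval 0 \<infinity>) (\<lambda>s. f x (- x / s) * (x / s\<^sup>2))"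
    unfolding set_integrable_def using theta_ker_integrable[OF q, of "x\<^sup>2" 2] x by simp
  qed (use x in \<open>auto simp: f_def\<close>)
  have "indicator (einterval 0 \<infinity>) s *\<^sub>R (f x (- x / s) * (x / s\<^sup>2)) = x * theta_ker q 2 (x\<^sup>2) s" for s
   using fg[of s] by (auto simp: theta_ker_def indicator_def einterval_def)
  then have "(LBINT s=0..\<infinity>. f x (- x / s) * (x / s\<^sup>2)) = x * theta q 2 (x\<^sup>2)"
   by (simp add: interval_lebesgue_integral_def set_lebesgue_integral_def theta_def)
  moreover have "einterval (-\<infinity>) 0 = {..<0::real}" by (auto simp: einterval_def)
  ultimately show ?thesis using eq by (simp add: interval_lebesgue_integral_def set_lebesgue_integral_def)
 qed
 have g: "L1 (\<lambda>t::real. exp (- t\<^sup>2))"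
  using gaussian_integrable[of 1, where 'a=real] by simp
 have "isCont (\<lambda>x. \<integral>t. indicator {..<0} t * f x t \<partial>lborel) 0"
 proof (rule isCont_integral_dominated[where U=UNIV and D="\<lambda>t. exp (- t\<^sup>2)"])
  show "isCont (\<lambda>x. indicator {..<0} t * f x t) 0" for t
   unfolding f_def by (cases "t = 0") (auto intro!: continuous_intros)
  show "\<bar>indicator {..<0} t * f x t\<bar> \<le> exp (- t\<^sup>2)" for x t using q by (auto simp: f_def indicator_def)
 qed (use g in \<open>auto simp: f_def\<close>)
 then have "((\<lambda>x. \<integral>t. indicator {..<0} t * f x t \<partial>lborel) \<longlongrightarrow> (\<integral>t. indicator {..<0} t * f 0 t)) (at_right 0)"
  by (simp add: isCont_def filterlim_at_split)
 moreover have "\<forall>\<^sub>F x in at_right 0. (\<integral>t. indicator {..<0} t * f x t) = x * theta q 2 (x\<^sup>2)"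
  using subst by (intro eventually_at_rightI[of 0 1]) auto
 moreover have "(\<integral>t. indicator {..<0} t * f 0 t) = sqrt pi / 2"
 proof -
  have "(\<integral>t. indicator {..<0} t * f 0 t) = (\<integral>t. indicator {..<0} (0 - t) * f 0 (0 - t))"
   by (rule integral_lborel_reflect[symmetric]) (simp add: f_def)
  also have "\<dots> = (\<integral>t. indicator {0..} t *\<^sub>R exp (- t\<^sup>2))"
  proof (rule integral_cong_AE)
   show "AE t in lborel. indicator {..<0} (0 - t) * f 0 (0 - t) = indicator {0..} t *\<^sub>R exp (- t\<^sup>2)"
    using AE_lborel_singleton[of "0::real"] by eventually_elim (auto simp: f_def indicator_def)
  qed (simp_all add: f_def)
  also have "\<dots> = sqrt pi / 2" using gaussian_moment_0 by (simp add: has_bochner_integral_iff)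
  finally show ?thesis .
 qed
 ultimately show ?thesis using Lim_transform_eventually by force
qed

section \<open>The Bessel kernel\<close>

text \<open>With \<open>d\<close> the dimension and \<open>4 t = s\<^sup>2\<close> this is \<open>\<integral>\<^sub>0\<^sup>\<infinity> exp (- 4 q t) (4 \<pi> t)\<^bsup>- d/2\<^esup> exp (-
 \<bar>z\<bar>\<^sup>2 / (4 t)) dt\<close>, the time integral of the heat kernel and hence the fundamental solution of \<open>4
 q - \<Delta>\<close>.\<close>

definition bessel :: "real \<Rightarrow> 'a::euclidean_space \<Rightarrow> real" where
 "bessel q z = theta q (real DIM('a) - 1) ((norm z)\<^sup>2) / (2 * pi powr (DIM('a) / 2))"

text \<open>The kernel is even, so \<open>z + \<zeta>\<close> instead of \<open>z - \<zeta>\<close> gives the same convolution.\<close>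

definition bessel_conv :: "real \<Rightarrow> ('a::euclidean_space \<Rightarrow> real) \<Rightarrow> 'a \<Rightarrow> real" where
 "bessel_conv q g z = (\<integral>\<zeta>. bessel q \<zeta> * g (z + \<zeta>))"

lemma bessel_nonneg: "0 \<le> bessel q z" by (simp add: bessel_def theta_nonneg)

lemma bessel_measurable [measurable]: "bessel q \<in> Borel"
 unfolding bessel_def[abs_def] by measurable

lemma bessel_integrable: "q > 0 \<Longrightarrow> L1 (bessel q :: 'a::euclidean_space \<Rightarrow> real)"
 unfolding bessel_def[abs_def] using theta_slice_integrable[of q 1 0 "real DIM('a) - 1", where 'a='a] by simp

lemma bessel_mult_integrable:
 fixes f :: "'a::euclidean_space \<Rightarrow> real"
 assumes q: "q > 0" and [measurable]: "f \<in> Borel" and B: "\<And>z. \<bar>f z\<bar> \<le> B"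
 shows "L1 (\<lambda>\<zeta>. bessel q \<zeta> * f \<zeta>)"
proof (rule integrable_bound_pointwise[OF integrable_mult_right[OF bessel_integrable[OF q], of B]])
 show "norm (bessel q z * f z) \<le> B * bessel q z" for z
  using mult_left_mono[OF B bessel_nonneg] by (simp add: abs_mult bessel_nonneg mult.commute)
qed measurable

lemma test_function_gradient_bounded:
 assumes "test_function S g"
 obtains B where "B > 0" "\<And>z. norm (gradient g z) \<le> B"
proof -
 have "\<exists>B. \<forall>z. norm (gradient g z) \<le> B"
 proof -
  have "\<exists>B. \<forall>z. \<bar>gradient g z \<bullet> b\<bar> \<le> B" for b
   using test_function_bounded[OF test_function_gradient_inner[OF assms, of b]] by metis
  then obtain B where B: "\<And>b z. \<bar>gradient g z \<bullet> b\<bar> \<le> B b" by metis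
  have "norm (gradient g z) \<le> (\<Sum>b\<in>Basis. B b)" for z
   using norm_le_l1[of "gradient g z"] sum_mono[of Basis "\<lambda>b. \<bar>gradient g z \<bullet> b\<bar>" B] B by fastforce
  then show ?thesis by blast
 qed
 then obtain B where "\<And>z. norm (gradient g z) \<le> B" by blast
 then have "\<And>z. norm (gradient g z) \<le> \<bar>B\<bar> + 1" by (metis abs_ge_self add_increasing2 order_trans zero_le_one)
 then show ?thesis by (intro that[of "\<bar>B\<bar> + 1"]) auto
qed

lemma test_function_shift_measurable:
 assumes "test_function S g" "f \<in> borel_measurable M" shows "(\<lambda>x. g (f x)) \<in> borel_measurable M"
 using measurable_compose[OF assms(2) test_function_measurable[OF assms(1)]] .

lemma test_function_gradient_measurable:
 "test_function S g \<Longrightarrow> gradient g \<in> Borel"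
 by (rule borel_measurable_continuous_onI[OF test_function_gradient_continuous])

lemma bessel_conv_derivative:
 fixes g :: "'a::euclidean_space \<Rightarrow> real"
 assumes q: "q > 0" and g: "test_function UNIV g"
 shows "(bessel_conv q g has_derivative (\<lambda>h. bessel_conv q (\<lambda>z. gradient g z \<bullet> h) z)) (at z)"
proof -
 obtain B R where B: "\<And>z. \<bar>g z\<bar> \<le> B" by (rule test_function_bounded[OF g], rule that)
 obtain C where C: "C > 0" "\<And>z. norm (gradient g z) \<le> C" by (rule test_function_gradient_bounded[OF g], rule that)
 have [measurable]: "g \<in> Borel" "gradient g \<in> Borel"
  using g test_function_measurable test_function_gradient_measurable by blast+
 define F' where "F' z \<zeta> = bessel q \<zeta> *\<^sub>R gradient g (z + \<zeta>)" for z \<zeta>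
 have [measurable]: "F' z \<in> Borel" for z unfolding F'_def[abs_def] by measurable
 have bnd: "norm (F' z \<zeta>) \<le> C * bessel q \<zeta>" for z \<zeta>
  using mult_right_mono[OF C(2) bessel_nonneg[of q \<zeta>]] by (simp add: F'_def bessel_nonneg mult.commute)
 have "((\<lambda>z. \<integral>\<zeta>. bessel q \<zeta> * g (z + \<zeta>) \<partial>lborel) has_derivative (\<lambda>h. (\<integral>\<zeta>. F' z \<zeta>) \<bullet> h)) (at z)"
 proof (rule has_derivative_integral_dominated[where U=UNIV and D="\<lambda>\<zeta>. C * bessel q \<zeta>"])
  show "L1 (\<lambda>\<zeta>. bessel q \<zeta> * g (x + \<zeta>))" for x
   using B by (intro bessel_mult_integrable[OF q, where B=B]) auto
  fix x \<zeta> :: 'a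
  have "((\<lambda>x. x + \<zeta>) has_derivative (\<lambda>h. h)) (at x)" by (auto intro!: derivative_eq_intros)
  from has_derivative_compose[OF this test_function_gradient[OF g]]
  have "((\<lambda>x. g (x + \<zeta>)) has_derivative (\<lambda>h. gradient g (x + \<zeta>) \<bullet> h)) (at x)" by simp
  from has_derivative_mult_right[OF this, of "bessel q \<zeta>"]
  show "((\<lambda>x. bessel q \<zeta> * g (x + \<zeta>)) has_derivative (\<lambda>h. F' x \<zeta> \<bullet> h)) (at x)"
   by (simp add: F'_def)
 qed (use bnd bessel_integrable[OF q, where 'a='a] in auto)
 moreover have "(\<integral>\<zeta>. F' z \<zeta>) \<bullet> h = bessel_conv q (\<lambda>z. gradient g z \<bullet> h) z" for h
 proof -
  have "L1 (F' z)"
   by (rule integrable_bound_pointwise[OF integrable_mult_right[OF bessel_integrable[OF q], of C] _ bnd]) measurable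
  then have "(\<integral>\<zeta>. F' z \<zeta>) \<bullet> h = (\<integral>\<zeta>. F' z \<zeta> \<bullet> h)" by simp
  then show ?thesis by (simp add: F'_def bessel_conv_def)
 qed
 ultimately show ?thesis by (simp add: bessel_conv_def[abs_def])
qed

text \<open>Derivatives fall on the test function, hence the convolution is smooth in spite of the
 singular kernel.\<close>

lemma Ck_on_bessel_conv:
 assumes q: "q > 0" and g: "test_function UNIV g"
 shows "Ck_on k (bessel_conv q g) UNIV"
 using g
proof (induction k arbitrary: g)
 case 0
 have "continuous_on UNIV (bessel_conv q g)"
  using has_derivative_continuous[OF bessel_conv_derivative[OF q 0]] continuous_at_imp_continuous_on by blast
 then show ?case by simp
next
 case (Suc k)
 show ?case
  by (rule Ck_on_SucI[OF open_UNIV bessel_conv_derivative[OF q Suc.prems]], rule Suc.IH)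
   (rule test_function_gradient_inner[OF Suc.prems])
qed

lemma bessel_conv_gradient:
 assumes q: "q > 0" and g: "test_function UNIV g"
 shows "gradient (bessel_conv q g) z \<bullet> h = bessel_conv q (\<lambda>z. gradient g z \<bullet> h) z"
 using gradient_inner[OF bessel_conv_derivative[OF assms]] .

lemma bessel_conv_measurable [measurable]:
 assumes [measurable]: "g \<in> Borel"
 shows "bessel_conv q g \<in> Borel"
proof -
 have [measurable]: "(\<lambda>(z, \<zeta>). bessel q \<zeta> * g (z + \<zeta>)) \<in> borel_measurable (borel \<Otimes>\<^sub>M lborel)"
 proof -
  have "(\<lambda>(z, \<zeta>). bessel q \<zeta> * g (z + \<zeta>)) \<in> borel_measurable (borel \<Otimes>\<^sub>M borel)" by measurable
  then show ?thesis by (simp cong: measurable_cong_sets sets_pair_measure_cong)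
 qed
 show ?thesis unfolding bessel_conv_def[abs_def] by measurable
qed

lemma bessel_conv_bounded:
 assumes q: "q > 0" and [measurable]: "g \<in> Borel" and B: "\<And>z. \<bar>g z\<bar> \<le> B"
 shows "\<bar>bessel_conv q g (z::'a::euclidean_space)\<bar> \<le> B * (\<integral>\<zeta>. bessel q (\<zeta>::'a))"
proof -
 have "\<bar>bessel_conv q g z\<bar> \<le> (\<integral>\<zeta>. norm (bessel q \<zeta> * g (z + \<zeta>)))"
  unfolding bessel_conv_def real_norm_def[symmetric] by (rule integral_norm_bound)
 also have "\<dots> \<le> (\<integral>\<zeta>. B * bessel q (\<zeta>::'a))"
 proof (rule integral_mono)
  show "L1 (\<lambda>\<zeta>. norm (bessel q \<zeta> * g (z + \<zeta>)))"
   using B by (intro integrable_norm bessel_mult_integrable[OF q, where B=B]) auto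
  show "norm (bessel q \<zeta> * g (z + \<zeta>)) \<le> B * bessel q \<zeta>" for \<zeta> :: 'a
   using mult_right_mono[OF B[of "z + \<zeta>"] bessel_nonneg[of q \<zeta>]] by (simp add: abs_mult bessel_nonneg mult.commute)
 qed (use bessel_integrable[OF q, where 'a='a] in simp)
 finally show ?thesis by simp
qed

lemma bessel_conv_abs_nn:
 assumes q: "q > 0" and [measurable]: "g \<in> Borel"
 shows "ennreal \<bar>bessel_conv q g z\<bar> \<le> (\<integral>\<^sup>+\<zeta>. ennreal (bessel q \<zeta>) * ennreal \<bar>g (z + \<zeta>)\<bar>)"
proof -
 have "ennreal (norm (\<integral>\<zeta>. bessel q \<zeta> * g (z + \<zeta>))) \<le> (\<integral>\<^sub>+\<zeta>. norm (bessel q \<zeta> * g (z + \<zeta>)))"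
 proof (cases "L1 (\<lambda>\<zeta>. bessel q \<zeta> * g (z + \<zeta>))")
  case True
  then show ?thesis by (rule integral_norm_bound_ennreal)
 qed (simp add: not_integrable_integral_eq)
 then show ?thesis by (simp add: bessel_conv_def abs_mult ennreal_mult bessel_nonneg)
qed

lemma bessel_conv_integrable:
 fixes g :: "'a::euclidean_space \<Rightarrow> real"
 assumes q: "q > 0" and g: "test_function UNIV g"
 shows "L1 (bessel_conv q g)"
proof -
 have [measurable]: "g \<in> Borel" using g by (rule test_function_measurable)
 have "(\<integral>\<^sub>+z. norm (bessel_conv q g z))
   \<le> (\<integral>\<^sup>+z. \<integral>\<^sup>+\<zeta>. ennreal (bessel q \<zeta>) * ennreal \<bar>g (z + \<zeta>)\<bar> \<partial>lborel)"
  by (intro nn_integral_mono) (simp add: bessel_conv_abs_nn[OF q])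
 also have "\<dots> = (\<integral>\<^sup>+\<zeta>. \<integral>\<^sup>+z. ennreal (bessel q \<zeta>) * ennreal \<bar>g (z + \<zeta>)\<bar> \<partial>lborel)"
  by (rule lborel_pair.Fubini'[symmetric]) measurable
 also have "\<dots> = (\<integral>\<^sup>+\<zeta>. ennreal (bessel q (\<zeta>::'a)) * (\<integral>\<^sub>+z. \<bar>g z\<bar>))"
  using nn_integral_lborel_translate[of "\<lambda>z. ennreal \<bar>g z\<bar>"] by (simp add: nn_integral_cmult)
 also have "\<dots> = (\<integral>\<^sub>+\<zeta>. bessel q (\<zeta>::'a)) * (\<integral>\<^sub>+z. \<bar>g z\<bar>)"
  by (simp add: nn_integral_multc)
 also have "\<dots> < \<infinity>"
  using bessel_integrable[OF q, where 'a='a] test_function_integrable[OF g]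
  by (auto simp: ennreal_mult_less_top integrable_iff_bounded bessel_nonneg)
 finally show ?thesis by (intro integrableI_bounded) simp_all
qed

lemma test_function_slice_nn:
 fixes g :: "real \<times> (real^'n) \<Rightarrow> real"
 assumes g: "test_function UNIV g"
 obtains C where "C \<ge> 0" "\<And>x. (\<integral>\<^sub>+y. \<bar>g (x, y)\<bar>) \<le> ennreal C"
proof -
 obtain B R where B: "\<And>z. \<bar>g z\<bar> \<le> B * indicator (cball 0 R) z" "B > 0"
  by (rule test_function_bounded[OF g], rule that)
 have "(\<integral>\<^sub>+y. \<bar>g (x, y)\<bar>) \<le> ennreal (B * measure lborel (cball (0::real^'n) R))" for x
 proof -
  have "(\<integral>\<^sub>+y. \<bar>g (x, y)\<bar>) \<le> (\<integral>\<^sup>+y. ennreal B * indicator (cball 0 R) (y::real^'n))"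
  proof (rule nn_integral_mono)
   fix y :: "real^'n"
   have "indicator (cball 0 R) (x, y) \<le> (indicator (cball 0 R) y :: real)"
    using norm_snd_le[of y x] by (auto simp: indicator_def)
   then have "B * indicator (cball 0 R) (x, y) \<le> B * indicator (cball 0 R) y" using B(2) by (intro mult_left_mono) auto
   then have "\<bar>g (x, y)\<bar> \<le> B * indicator (cball 0 R) y" by (rule order_trans[OF B(1)])
   then show "ennreal \<bar>g (x, y)\<bar> \<le> ennreal B * indicator (cball 0 R) y"
    by (auto simp: indicator_def ennreal_leI split: if_splits)
  qed
  also have "\<dots> = ennreal B * emeasure lborel (cball (0::real^'n) R)" by (rule nn_integral_cmult_indicator) simp
  also have "\<dots> = ennreal (B * measure lborel (cball (0::real^'n) R))"
   using B(2) emeasure_bounded_finite[of "cball (0::real^'n) R"]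
   by (simp add: ennreal_mult emeasure_eq_ennreal_measure)
  finally show ?thesis .
 qed
 then show ?thesis using B(2) by (intro that[of "B * measure lborel (cball (0::real^'n) R)"]) auto
qed

lemma bessel_conv_slice_nn:
 fixes g :: "real \<times> (real^'n) \<Rightarrow> real"
 assumes q: "q > 0" and g: "test_function UNIV g"
 shows "(\<integral>\<^sup>+y. (\<integral>\<^sup>+\<zeta>. ennreal (bessel q \<zeta>) * ennreal \<bar>g ((0, y) + \<zeta>)\<bar>)) < \<infinity>"
proof -
 have [measurable]: "g \<in> Borel" using g by (rule test_function_measurable)
 obtain C where C: "C \<ge> 0" "\<And>x. (\<integral>\<^sub>+y. \<bar>g (x, y)\<bar>) \<le> ennreal C"
  by (rule test_function_slice_nn[OF g], rule that)
 have "(\<integral>\<^sup>+y. (\<integral>\<^sup>+\<zeta>. ennreal (bessel q \<zeta>) * ennreal \<bar>g ((0, y) + \<zeta>)\<bar>))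
   = (\<integral>\<^sup>+\<zeta>. (\<integral>\<^sup>+y. ennreal (bessel q \<zeta>) * ennreal \<bar>g ((0, y) + \<zeta>)\<bar>))"
  by (rule lborel_pair.Fubini'[symmetric]) measurable
 also have "\<dots> \<le> (\<integral>\<^sup>+\<zeta>. ennreal (bessel q (\<zeta>::real \<times> (real^'n))) * ennreal C)"
 proof (rule nn_integral_mono)
  fix \<zeta> :: "real \<times> (real^'n)"
  have "(\<integral>\<^sup>+y. ennreal (bessel q \<zeta>) * ennreal \<bar>g ((0, y) + \<zeta>)\<bar>) =
    ennreal (bessel q \<zeta>) * (\<integral>\<^sub>+y. \<bar>g (fst \<zeta>, y + snd \<zeta>)\<bar>)"
   by (cases \<zeta>) (simp add: nn_integral_cmult)
  also have "(\<integral>\<^sub>+y. \<bar>g (fst \<zeta>, y + snd \<zeta>)\<bar>) = (\<integral>\<^sub>+y. \<bar>g (fst \<zeta>, y)\<bar>)"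
   by (rule nn_integral_lborel_translate) measurable
  finally show "(\<integral>\<^sup>+y. ennreal (bessel q \<zeta>) * ennreal \<bar>g ((0, y) + \<zeta>)\<bar>) \<le> ennreal (bessel q \<zeta>) * ennreal C"
   using C(2)[of "fst \<zeta>"] by (simp add: mult_left_mono)
 qed
 also have "\<dots> < \<infinity>"
  using bessel_integrable[OF q, where 'a="real \<times> (real^'n)"]
  by (auto simp: nn_integral_multc ennreal_mult_less_top integrable_iff_bounded bessel_nonneg)
 finally show ?thesis .
qed

text \<open>Integrability on the boundary hyperplane, needed for the trace, is not implied by
 integrability on the whole space; it holds since the slices of a test function have uniformly
 bounded integrals.\<close>

lemma bessel_conv_slice_integrable:
 fixes g :: "real \<times> (real^'n) \<Rightarrow> real"
 assumes q: "q > 0" and g: "test_function UNIV g"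
 shows "L1 (\<lambda>y. bessel_conv q g (0, y))"
proof -
 have [measurable]: "g \<in> Borel" using g by (rule test_function_measurable)
 have "(\<integral>\<^sub>+y. norm (bessel_conv q g (0, y))) \<le>
   (\<integral>\<^sup>+y. (\<integral>\<^sup>+\<zeta>. ennreal (bessel q \<zeta>) * ennreal \<bar>g ((0, y) + \<zeta>)\<bar>))"
  by (intro nn_integral_mono) (simp add: bessel_conv_abs_nn[OF q])
 also note bessel_conv_slice_nn[OF q g]
 finally show ?thesis by (intro integrableI_bounded) simp_all
qed

section \<open>The kernel inverts the operator\<close>

text \<open>The solution of the heat equation with initial value \<open>g\<close> at time \<open>s\<^sup>2 / 4\<close>. The variable \<open>s\<close>
 makes it differentiable up to \<open>s = 0\<close> without a singular kernel.\<close>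

definition gauss_mean :: "('a::euclidean_space \<Rightarrow> real) \<Rightarrow> 'a \<Rightarrow> real \<Rightarrow> real" where
 "gauss_mean g z s = (\<integral>\<zeta>. exp (- (norm \<zeta>)\<^sup>2) * g (z + s *\<^sub>R \<zeta>)) / pi powr (DIM('a) / 2)"

lemma gauss_integrable1: "L1 (\<lambda>\<zeta>::'a::euclidean_space. exp (- (norm \<zeta>)\<^sup>2))"
 using gaussian_integrable[of 1] by simp

lemma gauss_weight_integrable:
 fixes f :: "'a::euclidean_space \<Rightarrow> real"
 assumes [measurable]: "f \<in> Borel" and B: "\<And>z. \<bar>f z\<bar> \<le> B"
 shows "L1 (\<lambda>\<zeta>. exp (- (norm \<zeta>)\<^sup>2) * f \<zeta>)"
 by (rule integrable_bound_pointwise[OF integrable_mult_right[OF gauss_integrable1, of B]])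
  (use B in \<open>auto simp: abs_mult\<close>)

lemma gauss_mean_cont:
 assumes g: "test_function UNIV g"
 shows "isCont (gauss_mean g z) s"
proof -
 obtain B R where B: "\<And>z. \<bar>g z\<bar> \<le> B" by (rule test_function_bounded[OF g], rule that)
 have [measurable]: "g \<in> Borel" using g by (rule test_function_measurable)
 have "isCont (\<lambda>s. \<integral>\<zeta>. exp (- (norm \<zeta>)\<^sup>2) * g (z + s *\<^sub>R \<zeta>) \<partial>lborel) s"
 proof (rule isCont_integral_dominated[where U=UNIV and D="\<lambda>\<zeta>. B * exp (- (norm \<zeta>)\<^sup>2)"])
  show "isCont (\<lambda>s. exp (- (norm \<zeta>)\<^sup>2) * g (z + s *\<^sub>R \<zeta>)) s" for \<zeta>
   using test_function_continuous[OF g, of UNIV]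
   by (intro continuous_intros continuous_at_compose[of s "\<lambda>s. z + s *\<^sub>R \<zeta>" g, unfolded o_def])
    (auto simp: continuous_on_eq_continuous_at)
  show "\<bar>exp (- (norm \<zeta>)\<^sup>2) * g (z + s *\<^sub>R \<zeta>)\<bar> \<le> B * exp (- (norm \<zeta>)\<^sup>2)" for s \<zeta>
   using B by (simp add: abs_mult)
 qed (use gauss_integrable1 in auto)
 then show ?thesis unfolding gauss_mean_def[abs_def] by (intro continuous_intros) auto
qed

lemma gauss_mean_bounded:
 assumes [measurable]: "g \<in> Borel" and B: "\<And>z. \<bar>g z\<bar> \<le> B"
 shows "\<bar>gauss_mean g (z::'a::euclidean_space) s\<bar> \<le> B"
proof -
 have "\<bar>\<integral>\<zeta>. exp (- (norm \<zeta>)\<^sup>2) * g (z + s *\<^sub>R \<zeta>) \<partial>lborel\<bar> \<le> (\<integral>\<zeta>. norm (exp (- (norm \<zeta>)\<^sup>2) * g (z + s *\<^sub>R \<zeta>)))"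
  unfolding real_norm_def[symmetric] by (rule integral_norm_bound)
 also have "\<dots> \<le> (\<integral>\<zeta>. B * exp (- (norm (\<zeta>::'a))\<^sup>2))"
  using B gauss_integrable1
  by (intro integral_mono integrable_norm gauss_weight_integrable[where B=B]) (auto simp: abs_mult)
 also have "\<dots> = B * pi powr (DIM('a) / 2)" using gaussian_integral[of 1, where 'a='a] by simp
 finally show ?thesis by (simp add: gauss_mean_def field_simps)
qed

lemma gauss_mean_0: "gauss_mean g (z::'a::euclidean_space) 0 = g z"
 using gaussian_integral[of 1, where 'a='a] by (simp add: gauss_mean_def)

lemma norm_gauss_le: "norm (\<zeta>::'a::real_normed_vector) * exp (- (norm \<zeta>)\<^sup>2) \<le> exp (- (1/2) * (norm \<zeta>)\<^sup>2)"
proof -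
 have "norm \<zeta> \<le> 1 + (norm \<zeta>)\<^sup>2 / 2"
  using zero_le_power2[of "norm \<zeta> - 1"] by (simp add: power2_diff field_simps)
 also have "\<dots> \<le> exp ((norm \<zeta>)\<^sup>2 / 2)" using exp_ge_add_one_self[of "(norm \<zeta>)\<^sup>2 / 2"] by simp
 finally have "norm \<zeta> * exp (- (norm \<zeta>)\<^sup>2) \<le> exp ((norm \<zeta>)\<^sup>2 / 2) * exp (- (norm \<zeta>)\<^sup>2)" by (intro mult_right_mono) auto
 then show ?thesis by (simp add: exp_add[symmetric])
qed

text \<open>The heat equation in the variable \<open>s\<close>. Differentiation in \<open>s\<close> produces \<open>\<nabla>g(z + s\<zeta>) \<bullet> \<zeta>\<close> under
 the integral; the factor \<open>\<zeta> exp (- \<bar>\<zeta>\<bar>\<^sup>2)\<close> is \<open>- 1/2\<close> times the gradient of the Gaussian, and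
 integrating by parts moves this derivative to \<open>g\<close>, giving the Laplacian and a factor \<open>s\<close>.\<close>

lemma gauss_mean_derivative:
 fixes g :: "'a::euclidean_space \<Rightarrow> real"
 assumes g: "test_function UNIV g" and s: "s > 0"
 shows "(gauss_mean g z has_real_derivative s / 2 * gauss_mean (laplacian g) z s) (at s)"
proof -
 have [measurable]: "g \<in> Borel" "gradient g \<in> Borel"
  using g test_function_measurable test_function_gradient_measurable by blast+
 obtain B R where B: "\<And>z. \<bar>g z\<bar> \<le> B" by (rule test_function_bounded[OF g], rule that)
 obtain C where C: "C > 0" "\<And>z. norm (gradient g z) \<le> C" by (rule test_function_gradient_bounded[OF g], rule that)
 define E where "E \<zeta> = exp (- (norm \<zeta>)\<^sup>2)" for \<zeta> :: 'a
 have E[measurable]: "E \<in> Borel" unfolding E_def[abs_def] by measurable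
 have i2: "L1 (\<lambda>\<zeta>::'a. C * exp (- (1/2) * (norm \<zeta>)\<^sup>2))" by (intro integrable_mult_right gaussian_integrable) simp
 have bnd: "\<bar>E \<zeta> * (gradient g (z + t *\<^sub>R \<zeta>) \<bullet> \<zeta>)\<bar> \<le> C * exp (- (1/2) * (norm \<zeta>)\<^sup>2)" for t \<zeta>
 proof -
  have "\<bar>gradient g (z + t *\<^sub>R \<zeta>) \<bullet> \<zeta>\<bar> \<le> C * norm \<zeta>"
   using Cauchy_Schwarz_ineq2[of "gradient g (z + t *\<^sub>R \<zeta>)" \<zeta>] mult_right_mono[OF C(2)[of "z + t *\<^sub>R \<zeta>"] norm_ge_zero[of \<zeta>]] by linarith
  then have "\<bar>E \<zeta> * (gradient g (z + t *\<^sub>R \<zeta>) \<bullet> \<zeta>)\<bar> \<le> E \<zeta> * (C * norm \<zeta>)"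
   by (simp add: abs_mult E_def)
  also have "\<dots> = C * (norm \<zeta> * exp (- (norm \<zeta>)\<^sup>2))" by (simp add: E_def)
  also have "\<dots> \<le> C * exp (- (1/2) * (norm \<zeta>)\<^sup>2)" using C(1) norm_gauss_le by (intro mult_left_mono) auto
  finally show ?thesis .
 qed
 have "((\<lambda>s. \<integral>\<zeta>. E \<zeta> * g (z + s *\<^sub>R \<zeta>) \<partial>lborel) has_derivative
   (\<lambda>h. (\<integral>\<zeta>. (\<lambda>s \<zeta>. E \<zeta> * (gradient g (z + s *\<^sub>R \<zeta>) \<bullet> \<zeta>)) s \<zeta>) \<bullet> h)) (at s)"
 proof (rule has_derivative_integral_dominated[where U=UNIV and D="\<lambda>\<zeta>. C * exp (- (1/2) * (norm \<zeta>)\<^sup>2)"])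
  show "L1 (\<lambda>\<zeta>. E \<zeta> * g (z + x *\<^sub>R \<zeta>))" for x
   unfolding E_def using B by (intro gauss_weight_integrable[where B=B]) auto
  fix t \<zeta>
  have "((\<lambda>t::real. z + t *\<^sub>R \<zeta>) has_derivative (\<lambda>h. h *\<^sub>R \<zeta>)) (at t)" by (auto intro!: derivative_eq_intros)
  from has_derivative_mult_right[OF has_derivative_compose[OF this test_function_gradient[OF g]], of "E \<zeta>"]
  show "((\<lambda>t. E \<zeta> * g (z + t *\<^sub>R \<zeta>)) has_derivative (\<lambda>h. (E \<zeta> * (gradient g (z + t *\<^sub>R \<zeta>) \<bullet> \<zeta>)) \<bullet> h)) (at t)"
   by (simp add: mult_ac)
 qed (use bnd i2 in auto)
 moreover have eq: "(\<integral>\<zeta>. E \<zeta> * (gradient g (z + s *\<^sub>R \<zeta>) \<bullet> \<zeta>)) = s / 2 * (\<integral>\<zeta>. E \<zeta> * laplacian g (z + s *\<^sub>R \<zeta>))"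
 proof -
  define gb where "gb b = (\<lambda>z. gradient g z \<bullet> b)" for b
  have gb: "test_function UNIV (gb b)" for b unfolding gb_def by (rule test_function_gradient_inner[OF g])
  have [measurable]: "gb b \<in> Borel" "gradient (gb b) \<in> Borel" for b
   using gb test_function_measurable test_function_gradient_measurable by blast+
  have lap: "laplacian g z = (\<Sum>b\<in>Basis. gradient (gb b) z \<bullet> b)" for z
  proof -
   have "gb b = (\<lambda>z'. frechet_derivative g (at z') b)" for b
    unfolding gb_def using gradient_inner[OF test_function_deriv[OF g]] by simp
   then show ?thesis unfolding laplacian_def using gradient_inner[OF test_function_deriv[OF gb]] by simp
  qed
  let ?A = "\<lambda>b \<zeta>. E \<zeta> * gb b (z + s *\<^sub>R \<zeta>) * (\<zeta> \<bullet> b)" and ?B = "\<lambda>b \<zeta>. E \<zeta> * (gradient (gb b) (z + s *\<^sub>R \<zeta>) \<bullet> b)"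
  have i_lap: "L1 (?B b)" for b
  proof -
   obtain C' R' where "\<And>z. \<bar>gradient (gb b) z \<bullet> b\<bar> \<le> C'"
    by (rule test_function_bounded[OF test_function_gradient_inner[OF gb, of b b]], rule that)
   then show ?thesis unfolding E_def by (intro gauss_weight_integrable[where B=C']) auto
  qed
  have i_gb: "L1 (?A b)" for b
  proof -
   obtain C' R' where C': "\<And>z. \<bar>gb b z\<bar> \<le> C'" by (rule test_function_bounded[OF gb[of b]], rule that)
   have "L1 (\<lambda>\<zeta>::'a. C' * norm b * exp (- (1/2) * (norm \<zeta>)\<^sup>2))" by (intro integrable_mult_right gaussian_integrable) simp
   then show ?thesis
   proof (rule integrable_bound_pointwise)
    fix \<zeta> :: 'a
    have C0: "C' \<ge> 0" using C'[of 0] by linarith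
    have "\<bar>gb b (z + s *\<^sub>R \<zeta>)\<bar> * (E \<zeta> * \<bar>\<zeta> \<bullet> b\<bar>) \<le> C' * (E \<zeta> * (norm \<zeta> * norm b))"
     using C' C0 Cauchy_Schwarz_ineq2[of \<zeta> b] by (intro mult_mono) (auto simp: E_def)
    also have "\<dots> = C' * norm b * (norm \<zeta> * exp (- (norm \<zeta>)\<^sup>2))" by (simp add: E_def)
    also have "\<dots> \<le> C' * norm b * exp (- (1/2) * (norm \<zeta>)\<^sup>2)" using C0 norm_gauss_le[of \<zeta>] by (intro mult_left_mono) auto
    finally show "norm (?A b \<zeta>) \<le> C' * norm b * exp (- (1/2) * (norm \<zeta>)\<^sup>2)"
     by (simp add: abs_mult E_def mult_ac)
   qed measurable
  qed
  have key: "(\<integral>\<zeta>. ?A b \<zeta>) = s / 2 * (\<integral>\<zeta>. ?B b \<zeta>)" for b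
  proof -
   obtain C' R where R: "\<And>z. norm z > R \<Longrightarrow> gb b z = 0" by (rule test_function_bounded[OF gb[of b]], rule that)
   define G where "G \<zeta> = (- 2 * (E \<zeta> * gb b (z + s *\<^sub>R \<zeta>))) *\<^sub>R \<zeta> + (s * E \<zeta>) *\<^sub>R gradient (gb b) (z + s *\<^sub>R \<zeta>)" for \<zeta>
   have cE: "continuous_on UNIV E" unfolding E_def[abs_def] by (intro continuous_intros)
   have "(\<integral>\<zeta>. indicator UNIV \<zeta> * (G \<zeta> \<bullet> b)) = 0"
   proof (rule integral_directional_derivative_invariant)
    fix \<zeta>
    have 1: "(E has_derivative (\<lambda>h. - 2 * E \<zeta> * (\<zeta> \<bullet> h))) (at \<zeta>)"
     unfolding E_def[abs_def] power2_norm_eq_inner by (auto intro!: derivative_eq_intros simp: inner_commute)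
    have "((\<lambda>\<zeta>. z + s *\<^sub>R \<zeta>) has_derivative (\<lambda>h. s *\<^sub>R h)) (at \<zeta>)" by (auto intro!: derivative_eq_intros)
    from has_derivative_mult[OF 1 has_derivative_compose[OF this test_function_gradient[OF gb[of b]]]]
    show "((\<lambda>\<zeta>. E \<zeta> * gb b (z + s *\<^sub>R \<zeta>)) has_derivative (\<lambda>h. G \<zeta> \<bullet> h)) (at \<zeta>)"
     by (rule has_derivative_eq_rhs) (simp add: fun_eq_iff G_def inner_add_left algebra_simps)
   next
    show "continuous_on UNIV G" unfolding G_def[abs_def]
     by (intro continuous_intros cE continuous_on_compose2[OF test_function_continuous[OF gb, of UNIV b]]
       continuous_on_compose2[OF test_function_gradient_continuous[OF gb, of UNIV b]]) auto
   next
    fix \<zeta> :: 'a assume *: "norm \<zeta> > (\<bar>R\<bar> + norm z) / s"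
    then have "s * norm \<zeta> > \<bar>R\<bar> + norm z" using s by (simp add: field_simps)
    moreover have "s * norm \<zeta> \<le> norm (z + s *\<^sub>R \<zeta>) + norm z"
     using norm_triangle_ineq4[of "z + s *\<^sub>R \<zeta>" z] s by simp
    ultimately have "norm (z + s *\<^sub>R \<zeta>) > R" by linarith
    then show "E \<zeta> * gb b (z + s *\<^sub>R \<zeta>) = 0" using R by simp
   qed auto
   moreover have "(\<lambda>\<zeta>. indicator UNIV \<zeta> * (G \<zeta> \<bullet> b)) = (\<lambda>\<zeta>. - 2 * (?A b \<zeta>) + s * (?B b \<zeta>))"
    by (simp add: fun_eq_iff G_def inner_add_left inner_diff_left)
   ultimately have "- 2 * (\<integral>\<zeta>. ?A b \<zeta>) + s * (\<integral>\<zeta>. ?B b \<zeta>) = 0"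
    using i_gb i_lap by (simp del: mult_minus_left)
   then show ?thesis by simp
  qed
  have "(\<integral>\<zeta>. E \<zeta> * (gradient g (z + s *\<^sub>R \<zeta>) \<bullet> \<zeta>)) = (\<integral>\<zeta>. (\<Sum>b\<in>Basis. ?A b \<zeta>))"
  proof (rule Bochner_Integration.integral_cong[OF refl])
   fix \<zeta> :: 'a
   show "E \<zeta> * (gradient g (z + s *\<^sub>R \<zeta>) \<bullet> \<zeta>) = (\<Sum>b\<in>Basis. ?A b \<zeta>)"
    unfolding gb_def by (subst euclidean_inner) (simp add: sum_distrib_left mult.assoc)
  qed
  also have "\<dots> = (\<Sum>b\<in>Basis. (\<integral>\<zeta>. ?A b \<zeta>))" using i_gb by (intro Bochner_Integration.integral_sum)
  also have "\<dots> = s / 2 * (\<Sum>b\<in>Basis. (\<integral>\<zeta>. ?B b \<zeta>))" by (simp add: key sum_distrib_left)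
  also have "(\<Sum>b\<in>Basis. (\<integral>\<zeta>. ?B b \<zeta>)) = (\<integral>\<zeta>. E \<zeta> * laplacian g (z + s *\<^sub>R \<zeta>))"
   using i_lap by (subst Bochner_Integration.integral_sum[symmetric]) (auto simp: lap sum_distrib_left)
  finally show ?thesis .
 qed
 ultimately have "((\<lambda>s. \<integral>\<zeta>. E \<zeta> * g (z + s *\<^sub>R \<zeta>) \<partial>lborel) has_real_derivative s / 2 * (\<integral>\<zeta>. E \<zeta> * laplacian g (z + s *\<^sub>R \<zeta>))) (at s)"
  by (simp only: has_field_derivative_def inner_real_def)
 from DERIV_cdivide[OF this, of "pi powr (DIM('a) / 2)"] show ?thesis
  by (simp add: gauss_mean_def[abs_def] E_def)
qed


text \<open>Subordination: insert the integral for \<open>theta\<close>, exchange the integrals and rescale \<open>\<zeta>\<close> by \<open>s\<close>.\<close>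

lemma bessel_conv_eq_gauss_mean:
 fixes g :: "'a::euclidean_space \<Rightarrow> real"
 assumes q: "q > 0" and g: "test_function UNIV g"
 shows "bessel_conv q g z = (\<integral>s. indicator {0<..} s * (s / 2 * exp (- q * s\<^sup>2) * gauss_mean g z s))"
proof -
 have [measurable]: "g \<in> Borel" using g by (rule test_function_measurable)
 obtain B R where B: "\<And>z. \<bar>g z\<bar> \<le> B" by (rule test_function_bounded[OF g], rule that)
 let ?k = "real DIM('a) - 1"
 define f where "f \<zeta> s = theta_ker q ?k ((norm \<zeta>)\<^sup>2) s * g (z + \<zeta>)" for \<zeta> s
 have ti: "L1 (\<lambda>\<zeta>::'a. theta q ?k ((norm \<zeta>)\<^sup>2))"
  using theta_slice_integrable[of q 1 0 ?k, where 'a='a] q by simp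
 have mf: "(\<lambda>(\<zeta>, s). f \<zeta> s) \<in> borel_measurable (lborel \<Otimes>\<^sub>M lborel)"
  unfolding f_def theta_ker_def by measurable
 have int: "integrable (lborel \<Otimes>\<^sub>M lborel) (\<lambda>(\<zeta>, s). f \<zeta> s)"
 proof (rule lborel_pair.Fubini_integrable)
  have "(\<integral>s. norm (f \<zeta> s)) = theta q ?k ((norm \<zeta>)\<^sup>2) * \<bar>g (z + \<zeta>)\<bar>" for \<zeta>
   by (simp add: f_def theta_def abs_mult theta_ker_nonneg)
  moreover have "L1 (\<lambda>\<zeta>::'a. theta q ?k ((norm \<zeta>)\<^sup>2) * \<bar>g (z + \<zeta>)\<bar>)"
   by (rule integrable_bound_pointwise[OF integrable_mult_right[OF ti, of B]])
    (use B in \<open>auto simp: abs_mult theta_nonneg mult.commute[of B] intro!: mult_left_mono\<close>)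
  ultimately show "L1 (\<lambda>\<zeta>. \<integral>s. norm (case (\<zeta>, s) of (\<zeta>, s) \<Rightarrow> f \<zeta> s) \<partial>lborel)" by simp
  have "AE \<zeta> in lborel. \<zeta> \<noteq> (0::'a)" by (rule AE_lborel_singleton)
  then show "AE \<zeta> in lborel. L1 (\<lambda>s. case (\<zeta>, s) of (\<zeta>, s) \<Rightarrow> f \<zeta> s)"
   by eventually_elim (use q in \<open>auto simp: f_def intro!: integrable_mult_left theta_ker_integrable\<close>)
 qed (use mf in simp)
 have inner: "(\<integral>\<zeta>. f \<zeta> s) = indicator {0<..} s * (s * exp (- q * s\<^sup>2) * (pi powr (DIM('a) / 2) * gauss_mean g z s))" for s
 proof (cases "s > 0")
  case s: True
  have "(\<integral>\<zeta>. f \<zeta> s) = \<bar>s\<bar> ^ DIM('a) * (\<integral>\<zeta>. f (0 + s *\<^sub>R \<zeta>) s)"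
   using s by (intro integral_lborel_affine) (auto simp: f_def theta_ker_def)
  also have "(\<lambda>\<zeta>. f (0 + s *\<^sub>R \<zeta>) s) = (\<lambda>\<zeta>. s powr (- ?k) * exp (- q * s\<^sup>2) * (exp (- (norm \<zeta>)\<^sup>2) * g (z + s *\<^sub>R \<zeta>)))"
   using s by (simp add: fun_eq_iff f_def theta_ker_def power_mult_distrib exp_diff exp_minus field_simps)
  also have "\<bar>s\<bar> ^ DIM('a) * (\<integral>\<zeta>. s powr (- ?k) * exp (- q * s\<^sup>2) * (exp (- (norm \<zeta>)\<^sup>2) * g (z + s *\<^sub>R \<zeta>)))
    = (s powr DIM('a) * s powr (- ?k)) * exp (- q * s\<^sup>2) * (pi powr (DIM('a) / 2) * gauss_mean g z s)"
   using s by (simp add: gauss_mean_def powr_realpow)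
  also have "s powr DIM('a) * s powr (- ?k) = s" using s by (simp add: powr_add[symmetric])
  finally show ?thesis using s by simp
 qed (simp add: f_def theta_ker_def)
 have "bessel_conv q g z = (\<integral>\<zeta>. (\<integral>s. f \<zeta> s) / (2 * pi powr (DIM('a) / 2)))"
  unfolding bessel_conv_def by (intro Bochner_Integration.integral_cong refl) (simp add: f_def bessel_def theta_def)
 also have "\<dots> = (\<integral>\<zeta>. (\<integral>s. f \<zeta> s)) / (2 * pi powr (DIM('a) / 2))" by simp
 also have "(\<integral>\<zeta>. (\<integral>s. f \<zeta> s)) = (\<integral>s. (\<integral>\<zeta>. f \<zeta> s))"
  by (rule lborel_pair.Fubini_integral[symmetric, OF int])
 also have "(\<integral>s. (\<integral>\<zeta>. f \<zeta> s)) / (2 * pi powr (DIM('a) / 2)) =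
   (\<integral>s. indicator {0<..} s * (s / 2 * exp (- q * s\<^sup>2) * gauss_mean g z s))"
  unfolding inner by (subst integral_divide_zero[symmetric]) (simp add: field_simps)
 finally show ?thesis .
qed

lemma laplacian_eq_gradient:
 assumes g: "test_function S g"
 shows "laplacian g z = (\<Sum>b\<in>Basis. gradient (\<lambda>z. gradient g z \<bullet> b) z \<bullet> b)"
proof -
 have "(\<lambda>z. gradient g z \<bullet> b) = (\<lambda>z'. frechet_derivative g (at z') b)" for b
  using gradient_inner[OF test_function_deriv[OF g]] by simp
 then show ?thesis unfolding laplacian_def
  using gradient_inner[OF test_function_deriv[OF test_function_gradient_inner[OF g]]] by simp
qed

lemma test_function_sum:
 assumes "finite I" "I \<noteq> {}" "\<And>i. i \<in> I \<Longrightarrow> test_function S (f i)"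
 shows "test_function S (\<lambda>z. \<Sum>i\<in>I. f i z)"
 using assms by (induction rule: finite_ne_induct) (auto intro: test_function_add)

lemma test_function_laplacian:
 assumes g: "test_function S (g :: 'a::euclidean_space \<Rightarrow> real)"
 shows "test_function S (laplacian g)"
proof -
 have "laplacian g = (\<lambda>z. \<Sum>b\<in>Basis. gradient (\<lambda>z. gradient g z \<bullet> b) z \<bullet> b)"
  using laplacian_eq_gradient[OF g] by auto
 then show ?thesis by (simp only:) (intro test_function_sum test_function_gradient_inner g finite_Basis nonempty_Basis)
qed

text \<open>By subordination and the heat equation the left hand side is minus the integral over \<open>s\<close> of
 the derivative of \<open>exp (- q s\<^sup>2) * gauss_mean g z s\<close>, a function with the values \<open>g z\<close> at \<open>s = 0\<close>
 and \<open>0\<close> at infinity.\<close>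

theorem bessel_conv_inverse:
 fixes g :: "'a::euclidean_space \<Rightarrow> real"
 assumes q: "q > 0" and g: "test_function UNIV g"
 shows "4 * q * bessel_conv q g z - bessel_conv q (laplacian g) z = g z"
proof -
 note lap = test_function_laplacian[OF g]
 have [measurable]: "g \<in> Borel" "laplacian g \<in> Borel" using g lap test_function_measurable by blast+
 obtain B R where B: "\<And>z. \<bar>g z\<bar> \<le> B" by (rule test_function_bounded[OF g], rule that)
 obtain C R' where C: "\<And>z. \<bar>laplacian g z\<bar> \<le> C" by (rule test_function_bounded[OF lap], rule that)
 have mG: "gauss_mean h z \<in> Borel" if "test_function UNIV h" for h
  using gauss_mean_cont[OF that] by (intro borel_measurable_continuous_onI continuous_at_imp_continuous_on) auto
 note [measurable] = mG[OF g] mG[OF lap]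
 define F where "F s = exp (- q * s\<^sup>2) * gauss_mean g z s" for s
 define P where "P h s = s / 2 * exp (- q * s\<^sup>2) * gauss_mean h z s" for h s
 define f where "f s = - 4 * q * P g s + P (laplacian g) s" for s
 have int: "L1 (\<lambda>s. indicator {0<..} s * P h s)"
  if h: "\<And>z. \<bar>h z\<bar> \<le> K" "h \<in> Borel" "gauss_mean h z \<in> Borel" for h K
 proof (rule integrable_bound_pointwise[OF integrable_mult_right[OF theta_ker_integrable_0[OF q, of "-1"], of K]])
  fix s
  have K: "K \<ge> 0" using h(1)[of 0] by linarith
  show "norm (indicator {0<..} s * P h s) \<le> K * theta_ker q (- 1) 0 s"
  proof (cases "s > 0")
   case True
   have "\<bar>gauss_mean h z s\<bar> * (s / 2 * exp (- q * s\<^sup>2)) \<le> K * (s * exp (- q * s\<^sup>2))"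
    using gauss_mean_bounded[OF h(2) h(1), of z s] K True by (intro mult_mono) auto
   then show ?thesis using True by (simp add: P_def theta_ker_def abs_mult mult_ac)
  qed (simp add: theta_ker_def)
 qed (simp, use h(3) in \<open>simp add: P_def\<close>)
 have i1: "L1 (\<lambda>s. indicator {0<..} s * P g s)" "L1 (\<lambda>s. indicator {0<..} s * P (laplacian g) s)"
  by (rule int[OF B], simp, simp) (rule int[OF C], simp, simp)
 have F_der: "(F has_real_derivative f s) (at s)" if s: "s > 0" for s
 proof -
  have "((\<lambda>s. exp (- q * s\<^sup>2)) has_real_derivative exp (- q * s\<^sup>2) * (- 2 * q * s)) (at s)"
   by (auto intro!: derivative_eq_intros)
  from DERIV_mult[OF this gauss_mean_derivative[OF g s, of z]] show ?thesis
   unfolding F_def[abs_def] f_def P_def by (simp add: field_simps)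
 qed
 have f: "indicator {0<..} s * f s = (- 4 * q) * (indicator {0<..} s * P g s) + indicator {0<..} s * P (laplacian g) s" for s
  by (simp add: f_def algebra_simps)
 have "(\<integral>s. indicator {0<..} s * f s) = 0 - g z"
 proof (rule integral_positive_axis_FTC[OF F_der])
  show "isCont f x" for x
   unfolding f_def P_def by (intro continuous_intros gauss_mean_cont g lap) auto
  show "L1 (\<lambda>s. indicator {0<..} s * f s)" unfolding f
   using i1 by (intro Bochner_Integration.integrable_add integrable_mult_right)
  have "isCont F 0" unfolding F_def[abs_def] by (intro continuous_intros gauss_mean_cont g)
  then have "(F \<longlongrightarrow> F 0) (at_right 0)" by (simp add: isCont_def filterlim_at_split)
  then show "(F \<longlongrightarrow> g z) (at_right 0)" by (simp add: F_def gauss_mean_0)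
  show "(F \<longlongrightarrow> 0) at_top"
  proof (rule Lim_null_comparison)
   show "\<forall>\<^sub>F s in at_top. norm (F s) \<le> B * exp (- q * s\<^sup>2)"
    using gauss_mean_bounded[of g B z] B by (intro always_eventually) (auto simp: F_def abs_mult)
   have "((\<lambda>s::real. exp (- q * s\<^sup>2)) \<longlongrightarrow> 0) at_top" using q by real_asymp
   then show "((\<lambda>s. B * exp (- q * s\<^sup>2)) \<longlongrightarrow> 0) at_top" by (rule tendsto_mult_right_zero)
  qed
 qed
 moreover have "(\<integral>s. indicator {0<..} s * f s) = (- 4 * q) * (\<integral>s. indicator {0<..} s * P g s) + (\<integral>s. indicator {0<..} s * P (laplacian g) s)"
  unfolding f using i1 by (simp del: mult_minus_left)
 ultimately show ?thesis by (simp add: P_def bessel_conv_eq_gauss_mean[OF q g] bessel_conv_eq_gauss_mean[OF q lap])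
qed

section \<open>Integrals over the half space\<close>

lemma
 fixes f :: "'a::euclidean_space \<Rightarrow> real"
 assumes S: "S \<in> sets borel" and f[measurable]: "f \<in> Borel"
 shows integral_lebesgue_on: "(LINT z|lebesgue_on S. f z) = (\<integral>z. indicator S z * f z)"
  and integrable_lebesgue_on: "integrable (lebesgue_on S) f \<longleftrightarrow> L1 (\<lambda>z. indicator S z * f z)"
proof -
 note S[measurable]
 have m: "(\<lambda>z. indicator S z *\<^sub>R f z) \<in> borel_measurable lborel" by measurable
 have "S \<inter> space lebesgue \<in> sets lebesgue" using S by (simp add: sets_completionI_sets)
 then show "(LINT z|lebesgue_on S. f z) = (\<integral>z. indicator S z * f z)"
  "integrable (lebesgue_on S) f \<longleftrightarrow> L1 (\<lambda>z. indicator S z * f z)"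
  using integral_completion[OF m] integrable_completion[OF m]
  by (simp_all add: integral_restrict_space integrable_restrict_space)
qed

lemma borel_measurable_lebesgue_on:
 "f \<in> Borel \<Longrightarrow> f \<in> borel_measurable (lebesgue_on S)"
 by (intro measurable_restrict_space1 measurable_completion) simp

lemma square_integrable_on_borel:
 fixes u :: "'a::euclidean_space \<Rightarrow> 'b::euclidean_space"
 assumes "S \<in> sets borel" and [measurable]: "u \<in> Borel"
 shows "square_integrable_on S u \<longleftrightarrow> L1 (\<lambda>z. indicator S z * (norm (u z))\<^sup>2)"
 unfolding square_integrable_on_def using borel_measurable_lebesgue_on[of u S] assms
 by (subst integrable_lebesgue_on) auto

lemma integrable_indicator_mult:
 fixes f :: "'a::euclidean_space \<Rightarrow> real"
 assumes "S \<in> sets borel" "L1 f"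
 shows "L1 (\<lambda>z. indicator S z * f z)"
 using integrable_mult_indicator[OF _ assms(2), of S] assms(1) by simp

section \<open>Smooth cutoffs\<close>

lemma Ck_on_sum:
 assumes "finite I" "\<And>i. i \<in> I \<Longrightarrow> Ck_on k (u i) UNIV"
 shows "Ck_on k (\<lambda>z. \<Sum>i\<in>I. u i z) UNIV"
 using assms by (induction I rule: finite_induct) (auto intro!: Ck_on_const Ck_on_add)

lemma Ck_on_norm_square: "Ck_on k (\<lambda>z. c + l * (norm z)\<^sup>2) UNIV"
proof -
 have "(norm z)\<^sup>2 = (\<Sum>b\<in>Basis. (z \<bullet> b) * (z \<bullet> b))" for z :: 'a
  unfolding power2_norm_eq_inner by (rule euclidean_inner)
 then show ?thesis
  by (simp only:) (intro Ck_on_add Ck_on_mult Ck_on_sum Ck_on_inner Ck_on_const open_UNIV finite_Basis)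
qed

text \<open>The factor \<open>exp 1\<close> normalises the value at the origin to one.\<close>

definition cutoff :: "real \<Rightarrow> 'a::euclidean_space \<Rightarrow> real" where
 "cutoff c z = exp 1 * flat 1 (1 + (- 1 / c\<^sup>2) * (norm z)\<^sup>2)"

lemma Ck_on_cutoff: "Ck_on k (cutoff c) UNIV"
 unfolding cutoff_def[abs_def]
 by (rule Ck_on_mult[OF open_UNIV Ck_on_const Ck_on_flat_compose[OF Ck_on_norm_square]])

lemma cutoff_bounds: "0 \<le> cutoff c z" "cutoff c z \<le> 1"
proof -
 show "0 \<le> cutoff c z" by (simp add: cutoff_def flat1_bounds)
 define t where "t = 1 + (- 1 / c\<^sup>2) * (norm z)\<^sup>2"
 have "t \<le> 1" by (simp add: t_def)
 then have "t > 0 \<Longrightarrow> 1 \<le> 1 / t" by simp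
 then have "flat 1 t \<le> exp (- 1)" by (auto simp: flat_def)
 then have "exp 1 * flat 1 t \<le> exp 1 * exp (- 1)" by (intro mult_left_mono) auto
 also have "\<dots> = (1::real)" by (simp add: exp_add[symmetric])
 finally show "cutoff c z \<le> 1" by (simp add: cutoff_def t_def)
qed

lemma cutoff_zero: "c > 0 \<Longrightarrow> norm z \<ge> c \<Longrightarrow> cutoff c z = 0"
proof -
 assume c: "c > 0" "norm z \<ge> c"
 then have "c\<^sup>2 \<le> (norm z)\<^sup>2" by (intro power_mono) auto
 then have "1 + (- 1 / c\<^sup>2) * (norm z)\<^sup>2 \<le> 0" using c by (simp add: field_simps)
 then show ?thesis by (simp add: cutoff_def flat_def)
qed

lemma cutoff_test: assumes "c > 0" shows "test_function UNIV (cutoff c)"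
proof -
 have "cutoff c z = 0" if "z \<notin> cball 0 c" for z :: 'a using cutoff_zero[OF assms, of z] that by auto
 then show ?thesis unfolding test_function_def
  by (intro conjI allI impI exI[of _ "cball 0 c"] Ck_on_cutoff compact_cball subset_UNIV)
qed

lemma cutoff_gradient_bound: assumes c: "c > 0" shows "norm (gradient (cutoff c) z) \<le> 4 * exp 1 / c"
proof -
 define t where "t = 1 + (- 1 / c\<^sup>2) * (norm z)\<^sup>2"
 define p :: "real poly" where "p = [:0,0,1:] * (1 - pderiv 1)"
 have bound: "\<bar>flat p t\<bar> \<le> 2"
 proof (cases "t > 0")
  case True
  define x where "x = 1 / t"
  have x: "x > 0" using True by (simp add: x_def)
  have "x\<^sup>2 \<le> 2 * exp x" using exp_lower_Taylor_quadratic[of x] x by linarith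
  then have "x\<^sup>2 * exp (- x) \<le> 2 * exp x * exp (- x)" by (intro mult_right_mono) auto
  then have "x\<^sup>2 * exp (- x) \<le> 2" by (simp only: mult.assoc exp_add[symmetric]) simp
  then show ?thesis using True by (simp add: flat_def p_def x_def power2_eq_square)
 qed (simp add: flat_def)
 have 1: "((\<lambda>z. 1 + (- 1 / c\<^sup>2) * (norm z)\<^sup>2) has_derivative (\<lambda>h. (- 2 / c\<^sup>2) * (z \<bullet> h))) (at z)"
 proof -
  have "((\<lambda>z. 1 + l * (norm z)\<^sup>2) has_derivative (\<lambda>h. 2 * l * (z \<bullet> h))) (at z)" for l
   unfolding power2_norm_eq_inner by (auto intro!: derivative_eq_intros simp: inner_commute)
  from this[of "- 1 / c\<^sup>2"] show ?thesis by simp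
 qed
 have 2: "(cutoff c has_derivative (\<lambda>h. exp 1 * (flat p t * ((- 2 / c\<^sup>2) * (z \<bullet> h))))) (at z)"
  using has_derivative_mult_right[OF has_derivative_compose[OF 1 flat_derivative[of 1, unfolded has_field_derivative_def]], of "exp 1"]
  unfolding cutoff_def[abs_def] p_def t_def by simp
 have g: "gradient (cutoff c) z = (exp 1 * flat p t * (- 2 / c\<^sup>2)) *\<^sub>R z"
 proof (rule euclidean_eqI)
  fix b :: 'a
  show "gradient (cutoff c) z \<bullet> b = (exp 1 * flat p t * (- 2 / c\<^sup>2)) *\<^sub>R z \<bullet> b"
   unfolding gradient_inner[OF 2] by simp
 qed
 show ?thesis
 proof (cases "norm z \<le> c")
  case True
  have "\<bar>flat p t\<bar> * (norm z * (exp 1 * 2)) \<le> 2 * (c * (exp 1 * 2))" using bound True c by (intro mult_mono) auto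
  then show ?thesis unfolding g using c by (simp add: abs_mult power2_eq_square field_simps)
 next
  case False
  then have "c\<^sup>2 \<le> (norm z)\<^sup>2" using c by (intro power_mono) auto
  then have "t \<le> 0" using c by (simp add: t_def field_simps)
  then show ?thesis unfolding g using c by (simp add: flat_def)
 qed
qed

lemma cutoff_tendsto: "(\<lambda>k. cutoff (real (Suc k)) z) \<longlonglongrightarrow> 1"
proof -
 have "(\<lambda>k. 1 + (- 1 / (real (Suc k))\<^sup>2) * (norm z)\<^sup>2) \<longlonglongrightarrow> 1" by real_asymp
 from isCont_tendsto_compose[OF DERIV_isCont[OF flat_derivative[of 1]] this]
 have "(\<lambda>k. exp 1 * flat 1 (1 + (- 1 / (real (Suc k))\<^sup>2) * (norm z)\<^sup>2)) \<longlonglongrightarrow> exp 1 * flat 1 1"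
  by (intro tendsto_mult tendsto_const)
 then show ?thesis by (simp add: cutoff_def flat_def exp_add[symmetric])
qed

section \<open>Smooth functions in \<open>H\<^sup>1\<close> and their traces\<close>

lemma integrable_square:
 fixes u :: "'a::euclidean_space \<Rightarrow> real"
 assumes "L1 u" "\<And>z. \<bar>u z\<bar> \<le> B"
 shows "L1 (\<lambda>z. (u z)\<^sup>2)"
proof (rule integrable_bound_pointwise[OF integrable_mult_right[OF integrable_abs[OF assms(1)], of B]])
 show "norm ((u z)\<^sup>2) \<le> B * \<bar>u z\<bar>" for z
  using mult_right_mono[OF assms(2)[of z], of "\<bar>u z\<bar>"] by (simp add: power2_eq_square abs_mult)
qed (use assms(1) in measurable)

text \<open>Membership in \<open>H\<^sup>1\<close> is integration by parts against test functions. The multiples \<open>\<xi>\<^sub>k u\<close> with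
 cutoffs at radius \<open>k + 1\<close> are test functions; by dominated convergence they approximate \<open>u\<close> in
 \<open>H\<^sup>1\<close> and on the boundary, which identifies the trace with the restriction.\<close>

lemma smooth_H1_trace:
 fixes u :: "real \<times> (real^'n) \<Rightarrow> real"
 assumes C: "\<And>k. Ck_on k u UNIV"
  and B: "\<And>z. \<bar>u z\<bar> \<le> B" "\<And>z b. b \<in> Basis \<Longrightarrow> \<bar>gradient u z \<bullet> b\<bar> \<le> B"
  and int: "L1 u" "\<And>b. b \<in> Basis \<Longrightarrow> L1 (\<lambda>z. gradient u z \<bullet> b)"
  and slice: "L1 (\<lambda>y. u (0, y))"
 shows "H1_gradient half_space u (gradient u)" "has_trace u (\<lambda>y. u (0, y))"
proof -
 have du: "(u has_derivative (\<lambda>h. gradient u z \<bullet> h)) (at z)" for z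
  using gradient_inner[OF Ck_on_SucE[OF C UNIV_I], of z] Ck_on_SucE[OF C UNIV_I, of z] by simp
 have cu: "continuous_on UNIV u" using C[of 0] by simp
 have cg: "continuous_on UNIV (gradient u)" unfolding gradient_def[abs_def]
  using C[of 1] by (intro continuous_intros) auto
 have mu[measurable]: "u \<in> Borel" using cu by (rule borel_measurable_continuous_onI)
 have mg[measurable]: "gradient u \<in> Borel" using cg by (rule borel_measurable_continuous_onI)
 have iu2: "L1 (\<lambda>z. (u z)\<^sup>2)" using int(1) B(1) by (rule integrable_square)
 have ig2: "L1 (\<lambda>z. (norm (gradient u z))\<^sup>2)"
 proof -
  have "(norm x)\<^sup>2 = (\<Sum>b\<in>Basis. (x \<bullet> b)\<^sup>2)" for x :: "real \<times> (real^'n)"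
   unfolding power2_norm_eq_inner by (subst euclidean_inner) (simp add: power2_eq_square)
  moreover have "L1 (\<lambda>z. \<Sum>b\<in>Basis. (gradient u z \<bullet> b)\<^sup>2)"
   using int(2) B(2) by (intro Bochner_Integration.integrable_sum integrable_square) auto
  ultimately show ?thesis by simp
 qed
 have sq: "square_integrable_on half_space u" "square_integrable_on half_space (gradient u)"
  using iu2 ig2 by (simp_all add: square_integrable_on_borel integrable_indicator_mult)
 show H: "H1_gradient half_space u (gradient u)"
  unfolding H1_gradient_def
 proof (intro conjI sq allI impI ballI)
  fix \<phi> :: "real \<times> (real^'n) \<Rightarrow> real" and b :: "real \<times> (real^'n)"
  assume \<phi>: "test_function half_space \<phi>"
  have \<phi>': "test_function UNIV \<phi>" using \<phi> test_function_subset by blast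
  have [measurable]: "\<phi> \<in> Borel" "gradient \<phi> \<in> Borel"
   using \<phi> test_function_measurable test_function_gradient_measurable by blast+
  have z: "z \<notin> half_space \<Longrightarrow> \<phi> z = 0" "z \<notin> half_space \<Longrightarrow> gradient \<phi> z \<bullet> b = 0" for z
   using \<phi> test_function_gradient_inner[OF \<phi>, of b] unfolding test_function_def by blast+
  have t: "test_function UNIV (\<lambda>z. \<phi> z * u z)" by (rule test_function_mult[OF \<phi>' C])
  have t2: "test_function UNIV (\<lambda>z. (gradient \<phi> z \<bullet> b) * u z)"
   by (rule test_function_mult[OF test_function_gradient_inner[OF \<phi>'] C])
  have "Ck_on k (\<lambda>z. gradient u z \<bullet> b) UNIV" for k
  proof -
   have "Ck_on k (\<lambda>z. frechet_derivative u (at z) b) UNIV" using C[of "Suc k"] unfolding Ck_on.simps by blast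
   then show ?thesis by (simp only: gradient_inner[OF Ck_on_SucE[OF C[of "Suc 0"] UNIV_I]])
  qed
  then have t3: "test_function UNIV (\<lambda>z. \<phi> z * (gradient u z \<bullet> b))"
   by (rule test_function_mult[OF \<phi>'])
  have gr: "gradient (\<lambda>z. \<phi> z * u z) z \<bullet> b = \<phi> z * (gradient u z \<bullet> b) + (gradient \<phi> z \<bullet> b) * u z" for z
   using gradient_inner[OF has_derivative_mult[OF test_function_gradient[OF \<phi>'] du]] .
  obtain B' R where R: "\<And>z. norm z > R \<Longrightarrow> \<phi> z * u z = 0" by (rule test_function_bounded[OF t], rule that)
  have "(\<integral>z. indicator UNIV z * (gradient (\<lambda>z. \<phi> z * u z) z \<bullet> b)) = 0"
   using R by (rule integral_directional_derivative_invariant[OF test_function_gradient[OF t] test_function_gradient_continuous[OF t]]) auto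
  then have "(\<integral>z. \<phi> z * (gradient u z \<bullet> b)) + (\<integral>z. (gradient \<phi> z \<bullet> b) * u z) = 0"
   using test_function_integrable[OF t2] test_function_integrable[OF t3] by (simp add: gr)
  moreover have "(\<lambda>z. indicator half_space z * (u z * (gradient \<phi> z \<bullet> b))) = (\<lambda>z. (gradient \<phi> z \<bullet> b) * u z)"
   "(\<lambda>z. indicator half_space z * ((gradient u z \<bullet> b) * \<phi> z)) = (\<lambda>z. \<phi> z * (gradient u z \<bullet> b))"
   using z by (auto simp: fun_eq_iff indicator_def)
  ultimately show "(LINT z|lebesgue_on half_space. u z * (gradient \<phi> z \<bullet> b))
    = - (LINT z|lebesgue_on half_space. (gradient u z \<bullet> b) * \<phi> z)"
   by (simp add: integral_lebesgue_on)
 qed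
 define \<xi> :: "nat \<Rightarrow> real \<times> (real^'n) \<Rightarrow> real" where chi: "\<xi> k = cutoff (real (Suc k))" for k
 let ?G = "\<lambda>k z. \<xi> k z *\<^sub>R gradient u z + u z *\<^sub>R gradient (\<xi> k) z" and ?U = "\<lambda>k y. (u (0, y) - \<xi> k (0, y) * u (0, y))\<^sup>2"
 have t: "test_function UNIV (\<lambda>z. \<xi> k z * u z)" for k
  unfolding chi by (rule test_function_mult[OF cutoff_test C]) simp
 have [measurable]: "\<xi> k \<in> Borel" "gradient (\<xi> k) \<in> Borel" for k
  unfolding chi using cutoff_test[of "real (Suc k)"] test_function_measurable test_function_gradient_measurable by auto
 have [measurable]: "(\<lambda>y::real^'n. (0::real, y)) \<in> Borel"
  by (intro borel_measurable_continuous_onI continuous_intros)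
 have gr: "gradient (\<lambda>z. \<xi> k z * u z) z = ?G k z" for k z
 proof (rule euclidean_eqI)
  fix b :: "real \<times> (real^'n)"
  have "test_function UNIV (\<xi> k)" unfolding chi by (rule cutoff_test) simp
  from gradient_inner[OF has_derivative_mult[OF test_function_gradient[OF this] du]]
  show "gradient (\<lambda>z. \<xi> k z * u z) z \<bullet> b = ?G k z \<bullet> b"
   by (simp add: inner_add_left)
 qed
 define K where "K = 4 * exp (1::real)"
 let ?W = "\<lambda>z. (1 + 2 * K\<^sup>2) * (u z)\<^sup>2 + 2 * (norm (gradient u z))\<^sup>2"
 have gb: "norm (gradient (\<xi> k) z) \<le> K / real (Suc k)" for k z
  unfolding chi K_def by (rule cutoff_gradient_bound) simp
 have K0: "K \<ge> 0" by (simp add: K_def)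
 have gb2: "norm (gradient (\<xi> k) z) \<le> K" for k z
 proof -
  have "K / real (Suc k) \<le> K / 1" using K0 by (intro divide_left_mono) auto
  then show ?thesis using gb[of k z] by simp
 qed
 have glim: "(\<lambda>k. gradient (\<xi> k) z) \<longlonglongrightarrow> 0" for z
 proof (rule Lim_null_comparison)
  show "\<forall>\<^sub>F k in sequentially. norm (gradient (\<xi> k) z) \<le> K / real (Suc k)" using gb by simp
  show "(\<lambda>k. K / real (Suc k)) \<longlonglongrightarrow> 0" by real_asymp
 qed
 have clim: "(\<lambda>k. \<xi> k z) \<longlonglongrightarrow> 1" for z unfolding chi by (rule cutoff_tendsto)
 have cb: "0 \<le> \<xi> k z" "\<xi> k z \<le> 1" for k z unfolding chi by (rule cutoff_bounds)+
 define f where "f k z = indicator half_space z * ((u z - \<xi> k z * u z)\<^sup>2 + (norm (gradient u z - ?G k z))\<^sup>2)" for k z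
 have L1: "(\<lambda>k. \<integral>z. f k z \<partial>lborel) \<longlonglongrightarrow> (\<integral>z. 0 \<partial>(lborel :: (real \<times> (real^'n)) measure))"
 proof (rule integral_dominated_convergence[where w="\<lambda>z. ?W z"])
  show "L1 (\<lambda>z. ?W z)" using iu2 ig2 by simp
  show "f k \<in> borel_measurable lborel" for k unfolding f_def[abs_def] by measurable
  show "AE z in lborel. (\<lambda>k. f k z) \<longlonglongrightarrow> 0"
  proof (rule AE_I2)
   fix z
   have "(\<lambda>k. f k z) \<longlonglongrightarrow> indicator half_space z * ((u z - 1 * u z)\<^sup>2 + (norm (gradient u z - (1 *\<^sub>R gradient u z + u z *\<^sub>R 0)))\<^sup>2)"
    unfolding f_def by (intro tendsto_intros clim glim)
   then show "(\<lambda>k. f k z) \<longlonglongrightarrow> 0" by simp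
  qed
  show "AE z in lborel. norm (f k z) \<le> ?W z" for k
  proof (rule AE_I2)
   fix z
   have "(u z - \<xi> k z * u z)\<^sup>2 = (1 - \<xi> k z)\<^sup>2 * (u z)\<^sup>2" by (simp add: power2_eq_square algebra_simps)
   also have "\<dots> \<le> 1 * (u z)\<^sup>2" using cb[of k z] by (intro mult_right_mono power_le_one) auto
   finally have a: "(u z - \<xi> k z * u z)\<^sup>2 \<le> (u z)\<^sup>2" by simp
   have eq: "gradient u z - ?G k z = (1 - \<xi> k z) *\<^sub>R gradient u z - u z *\<^sub>R gradient (\<xi> k) z"
    by (simp add: algebra_simps)
   have "norm (gradient u z - ?G k z) \<le> (1 - \<xi> k z) * norm (gradient u z) + \<bar>u z\<bar> * norm (gradient (\<xi> k) z)"
    unfolding eq using norm_triangle_ineq4[of "(1 - \<xi> k z) *\<^sub>R gradient u z" "u z *\<^sub>R gradient (\<xi> k) z"] cb[of k z] by simp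
   also have "\<dots> \<le> 1 * norm (gradient u z) + \<bar>u z\<bar> * K" using cb[of k z] gb2[of k z] by (intro add_mono mult_right_mono mult_left_mono) auto
   finally have "(norm (gradient u z - ?G k z))\<^sup>2 \<le> (norm (gradient u z) + \<bar>u z\<bar> * K)\<^sup>2"
    by (intro power_mono) auto
   also have "\<dots> \<le> 2 * (norm (gradient u z))\<^sup>2 + 2 * K\<^sup>2 * (u z)\<^sup>2"
    using sum_squares_bound[of "norm (gradient u z)" "\<bar>u z\<bar> * K"] by (simp add: power2_sum power_mult_distrib algebra_simps)
   finally show "norm (f k z) \<le> ?W z"
    using a by (auto simp: f_def indicator_def algebra_simps)
  qed
 qed simp
 have s2: "L1 (\<lambda>y. (u (0, y))\<^sup>2)" using slice B(1) by (rule integrable_square)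
 have L2: "(\<lambda>k. \<integral>y. ?U k y \<partial>lborel) \<longlonglongrightarrow> (\<integral>y. 0 \<partial>(lborel :: (real^'n) measure))"
 proof (rule integral_dominated_convergence[where w="\<lambda>y. (u (0, y))\<^sup>2"])
  show "AE y in lborel. (\<lambda>k. ?U k y) \<longlonglongrightarrow> 0"
  proof (rule AE_I2)
   fix y
   have "(\<lambda>k. ?U k y) \<longlonglongrightarrow> (u (0, y) - 1 * u (0, y))\<^sup>2" by (intro tendsto_intros clim)
   then show "(\<lambda>k. ?U k y) \<longlonglongrightarrow> 0" by simp
  qed
  show "AE y in lborel. norm (?U k y) \<le> (u (0, y))\<^sup>2" for k
  proof (rule AE_I2)
   fix y
   have "?U k y = (1 - \<xi> k (0, y))\<^sup>2 * (u (0, y))\<^sup>2" by (simp add: power2_eq_square algebra_simps)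
   also have "\<dots> \<le> 1 * (u (0, y))\<^sup>2" using cb[of k "(0, y)"] by (intro mult_right_mono power_le_one) auto
   finally show "norm (?U k y) \<le> (u (0, y))\<^sup>2" by simp
  qed
 qed (simp, measurable, rule s2)
 show "has_trace u (\<lambda>y. u (0, y))"
  unfolding has_trace_def
 proof (intro conjI exI[of _ "gradient u"] exI[of _ "\<lambda>k z. \<xi> k z * u z"] H allI t)
  show "square_integrable_on UNIV (\<lambda>y. u (0, y))"
   using s2 by (subst square_integrable_on_borel) auto
  have "(LINT z|lebesgue_on half_space. (u z - \<xi> k z * u z)\<^sup>2 + (norm (gradient u z - gradient (\<lambda>z. \<xi> k z * u z) z))\<^sup>2) = (\<integral>z. f k z)" for k
   unfolding gr by (subst integral_lebesgue_on) (auto simp: f_def[abs_def])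
  then show "(\<lambda>k. LINT z|lebesgue_on half_space. (u z - \<xi> k z * u z)\<^sup>2 + (norm (gradient u z - gradient (\<lambda>z. \<xi> k z * u z) z))\<^sup>2) \<longlonglongrightarrow> 0"
   using L1 by simp
  have "(LINT y|lebesgue. ?U k y) = (\<integral>y. ?U k y)" for k
   by (rule integral_completion) measurable
  then show "(\<lambda>k. LINT y|lebesgue. ?U k y) \<longlonglongrightarrow> 0" using L2 by simp
 qed
qed

section \<open>Even reflection\<close>

definition refl_x :: "real \<times> (real^'n) \<Rightarrow> real \<times> (real^'n)" where
 "refl_x z = (- fst z, snd z)"

text \<open>For \<open>\<psi>\<close> supported in the open half space the two summands have disjoint supports, and the sum
 is smooth on the whole space. Solutions with an even right hand side are even, which is how the
 Neumann condition is enforced.\<close>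

definition even_ext :: "(real \<times> (real^'n) \<Rightarrow> real) \<Rightarrow> real \<times> (real^'n) \<Rightarrow> real" where
 "even_ext \<psi> z = \<psi> z + \<psi> (refl_x z)"

lemma refl_x_linear: "bounded_linear refl_x"
 unfolding refl_x_def[abs_def] by (intro bounded_linear_Pair bounded_linear_minus bounded_linear_fst bounded_linear_snd)

lemma refl_x_simps [simp]: "refl_x (refl_x z) = z" "norm (refl_x z) = norm z" "refl_x (a + b) = refl_x a + refl_x b"
 by (cases z; cases a; cases b; simp add: refl_x_def norm_Pair)+

lemma refl_x_measurable [measurable]: "refl_x \<in> Borel"
 by (intro borel_measurable_continuous_onI linear_continuous_on refl_x_linear)

lemma lborel_refl_x: "distr lborel borel (refl_x :: real \<times> (real^'n) \<Rightarrow> _) = lborel"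
proof -
 define c where "c b = (if fst b = 0 then 1 else - 1 :: real)" for b :: "real \<times> (real^'n)"
 have T: "0 + (\<Sum>j\<in>Basis. (c j * (z \<bullet> j)) *\<^sub>R j) = refl_x z" for z
 proof (rule euclidean_eqI)
  fix b :: "real \<times> (real^'n)" assume b: "b \<in> Basis"
  have "(0 + (\<Sum>j\<in>Basis. (c j * (z \<bullet> j)) *\<^sub>R j)) \<bullet> b = c b * (z \<bullet> b)"
   using b by (simp add: inner_sum_left_Basis)
  also have "\<dots> = refl_x z \<bullet> b" using b by (cases z) (auto simp: c_def refl_x_def Basis_prod_def)
  finally show "(0 + (\<Sum>j\<in>Basis. (c j * (z \<bullet> j)) *\<^sub>R j)) \<bullet> b = refl_x z \<bullet> b" .
 qed
 have "lborel = density (distr lborel borel (\<lambda>x. 0 + (\<Sum>j\<in>Basis. (c j * (x \<bullet> j)) *\<^sub>R j))) (\<lambda>_. \<Prod>j\<in>Basis. \<bar>c j\<bar>)"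
  by (rule lborel_affine_euclidean) (simp add: c_def)
 also have "\<dots> = density (distr lborel borel refl_x) (\<lambda>_. 1)"
  unfolding T by (simp add: c_def if_distrib[of abs] cong: if_cong)
 finally have "lborel = distr lborel borel (refl_x :: real \<times> (real^'n) \<Rightarrow> _)" by (simp add: density_1)
 then show ?thesis by (rule sym)
qed

lemma integral_refl_x:
 fixes f :: "real \<times> (real^'n) \<Rightarrow> real"
 assumes [measurable]: "f \<in> Borel"
 shows "(\<integral>z. f (refl_x z)) = (\<integral>z. f z)"
proof -
 have "(\<integral>z. f z) = (\<integral>z. f z \<partial>distr lborel borel refl_x)" by (simp add: lborel_refl_x)
 also have "\<dots> = (\<integral>z. f (refl_x z))" by (rule integral_distr) auto
 finally show ?thesis by simp
qed

lemma even_ext_test: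
 assumes "test_function half_space \<psi>"
 shows "test_function UNIV (even_ext \<psi>)"
proof -
 have 1: "test_function UNIV \<psi>" using assms test_function_subset by blast
 have "test_function UNIV (\<lambda>z. \<psi> (refl_x z))"
 proof -
  obtain K where K: "compact K" "\<And>z. z \<notin> K \<Longrightarrow> \<psi> z = 0" using 1 unfolding test_function_def by blast
  have "compact (refl_x ` K)" using K(1) by (intro compact_continuous_image linear_continuous_on refl_x_linear)
  moreover have "\<psi> (refl_x z) = 0" if "z \<notin> refl_x ` K" for z
   using K(2)[of "refl_x z"] that by (metis image_eqI refl_x_simps(1))
  moreover have "Ck_on k (\<lambda>z. \<psi> (refl_x z)) UNIV" for k
   using Ck_on_affine[OF refl_x_linear, of k \<psi> 0] 1 by (simp add: test_function_def)
  ultimately show ?thesis unfolding test_function_def by blast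
 qed
 from test_function_add[OF 1 this] show ?thesis by (simp add: even_ext_def[abs_def])
qed

lemma bessel_refl_x: "bessel q (refl_x z) = bessel q z"
 by (simp add: bessel_def)

lemma bessel_conv_even:
 assumes "test_function half_space \<psi>"
 shows "bessel_conv q (even_ext \<psi>) (refl_x z) = bessel_conv q (even_ext \<psi>) z"
proof -
 have [measurable]: "even_ext \<psi> \<in> Borel" using even_ext_test[OF assms] by (rule test_function_measurable)
 have "bessel_conv q (even_ext \<psi>) (refl_x z) = (\<integral>\<zeta>. bessel q (refl_x \<zeta>) * even_ext \<psi> (refl_x z + refl_x \<zeta>))"
  unfolding bessel_conv_def by (rule integral_refl_x[symmetric]) measurable
 also have "\<dots> = bessel_conv q (even_ext \<psi>) z"
  unfolding bessel_conv_def by (simp only: bessel_refl_x refl_x_simps(3)[symmetric]) (simp add: even_ext_def add.commute del: refl_x_simps(3))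
 finally show ?thesis .
qed

text \<open>The normal derivative of an even function is odd.\<close>

lemma bessel_conv_normal_derivative_zero:
 assumes q: "q > 0" and \<psi>: "test_function half_space \<psi>"
 shows "gradient (bessel_conv q (even_ext \<psi>)) (0, y) \<bullet> (1, 0) = 0"
proof -
 let ?u = "bessel_conv q (even_ext \<psi>)"
 note d = bessel_conv_derivative[OF q even_ext_test[OF \<psi>]]
 define D where "D h = gradient ?u (0, y) \<bullet> h" for h
 have 1: "(?u has_derivative D) (at (0, y))"
  using d[of "(0, y)"] bessel_conv_gradient[OF q even_ext_test[OF \<psi>]] by (simp add: D_def[abs_def])
 have r: "refl_x (0, y) = (0, y)" by (simp add: refl_x_def)
 have "((\<lambda>z. ?u (refl_x z)) has_derivative (\<lambda>h. D (refl_x h))) (at (0, y))"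
  by (rule has_derivative_compose[OF bounded_linear_imp_has_derivative[OF refl_x_linear]]) (simp add: r 1)
 then have "(?u has_derivative (\<lambda>h. D (refl_x h))) (at (0, y))" by (simp add: bessel_conv_even[OF \<psi>])
 then have "D = (\<lambda>h. D (refl_x h))" using 1 has_derivative_unique by blast
 then have "D (1, 0) = D (refl_x (1, 0))" by (rule fun_cong)
 also have "refl_x (1, 0) = - (1, 0 :: real^'n)" by (simp add: refl_x_def)
 also have "D (- (1, 0)) = - D (1, 0)" by (simp only: D_def inner_minus_right)
 finally show ?thesis by (simp add: D_def)
qed

text \<open>Integration by parts in the half space for \<open>\<eta> \<nabla>u\<close>: there is no boundary term, since the
 tangential directions produce none and the normal derivative of \<open>u\<close> vanishes on the boundary.\<close>

lemma bessel_conv_weak_identity: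
 fixes \<psi> \<eta> :: "real \<times> (real^'n) \<Rightarrow> real"
 assumes q: "q > 0" and \<psi>: "test_function half_space \<psi>" and \<eta>: "test_function UNIV \<eta>"
 defines "u \<equiv> bessel_conv q (even_ext \<psi>)"
 shows "(\<integral>z. indicator half_space z * (gradient \<eta> z \<bullet> gradient u z + 4 * q * \<eta> z * u z))
  = (\<integral>z. indicator half_space z * (\<eta> z * \<psi> z))"
proof -
 note e = even_ext_test[OF \<psi>]
 define ub where "ub b z = gradient u z \<bullet> b" for b z
 have ub: "ub b = bessel_conv q (\<lambda>z. gradient (even_ext \<psi>) z \<bullet> b)" for b
  unfolding ub_def u_def using bessel_conv_gradient[OF q e] by auto
 let ?L = "\<lambda>z. indicator half_space z * (gradient \<eta> z \<bullet> gradient u z + 4 * q * \<eta> z * u z)"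
  and ?g = "\<lambda>b. gradient (\<lambda>z. \<eta> z * ub b z)" and ?e = "\<lambda>b z. gradient (even_ext \<psi>) z \<bullet> b"
 note te = test_function_gradient_inner[OF e]
 have Cub: "Ck_on k (ub b) UNIV" for k b unfolding ub by (rule Ck_on_bessel_conv[OF q te])
 have t: "test_function UNIV (\<lambda>z. \<eta> z * ub b z)" for b by (rule test_function_mult[OF \<eta> Cub])
 have gub: "gradient (ub b) z \<bullet> b = bessel_conv q (\<lambda>z. gradient (?e b) z \<bullet> b) z" for b z
  unfolding ub by (rule bessel_conv_gradient[OF q te])
 have gr: "?g b z \<bullet> b = \<eta> z * (gradient (ub b) z \<bullet> b) + (gradient \<eta> z \<bullet> b) * ub b z" for b z
 proof -
  have "(ub b has_derivative (\<lambda>h. gradient (ub b) z \<bullet> h)) (at z)"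
   using gradient_inner[OF Ck_on_SucE[OF Cub UNIV_I], of b z] Ck_on_SucE[OF Cub UNIV_I, of b z] by simp
  from gradient_inner[OF has_derivative_mult[OF test_function_gradient[OF \<eta>] this]] show ?thesis .
 qed
 (* The divergence theorem for the field \<eta> * \<nabla>u, one coordinate direction at a time. *)
 have zero: "(\<integral>z. indicator half_space z * (?g b z \<bullet> b)) = 0" if b: "b \<in> Basis" for b
 proof -
  obtain B' R where R: "\<And>z. norm z > R \<Longrightarrow> \<eta> z * ub b z = 0" by (rule test_function_bounded[OF t[of b]], rule that)
  show ?thesis
  proof (cases "fst b = 0")
   case True
   show ?thesis
    by (rule integral_directional_derivative_invariant[OF test_function_gradient[OF t] test_function_gradient_continuous[OF t] R])
     (use True in \<open>auto simp: mem_half_space\<close>)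
  next
   case False
   then have b1: "b = (1, 0)" using b by (auto simp: Basis_prod_def)
   have z0: "\<eta> (0, y) * ub b (0, y) = 0" for y
    unfolding ub_def u_def b1 using bessel_conv_normal_derivative_zero[OF q \<psi>] by simp
   have "(\<integral>z. indicator half_space z * (?g b z \<bullet> (1, 0))) = - (\<integral>y. \<eta> (0, y) * ub b (0, y))"
    using R by (rule integral_normal_derivative_half_space[OF test_function_gradient[OF t] test_function_gradient_continuous[OF t]])
   then show ?thesis unfolding z0 by (simp add: b1)
  qed
 qed
 have it: "L1 (\<lambda>z. indicator half_space z * (?g b z \<bullet> b))" for b
  by (intro integrable_indicator_mult test_function_integrable[OF test_function_gradient_inner[OF t]]) simp
 have lap: "(\<Sum>b\<in>Basis. gradient (ub b) z \<bullet> b) = 4 * q * u z - even_ext \<psi> z" for z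
 proof -
  have "(\<Sum>b\<in>Basis. gradient (ub b) z \<bullet> b) = (\<Sum>b\<in>Basis. (\<integral>\<zeta>. bessel q \<zeta> * (gradient (?e b) (z + \<zeta>) \<bullet> b)))"
   unfolding gub by (simp add: bessel_conv_def)
  also have "\<dots> = (\<integral>\<zeta>. (\<Sum>b\<in>Basis. bessel q \<zeta> * (gradient (?e b) (z + \<zeta>) \<bullet> b)))"
  proof (rule Bochner_Integration.integral_sum[symmetric])
   fix b :: "real \<times> (real^'n)"
   have tt: "test_function UNIV (\<lambda>z. gradient (?e b) z \<bullet> b)"
    by (rule test_function_gradient_inner[OF te])
   obtain B' R where B': "\<And>z. \<bar>gradient (?e b) z \<bullet> b\<bar> \<le> B'" by (rule test_function_bounded[OF tt], rule that)
   show "L1 (\<lambda>\<zeta>. bessel q \<zeta> * (gradient (?e b) (z + \<zeta>) \<bullet> b))"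
    using B' test_function_shift_measurable[OF tt, of "\<lambda>\<zeta>. z + \<zeta>" borel] by (intro bessel_mult_integrable[OF q, where B=B']) auto
  qed
  also have "\<dots> = bessel_conv q (laplacian (even_ext \<psi>)) z"
   by (simp add: bessel_conv_def laplacian_eq_gradient[OF e] sum_distrib_left)
  also have "\<dots> = 4 * q * u z - even_ext \<psi> z" using bessel_conv_inverse[OF q e, of z] by (simp add: u_def)
  finally show ?thesis .
 qed
 have "0 = (\<integral>z. (\<Sum>b\<in>Basis. indicator half_space z * (?g b z \<bullet> b)))"
  using zero it by (subst Bochner_Integration.integral_sum) auto
 also have "\<dots> = (\<integral>z. ?L z - indicator half_space z * (\<eta> z * \<psi> z))"
 proof (rule Bochner_Integration.integral_cong[OF refl])
  fix z
  have "(\<Sum>b\<in>Basis. ?g b z \<bullet> b) = \<eta> z * (4 * q * u z - even_ext \<psi> z) + gradient \<eta> z \<bullet> gradient u z"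
  proof -
   have "gradient \<eta> z \<bullet> gradient u z = (\<Sum>b\<in>Basis. (gradient \<eta> z \<bullet> b) * ub b z)"
    by (subst euclidean_inner) (simp add: ub_def)
   then show ?thesis by (simp add: gr sum.distrib sum_distrib_left[symmetric] lap)
  qed
  moreover have "even_ext \<psi> z = \<psi> z" if "z \<in> half_space"
  proof -
   have "refl_x z \<notin> half_space" using that by (auto simp: mem_half_space refl_x_def)
   then have "\<psi> (refl_x z) = 0" using \<psi> unfolding test_function_def by blast
   then show ?thesis by (simp add: even_ext_def)
  qed
  ultimately show "(\<Sum>b\<in>Basis. indicator half_space z * (?g b z \<bullet> b)) =
   ?L z - indicator half_space z * (\<eta> z * \<psi> z)"
   unfolding sum_distrib_left[symmetric] by (cases "z \<in> half_space") (auto simp: algebra_simps)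
 qed
 also have "\<dots> = (\<integral>z. ?L z) - (\<integral>z. indicator half_space z * (\<eta> z * \<psi> z))"
 proof (rule Bochner_Integration.integral_diff)
  have Cu: "Ck_on k u UNIV" for k unfolding u_def by (rule Ck_on_bessel_conv[OF q e])
  have i1: "L1 (\<lambda>z. \<eta> z * u z)" by (rule test_function_integrable[OF test_function_mult[OF \<eta> Cu]])
  have "L1 (\<lambda>z. \<Sum>b\<in>Basis. (gradient \<eta> z \<bullet> b) * ub b z)"
   by (intro Bochner_Integration.integrable_sum test_function_integrable[OF test_function_mult[OF test_function_gradient_inner[OF \<eta>] Cub]])
  then have i2: "L1 (\<lambda>z. gradient \<eta> z \<bullet> gradient u z)"
   by (subst euclidean_inner) (simp add: ub_def)
  show "L1 ?L"
   using i1 i2 by (intro integrable_indicator_mult) (auto simp: mult.assoc)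
  have "\<And>k. Ck_on k \<psi> UNIV" using \<psi> by (simp add: test_function_def)
  then show "L1 (\<lambda>z. indicator half_space z * (\<eta> z * \<psi> z))"
   by (intro integrable_indicator_mult test_function_integrable[OF test_function_mult[OF \<eta>]]) simp_all
 qed
 finally show ?thesis by simp
qed

section \<open>Borel representatives\<close>

text \<open>The problem is posed with Lebesgue measurable functions, while product measurability and the
 uniqueness of densities are used for Borel functions; the following lemmas pass to Borel
 representatives.\<close>

lemma AE_lebesgue_on:
 fixes P :: "'a::euclidean_space \<Rightarrow> bool"
 assumes "S \<in> sets borel"
 shows "(AE z in lebesgue_on S. P z) \<longleftrightarrow> (AE z in lborel. z \<in> S \<longrightarrow> P z)"
proof -
 have "S \<inter> space lebesgue \<in> sets lebesgue" using assms by (simp add: sets_completionI_sets)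
 then show ?thesis by (simp add: AE_restrict_space_iff AE_completion_iff)
qed

lemma borel_representative_real:
 fixes f :: "'a::euclidean_space \<Rightarrow> real"
 assumes S: "S \<in> sets borel" and f: "f \<in> borel_measurable (lebesgue_on S)"
 obtains g where "g \<in> Borel" "AE z in lebesgue_on S. f z = g z"
proof -
 have "S \<inter> space lebesgue \<in> sets lebesgue" using S by (simp add: sets_completionI_sets)
 then have "(\<lambda>z. indicator S z *\<^sub>R f z) \<in> borel_measurable lebesgue"
  using f by (simp add: borel_measurable_restrict_space_iff)
 from completion_ex_borel_measurable_real[OF this[simplified]]
 obtain g where g: "g \<in> borel_measurable lborel" "AE z in lborel. indicator S z * f z = g z" by auto
 have "AE z in lebesgue_on S. f z = g z"
  unfolding AE_lebesgue_on[OF S] using g(2) by eventually_elim auto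
 then show ?thesis using g(1) that by simp
qed

lemma borel_representative:
 fixes f :: "'a::euclidean_space \<Rightarrow> 'b::euclidean_space"
 assumes S: "S \<in> sets borel" and f: "f \<in> borel_measurable (lebesgue_on S)"
 obtains g where "g \<in> Borel" "AE z in lebesgue_on S. f z = g z"
proof -
 have "\<exists>g. g \<in> Borel \<and> (AE z in lebesgue_on S. f z \<bullet> b = g z)" for b
 proof -
  have "(\<lambda>z. f z \<bullet> b) \<in> borel_measurable (lebesgue_on S)" using f by measurable
  from borel_representative_real[OF S this] show ?thesis by metis
 qed
 then obtain g where g: "\<And>b. g b \<in> Borel" "\<And>b. AE z in lebesgue_on S. f z \<bullet> b = g b z" by metis
 have "AE z in lebesgue_on S. \<forall>b\<in>Basis. f z \<bullet> b = g b z" using g(2) by (intro AE_finite_allI) auto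
 then have "AE z in lebesgue_on S. f z = (\<Sum>b\<in>Basis. g b z *\<^sub>R b)"
 proof eventually_elim
  case (elim z)
  have "f z = (\<Sum>b\<in>Basis. (f z \<bullet> b) *\<^sub>R b)" by (simp add: euclidean_representation)
  then show ?case using elim by simp
 qed
 moreover have "(\<lambda>z. \<Sum>b\<in>Basis. g b z *\<^sub>R b) \<in> Borel"
  using g(1) by (intro borel_measurable_sum borel_measurable_scaleR) auto
 ultimately show ?thesis using that by blast
qed

lemma square_integrable_on_cong:
 assumes "square_integrable_on S u" "AE z in lebesgue_on S. u z = u' z" "u' \<in> Borel"
 shows "square_integrable_on S u'"
proof -
 have [measurable]: "u \<in> borel_measurable (lebesgue_on S)" "u' \<in> borel_measurable (lebesgue_on S)"
  using assms(1,3) by (auto simp: square_integrable_on_def borel_measurable_lebesgue_on)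
 have "integrable (lebesgue_on S) (\<lambda>z. (norm (u z))\<^sup>2) \<longleftrightarrow> integrable (lebesgue_on S) (\<lambda>z. (norm (u' z))\<^sup>2)"
  by (rule integrable_cong_AE; (measurable)?) (use assms(2) in eventually_elim, simp)
 then show ?thesis using assms(1) by (simp add: square_integrable_on_def)
qed

lemma H1_gradient_cong:
 assumes H: "H1_gradient S u G"
  and u: "AE z in lebesgue_on S. u z = u' z" "u' \<in> Borel"
  and G: "AE z in lebesgue_on S. G z = G' z" "G' \<in> Borel"
 shows "H1_gradient S u' G'"
 unfolding H1_gradient_def
proof (intro conjI allI impI ballI)
 show "square_integrable_on S u'" "square_integrable_on S G'"
  using H u G square_integrable_on_cong unfolding H1_gradient_def by blast+
 fix \<phi> and b :: 'a assume \<phi>: "test_function S \<phi>" and b: "b \<in> Basis"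
 have m[measurable]: "u \<in> borel_measurable (lebesgue_on S)" "G \<in> borel_measurable (lebesgue_on S)"
   "u' \<in> borel_measurable (lebesgue_on S)" "G' \<in> borel_measurable (lebesgue_on S)"
   "\<phi> \<in> borel_measurable (lebesgue_on S)" "gradient \<phi> \<in> borel_measurable (lebesgue_on S)"
  using H u G \<phi> by (auto simp: H1_gradient_def square_integrable_on_def
    intro!: borel_measurable_lebesgue_on test_function_measurable test_function_gradient_measurable)
 have "(LINT z|lebesgue_on S. u' z * (gradient \<phi> z \<bullet> b)) = (LINT z|lebesgue_on S. u z * (gradient \<phi> z \<bullet> b))"
  by (rule integral_cong_AE; (measurable)?) (use u(1) in eventually_elim, simp)
 moreover have "(LINT z|lebesgue_on S. (G' z \<bullet> b) * \<phi> z) = (LINT z|lebesgue_on S. (G z \<bullet> b) * \<phi> z)"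
  by (rule integral_cong_AE; (measurable)?) (use G(1) in eventually_elim, simp)
 ultimately show "(LINT z|lebesgue_on S. u' z * (gradient \<phi> z \<bullet> b)) = - (LINT z|lebesgue_on S. (G' z \<bullet> b) * \<phi> z)"
  using H \<phi> b unfolding H1_gradient_def by simp
qed

lemma integrable_mult_squares:
 fixes f g :: "'a \<Rightarrow> real"
 assumes "f \<in> borel_measurable M" "g \<in> borel_measurable M"
  and "integrable M (\<lambda>z. (f z)\<^sup>2)" "integrable M (\<lambda>z. (g z)\<^sup>2)"
 shows "integrable M (\<lambda>z. f z * g z)"
proof (rule integrable_bound_pointwise[OF Bochner_Integration.integrable_add[OF assms(3,4)]])
 show "norm (f z * g z) \<le> (f z)\<^sup>2 + (g z)\<^sup>2" for z
  using sum_squares_bound[of "\<bar>f z\<bar>" "\<bar>g z\<bar>"] mult_nonneg_nonneg[OF abs_ge_zero[of "f z"] abs_ge_zero[of "g z"]]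
  unfolding real_norm_def abs_mult power2_abs by linarith
qed (use assms in measurable)

lemma integrable_inner_squares:
 fixes F G :: "'a::euclidean_space \<Rightarrow> 'b::euclidean_space"
 assumes [measurable]: "S \<in> sets borel" "F \<in> Borel" "G \<in> Borel"
  and "L1 (\<lambda>z. indicator S z * (norm (F z))\<^sup>2)" "L1 (\<lambda>z. indicator S z * (norm (G z))\<^sup>2)"
 shows "L1 (\<lambda>z. indicator S z * (F z \<bullet> G z))"
proof (rule integrable_bound_pointwise[OF Bochner_Integration.integrable_add[OF assms(4,5)]])
 fix z
 have "\<bar>F z \<bullet> G z\<bar> \<le> (norm (F z))\<^sup>2 + (norm (G z))\<^sup>2"
  using Cauchy_Schwarz_ineq2[of "F z" "G z"] sum_squares_bound[of "norm (F z)" "norm (G z)"]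
   mult_nonneg_nonneg[OF norm_ge_zero[of "F z"] norm_ge_zero[of "G z"]] by linarith
 then show "norm (indicator S z * (F z \<bullet> G z)) \<le> indicator S z * (norm (F z))\<^sup>2 + indicator S z * (norm (G z))\<^sup>2"
  by (simp add: indicator_def)
qed measurable

lemma norm_diff_square_le: "(norm (a - b))\<^sup>2 \<le> 2 * (norm a)\<^sup>2 + 2 * (norm (b :: 'a::real_normed_vector))\<^sup>2"
proof -
 have "(norm (a - b))\<^sup>2 \<le> (norm a + norm b)\<^sup>2" by (intro power_mono norm_triangle_ineq4) simp
 also have "\<dots> \<le> 2 * (norm a)\<^sup>2 + 2 * (norm b)\<^sup>2" using sum_squares_bound[of "norm a" "norm b"] by (simp add: power2_sum)
 finally show ?thesis .
qed

lemma integrable_indicator_cbox: "L1 (\<lambda>z. indicator (cbox a b) z :: real)"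
 by (intro integrable_real_indicator) (auto intro: emeasure_bounded_finite[OF bounded_cbox, unfolded infinity_ennreal_def])

lemma test_function_zero_outside: "test_function S g \<Longrightarrow> z \<notin> S \<Longrightarrow> g z = 0"
 unfolding test_function_def by blast

lemma test_function_square_integrable:
 assumes "test_function S g" shows "L1 (\<lambda>z. (g z)\<^sup>2)"
proof -
 obtain B R where B: "\<And>z. \<bar>g z\<bar> \<le> B" by (rule test_function_bounded[OF assms], rule that)
 show ?thesis by (rule integrable_square[OF test_function_integrable[OF assms] B])
qed

text \<open>The gradient in the weak equation and the one in the definition of the trace come from
 different quantifiers; both are identified here by the fundamental lemma applied to each component
 of the difference.\<close>

lemma weak_gradient_unique:
 assumes H: "H1_gradient half_space u G" "H1_gradient half_space u G'"
  and [measurable]: "G \<in> Borel" "G' \<in> Borel"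
 shows "AE z in lborel. z \<in> half_space \<longrightarrow> G z = (G' z :: real \<times> (real^'n))"
proof -
 have sq: "L1 (\<lambda>z. indicator half_space z * (norm (G z))\<^sup>2)" "L1 (\<lambda>z. indicator half_space z * (norm (G' z))\<^sup>2)"
  using H by (auto simp: H1_gradient_def square_integrable_on_borel)
 have "AE z in lborel. z \<in> half_space \<longrightarrow> (G z - G' z) \<bullet> b = 0" if b: "b \<in> Basis" for b
 proof (rule fundamental_lemma[OF open_half_space])
  have prod: "L1 (\<lambda>z. indicator half_space z * (F z \<bullet> (g z *\<^sub>R b)))"
   if "L1 (\<lambda>z. indicator half_space z * (norm (F z))\<^sup>2)" "F \<in> Borel"
    "g \<in> Borel" "L1 (\<lambda>z. (g z)\<^sup>2)" for F g
   using that b integrable_indicator_mult[OF half_space_borel that(4)] by (intro integrable_inner_squares) auto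
  show "(\<lambda>z. (G z - G' z) \<bullet> b) \<in> Borel" by measurable
  show "L1 (\<lambda>z. indicator (cbox l r) z * ((G z - G' z) \<bullet> b))" if lr: "cbox l r \<subseteq> half_space" for l r
  proof -
   have "(indicator (cbox l r) z :: real)\<^sup>2 = indicator (cbox l r) z" for z by (simp add: indicator_def)
   then have c: "L1 (\<lambda>z. (indicator (cbox l r) z :: real)\<^sup>2)" by (simp only: integrable_indicator_cbox)
   have "L1 (\<lambda>z. indicator half_space z * (G z \<bullet> (indicator (cbox l r) z *\<^sub>R b)) - indicator half_space z * (G' z \<bullet> (indicator (cbox l r) z *\<^sub>R b)))"
    using sq c by (intro Bochner_Integration.integrable_diff prod) auto
   moreover have "indicator half_space z * (G z \<bullet> (indicator (cbox l r) z *\<^sub>R b)) - indicator half_space z * (G' z \<bullet> (indicator (cbox l r) z *\<^sub>R b)) = indicator (cbox l r) z * ((G z - G' z) \<bullet> b)" for z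
    using lr by (auto simp: indicator_def inner_diff_left)
   ultimately show ?thesis by simp
  qed
  show "(\<integral>z. \<psi> z * ((G z - G' z) \<bullet> b)) = 0" if \<psi>: "test_function half_space \<psi>" for \<psi>
  proof -
   have [measurable]: "\<psi> \<in> Borel" using \<psi> by (rule test_function_measurable)
   note p = prod[OF _ _ _ test_function_square_integrable[OF \<psi>]]
   have "(LINT z|lebesgue_on half_space. (G z \<bullet> b) * \<psi> z) = (LINT z|lebesgue_on half_space. (G' z \<bullet> b) * \<psi> z)"
    using H \<psi> b unfolding H1_gradient_def by (metis (no_types, lifting) neg_equal_iff_equal)
   then have "(\<integral>z. indicator half_space z * (G z \<bullet> (\<psi> z *\<^sub>R b))) = (\<integral>z. indicator half_space z * (G' z \<bullet> (\<psi> z *\<^sub>R b)))"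
    by (simp add: integral_lebesgue_on mult.commute)
   then have "(\<integral>z. indicator half_space z * (G z \<bullet> (\<psi> z *\<^sub>R b)) - indicator half_space z * (G' z \<bullet> (\<psi> z *\<^sub>R b))) = 0"
    using p sq by (subst Bochner_Integration.integral_diff) auto
   moreover have "indicator half_space z * (G z \<bullet> (\<psi> z *\<^sub>R b)) - indicator half_space z * (G' z \<bullet> (\<psi> z *\<^sub>R b)) = \<psi> z * ((G z - G' z) \<bullet> b)" for z
    using test_function_zero_outside[OF \<psi>] by (auto simp: indicator_def inner_diff_left algebra_simps)
   ultimately show ?thesis by simp
  qed
 qed
 then have "AE z in lborel. \<forall>b\<in>Basis. z \<in> half_space \<longrightarrow> (G z - G' z) \<bullet> b = 0" by (intro AE_finite_allI) auto
 then show ?thesis by eventually_elim (auto simp: inner_diff_left intro: euclidean_eqI)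
qed

text \<open>First let \<open>k\<close> tend to infinity, then \<open>e\<close> to zero.\<close>

lemma zero_if_le_eps:
 fixes X :: real
 assumes "\<And>k e. e > 0 \<Longrightarrow> \<bar>X\<bar> \<le> d k / e + e * W" "d \<longlonglongrightarrow> 0"
 shows "X = 0"
proof -
 have le: "\<bar>X\<bar> \<le> e * W" if e: "e > 0" for e
 proof (rule LIMSEQ_le_const)
  have "(\<lambda>k. d k / e + e * W) \<longlonglongrightarrow> 0 / e + e * W" using assms(2) e by (intro tendsto_intros) auto
  then show "(\<lambda>k. d k / e + e * W) \<longlonglongrightarrow> e * W" by simp
  show "\<exists>N. \<forall>n\<ge>N. \<bar>X\<bar> \<le> d n / e + e * W" using assms(1)[OF e] by blast
 qed
 have "((\<lambda>e. e * W) \<longlongrightarrow> 0 * W) (at_right 0)" by (intro tendsto_intros)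
 then have "\<bar>X\<bar> \<le> 0 * W"
  by (rule tendsto_lowerbound) (auto simp: eventually_at_filter le)
 then show ?thesis by simp
qed

section \<open>The weak formulation\<close>

definition h1_error :: "('a \<Rightarrow> real) \<Rightarrow> ('a \<Rightarrow> 'a) \<Rightarrow> ('a::euclidean_space \<Rightarrow> real) \<Rightarrow> 'a \<Rightarrow> real" where
 "h1_error v G \<phi> z = (v z - \<phi> z)\<^sup>2 + (norm (G z - gradient \<phi> z))\<^sup>2"

text \<open>What the later sections use of an element of \<open>H\<^sup>1\<close>: Borel representatives \<open>v\<close>, \<open>G\<close>, \<open>u\<close> of the
 function, its weak gradient and its trace, together with test functions \<open>\<phi> k\<close> that converge to it
 in \<open>H\<^sup>1\<close> and on the boundary in \<open>L\<^sup>2\<close>.\<close>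

definition H1_approx ::
  "(real \<times> (real^'n) \<Rightarrow> real) \<Rightarrow> (real \<times> (real^'n) \<Rightarrow> real \<times> (real^'n)) \<Rightarrow> (real^'n \<Rightarrow> real) \<Rightarrow> (nat \<Rightarrow> real \<times> (real^'n) \<Rightarrow> real) \<Rightarrow> bool" where
 "H1_approx v G u \<phi> \<longleftrightarrow>
   v \<in> Borel \<and> G \<in> Borel \<and> u \<in> Borel \<and>
   L1 (\<lambda>z. indicator half_space z * (v z)\<^sup>2) \<and>
   L1 (\<lambda>z. indicator half_space z * (norm (G z))\<^sup>2) \<and>
   L1 (\<lambda>y. (u y)\<^sup>2) \<and> (\<forall>k. test_function UNIV (\<phi> k)) \<and>
   (\<lambda>k. \<integral>z. indicator half_space z * h1_error v G (\<phi> k) z \<partial>lborel) \<longlonglongrightarrow> 0 \<and>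
   (\<lambda>k. \<integral>y. (u y - \<phi> k (0, y))\<^sup>2 \<partial>lborel) \<longlonglongrightarrow> 0"

lemma H1_approxD:
 assumes "H1_approx v G u \<phi>"
 shows "v \<in> Borel" "G \<in> Borel" "u \<in> Borel"
  "L1 (\<lambda>z. indicator half_space z * (v z)\<^sup>2)"
  "L1 (\<lambda>z. indicator half_space z * (norm (G z))\<^sup>2)"
  "L1 (\<lambda>y. (u y)\<^sup>2)" "test_function UNIV (\<phi> k)"
  "(\<lambda>k. \<integral>z. indicator half_space z * h1_error v G (\<phi> k) z \<partial>lborel) \<longlonglongrightarrow> 0"
  "(\<lambda>k. \<integral>y. (u y - \<phi> k (0, y))\<^sup>2 \<partial>lborel) \<longlonglongrightarrow> 0"
  "\<phi> k \<in> Borel" "gradient (\<phi> k) \<in> Borel"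
 using assms test_function_measurable test_function_gradient_measurable unfolding H1_approx_def by blast+

text \<open>The weak formulation is kept for smooth comparison functions only, where gradient and trace
 are the classical ones.\<close>

lemma weak_solution_borel:
 fixes v :: "real \<times> (real^'n) \<Rightarrow> real"
 assumes w: "weak_solution m f v" and f: "continuous_on UNIV f"
 obtains v0 G0 u \<phi> where
  "H1_approx v0 G0 u \<phi>" "AE z in lebesgue_on half_space. v z = v0 z"
  "\<And>w. H1_gradient half_space w (gradient w) \<Longrightarrow> has_trace w (\<lambda>y. w (0, y)) \<Longrightarrow>
    w \<in> Borel \<Longrightarrow> gradient w \<in> Borel \<Longrightarrow>
    (\<integral>z. indicator half_space z * (G0 z \<bullet> gradient w z + m\<^sup>2 * v0 z * w z)) = (\<integral>y. f (u y) * w (0, y))"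
proof -
 obtain Gv tv where Gv: "H1_gradient half_space v Gv" and tr: "has_trace v tv"
  and weak: "\<And>\<phi> G\<phi> t\<phi>. H1_gradient half_space \<phi> G\<phi> \<Longrightarrow> has_trace \<phi> t\<phi> \<Longrightarrow>
    (LINT z|lebesgue_on half_space. Gv z \<bullet> G\<phi> z + m\<^sup>2 * v z * \<phi> z) = (LINT y|lebesgue. f (tv y) * t\<phi> y)"
  using w unfolding weak_solution_def H1_def by blast
 obtain G \<phi> where G: "H1_gradient half_space v G" and \<phi>: "\<And>k::nat. test_function UNIV (\<phi> k)"
  and lim: "(\<lambda>k. LINT z|lebesgue_on half_space. h1_error v G (\<phi> k) z) \<longlonglongrightarrow> 0"
  and lim0: "(\<lambda>k. LINT y|lebesgue. (tv y - \<phi> k (0, y))\<^sup>2) \<longlonglongrightarrow> 0" and sqt: "square_integrable_on UNIV tv"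
  using tr unfolding has_trace_def h1_error_def by blast
 have mv: "v \<in> borel_measurable (lebesgue_on half_space)" "Gv \<in> borel_measurable (lebesgue_on half_space)" "G \<in> borel_measurable (lebesgue_on half_space)"
  "tv \<in> borel_measurable (lebesgue_on UNIV)"
  using Gv G sqt by (auto simp: H1_gradient_def square_integrable_on_def)
 obtain v0 where v0: "v0 \<in> Borel" "AE z in lebesgue_on half_space. v z = v0 z"
  using borel_representative[OF half_space_borel mv(1)] by blast
 obtain G0 where G0: "G0 \<in> Borel" "AE z in lebesgue_on half_space. Gv z = G0 z"
  using borel_representative[OF half_space_borel mv(2)] by blast
 obtain G1 where G1: "G1 \<in> Borel" "AE z in lebesgue_on half_space. G z = G1 z"
  using borel_representative[OF half_space_borel mv(3)] by blast
 obtain u where u: "u \<in> Borel" "AE y in lebesgue_on UNIV. tv y = u y"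
  using borel_representative[OF _ mv(4)] by auto
 have H0: "H1_gradient half_space v0 G0" by (rule H1_gradient_cong[OF Gv v0(2,1) G0(2,1)])
 have H1: "H1_gradient half_space v0 G1" by (rule H1_gradient_cong[OF G v0(2,1) G1(2,1)])
 have GG: "AE z in lebesgue_on half_space. G0 z = G1 z"
  unfolding AE_lebesgue_on[OF half_space_borel] by (rule weak_gradient_unique[OF H0 H1 G0(1) G1(1)])
 have u2: "AE y in lebesgue. tv y = u y" and mt: "tv \<in> borel_measurable lebesgue"
  using u(2) mv(4) unfolding lebesgue_on_UNIV_eq by blast+
 have sl: "(\<lambda>y::real^'n. (0::real, y)) \<in> Borel"
  by (intro borel_measurable_continuous_onI continuous_intros)
 note [measurable] = v0(1) G0(1) u(1) mv(1,2,3) mt sl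
 have fm[measurable]: "f \<in> Borel" using f by (rule borel_measurable_continuous_onI)
 have lm: "g \<in> Borel \<Longrightarrow> g \<in> borel_measurable (lebesgue_on half_space)" for g :: "real \<times> (real^'n) \<Rightarrow> 'b::euclidean_space"
  by (rule borel_measurable_lebesgue_on)
 have [measurable]: "\<phi> k \<in> Borel" "gradient (\<phi> k) \<in> Borel" for k
  using \<phi> test_function_measurable test_function_gradient_measurable by blast+
 note [measurable] = lm[OF v0(1)] lm[OF G0(1)]
 have [measurable]: "\<phi> k \<in> borel_measurable (lebesgue_on half_space)" "gradient (\<phi> k) \<in> borel_measurable (lebesgue_on half_space)" for k
  by (auto intro!: borel_measurable_lebesgue_on)
 have sq: "L1 (\<lambda>z. indicator half_space z * (norm (v0 z))\<^sup>2)" "L1 (\<lambda>z. indicator half_space z * (norm (G0 z))\<^sup>2)"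
  using H0 by (auto simp: H1_gradient_def square_integrable_on_borel)
 have squ: "L1 (\<lambda>y. (u y)\<^sup>2)"
 proof -
  have "square_integrable_on UNIV u" using sqt u(2,1) by (rule square_integrable_on_cong)
  then show ?thesis by (simp add: square_integrable_on_borel)
 qed
 have L: "(LINT z|lebesgue_on half_space. h1_error v G (\<phi> k) z) =
   (\<integral>z. indicator half_space z * h1_error v0 G0 (\<phi> k) z)" for k
 proof -
  have "(LINT z|lebesgue_on half_space. h1_error v G (\<phi> k) z) =
   (LINT z|lebesgue_on half_space. h1_error v0 G0 (\<phi> k) z)"
  proof (rule integral_cong_AE)
   show "AE z in lebesgue_on half_space. h1_error v G (\<phi> k) z = h1_error v0 G0 (\<phi> k) z"
    using v0(2) G1(2) GG by eventually_elim (simp add: h1_error_def)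
  qed (unfold h1_error_def, measurable)
  then show ?thesis by (subst (asm) (2) integral_lebesgue_on) (auto simp: h1_error_def[abs_def])
 qed
 have L0: "(LINT y|lebesgue. (tv y - \<phi> k (0, y))\<^sup>2) = (\<integral>y. (u y - \<phi> k (0, y))\<^sup>2)" for k
 proof -
  have m: "(\<lambda>y. (u y - \<phi> k (0, y))\<^sup>2) \<in> borel_measurable lborel" by measurable
  have m2: "(\<lambda>y. \<phi> k (0, y)) \<in> borel_measurable lebesgue" by (rule measurable_completion) measurable
  have "(LINT y|lebesgue. (tv y - \<phi> k (0, y))\<^sup>2) = (LINT y|lebesgue. (u y - \<phi> k (0, y))\<^sup>2)"
  proof (rule integral_cong_AE)
   show "(\<lambda>y. (tv y - \<phi> k (0, y))\<^sup>2) \<in> borel_measurable lebesgue" using mt m2 by measurable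
   show "(\<lambda>y. (u y - \<phi> k (0, y))\<^sup>2) \<in> borel_measurable lebesgue" using m by (rule measurable_completion)
  qed (use u2 in eventually_elim, simp)
  then show ?thesis using integral_completion[OF m] by simp
 qed
 have W: "(\<integral>z. indicator half_space z * (G0 z \<bullet> gradient w z + m\<^sup>2 * v0 z * w z)) = (\<integral>y. f (u y) * w (0, y))"
  if H: "H1_gradient half_space w (gradient w)" "has_trace w (\<lambda>y. w (0, y))" and [measurable]: "w \<in> Borel" "gradient w \<in> Borel" for w
 proof -
  have [measurable]: "w \<in> borel_measurable (lebesgue_on half_space)" "gradient w \<in> borel_measurable (lebesgue_on half_space)"
   using that by (auto intro!: borel_measurable_lebesgue_on)
  let ?X = "\<lambda>z. G0 z \<bullet> gradient w z + m\<^sup>2 * v0 z * w z" and ?Y = "\<lambda>z. Gv z \<bullet> gradient w z + m\<^sup>2 * v z * w z" and ?W = "\<lambda>y. f (u y) * w (0, y)"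
  have "(LINT z|lebesgue_on half_space. ?Y z) = (LINT z|lebesgue_on half_space. ?X z)"
  proof (rule integral_cong_AE)
   show "AE z in lebesgue_on half_space. ?Y z = ?X z"
    using v0(2) G0(2) by eventually_elim simp
  qed measurable
  also have "\<dots> = (\<integral>z. indicator half_space z * (?X z))"
   by (rule integral_lebesgue_on) auto
  finally have 1: "(\<integral>z. indicator half_space z * (?X z)) = (LINT y|lebesgue. f (tv y) * w (0, y))"
   using weak[OF H] by simp
  have m: "?W \<in> borel_measurable lborel" by measurable
  have m2: "(\<lambda>y. w (0, y)) \<in> borel_measurable lebesgue" by (rule measurable_completion) measurable
  have "(LINT y|lebesgue. f (tv y) * w (0, y)) = (LINT y|lebesgue. ?W y)"
  proof (rule integral_cong_AE)
   have "(\<lambda>y. f (tv y)) \<in> borel_measurable lebesgue" using measurable_compose[OF mt fm] .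
   then show "(\<lambda>y. f (tv y) * w (0, y)) \<in> borel_measurable lebesgue" using m2 by (rule borel_measurable_times)
   show "?W \<in> borel_measurable lebesgue" using m by (rule measurable_completion)
  qed (use u2 in eventually_elim, simp)
  then show ?thesis using integral_completion[OF m] 1 by simp
 qed
 show ?thesis
  using v0 G0(1) u(1) sq squ \<phi> lim[unfolded L] lim0[unfolded L0] W
  by (intro that[of v0 G0 u \<phi>]) (simp_all add: H1_approx_def)
qed

lemma bessel_conv_H1_trace:
 fixes g :: "real \<times> (real^'n) \<Rightarrow> real"
 assumes q: "q > 0" and g: "test_function UNIV g"
 defines "w \<equiv> bessel_conv q g"
 shows "H1_gradient half_space w (gradient w)" "has_trace w (\<lambda>y. w (0, y))"
proof -
 have gm[measurable]: "g \<in> Borel" using g by (rule test_function_measurable)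
 obtain B R where B: "\<And>z. \<bar>g z\<bar> \<le> B" by (rule test_function_bounded[OF g], rule that)
 note tg = test_function_gradient_inner[OF g]
 have "\<exists>B. \<forall>z. \<bar>gradient g z \<bullet> b\<bar> \<le> B" for b using test_function_bounded[OF tg[of b]] by metis
 then obtain Bb where Bb: "\<And>b z. \<bar>gradient g z \<bullet> b\<bar> \<le> Bb b" by metis
 define M where "M = Max (insert B (Bb ` Basis))"
 have M: "\<bar>g z\<bar> \<le> M" "b \<in> Basis \<Longrightarrow> \<bar>gradient g z \<bullet> b\<bar> \<le> M" for z b
 proof -
  have "B \<le> M" by (simp add: M_def)
  then show "\<bar>g z\<bar> \<le> M" using B[of z] by simp
  assume "b \<in> Basis"
  then have "Bb b \<le> M" unfolding M_def by (intro Max_ge) auto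
  then show "\<bar>gradient g z \<bullet> b\<bar> \<le> M" using Bb[of z b] by simp
 qed
 define I where "I = (\<integral>\<zeta>. bessel q (\<zeta>::real \<times> (real^'n)))"
 note gr = bessel_conv_gradient[OF q g]
 have c1: "Ck_on k w UNIV" for k unfolding w_def by (rule Ck_on_bessel_conv[OF q g])
 have c2: "\<bar>w z\<bar> \<le> M * I" for z unfolding w_def I_def by (rule bessel_conv_bounded[OF q gm M(1)])
 have c3: "\<bar>gradient w z \<bullet> b\<bar> \<le> M * I" if "b \<in> Basis" for z b
  unfolding w_def gr I_def by (rule bessel_conv_bounded[OF q test_function_measurable[OF tg] M(2)[OF that]])
 have c4: "L1 w" unfolding w_def by (rule bessel_conv_integrable[OF q g])
 have c5: "L1 (\<lambda>z. gradient w z \<bullet> b)" for b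
  unfolding w_def gr using bessel_conv_integrable[OF q tg] by simp
 have c6: "L1 (\<lambda>y. w (0, y))" unfolding w_def by (rule bessel_conv_slice_integrable[OF q g])
 show "H1_gradient half_space w (gradient w)" "has_trace w (\<lambda>y. w (0, y))"
  by (rule smooth_H1_trace[OF c1 c2 c3 c4 c5 c6]; assumption)+
qed

lemma test_function_energy_integrable:
 assumes \<phi>: "test_function UNIV (\<phi> :: real \<times> (real^'n) \<Rightarrow> real)"
 shows "L1 (\<lambda>z. indicator half_space z * (norm (\<phi> z))\<^sup>2)" "L1 (\<lambda>z. indicator half_space z * (norm (gradient \<phi> z))\<^sup>2)"
proof -
 show "L1 (\<lambda>z. indicator half_space z * (norm (\<phi> z))\<^sup>2)"
  using test_function_square_integrable[OF \<phi>] by (intro integrable_indicator_mult) auto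
 have "(norm (gradient \<phi> z))\<^sup>2 = (\<Sum>b\<in>Basis. (gradient \<phi> z \<bullet> b)\<^sup>2)" for z
  unfolding power2_norm_eq_inner by (subst euclidean_inner) (simp add: power2_eq_square)
 then show "L1 (\<lambda>z. indicator half_space z * (norm (gradient \<phi> z))\<^sup>2)"
  by (simp only:) (intro integrable_indicator_mult Bochner_Integration.integrable_sum test_function_square_integrable[OF test_function_gradient_inner[OF \<phi>]] half_space_borel finite_Basis)
qed

lemma approx_error_integrable:
 assumes a: "H1_approx v0 G0 u \<phi>"
 shows "L1 (\<lambda>z. indicator half_space z * h1_error v0 G0 (\<phi> k) z)"
proof -
 let ?I = "indicator half_space :: real \<times> (real^'n) \<Rightarrow> real"
 note [measurable] = H1_approxD(1,2,10,11)[OF a]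
 let ?g = "\<lambda>z. 2 * (?I z * (v0 z)\<^sup>2 + ?I z * (norm (G0 z))\<^sup>2) + 2 * (?I z * (norm (\<phi> k z))\<^sup>2 + ?I z * (norm (gradient (\<phi> k) z))\<^sup>2)"
 show ?thesis
 proof (rule integrable_bound_pointwise)
  show "L1 ?g"
   using H1_approxD(4,5)[OF a] test_function_energy_integrable[OF H1_approxD(7)[OF a]]
   by (intro Bochner_Integration.integrable_add integrable_mult_right) auto
  show "norm (?I z * h1_error v0 G0 (\<phi> k) z) \<le> ?g z" for z
   using norm_diff_square_le[of "v0 z" "\<phi> k z"] norm_diff_square_le[of "G0 z" "gradient (\<phi> k) z"]
   by (auto simp: h1_error_def indicator_def)
 qed (unfold h1_error_def, measurable)
qed

text \<open>For smooth functions in place of \<open>v0\<close> this is \<open>bessel_conv_weak_identity\<close>. Both sides are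
 continuous in the \<open>H\<^sup>1\<close> norm, as Young's inequality with a small parameter shows, so the identity
 passes to the limit of the approximating test functions.\<close>

lemma weak_limit_identity:
 fixes v0 :: "real \<times> (real^'n) \<Rightarrow> real"
 assumes q: "q > 0" and \<psi>: "test_function half_space \<psi>"
  and a: "H1_approx v0 G0 u \<phi>"
 defines "w \<equiv> bessel_conv q (even_ext \<psi>)"
 shows "(\<integral>z. indicator half_space z * (G0 z \<bullet> gradient w z + 4 * q * v0 z * w z)) = (\<integral>z. indicator half_space z * (v0 z * \<psi> z))"
proof -
 note e = even_ext_test[OF \<psi>]
 note \<phi> = H1_approxD(7)[OF a] and sq = H1_approxD(4,5)[OF a] and lim = H1_approxD(8)[OF a] and [measurable] = H1_approxD(1,2,10,11)[OF a]
 have Hw: "H1_gradient half_space w (gradient w)" unfolding w_def by (rule bessel_conv_H1_trace[OF q e])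
 have Cw: "Ck_on k w UNIV" for k unfolding w_def by (rule Ck_on_bessel_conv[OF q e])
 have wm[measurable]: "w \<in> Borel" using Cw[of 0] by (simp add: borel_measurable_continuous_onI)
 have gwm[measurable]: "gradient w \<in> Borel" unfolding gradient_def[abs_def]
  using Cw[of 1] by (intro borel_measurable_continuous_onI continuous_intros) auto
 have pm[measurable]: "\<psi> \<in> Borel" using \<psi> by (rule test_function_measurable)
 let ?I = "indicator half_space :: real \<times> (real^'n) \<Rightarrow> real"
 define r where "r z = 4 * q * w z - \<psi> z" for z
 have rm[measurable]: "r \<in> Borel" unfolding r_def[abs_def] by measurable
 have sw: "L1 (\<lambda>z. ?I z * (norm (w z))\<^sup>2)" "L1 (\<lambda>z. ?I z * (norm (gradient w z))\<^sup>2)"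
  using Hw by (auto simp: H1_gradient_def square_integrable_on_borel)
 have sp: "L1 (\<lambda>z. ?I z * (norm (\<psi> z))\<^sup>2)"
  using test_function_square_integrable[OF \<psi>] by (intro integrable_indicator_mult) auto
 have sv: "L1 (\<lambda>z. ?I z * (norm (v0 z))\<^sup>2)" using sq(1) by simp
 note sf = test_function_energy_integrable[OF \<phi>]
 note ii = integrable_inner_squares[OF half_space_borel]
 have i1: "L1 (\<lambda>z. ?I z * (G0 z \<bullet> gradient w z))" by (rule ii) (use sq sw in auto)
 have i2: "L1 (\<lambda>z. ?I z * (v0 z * w z))" using ii[of v0 w] sv sw by simp
 have i3: "L1 (\<lambda>z. ?I z * (v0 z * \<psi> z))" using ii[of v0 \<psi>] sv sp by simp
 have j1: "L1 (\<lambda>z. ?I z * (gradient (\<phi> k) z \<bullet> gradient w z))" for k by (rule ii) (use sf sw in auto)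
 have j2: "L1 (\<lambda>z. ?I z * (\<phi> k z * w z))" for k using ii[of "\<phi> k" w] sf[of k] sw by simp
 have j3: "L1 (\<lambda>z. ?I z * (\<phi> k z * \<psi> z))" for k using ii[of "\<phi> k" \<psi>] sf[of k] sp by simp
 let ?R = "\<lambda>z. ?I z * ((norm (gradient w z))\<^sup>2 + (r z)\<^sup>2)"
 have ir: "L1 ?R"
 proof (rule integrable_bound_pointwise)
  show "L1 (\<lambda>z. ?I z * (norm (gradient w z))\<^sup>2 + (2 * ((4 * q)\<^sup>2 * (?I z * (norm (w z))\<^sup>2)) + 2 * (?I z * (norm (\<psi> z))\<^sup>2)))"
   using sw sp by (intro Bochner_Integration.integrable_add integrable_mult_right)
  show "norm (?R z) \<le> ?I z * (norm (gradient w z))\<^sup>2 + (2 * ((4 * q)\<^sup>2 * (?I z * (norm (w z))\<^sup>2)) + 2 * (?I z * (norm (\<psi> z))\<^sup>2))" for z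
   using norm_diff_square_le[of "4 * q * w z" "\<psi> z"] by (auto simp: r_def indicator_def power_mult_distrib)
 qed measurable
 let ?E = "\<lambda>k z. ?I z * h1_error v0 G0 (\<phi> k) z"
 define d where "d k = (\<integral>z. ?E k z)" for k
 have id: "L1 (\<lambda>z. ?E k z)" for k
  by (rule approx_error_integrable[OF a])
 define X where "X = (\<integral>z. ?I z * (G0 z \<bullet> gradient w z + 4 * q * v0 z * w z)) - (\<integral>z. ?I z * (v0 z * \<psi> z))"
 define W where "W = (\<integral>z. ?R z)"
 have "X = 0"
 proof (rule zero_if_le_eps[where d=d and W=W])
  show "d \<longlonglongrightarrow> 0" using lim by (simp add: d_def[abs_def])
  fix k and ep :: real assume ep: "ep > 0"
  define F where "F z = ?I z * ((G0 z - gradient (\<phi> k) z) \<bullet> gradient w z + (v0 z - \<phi> k z) * r z)" for z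
  have s1: "?I z * (G0 z \<bullet> gradient w z + 4 * q * v0 z * w z) = ?I z * (G0 z \<bullet> gradient w z) + 4 * q * (?I z * (v0 z * w z))"
    "?I z * (gradient (\<phi> k) z \<bullet> gradient w z + 4 * q * \<phi> k z * w z) = ?I z * (gradient (\<phi> k) z \<bullet> gradient w z) + 4 * q * (?I z * (\<phi> k z * w z))" for z
   by (auto simp: algebra_simps)
  have Feq: "F = (\<lambda>z. (?I z * (G0 z \<bullet> gradient w z) + 4 * q * (?I z * (v0 z * w z)) - ?I z * (v0 z * \<psi> z)) - (?I z * (gradient (\<phi> k) z \<bullet> gradient w z) + 4 * q * (?I z * (\<phi> k z * w z)) - ?I z * (\<phi> k z * \<psi> z)))"
   by (auto simp: F_def fun_eq_iff r_def inner_diff_left algebra_simps)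
  have iF: "L1 F" unfolding Feq using i1 i2 i3 j1 j2 j3 by simp
  have "(\<integral>z. F z) = X"
   using bessel_conv_weak_identity[OF q \<psi> \<phi>[of k]] i1 i2 i3 j1[of k] j2[of k] j3[of k]
   unfolding Feq X_def s1 w_def[symmetric] by simp
  then have "\<bar>X\<bar> \<le> (\<integral>z. norm (F z))" using integral_norm_bound[of lborel F] by simp
  also have "\<dots> \<le> (\<integral>z. 1 / ep * (?E k z) + ep * ?R z)"
  proof (rule integral_mono)
   show "L1 (\<lambda>z. norm (F z))" using iF by simp
   show "L1 (\<lambda>z. 1 / ep * (?E k z) + ep * ?R z)"
    using id ir by (intro Bochner_Integration.integrable_add integrable_mult_right)
   fix z :: "real \<times> (real^'n)"
   have young: "a * b \<le> 1 / ep * a\<^sup>2 + ep * b\<^sup>2" if "a \<ge> 0" "b \<ge> 0" for a b :: real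
   proof -
    have "2 * (a / sqrt ep) * (sqrt ep * b) \<le> (a / sqrt ep)\<^sup>2 + (sqrt ep * b)\<^sup>2" by (rule sum_squares_bound)
    moreover have "2 * (a / sqrt ep) * (sqrt ep * b) = 2 * (a * b)" using ep by simp
    moreover have "(a / sqrt ep)\<^sup>2 + (sqrt ep * b)\<^sup>2 = 1 / ep * a\<^sup>2 + ep * b\<^sup>2" using ep by (simp add: power_divide power_mult_distrib)
    moreover have "0 \<le> a * b" using that by simp
    ultimately show ?thesis by linarith
   qed
   have "\<bar>(G0 z - gradient (\<phi> k) z) \<bullet> gradient w z + (v0 z - \<phi> k z) * r z\<bar> \<le> norm (G0 z - gradient (\<phi> k) z) * norm (gradient w z) + \<bar>v0 z - \<phi> k z\<bar> * \<bar>r z\<bar>"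
    using Cauchy_Schwarz_ineq2[of "G0 z - gradient (\<phi> k) z" "gradient w z"] abs_triangle_ineq[of "(G0 z - gradient (\<phi> k) z) \<bullet> gradient w z" "(v0 z - \<phi> k z) * r z"]
    by (simp add: abs_mult)
   also have "\<dots> \<le> (1 / ep * (norm (G0 z - gradient (\<phi> k) z))\<^sup>2 + ep * (norm (gradient w z))\<^sup>2) + (1 / ep * \<bar>v0 z - \<phi> k z\<bar>\<^sup>2 + ep * \<bar>r z\<bar>\<^sup>2)"
    by (intro add_mono young) auto
   finally show "norm (F z) \<le> 1 / ep * (?E k z) + ep * ?R z"
    by (auto simp: F_def h1_error_def indicator_def algebra_simps)
  qed
  also have "\<dots> = d k / ep + ep * W"
   using id ir by (simp add: d_def W_def)
  finally show "\<bar>X\<bar> \<le> d k / ep + ep * W" .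
 qed
 then show ?thesis by (simp add: X_def)
qed


section \<open>The single layer representation\<close>

definition layer :: "(real \<times> (real^'n) \<Rightarrow> real) \<Rightarrow> (real^'n \<Rightarrow> real) \<Rightarrow> real \<times> (real^'n) \<Rightarrow> real" where
 "layer \<kappa> h z = (\<integral>y. \<kappa> (z - (0, y)) * h y)"

lemma slice_borel [measurable]: "(\<lambda>y::real^'n. (x::real, y)) \<in> Borel"
 by (intro borel_measurable_continuous_onI continuous_intros)

lemma layer_arg_borel [measurable]: "(\<lambda>(z, y). z - (0::real, y::real^'n)) \<in> borel_measurable (borel \<Otimes>\<^sub>M borel)"
 "(\<lambda>y::real^'n. z - (0::real, y)) \<in> Borel"
 by measurable

lemma layer_measurable [measurable]:
 assumes [measurable]: "\<kappa> \<in> Borel" "h \<in> Borel"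
 shows "layer \<kappa> h \<in> Borel"
proof -
 have "(\<lambda>(z, y). \<kappa> (z - (0, y)) * h y) \<in> borel_measurable (borel \<Otimes>\<^sub>M borel)" by measurable
 then have [measurable]: "(\<lambda>(z, y). \<kappa> (z - (0, y)) * h y) \<in> borel_measurable (borel \<Otimes>\<^sub>M lborel)"
  by (simp cong: measurable_cong_sets sets_pair_measure_cong)
 show ?thesis unfolding layer_def[abs_def] by measurable
qed

lemma norm_half: "(norm (z - (0, y)))\<^sup>2 = (fst z)\<^sup>2 + (norm (snd z - y))\<^sup>2"
 by (cases z) (simp add: norm_Pair)

lemma bessel_half:
 fixes z :: "real \<times> (real^'n)"
 shows "bessel q (z - (0, y)) = theta q (real CARD('n)) ((fst z)\<^sup>2 + (norm (snd z - y))\<^sup>2) / (2 * pi powr ((1 + real CARD('n)) / 2))"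
 unfolding bessel_def norm_half by simp

text \<open>The mass of the kernel on the hyperplane through its singularity, which is the largest one
 over parallel hyperplanes; it is finite because the singularity on the hyperplane is of order one
 less than its dimension.\<close>

definition slice_mass :: "'n::finite itself \<Rightarrow> real \<Rightarrow> real" where
 "slice_mass _ q = theta q 0 0 * pi powr (real CARD('n) / 2) / (2 * pi powr ((1 + real CARD('n)) / 2))"

lemma bessel_slice_nn:
 fixes z :: "real \<times> (real^'n)"
 assumes q: "q > 0"
 shows "(\<integral>\<^sub>+y. bessel q (z - (0, y))) \<le> ennreal (slice_mass TYPE('n) q)"
proof -
 let ?c = "1 / (2 * pi powr ((1 + real CARD('n)) / 2))"
 have "(\<integral>\<^sub>+y. bessel q (z - (0, y))) = (\<integral>\<^sup>+y. ennreal ?c * ennreal (theta q (real CARD('n)) ((fst z)\<^sup>2 + (norm (snd z - y))\<^sup>2)))"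
  unfolding bessel_half by (simp add: ennreal_mult[symmetric] theta_nonneg)
 also have "\<dots> = ennreal ?c * (\<integral>\<^sub>+y. theta q (real CARD('n)) ((fst z)\<^sup>2 + (norm (snd z - y))\<^sup>2))"
  by (rule nn_integral_cmult) measurable
 finally have 1: "(\<integral>\<^sub>+y. bessel q (z - (0, y))) = ennreal ?c * (\<integral>\<^sub>+y. theta q (real CARD('n)) ((fst z)\<^sup>2 + (norm (snd z - y))\<^sup>2))" .
 have "(\<integral>\<^sub>+y. theta q (real CARD('n)) ((fst z)\<^sup>2 + (norm (snd z - y))\<^sup>2)) =
   (\<integral>\<^sub>+y. theta q (real CARD('n)) ((fst z)\<^sup>2 + 1 * (norm (y::real^'n))\<^sup>2))"
  using nn_integral_lborel_reflect[of "\<lambda>y. ennreal (theta q (real CARD('n)) ((fst z)\<^sup>2 + (norm y)\<^sup>2))" "snd z"] by simp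
 also have "\<dots> = ennreal ((pi / 1) powr (DIM(real^'n) / 2) * theta q (real CARD('n) - DIM(real^'n)) ((fst z)\<^sup>2))"
  using q by (intro theta_slice_nn) auto
 also have "\<dots> \<le> ennreal (pi powr (real CARD('n) / 2) * theta q 0 0)"
  using theta_mono[of q 0 0 "(fst z)\<^sup>2"] q by (intro ennreal_leI) (auto intro!: mult_left_mono)
 finally have "ennreal ?c * (\<integral>\<^sub>+y. theta q (real CARD('n)) ((fst z)\<^sup>2 + (norm (snd z - y))\<^sup>2))
   \<le> ennreal ?c * ennreal (pi powr (real CARD('n) / 2) * theta q 0 0)" by (rule mult_left_mono) simp
 also have "\<dots> = ennreal (slice_mass TYPE('n) q)"
  by (simp add: slice_mass_def ennreal_mult[symmetric] theta_nonneg mult.commute)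
 finally show ?thesis unfolding 1 .
qed

text \<open>The hypothesis splits the density into a bounded and an integrable part. For the bounded part
 the mass of the kernel on hyperplanes is used together with the integrability of \<open>F\<close>, for the
 integrable part the mass of the kernel on the whole space together with the boundedness of \<open>F\<close>.\<close>

lemma layer_nn_finite:
 fixes F :: "real \<times> (real^'n) \<Rightarrow> real"
 assumes q: "q > 0" and [measurable]: "F \<in> Borel" "h \<in> Borel" "k \<in> Borel"
  and B: "\<And>z. \<bar>F z\<bar> \<le> B" and iF: "L1 F"
  and h: "\<And>y. \<bar>h y\<bar> \<le> C + k y" and k: "\<And>y. 0 \<le> k y" "L1 k" and C: "C \<ge> 0"
 shows "(\<integral>\<^sup>+z. \<integral>\<^sup>+y. ennreal \<bar>F z\<bar> * ennreal (bessel q (z - (0, y))) * ennreal \<bar>h y\<bar> \<partial>lborel) < \<infinity>"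
proof -
 let ?b = "\<lambda>(z::real \<times> (real^'n)) y. ennreal (bessel q (z - (0, y)))"
 let ?f = "\<lambda>z. ennreal \<bar>F z\<bar>" and ?m = "\<integral>\<^sub>+z. bessel q (z::real \<times> (real^'n))"
 have [measurable]: "(\<lambda>(z, y). ?b z y) \<in> borel_measurable (borel \<Otimes>\<^sub>M borel)" by measurable
 have B0: "B \<ge> 0" using B[of 0] by linarith
 have "(\<integral>\<^sup>+z. \<integral>\<^sup>+y. ?f z * ?b z y * ennreal \<bar>h y\<bar> \<partial>lborel)
   \<le> (\<integral>\<^sup>+z. \<integral>\<^sup>+y. ?f z * (?b z y * ennreal C) + ?f z * ?b z y * ennreal (k y) \<partial>lborel)"
 proof (intro nn_integral_mono)
  fix z y
  have "ennreal \<bar>h y\<bar> \<le> ennreal C + ennreal (k y)" using h[of y] C k(1)[of y] by (simp add: ennreal_leI flip: ennreal_plus)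
  then have "?f z * ?b z y * ennreal \<bar>h y\<bar> \<le> ?f z * ?b z y * (ennreal C + ennreal (k y))" by (rule mult_left_mono) simp
  then show "?f z * ?b z y * ennreal \<bar>h y\<bar> \<le> ?f z * (?b z y * ennreal C) + ?f z * ?b z y * ennreal (k y)"
   by (simp add: distrib_left mult.assoc)
 qed
 also have "\<dots> = (\<integral>\<^sup>+z. (\<integral>\<^sup>+y. ?f z * (?b z y * ennreal C))) + (\<integral>\<^sup>+z. (\<integral>\<^sup>+y. ?f z * ?b z y * ennreal (k y)))"
  by (simp add: nn_integral_add)
 also have "\<dots> \<le> (\<integral>\<^sup>+z. ?f z * (ennreal (slice_mass TYPE('n) q) * ennreal C)) + (\<integral>\<^sup>+y. ennreal B * ?m * ennreal (k y))"
 proof (intro add_mono)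
  show "(\<integral>\<^sup>+z. (\<integral>\<^sup>+y. ?f z * (?b z y * ennreal C))) \<le> (\<integral>\<^sup>+z. ?f z * (ennreal (slice_mass TYPE('n) q) * ennreal C))"
   by (intro nn_integral_mono) (auto simp: nn_integral_cmult nn_integral_multc intro!: mult_left_mono mult_right_mono bessel_slice_nn[OF q])
  have "(\<integral>\<^sup>+z. (\<integral>\<^sup>+y. ?f z * ?b z y * ennreal (k y))) = (\<integral>\<^sup>+y. (\<integral>\<^sup>+z. ?f z * ?b z y * ennreal (k y)))"
   by (rule lborel_pair.Fubini'[symmetric]) measurable
  also have "\<dots> \<le> (\<integral>\<^sup>+y. ennreal B * ?m * ennreal (k y))"
  proof (rule nn_integral_mono)
   fix y :: "real^'n"
   have "(\<integral>\<^sup>+z. ?f z * ?b z y * ennreal (k y)) \<le> (\<integral>\<^sup>+z. ennreal B * ?b z y * ennreal (k y))"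
    using B by (intro nn_integral_mono mult_right_mono ennreal_leI) auto
   also have "\<dots> = ennreal B * (\<integral>\<^sup>+z. ?b z y) * ennreal (k y)" by (simp add: nn_integral_cmult nn_integral_multc)
   also have "(\<integral>\<^sup>+z. ?b z y) = ?m"
    using nn_integral_lborel_translate[of "\<lambda>z. ennreal (bessel q (z::real \<times> (real^'n)))" "- (0, y)"]
    by (simp only: diff_conv_add_uminus[symmetric]) measurable
   finally show "(\<integral>\<^sup>+z. ?f z * ?b z y * ennreal (k y)) \<le> ennreal B * ?m * ennreal (k y)" .
  qed
  finally show "(\<integral>\<^sup>+z. (\<integral>\<^sup>+y. ?f z * ?b z y * ennreal (k y))) \<le> (\<integral>\<^sup>+y. ennreal B * ?m * ennreal (k y))" .
 qed
 also have "\<dots> < \<infinity>"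
  using bessel_integrable[OF q, where 'a="real \<times> (real^'n)"] iF k
  by (auto simp: nn_integral_multc nn_integral_cmult ennreal_mult_less_top integrable_iff_bounded bessel_nonneg)
 finally show ?thesis .
qed

text \<open>On the boundary the convolution of the kernel with the even reflection of \<open>\<psi>\<close> is twice the
 convolution with \<open>\<psi>\<close> itself, as points of the boundary are fixed by the reflection. Fubini moves
 the kernel to the density, and the fundamental lemma identifies \<open>v0\<close>.\<close>

theorem single_layer_representation:
 fixes v0 :: "real \<times> (real^'n) \<Rightarrow> real"
 assumes q: "q > 0" and [measurable]: "v0 \<in> Borel" "h \<in> Borel" "k \<in> Borel"
  and sq: "L1 (\<lambda>z. indicator half_space z * (v0 z)\<^sup>2)"
  and h: "\<And>y. \<bar>h y\<bar> \<le> C + k y" and k: "\<And>y. 0 \<le> k y" "L1 k" and C: "C \<ge> 0"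
  and test: "\<And>\<psi>. test_function half_space \<psi> \<Longrightarrow>
    (\<integral>z. indicator half_space z * (v0 z * \<psi> z)) = (\<integral>y. h y * bessel_conv q (even_ext \<psi>) (0, y))"
 shows "AE z in lborel. z \<in> half_space \<longrightarrow> v0 z = 2 * layer (bessel q) h z"
proof -
 have km: "(\<lambda>(z, y). bessel q (z - (0::real, y::real^'n)) * h y) \<in> borel_measurable (lborel \<Otimes>\<^sub>M lborel)" by measurable
 let ?b = "\<lambda>(z::real \<times> (real^'n)) y. bessel q (z - (0, y)) * h y" and ?L = "layer (bessel q) h"
 have int: "integrable (lborel \<Otimes>\<^sub>M lborel) (\<lambda>(z, y). F z * ?b z y)"
  if [measurable]: "F \<in> Borel" and F: "\<And>z. \<bar>F z\<bar> \<le> B" "L1 F" for F :: "real \<times> (real^'n) \<Rightarrow> real" and B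
 proof (rule integrableI_bounded)
  show m: "(\<lambda>(z, y). F z * ?b z y) \<in> borel_measurable (lborel \<Otimes>\<^sub>M lborel)" by measurable
  have "(\<integral>\<^sup>+x. ennreal (norm (case x of (z, y) \<Rightarrow> F z * ?b z y)) \<partial>(lborel \<Otimes>\<^sub>M lborel)) =
   (\<integral>\<^sup>+z. \<integral>\<^sup>+y. ennreal (norm (F z * ?b z y)) \<partial>lborel)"
   using m by (subst lborel.nn_integral_fst[symmetric]) auto
  also have "\<dots> = (\<integral>\<^sup>+z. \<integral>\<^sup>+y. ennreal \<bar>F z\<bar> * ennreal (bessel q (z - (0, y))) * ennreal \<bar>h y\<bar> \<partial>lborel)"
   by (simp add: abs_mult ennreal_mult bessel_nonneg mult.assoc)
  also have "\<dots> < \<infinity>" by (rule layer_nn_finite[OF q _ _ _ F h k C]) measurable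
  finally show "(\<integral>\<^sup>+x. ennreal (norm (case x of (z, y) \<Rightarrow> F z * ?b z y)) \<partial>(lborel \<Otimes>\<^sub>M lborel)) < \<infinity>" .
 qed
 have intz: "L1 (\<lambda>z. F z * ?L z)"
  if "F \<in> Borel" "\<And>z. \<bar>F z\<bar> \<le> B" "L1 F" for F :: "real \<times> (real^'n) \<Rightarrow> real" and B
  using lborel_pair.integrable_fst[OF int[OF that]] by (simp add: layer_def)
 have "AE z in lborel. z \<in> half_space \<longrightarrow> v0 z - 2 * ?L z = 0"
 proof (rule fundamental_lemma[OF open_half_space])
  show "(\<lambda>z. v0 z - 2 * ?L z) \<in> Borel" by measurable
  show "L1 (\<lambda>z. indicator (cbox a b) z * (v0 z - 2 * ?L z))" if ab: "cbox a b \<subseteq> half_space" for a b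
  proof -
   note i = integrable_indicator_cbox[of a b]
   have i2: "(indicator (cbox a b) z :: real)\<^sup>2 = indicator (cbox a b) z" for z by (simp add: indicator_def)
   have s: "L1 (\<lambda>z. (indicator half_space z * v0 z)\<^sup>2)"
    using sq by (rule Bochner_Integration.integrable_cong[THEN iffD1, rotated -1]) (auto simp: indicator_def)
   let ?d = "\<lambda>z. indicator (cbox a b) z * (indicator half_space z * v0 z) - 2 * (indicator (cbox a b) z * ?L z)"
   have 1: "L1 (\<lambda>z. indicator (cbox a b) z * (indicator half_space z * v0 z))"
    by (rule integrable_mult_squares) (use s i in \<open>simp_all only: i2, auto\<close>)
   have 2: "L1 (\<lambda>z. indicator (cbox a b) z * ?L z)"
    by (rule intz[where B=1]) (use i in auto)
   have "L1 ?d"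
    using 1 2 by (intro Bochner_Integration.integrable_diff integrable_mult_right)
   moreover have "?d = (\<lambda>z. indicator (cbox a b) z * (v0 z - 2 * ?L z))"
    using ab by (auto simp: fun_eq_iff indicator_def)
   ultimately show ?thesis by simp
  qed
  fix \<psi> :: "real \<times> (real^'n) \<Rightarrow> real" assume \<psi>: "test_function half_space \<psi>"
  have pm[measurable]: "\<psi> \<in> Borel" using \<psi> by (rule test_function_measurable)
  obtain B R where B: "\<And>z. \<bar>\<psi> z\<bar> \<le> B" by (rule test_function_bounded[OF \<psi>], rule that)
  note ip = test_function_integrable[OF \<psi>]
  have ib: "L1 (\<lambda>\<zeta>. bessel q \<zeta> * \<psi> ((0, y) + \<zeta>))" for y
   using B by (intro bessel_mult_integrable[OF q, where B=B]) auto
  have conv: "bessel_conv q (even_ext \<psi>) (0, y) = 2 * (\<integral>z. bessel q (z - (0, y)) * \<psi> z)" for y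
  proof -
   have r: "refl_x (0, y) = (0, y)" by (simp add: refl_x_def)
   have "(\<integral>\<zeta>. bessel q (refl_x \<zeta>) * \<psi> ((0, y) + refl_x \<zeta>)) = (\<integral>\<zeta>. bessel q \<zeta> * \<psi> ((0, y) + \<zeta>))"
    by (rule integral_refl_x) measurable
   moreover have "L1 (\<lambda>\<zeta>. bessel q (refl_x \<zeta>) * \<psi> ((0, y) + refl_x \<zeta>))"
    unfolding bessel_refl_x using B by (intro bessel_mult_integrable[OF q, where B=B]) auto
   ultimately have "bessel_conv q (even_ext \<psi>) (0, y) = 2 * (\<integral>\<zeta>. bessel q \<zeta> * \<psi> ((0, y) + \<zeta>))"
    using ib[of y] unfolding bessel_conv_def even_ext_def by (simp add: distrib_left r bessel_refl_x)
   also have "(\<integral>\<zeta>. bessel q \<zeta> * \<psi> ((0, y) + \<zeta>)) = (\<integral>\<zeta>. bessel q ((\<zeta> + (0, y)) - (0, y)) * \<psi> (\<zeta> + (0, y)))"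
    by (simp add: add.commute)
   also have "\<dots> = (\<integral>z. bessel q (z - (0, y)) * \<psi> z)"
    by (rule integral_lborel_translate) measurable
   finally show ?thesis .
  qed
  note int' = int[OF pm B ip]
  have "(\<integral>y. h y * bessel_conv q (even_ext \<psi>) (0, y)) = 2 * (\<integral>y. (\<integral>z. \<psi> z * ?b z y))"
  proof -
   have "(\<integral>z. \<psi> z * ?b z y) = h y * (\<integral>z. bessel q (z - (0, y)) * \<psi> z)" for y
    by (subst integral_mult_right_zero[symmetric]) (simp add: mult_ac)
   then show ?thesis by (simp only: conv mult.left_commute[of _ 2] integral_mult_right_zero)
  qed
  also have "(\<integral>y. (\<integral>z. \<psi> z * ?b z y)) = (\<integral>z. (\<integral>y. \<psi> z * ?b z y))"
   by (rule lborel_pair.Fubini_integral[OF int'])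
  also have "\<dots> = (\<integral>z. \<psi> z * ?L z)" by (simp add: layer_def)
  finally have rhs: "(\<integral>y. h y * bessel_conv q (even_ext \<psi>) (0, y)) = 2 * (\<integral>z. \<psi> z * ?L z)" .
  have s: "L1 (\<lambda>z. (indicator half_space z * v0 z)\<^sup>2)"
   using sq by (rule Bochner_Integration.integrable_cong[THEN iffD1, rotated -1]) (auto simp: indicator_def)
  have iv: "L1 (\<lambda>z. (indicator half_space z * v0 z) * \<psi> z)"
   by (rule integrable_mult_squares[OF _ _ s test_function_square_integrable[OF \<psi>]]) measurable
  have iv': "(\<lambda>z. (indicator half_space z * v0 z) * \<psi> z) = (\<lambda>z. \<psi> z * v0 z)" "(\<lambda>z. indicator half_space z * (v0 z * \<psi> z)) = (\<lambda>z. \<psi> z * v0 z)"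
   using test_function_zero_outside[OF \<psi>] by (auto simp: fun_eq_iff indicator_def)
  have "(\<integral>z. \<psi> z * (v0 z - 2 * ?L z)) = (\<integral>z. \<psi> z * v0 z - 2 * (\<psi> z * ?L z))"
   by (simp add: algebra_simps)
  also have "\<dots> = (\<integral>z. \<psi> z * v0 z) - 2 * (\<integral>z. \<psi> z * ?L z)"
   using iv[unfolded iv'] intz[OF pm B ip] by simp
  also have "\<dots> = 0" using test[OF \<psi>] rhs unfolding iv' by simp
  finally show "(\<integral>z. \<psi> z * (v0 z - 2 * ?L z)) = 0" .
 qed
 then show ?thesis by simp
qed

section \<open>The trace embedding below the critical exponent\<close>

text \<open>The fundamental theorem of calculus for \<open>(1 - s) \<phi>(s, y + s b)\<close>, which vanishes at \<open>s = 1\<close>.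
 The segment leaves the boundary at an angle, and its direction \<open>(1, b)\<close> has norm at most two.\<close>

lemma trace_along_segment:
 fixes \<phi> :: "real \<times> (real^'n) \<Rightarrow> real"
 assumes \<phi>: "test_function UNIV \<phi>" and b: "norm b \<le> 1"
 shows "ennreal \<bar>\<phi> (0, y)\<bar> \<le> (\<integral>\<^sub>+s. indicator {0<..<1} s * (\<bar>\<phi> (s, y + s *\<^sub>R b)\<bar> + 2 * norm (gradient \<phi> (s, y + s *\<^sub>R b))))"
proof -
 let ?p = "\<lambda>s. (s, y + s *\<^sub>R b)"
 let ?g = "\<lambda>s. gradient \<phi> (?p s) \<bullet> (1, b)"
 let ?B = "\<lambda>s. \<bar>\<phi> (?p s)\<bar> + 2 * norm (gradient \<phi> (?p s))"
 define \<gamma>' where "\<gamma>' s = - \<phi> (?p s) + (1 - s) * (gradient \<phi> (?p s) \<bullet> (1, b))" for s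
 define \<gamma> where "\<gamma> s = (1 - s) * \<phi> (?p s)" for s
 have d: "(\<gamma> has_real_derivative \<gamma>' s) (at s)" for s
 proof -
  have 1: "((\<lambda>s. \<phi> (?p s)) has_real_derivative gradient \<phi> (?p s) \<bullet> (1, b)) (at s)"
   using has_real_derivative_along_line[of \<phi> "gradient \<phi> (?p s)" "(0, y)" s "(1, b)"] test_function_gradient[OF \<phi>, of "?p s"] by simp
  have "((\<lambda>s. 1 - s) has_real_derivative - 1) (at s)" by (auto intro!: derivative_eq_intros)
  from DERIV_mult[OF this 1] show ?thesis unfolding \<gamma>_def[abs_def] \<gamma>'_def by (simp add: algebra_simps)
 qed
 have c: "isCont \<gamma>' s" for s
 proof -
  have "continuous_on UNIV \<gamma>'" unfolding \<gamma>'_def[abs_def]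
   by (intro continuous_intros continuous_on_compose2[OF test_function_continuous[OF \<phi>, of UNIV]]
     continuous_on_compose2[OF test_function_gradient_continuous[OF \<phi>, of UNIV]]) auto
  then show ?thesis by (simp add: continuous_on_eq_continuous_at)
 qed
 have hb: "has_bochner_integral lborel (\<lambda>s. \<gamma>' s * indicator {0..1} s) (\<gamma> 1 - \<gamma> 0)"
  using d c by (intro has_bochner_integral_FTC_Icc_real) auto
 have "\<phi> (0, y) = - (\<integral>s. \<gamma>' s * indicator {0..1} s)"
  using has_bochner_integral_integral_eq[OF hb] by (simp add: \<gamma>_def)
 then have "ennreal \<bar>\<phi> (0, y)\<bar> = ennreal (norm (\<integral>s. \<gamma>' s * indicator {0..1} s))" by simp
 also have "\<dots> \<le> (\<integral>\<^sub>+s. norm (\<gamma>' s * indicator {0..1} s))"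
  using hb by (intro integral_norm_bound_ennreal) (simp add: has_bochner_integral_iff)
 also have "\<dots> \<le> (\<integral>\<^sub>+s. indicator {0<..<1} s * ?B s)"
 proof (rule nn_integral_mono_AE)
  show "AE s in lborel. ennreal (norm (\<gamma>' s * indicator {0..1} s)) \<le> ennreal (indicator {0<..<1} s * ?B s)"
   using AE_lborel_singleton[of "0::real"] AE_lborel_singleton[of "1::real"]
  proof eventually_elim
   case (elim s)
   show ?case
   proof (cases "0 < s \<and> s < 1")
    case True
    have "norm (1::real, b) \<le> norm (1::real) + norm b" by (rule norm_Pair_le)
    then have n: "norm (1::real, b) \<le> 2" using b by simp
    have "\<bar>?g s\<bar> \<le> norm (gradient \<phi> (?p s)) * norm (1::real, b)" by (rule Cauchy_Schwarz_ineq2)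
    also have "\<dots> \<le> norm (gradient \<phi> (?p s)) * 2" using n by (intro mult_left_mono) auto
    finally have "(1 - s) * \<bar>?g s\<bar> \<le> 1 * (norm (gradient \<phi> (?p s)) * 2)"
     using True by (intro mult_mono) auto
    then have "\<bar>\<gamma>' s\<bar> \<le> ?B s"
     unfolding \<gamma>'_def using True abs_triangle_ineq[of "- \<phi> (?p s)" "(1 - s) * ?g s"]
     by (simp add: abs_mult)
    then show ?thesis using True by (auto intro!: ennreal_leI simp del: ennreal_plus)
   qed (use elim in auto)
  qed
 qed
 finally show ?thesis .
qed

definition energy :: "(real \<times> (real^'n) \<Rightarrow> real) \<Rightarrow> real \<times> (real^'n) \<Rightarrow> real" where
 "energy \<phi> z = (\<phi> z)\<^sup>2 + (norm (gradient \<phi> z))\<^sup>2"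

text \<open>Supported in the cone \<open>\<bar>y' - y\<bar> < x < 1\<close> with vertex \<open>(0, y)\<close>.\<close>

definition cone_ker :: "real \<Rightarrow> real^'n \<Rightarrow> real \<times> (real^'n) \<Rightarrow> real" where
 "cone_ker \<beta> y z = indicator {0<..<1} (fst z) * indicator {b. norm b < fst z} (snd z - y) * fst z powr (\<beta> - real CARD('n))"

lemma cone_ker_nonneg: "0 \<le> cone_ker \<beta> y z" by (simp add: cone_ker_def)

lemma borel_measurable_fst_snd [measurable (raw)]:
 fixes f :: "'a \<Rightarrow> 'b::euclidean_space \<times> 'c::euclidean_space"
 assumes "f \<in> borel_measurable M"
 shows "(\<lambda>x. fst (f x)) \<in> borel_measurable M" "(\<lambda>x. snd (f x)) \<in> borel_measurable M"
 by (rule measurable_compose[OF assms], rule borel_measurable_continuous_onI, intro continuous_intros)+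

lemma cone_ker_measurable [measurable]: "(\<lambda>(y :: real^'n, z). cone_ker \<beta> y z) \<in> borel_measurable (borel \<Otimes>\<^sub>M borel)"
proof -
 have "cone_ker \<beta> y z = (if norm (snd z - y) < fst z then indicator {0<..<1} (fst z) * fst z powr (\<beta> - real CARD('n)) else 0)" for y :: "real^'n" and z
  by (auto simp: cone_ker_def indicator_def)
 then show ?thesis by (simp only:) measurable
qed

lemma energy_measurable: "test_function UNIV \<phi> \<Longrightarrow> energy \<phi> \<in> Borel"
 using test_function_measurable[of UNIV \<phi>] test_function_gradient_measurable[of UNIV \<phi>]
 unfolding energy_def[abs_def] by measurable

text \<open>A pointwise bound of the trace by a weighted energy in a cone. Jensen's inequality along each
 segment with the integrable weight \<open>s\<^bsup>-\<beta>\<^esup>\<close> bounds \<open>\<phi>(0, y)\<^sup>2\<close> by the integral of \<open>s\<^bsup>\<beta>\<^esup>\<close> times the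
 energy; averaging over the directions \<open>b\<close> of the unit ball and substituting \<open>y' = y + s b\<close>
 contributes the Jacobian \<open>s\<^bsup>-N\<^esup>\<close>.\<close>

lemma trace_cone_bound:
 fixes \<beta> :: real
 assumes \<beta>: "\<beta> < 1"
 shows "\<exists>C>0. \<forall>(\<phi> :: real \<times> (real^'n) \<Rightarrow> real) y. test_function UNIV \<phi> \<longrightarrow>
  ennreal ((\<phi> (0, y))\<^sup>2) \<le> (\<integral>\<^sub>+z. C * cone_ker \<beta> y z * energy \<phi> z)"
proof -
 define A where "A = exp 1 * theta 1 \<beta> 0 + 1"
 have A: "A > 0" by (simp add: A_def theta_nonneg add_nonneg_pos)
 define V where "V = measure lborel (ball (0::real^'n) 1)"
 have eV: "emeasure lborel (ball (0::real^'n) 1) = ennreal V"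
  unfolding V_def using emeasure_bounded_finite[of "ball (0::real^'n) 1"] by (intro emeasure_eq_ennreal_measure) auto
 have V: "V > 0" unfolding V_def using content_ball_pos[of 1 "0::real^'n"] by simp
 define w where "w s = indicator {0<..<1} s * s powr (- \<beta>)" for s :: real
 have [measurable]: "w \<in> Borel" unfolding w_def[abs_def] by measurable
 (* On (0,1) the weight is at most exp 1 times the integrand of theta 1 \<beta> 0, which is integrable because \<beta> < 1. *)
 have wA: "(\<integral>\<^sub>+s. w s) \<le> ennreal A"
 proof -
  have "(\<integral>\<^sub>+s. w s) \<le> ennreal (exp 1) * (\<integral>\<^sub>+s. theta_ker 1 \<beta> 0 s)"
  proof (rule nn_integral_le_cmult)
   show "w s \<le> exp 1 * theta_ker 1 \<beta> 0 s" for s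
   proof (cases "0 < s \<and> s < 1")
    case True
    then have "s\<^sup>2 \<le> 1" by (simp add: power_le_one)
    then have "1 \<le> exp (1 - s\<^sup>2)" by simp
    then have "s powr (- \<beta>) * 1 \<le> s powr (- \<beta>) * exp (1 - s\<^sup>2)" by (intro mult_left_mono) auto
    then show ?thesis using True by (simp add: w_def theta_ker_def exp_diff exp_minus field_simps)
   qed (auto simp: w_def theta_ker_nonneg)
  qed simp_all
  also have "\<dots> = ennreal (exp 1) * ennreal (theta 1 \<beta> 0)"
   using \<beta> by (simp add: theta_nn theta_ker_integrable_0)
  also have "\<dots> \<le> ennreal A" by (simp add: A_def ennreal_mult[symmetric] theta_nonneg ennreal_leI)
  finally show ?thesis .
 qed
 define C where "C = 32 * A / V"
 have C: "C > 0" using A V by (simp add: C_def)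
 have "ennreal ((\<phi> (0, y))\<^sup>2) \<le> (\<integral>\<^sub>+z. C * cone_ker \<beta> y z * energy \<phi> z)"
  if \<phi>: "test_function UNIV \<phi>" for \<phi> :: "real \<times> (real^'n) \<Rightarrow> real" and y
 proof -
  have [measurable]: "\<phi> \<in> Borel" "gradient \<phi> \<in> Borel"
   using \<phi> test_function_measurable test_function_gradient_measurable by blast+
  have em[measurable]: "energy \<phi> \<in> Borel" by (rule energy_measurable[OF \<phi>])
  have e0: "0 \<le> energy \<phi> z" for z by (simp add: energy_def)
  have ray[measurable]: "(\<lambda>s. (s, y + s *\<^sub>R b)) \<in> Borel" for b
   by (intro borel_measurable_continuous_onI continuous_intros)
  have ray2[measurable]: "(\<lambda>(b, s). (s, y + s *\<^sub>R b)) \<in> borel_measurable (borel \<Otimes>\<^sub>M borel)"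
   by measurable
  let ?E = "\<lambda>b s. energy \<phi> (s, y + s *\<^sub>R b)"
  let ?e = "\<lambda>b s. indicator {0<..<1} s * s powr \<beta> * ?E b s" and ?u = "indicator {b. norm b < 1} :: real^'n \<Rightarrow> real"
   and ?v = "\<lambda>s y'. indicator {b. norm b < s} (y' - y) * energy \<phi> (s, y')"
  let ?L = "ennreal ((\<phi> (0, y))\<^sup>2)" and ?R = "\<integral>\<^sub>+z. cone_ker \<beta> y z * energy \<phi> z"
  let ?p = "\<lambda>s. ennreal (s powr (- real CARD('n)))"
  have fixed: "?L \<le> ennreal (32 * A) * (\<integral>\<^sub>+s. ?e b s)"
   if b: "norm b \<le> 1" for b
  proof -
   define g where "g s = \<bar>\<phi> (s, y + s *\<^sub>R b)\<bar> + 2 * norm (gradient \<phi> (s, y + s *\<^sub>R b))" for s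
   define gg where "gg s = indicator {0<..<1} s * (s powr \<beta> * g s)" for s
   have [measurable]: "g \<in> Borel" unfolding g_def[abs_def] by measurable
   have [measurable]: "gg \<in> Borel" unfolding gg_def[abs_def] by measurable
   have g0: "0 \<le> g s" for s by (simp add: g_def)
   have wg: "w s * gg s = indicator {0<..<1} s * g s" for s
    by (auto simp: w_def gg_def indicator_def powr_minus field_simps)
   have "ennreal (\<bar>\<phi> (0, y)\<bar> powr 2) \<le> ennreal (2 powr 2 * A powr (2 - 1)) * (\<integral>\<^sub>+s. w s * gg s powr 2)"
   proof (rule nn_integral_weighted_Jensen)
    show "ennreal \<bar>\<phi> (0, y)\<bar> \<le> (\<integral>\<^sub>+s. w s * gg s)"
     unfolding wg unfolding g_def by (rule trace_along_segment[OF \<phi> b])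
   qed (use wA A g0 in \<open>auto simp: w_def gg_def\<close>)
   also have "(\<integral>\<^sub>+s. w s * gg s powr 2) \<le> ennreal 8 * (\<integral>\<^sub>+s. ?e b s)"
   proof (rule nn_integral_le_cmult)
    fix s :: real
    show "w s * gg s powr 2 \<le> 8 * ?e b s"
    proof (cases "0 < s \<and> s < 1")
     case True
     have "(g s)\<^sup>2 \<le> 8 * ?E b s"
     proof -
      have sq: "(a + 2 * c)\<^sup>2 \<le> 2 * a\<^sup>2 + 8 * c\<^sup>2" for a c :: real
       using zero_le_power2[of "a - 2 * c"] by (simp add: power2_eq_square algebra_simps)
      have "(g s)\<^sup>2 \<le> 2 * \<bar>\<phi> (s, y + s *\<^sub>R b)\<bar>\<^sup>2 + 8 * (norm (gradient \<phi> (s, y + s *\<^sub>R b)))\<^sup>2" unfolding g_def by (rule sq)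
      also have "\<dots> \<le> 8 * ?E b s" unfolding energy_def by simp
      finally show ?thesis .
     qed
     then have "s powr \<beta> * (g s)\<^sup>2 \<le> s powr \<beta> * (8 * ?E b s)" by (intro mult_left_mono) auto
     moreover have "w s * gg s powr 2 = s powr \<beta> * (g s)\<^sup>2"
     proof -
      have "gg s powr 2 = (gg s)\<^sup>2" using g0[of s] True by (auto simp: gg_def)
      moreover have "s powr (- \<beta>) * s powr \<beta> = 1" using True by (simp add: powr_minus)
      ultimately show ?thesis using True by (simp add: w_def gg_def power_mult_distrib power2_eq_square)
     qed
     ultimately show ?thesis using True by simp
    qed (auto simp: w_def)
   qed (auto, measurable)
   finally have "ennreal (\<bar>\<phi> (0, y)\<bar> powr 2) \<le> ennreal (2 powr 2 * A powr (2 - 1)) * (ennreal 8 * (\<integral>\<^sub>+s. ?e b s))"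
    by (simp add: mult_left_mono)
   moreover have "\<bar>\<phi> (0, y)\<bar> powr 2 = (\<phi> (0, y))\<^sup>2" by simp
   moreover have "ennreal (2 powr 2 * A powr (2 - 1)) * ennreal 8 = ennreal (32 * A)" using A by (subst ennreal_mult[symmetric]) auto
   ultimately show ?thesis by (simp only: mult.assoc[symmetric])
  qed
  have chg: "(\<integral>\<^sub>+b. ?u b * ?E b s) = ?p s * (\<integral>\<^sub>+y'. ?v s y')"
   if s: "s > 0" for s
  proof -
   have "(\<integral>\<^sub>+y'. ?v s y') = ennreal (\<bar>s\<bar> ^ DIM(real^'n)) * (\<integral>\<^sub>+b. indicator {b. norm b < s} (y + s *\<^sub>R b - y) * ?E b s)"
    by (rule nn_integral_lborel_affine) (use s in simp, measurable)
   also have "(\<lambda>b. indicator {b. norm b < s} (y + s *\<^sub>R b - y) :: real) = indicator {b. norm b < 1}"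
    using s by (auto simp: fun_eq_iff indicator_def)
   finally have "?p s * (\<integral>\<^sub>+y'. ?v s y')
     = (?p s * ennreal (\<bar>s\<bar> ^ DIM(real^'n))) * (\<integral>\<^sub>+b. ?u b * ?E b s)"
    by (simp add: fun_eq_iff mult.assoc)
   also have "?p s * ennreal (\<bar>s\<bar> ^ DIM(real^'n)) = 1"
    using s by (simp add: ennreal_mult[symmetric] powr_minus powr_realpow)
   finally show ?thesis by simp
  qed
  have "ennreal V * ?L = (\<integral>\<^sup>+b. ?L * indicator (ball (0::real^'n) 1) b)"
   by (subst nn_integral_cmult_indicator) (auto simp: eV mult.commute)
  also have "\<dots> \<le> (\<integral>\<^sup>+b. ennreal (32 * A) * (\<integral>\<^sub>+s. ?u b * ?e b s))"
   by (intro nn_integral_mono) (use fixed in \<open>auto simp: indicator_def\<close>)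
  also have "\<dots> = ennreal (32 * A) * (\<integral>\<^sup>+b. (\<integral>\<^sub>+s. ?u b * ?e b s))"
   by (rule nn_integral_cmult) measurable
  also have "(\<integral>\<^sup>+b. (\<integral>\<^sub>+s. ?u b * ?e b s))
    = (\<integral>\<^sup>+s. (\<integral>\<^sub>+b. ?u b * ?e b s))"
   by (rule lborel_pair.Fubini'[symmetric]) measurable
  also have "\<dots> = (\<integral>\<^sup>+s. (\<integral>\<^sub>+y'. cone_ker \<beta> y (s, y') * energy \<phi> (s, y')))"
  proof (rule nn_integral_cong)
   fix s :: real
   show "(\<integral>\<^sub>+b. ?u b * ?e b s) = (\<integral>\<^sub>+y'. cone_ker \<beta> y (s, y') * energy \<phi> (s, y'))"
   proof (cases "0 < s \<and> s < 1")
    case True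
    have "(\<integral>\<^sub>+b. ?u b * ?e b s)
     = (\<integral>\<^sup>+b. ennreal (s powr \<beta>) * ennreal (?u b * ?E b s))"
     using True by (intro nn_integral_cong) (auto simp: ennreal_mult[symmetric] e0 mult_ac)
    also have "\<dots> = ennreal (s powr \<beta>) * (\<integral>\<^sub>+b. ?u b * ?E b s)"
     by (rule nn_integral_cmult) measurable
    also have "\<dots> = ennreal (s powr \<beta> * s powr (- real CARD('n))) * (\<integral>\<^sub>+y'. ?v s y')"
     using chg True by (simp add: ennreal_mult mult.assoc)
    also have "\<dots> = (\<integral>\<^sup>+y'. ennreal (s powr \<beta> * s powr (- real CARD('n))) * ennreal (?v s y'))"
     by (rule nn_integral_cmult[symmetric]) measurable
    also have "\<dots> = (\<integral>\<^sub>+y'. cone_ker \<beta> y (s, y') * energy \<phi> (s, y'))"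
     using True by (intro nn_integral_cong) (auto simp: cone_ker_def ennreal_mult[symmetric] e0 powr_add[symmetric] mult_ac)
    finally show ?thesis .
   qed (auto simp: cone_ker_def)
  qed
  also have "\<dots> = ?R"
   by (subst nn_integral_lborel_fst) auto
  finally have *: "ennreal V * ?L \<le> ennreal (32 * A) * ?R" .
  have "?L = ennreal (1 / V) * (ennreal V * ?L)"
   using V by (simp add: ennreal_mult[symmetric])
  also have "\<dots> \<le> ennreal (1 / V) * (ennreal (32 * A) * ?R)"
   using * by (rule mult_left_mono) simp
  also have "\<dots> = ennreal C * ?R"
   using V A by (simp add: mult.assoc[symmetric] ennreal_mult[symmetric] C_def)
  also have "\<dots> = (\<integral>\<^sup>+z. ennreal C * ennreal (cone_ker \<beta> y z * energy \<phi> z))"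
   by (rule nn_integral_cmult[symmetric]) measurable
  also have "\<dots> = (\<integral>\<^sub>+z. C * cone_ker \<beta> y z * energy \<phi> z)"
   using C by (simp add: ennreal_mult[symmetric] cone_ker_nonneg e0 mult.assoc)
  finally show ?thesis .
 qed
 then show ?thesis using C by blast
qed

text \<open>The trace belongs to \<open>L\<^bsup>2r\<^esup>\<close> below the critical exponent. Jensen's inequality with the energy
 as weight raises the cone bound to the power \<open>r\<close> without losing the energy. For \<open>\<beta> = N - N / r\<close>,
 which is less than one by hypothesis, the \<open>r\<close>-th power of the cone kernel has a slice integral in
 \<open>y\<close> that is the same at all heights below one, and Tonelli concludes.\<close>

lemma trace_embedding:
 assumes r: "1 \<le> r" "r * (real CARD('n) - 1) < real CARD('n)"
 shows "\<exists>C\<ge>0. \<forall>(\<phi> :: real \<times> (real^'n) \<Rightarrow> real) E. test_function UNIV \<phi> \<longrightarrow> E > 0 \<longrightarrow>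
   (\<integral>\<^sub>+z. indicator half_space z * energy \<phi> z) \<le> ennreal E \<longrightarrow>
   (\<integral>\<^sub>+y. \<bar>\<phi> (0, y)\<bar> powr (2 * r)) \<le> ennreal (C * E powr (r - 1) * E)"
proof -
 let ?N = "real CARD('n)"
 define \<beta> where "\<beta> = ?N - ?N / r"
 have \<beta>: "\<beta> < 1" using r by (simp add: \<beta>_def field_simps)
 obtain K where K: "K > 0" "\<And>(\<phi> :: real \<times> (real^'n) \<Rightarrow> real) y. test_function UNIV \<phi> \<Longrightarrow>
  ennreal ((\<phi> (0, y))\<^sup>2) \<le> (\<integral>\<^sub>+z. K * cone_ker \<beta> y z * energy \<phi> z)"
  using trace_cone_bound[OF \<beta>] by blast
 define V where "V = measure lborel (ball (0::real^'n) 1)"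
 have V: "V \<ge> 0" by (simp add: V_def)
 have slice: "(\<integral>\<^sub>+y. (K * cone_ker \<beta> y z) powr r) \<le> ennreal (K powr r * V)" for z :: "real \<times> (real^'n)"
 proof (cases "0 < fst z \<and> fst z < 1")
  case True
  let ?s = "fst z"
  have "(\<integral>\<^sub>+y. (K * cone_ker \<beta> y z) powr r) = (\<integral>\<^sup>+y. ennreal (K powr r * ?s powr (- ?N)) * indicator (ball (snd z) ?s) y)"
  proof (rule nn_integral_cong)
   fix y
   have "(\<beta> - ?N) * r = - ?N" using r by (simp add: \<beta>_def field_simps)
   then show "ennreal ((K * cone_ker \<beta> y z) powr r) = ennreal (K powr r * ?s powr (- ?N)) * indicator (ball (snd z) ?s) y"
    using True K(1) by (auto simp: cone_ker_def indicator_def powr_mult powr_powr dist_norm norm_minus_commute)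
  qed
  also have "\<dots> = ennreal (K powr r * ?s powr (- ?N)) * emeasure lborel (ball (snd z) ?s)"
   by (rule nn_integral_cmult_indicator) simp
  also have "emeasure lborel (ball (snd z) ?s) = ennreal (?s ^ CARD('n)) * ennreal V"
  proof -
   have "emeasure lborel (ball (snd z) ?s) = ennreal (measure lborel (ball (snd z) ?s))"
    using emeasure_bounded_finite[of "ball (snd z) ?s"] by (intro emeasure_eq_ennreal_measure) auto
   also have "measure lborel (ball (snd z) ?s) = ?s ^ CARD('n) * V"
    using True content_ball_conv_unit_ball[of ?s "snd z"] by (simp add: V_def)
   finally show ?thesis using V True by (simp add: ennreal_mult)
  qed
  also have "ennreal (K powr r * ?s powr (- ?N)) * (ennreal (?s ^ CARD('n)) * ennreal V) = ennreal (K powr r * (?s powr (- ?N) * ?s ^ CARD('n)) * V)"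
   using True V by (simp add: ennreal_mult[symmetric] mult.assoc)
  also have "?s powr (- ?N) * ?s ^ CARD('n) = 1" using True by (simp add: powr_minus powr_realpow)
  finally show ?thesis by simp
 qed (auto simp: cone_ker_def)
 define C where "C = 2 powr r * (K powr r * V)"
 have C: "C \<ge> 0" using V by (simp add: C_def)
 have "(\<integral>\<^sub>+y. \<bar>\<phi> (0, y)\<bar> powr (2 * r)) \<le> ennreal (C * E powr (r - 1) * E)"
  if \<phi>: "test_function UNIV \<phi>" and E: "E > 0" and le: "(\<integral>\<^sub>+z. indicator half_space z * energy \<phi> z) \<le> ennreal E"
  for \<phi> :: "real \<times> (real^'n) \<Rightarrow> real" and E
 proof -
  have em[measurable]: "energy \<phi> \<in> Borel" by (rule energy_measurable[OF \<phi>])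
  have pm[measurable]: "\<phi> \<in> Borel" by (rule test_function_measurable[OF \<phi>])
  have e0: "0 \<le> energy \<phi> z" for z by (simp add: energy_def)
  define w where "w z = indicator half_space z * energy \<phi> z" for z
  have wm[measurable]: "w \<in> Borel" unfolding w_def[abs_def] by measurable
  have w0: "0 \<le> w z" for z by (simp add: w_def e0)
  let ?W = "\<lambda>y z. w z * (K * cone_ker \<beta> y z) powr r" and ?c = "ennreal (2 powr r * E powr (r - 1))"
   and ?T = "\<integral>\<^sub>+y. \<bar>\<phi> (0, y)\<bar> powr (2 * r)"
  have pt: "ennreal (\<bar>\<phi> (0, y)\<bar> powr (2 * r)) \<le> ?c * (\<integral>\<^sub>+z. ?W y z)" for y
  proof -
   have "ennreal (((\<phi> (0, y))\<^sup>2) powr r) \<le> ?c * (\<integral>\<^sub>+z. ?W y z)"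
   proof (rule nn_integral_weighted_Jensen)
    have "K * cone_ker \<beta> y z * energy \<phi> z = w z * (K * cone_ker \<beta> y z)" for z
     by (auto simp: w_def cone_ker_def indicator_def mem_half_space)
    then show "ennreal ((\<phi> (0, y))\<^sup>2) \<le> (\<integral>\<^sub>+z. w z * (K * cone_ker \<beta> y z))"
     using K(2)[OF \<phi>, of y] by (simp only:)
    show "(\<integral>\<^sub>+z. w z) \<le> ennreal E" using le by (simp add: w_def)
   qed (use E w0 K(1) r in \<open>auto simp: cone_ker_nonneg\<close>)
   moreover have "((\<phi> (0, y))\<^sup>2) powr r = \<bar>\<phi> (0, y)\<bar> powr (2 * r)"
    by (cases "\<phi> (0, y) = 0") (simp_all add: powr_powr[symmetric])
   ultimately show ?thesis by simp
  qed
  have "?T \<le> (\<integral>\<^sup>+y. ?c * (\<integral>\<^sub>+z. ?W y z))"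
   by (intro nn_integral_mono pt)
  also have "\<dots> = ?c * (\<integral>\<^sup>+y. (\<integral>\<^sub>+z. ?W y z))"
   by (rule nn_integral_cmult) measurable
  also have "(\<integral>\<^sup>+y. (\<integral>\<^sub>+z. ?W y z)) = (\<integral>\<^sup>+z. (\<integral>\<^sub>+y. ?W y z))"
   by (rule lborel_pair.Fubini'[symmetric]) measurable
  also have "\<dots> \<le> (\<integral>\<^sup>+z. ennreal (w z) * ennreal (K powr r * V))"
  proof (rule nn_integral_mono)
   fix z :: "real \<times> (real^'n)"
   have "(\<integral>\<^sub>+y. ?W y z) = ennreal (w z) * (\<integral>\<^sub>+y. (K * cone_ker \<beta> y z) powr r)"
    using w0 by (simp add: ennreal_mult nn_integral_cmult)
   also have "\<dots> \<le> ennreal (w z) * ennreal (K powr r * V)" by (intro mult_left_mono slice) simp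
   finally show "(\<integral>\<^sub>+y. ?W y z) \<le> ennreal (w z) * ennreal (K powr r * V)" .
  qed
  also have "\<dots> = (\<integral>\<^sub>+z. w z) * ennreal (K powr r * V)" by (rule nn_integral_multc) measurable
  also have "\<dots> \<le> ennreal E * ennreal (K powr r * V)" using le by (intro mult_right_mono) (auto simp: w_def)
  finally have "?T \<le> ?c * (ennreal E * ennreal (K powr r * V))"
   by (simp add: mult_left_mono)
  also have "\<dots> = ennreal (C * E powr (r - 1) * E)"
   using E V by (simp add: ennreal_mult[symmetric] C_def mult_ac)
  finally show ?thesis .
 qed
 then show ?thesis using C by blast
qed

lemma test_slice_square_integrable:
 fixes \<phi> :: "real \<times> (real^'n) \<Rightarrow> real"
 assumes \<phi>: "test_function UNIV \<phi>"
 shows "L1 (\<lambda>y. (\<phi> (x, y))\<^sup>2)"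
proof -
 have [measurable]: "\<phi> \<in> Borel" using \<phi> by (rule test_function_measurable)
 obtain B R where B: "\<And>z. \<bar>\<phi> z\<bar> \<le> B" "\<And>z. norm z > R \<Longrightarrow> \<phi> z = 0" by (rule test_function_bounded[OF \<phi>], rule that)
 show ?thesis
 proof (rule integrable_bound_pointwise[OF integrable_cball_const[of "B\<^sup>2" R]])
  fix y :: "real^'n"
  have "\<bar>\<phi> (x, y)\<bar>\<^sup>2 \<le> B\<^sup>2" using B(1) by (intro power_mono) auto
  moreover have "\<phi> (x, y) = 0" if "norm y > R" using B(2)[of "(x, y)"] norm_snd_le[of y x] that by simp
  ultimately show "norm ((\<phi> (x, y))\<^sup>2) \<le> B\<^sup>2 * indicator (cball 0 R) y"
   by (cases "norm y \<le> R") (auto simp: indicator_def)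
 qed measurable
qed

lemma trace_error_integrable:
 fixes \<phi> :: "nat \<Rightarrow> real \<times> (real^'n) \<Rightarrow> real"
 assumes a: "H1_approx v0 G0 u \<phi>"
 shows "L1 (\<lambda>y. (u y - \<phi> k (0, y))\<^sup>2)"
proof (rule integrable_bound_pointwise)
 note [measurable] = H1_approxD(3,10)[OF a]
 show "L1 (\<lambda>y. 2 * (u y)\<^sup>2 + 2 * (\<phi> k (0, y))\<^sup>2)"
  using H1_approxD(6)[OF a] test_slice_square_integrable[OF H1_approxD(7)[OF a, of k], of 0] by simp
 show "norm ((u y - \<phi> k (0, y))\<^sup>2) \<le> 2 * (u y)\<^sup>2 + 2 * (\<phi> k (0, y))\<^sup>2" for y
  using norm_diff_square_le[of "u y" "\<phi> k (0, y)"] by simp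
qed (use H1_approxD(3,10)[OF a] in measurable)

lemma approx_energy_bound:
 assumes a: "H1_approx v0 G0 u \<phi>"
 shows "(\<integral>\<^sub>+z. indicator half_space z * (norm (gradient (\<phi> k) z))\<^sup>2)
   \<le> ennreal (2 * (\<integral>z. indicator half_space z * (norm (G0 z))\<^sup>2) + 2 * (\<integral>z. indicator half_space z * h1_error v0 G0 (\<phi> k) z))"
  and "(\<integral>\<^sub>+z. indicator half_space z * energy (\<phi> k) z)
   \<le> ennreal (2 * ((\<integral>z. indicator half_space z * (v0 z)\<^sup>2) + (\<integral>z. indicator half_space z * (norm (G0 z))\<^sup>2)) + 2 * (\<integral>z. indicator half_space z * h1_error v0 G0 (\<phi> k) z))"
proof -
 let ?I = "indicator half_space :: real \<times> (real^'n) \<Rightarrow> real"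
 note sq = H1_approxD(4,5)[OF a] and id = approx_error_integrable[OF a, of k]
 have g: "(norm (gradient (\<phi> k) z))\<^sup>2 \<le> 2 * (norm (G0 z))\<^sup>2 + 2 * (norm (G0 z - gradient (\<phi> k) z))\<^sup>2" for z
  using norm_diff_square_le[of "G0 z" "G0 z - gradient (\<phi> k) z"] by simp
 have f: "(\<phi> k z)\<^sup>2 \<le> 2 * (v0 z)\<^sup>2 + 2 * (v0 z - \<phi> k z)\<^sup>2" for z
  using norm_diff_square_le[of "v0 z" "v0 z - \<phi> k z"] by simp
 have "(\<integral>\<^sub>+z. ?I z * (norm (gradient (\<phi> k) z))\<^sup>2) \<le> (\<integral>\<^sub>+z. 2 * (?I z * (norm (G0 z))\<^sup>2) + 2 * (?I z * h1_error v0 G0 (\<phi> k) z))"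
 proof (intro nn_integral_mono ennreal_leI)
  show "?I z * (norm (gradient (\<phi> k) z))\<^sup>2 \<le> 2 * (?I z * (norm (G0 z))\<^sup>2) + 2 * (?I z * h1_error v0 G0 (\<phi> k) z)" for z
   using g[of z] zero_le_power2[of "v0 z - \<phi> k z"] unfolding h1_error_def indicator_def by (simp, linarith?)
 qed
 also have "\<dots> = ennreal (2 * (\<integral>z. ?I z * (norm (G0 z))\<^sup>2) + 2 * (\<integral>z. ?I z * h1_error v0 G0 (\<phi> k) z))"
  using sq id by (subst nn_integral_eq_integral) (auto simp: h1_error_def)
 finally show "(\<integral>\<^sub>+z. ?I z * (norm (gradient (\<phi> k) z))\<^sup>2) \<le> \<dots>" .
 have "(\<integral>\<^sub>+z. ?I z * energy (\<phi> k) z) \<le> (\<integral>\<^sub>+z. 2 * (?I z * (v0 z)\<^sup>2 + ?I z * (norm (G0 z))\<^sup>2) + 2 * (?I z * h1_error v0 G0 (\<phi> k) z))"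
 proof (intro nn_integral_mono ennreal_leI)
  show "?I z * energy (\<phi> k) z \<le> 2 * (?I z * (v0 z)\<^sup>2 + ?I z * (norm (G0 z))\<^sup>2) + 2 * (?I z * h1_error v0 G0 (\<phi> k) z)" for z
   using f[of z] g[of z] unfolding h1_error_def energy_def indicator_def by (simp, linarith?)
 qed
 also have "\<dots> = ennreal (2 * ((\<integral>z. ?I z * (v0 z)\<^sup>2) + (\<integral>z. ?I z * (norm (G0 z))\<^sup>2)) + 2 * (\<integral>z. ?I z * h1_error v0 G0 (\<phi> k) z))"
  using sq id by (subst nn_integral_eq_integral) (auto simp: h1_error_def)
 finally show "(\<integral>\<^sub>+z. ?I z * energy (\<phi> k) z) \<le> \<dots>" .
qed

text \<open>The embedding bounds the approximating test functions uniformly; Fatou's lemma along an almost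
 everywhere convergent subsequence passes to the trace.\<close>

lemma trace_integrability:
 assumes a: "H1_approx v0 G0 u \<phi>"
  and r: "1 \<le> r" "r * (real CARD('n) - 1) < real CARD('n)"
 shows "L1 (\<lambda>y :: real^'n. \<bar>u y\<bar> powr (2 * r))"
proof -
 note \<phi> = H1_approxD(7)[OF a] and lim = H1_approxD(8)[OF a] and lim0 = H1_approxD(9)[OF a] and [measurable] = H1_approxD(3,10)[OF a]
 let ?I = "indicator half_space :: real \<times> (real^'n) \<Rightarrow> real"
 define d where "d k = (\<integral>z. ?I z * h1_error v0 G0 (\<phi> k) z)" for k
 have "Bseq d" using lim by (intro convergent_imp_Bseq convergentI[of _ 0]) (simp add: d_def[abs_def])
 then obtain D where D: "D > 0" "\<And>k. norm (d k) \<le> D" by (auto elim: BseqE)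
 define S where "S = (\<integral>z. ?I z * (v0 z)\<^sup>2) + (\<integral>z. ?I z * (norm (G0 z))\<^sup>2)"
 define E where "E = 2 * S + 2 * D"
 have S0: "S \<ge> 0" by (simp add: S_def)
 then have E: "E > 0" using D by (simp add: E_def)
 have en: "(\<integral>\<^sub>+z. ?I z * energy (\<phi> k) z) \<le> ennreal E" for k
 proof -
  have "2 * S + 2 * d k \<le> E" using D(2)[of k] by (simp add: E_def)
  then show ?thesis using approx_energy_bound(2)[OF a, of k] by (auto simp: S_def d_def intro: order_trans ennreal_leI simp del: ennreal_plus)
 qed
 obtain C where C: "C \<ge> 0" "\<And>(\<phi> :: real \<times> (real^'n) \<Rightarrow> real) E. test_function UNIV \<phi> \<Longrightarrow> E > 0 \<Longrightarrow>
   (\<integral>\<^sub>+z. indicator half_space z * energy \<phi> z) \<le> ennreal E \<Longrightarrow>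
   (\<integral>\<^sub>+y. \<bar>\<phi> (0, y)\<bar> powr (2 * r)) \<le> ennreal (C * E powr (r - 1) * E)"
  using trace_embedding[OF r] by blast
 note bound = C(2)[OF \<phi> E en]
 note ie = trace_error_integrable[OF a]
 have "\<exists>s::nat \<Rightarrow> nat. strict_mono s \<and> (AE y in lborel. (\<lambda>n. (u y - \<phi> (s n) (0, y))\<^sup>2) \<longlonglongrightarrow> 0)"
  by (rule tendsto_L1_AE_subseq[OF ie]) (use lim0 in simp)
 then obtain s :: "nat \<Rightarrow> nat" where s: "AE y in lborel. (\<lambda>n. (u y - \<phi> (s n) (0, y))\<^sup>2) \<longlonglongrightarrow> 0" by blast
 have "(\<integral>\<^sub>+y. \<bar>u y\<bar> powr (2 * r)) = (\<integral>\<^sup>+y. liminf (\<lambda>n. ennreal (\<bar>\<phi> (s n) (0, y)\<bar> powr (2 * r))))"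
 proof (rule nn_integral_cong_AE)
  show "AE y in lborel. ennreal (\<bar>u y\<bar> powr (2 * r)) = liminf (\<lambda>n. ennreal (\<bar>\<phi> (s n) (0, y)\<bar> powr (2 * r)))"
   using s
  proof eventually_elim
   case (elim y)
   have "(\<lambda>n. sqrt ((u y - \<phi> (s n) (0, y))\<^sup>2)) \<longlonglongrightarrow> sqrt 0" by (intro tendsto_real_sqrt elim)
   then have "(\<lambda>n. u y - \<phi> (s n) (0, y)) \<longlonglongrightarrow> 0" by (simp add: tendsto_rabs_zero_iff)
   from tendsto_diff[OF tendsto_const[of "u y"] this]
   have "(\<lambda>n. \<phi> (s n) (0, y)) \<longlonglongrightarrow> u y" by simp
   then have "(\<lambda>n. \<bar>\<phi> (s n) (0, y)\<bar> powr (2 * r)) \<longlonglongrightarrow> \<bar>u y\<bar> powr (2 * r)"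
    using r by (intro tendsto_powr' tendsto_rabs tendsto_const) auto
   then have "(\<lambda>n. ennreal (\<bar>\<phi> (s n) (0, y)\<bar> powr (2 * r))) \<longlonglongrightarrow> ennreal (\<bar>u y\<bar> powr (2 * r))" by (rule tendsto_ennrealI)
   from lim_imp_Liminf[OF _ this] show ?case by simp
  qed
 qed
 also have "\<dots> \<le> liminf (\<lambda>n. \<integral>\<^sup>+y. ennreal (\<bar>\<phi> (s n) (0, y)\<bar> powr (2 * r)) \<partial>lborel)"
  by (rule nn_integral_liminf) measurable
 also have "\<dots> \<le> liminf (\<lambda>n::nat. ennreal (C * E powr (r - 1) * E))" by (intro Liminf_mono always_eventually allI bound)
 also have "\<dots> = ennreal (C * E powr (r - 1) * E)" by (rule Liminf_const) simp
 also have "\<dots> < \<infinity>" by simp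
 finally show ?thesis by (intro integrableI_bounded) simp_all
qed

section \<open>The trace is the boundary value of the layer potential\<close>

text \<open>On a normal line the increment is the integral of the normal derivative over an interval of
 length less than \<open>e\<close>. Jensen's inequality gives a factor \<open>4 e\<close> and the integration over the strip
 another \<open>e\<close>.\<close>

lemma normal_increment_bound:
 fixes \<phi> :: "real \<times> (real^'n) \<Rightarrow> real"
 assumes \<phi>: "test_function UNIV \<phi>" and e: "e > 0"
 shows "(\<integral>\<^sub>+z. indicator {0<..<e} (fst z) * (\<phi> z - \<phi> (0, snd z))\<^sup>2)
  \<le> ennreal (4 * e\<^sup>2) * (\<integral>\<^sub>+z. indicator half_space z * (norm (gradient \<phi> z))\<^sup>2)"
proof -
 have pm[measurable]: "\<phi> \<in> Borel" and gm[measurable]: "gradient \<phi> \<in> Borel"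
  using \<phi> test_function_measurable test_function_gradient_measurable by blast+
 define J where "J y = (\<integral>\<^sub>+t. indicator {0<..} t * (norm (gradient \<phi> (t, y)))\<^sup>2)" for y
 have sl[measurable]: "(\<lambda>t. (t::real, y::real^'n)) \<in> Borel" for y
  by (intro borel_measurable_continuous_onI continuous_intros)
 have "(\<lambda>(y, t). ennreal (indicator {0<..} t * (norm (gradient \<phi> (t, y)))\<^sup>2)) \<in> borel_measurable (borel \<Otimes>\<^sub>M borel)" by measurable
 then have [measurable]: "(\<lambda>(y, t). ennreal (indicator {0<..} t * (norm (gradient \<phi> (t, y)))\<^sup>2)) \<in> borel_measurable (borel \<Otimes>\<^sub>M lborel)"
  by (simp cong: measurable_cong_sets sets_pair_measure_cong)
 have Jm[measurable]: "J \<in> Borel" unfolding J_def[abs_def] by measurable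
 have pt: "ennreal ((\<phi> (x, y) - \<phi> (0, y))\<^sup>2) \<le> ennreal (4 * e) * J y" if x: "0 < x" "x < e" for x y
 proof -
  define g where "g t = norm (gradient \<phi> (t, y))" for t
  define w :: "real \<Rightarrow> real" where "w t = indicator {0<..<x} t" for t
  have [measurable]: "g \<in> Borel" unfolding g_def[abs_def] by measurable
  have [measurable]: "w \<in> Borel" unfolding w_def[abs_def] by measurable
  let ?D = "\<lambda>t. gradient \<phi> (t, y) \<bullet> (1, 0)"
  have d: "((\<lambda>t. \<phi> (t, y)) has_real_derivative ?D t) (at t)" for t
   using has_real_derivative_along_line[of \<phi> "gradient \<phi> (t, y)" "(0, y)" t "(1, 0)"] test_function_gradient[OF \<phi>, of "(t, y)"] by simp
  have c: "isCont ?D t" for t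
  proof -
   have "continuous_on UNIV ?D"
    by (intro continuous_intros continuous_on_compose2[OF test_function_gradient_continuous[OF \<phi>, of UNIV]]) auto
   then show ?thesis by (simp add: continuous_on_eq_continuous_at)
  qed
  have hb: "has_bochner_integral lborel (\<lambda>t. ?D t * indicator {0..x} t) (\<phi> (x, y) - \<phi> (0, y))"
   using d c x by (intro has_bochner_integral_FTC_Icc_real) auto
  have "ennreal \<bar>\<phi> (x, y) - \<phi> (0, y)\<bar> \<le> (\<integral>\<^sub>+t. norm (?D t * indicator {0..x} t))"
   using hb integral_norm_bound_ennreal[of lborel "\<lambda>t. ?D t * indicator {0..x} t"]
   by (auto simp: has_bochner_integral_iff)
  also have "\<dots> \<le> (\<integral>\<^sub>+t. w t * g t)"
  proof (rule nn_integral_mono_AE)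
   show "AE t in lborel. ennreal (norm (?D t * indicator {0..x} t)) \<le> ennreal (w t * g t)"
    using AE_lborel_singleton[of "0::real"] AE_lborel_singleton[of x]
   proof eventually_elim
    case (elim t)
    have "\<bar>?D t\<bar> \<le> g t"
     using Cauchy_Schwarz_ineq2[of "gradient \<phi> (t, y)" "(1, 0)"] by (simp add: g_def norm_Pair)
    then show ?case using elim by (auto simp: w_def indicator_def intro!: ennreal_leI)
   qed
  qed
  finally have "ennreal (\<bar>\<phi> (x, y) - \<phi> (0, y)\<bar> powr 2) \<le> ennreal (2 powr 2 * x powr (2 - 1)) * (\<integral>\<^sub>+t. w t * g t powr 2)"
  proof (rule nn_integral_weighted_Jensen[rotated -2])
   have "(\<lambda>t. ennreal (w t)) = indicator {0<..<x}" by (auto simp: w_def indicator_def)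
   then show "(\<integral>\<^sub>+t. w t) \<le> ennreal x" using x by simp
  qed (use x in \<open>auto simp: w_def g_def\<close>)
  also have "(\<integral>\<^sub>+t. w t * g t powr 2) \<le> J y"
   unfolding J_def by (intro nn_integral_mono ennreal_leI) (auto simp: w_def g_def indicator_def)
  also have "ennreal (2 powr 2 * x powr (2 - 1)) \<le> ennreal (4 * e)" using x by (intro ennreal_leI) auto
  finally show ?thesis by (simp add: mult_left_mono mult_right_mono)
 qed
 have "(\<integral>\<^sub>+z. indicator {0<..<e} (fst z) * (\<phi> z - \<phi> (0, snd z))\<^sup>2) =
   (\<integral>\<^sup>+x. \<integral>\<^sup>+y. ennreal (indicator {0<..<e} x * (\<phi> (x, y) - \<phi> (0, y))\<^sup>2) \<partial>lborel)"
  by (subst nn_integral_lborel_fst) auto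
 also have "\<dots> \<le> (\<integral>\<^sup>+x. \<integral>\<^sup>+y. (ennreal (4 * e) * indicator {0<..<e} x) * J y \<partial>lborel)"
  using pt by (intro nn_integral_mono) (auto simp: indicator_def)
 also have "\<dots> = (\<integral>\<^sup>+x. ennreal (4 * e) * indicator {0<..<e} x) * (\<integral>\<^sup>+y. J y)"
  by (simp add: nn_integral_cmult nn_integral_multc)
 also have "(\<integral>\<^sup>+x. ennreal (4 * e) * indicator {0<..<e} x) = ennreal (4 * e\<^sup>2)"
  using e by (subst nn_integral_cmult_indicator) (auto simp: ennreal_mult[symmetric] power2_eq_square)
 also have "(\<integral>\<^sup>+y. J y) = (\<integral>\<^sub>+z. indicator half_space z * (norm (gradient \<phi> z))\<^sup>2)"
  by (subst nn_integral_lborel_snd) (auto simp: J_def[abs_def] indicator_def mem_half_space)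
 finally show ?thesis .
qed

text \<open>This quantifies in which sense \<open>u\<close> is the boundary value of \<open>v0\<close>: on average over the strip of
 width \<open>e\<close> the squared \<open>L\<^sup>2\<close> distance of the slices to \<open>u\<close> is \<open>O(e)\<close>. The bound for smooth
 functions is passed to the limit.\<close>

lemma trace_increment_bound:
 fixes v0 :: "real \<times> (real^'n) \<Rightarrow> real"
 assumes a: "H1_approx v0 G0 u \<phi>"
  and e: "e > 0"
 shows "(\<integral>\<^sub>+z. indicator {0<..<e} (fst z) * (v0 z - u (snd z))\<^sup>2)
  \<le> ennreal (24 * e\<^sup>2 * (\<integral>z. indicator half_space z * (norm (G0 z))\<^sup>2))"
proof -
 let ?I = "indicator half_space :: real \<times> (real^'n) \<Rightarrow> real"
 note \<phi> = H1_approxD(7)[OF a] and lim = H1_approxD(8)[OF a] and lim0 = H1_approxD(9)[OF a] and [measurable] = H1_approxD(1,2,3,10,11)[OF a]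
 let ?J = "\<lambda>z :: real \<times> (real^'n). indicator {0<..<e} (fst z) :: real"
 let ?E = "\<lambda>k z. ?I z * h1_error v0 G0 (\<phi> k) z" and ?A = "\<lambda>k z. ?J z * (\<phi> k z - \<phi> k (0, snd z))\<^sup>2"
  and ?B = "\<lambda>k z. ?J z * (u (snd z) - \<phi> k (0, snd z))\<^sup>2"
 have [measurable]: "?E k \<in> Borel" for k unfolding h1_error_def by measurable
 define d where "d k = (\<integral>z. ?E k z)" for k
 define d0 where "d0 k = (\<integral>y. (u y - \<phi> k (0, y))\<^sup>2)" for k
 define S where "S = (\<integral>z. ?I z * (norm (G0 z))\<^sup>2)"
 have S0: "S \<ge> 0" and dk0: "d k \<ge> 0" "d0 k \<ge> 0" for k by (simp_all add: S_def d_def d0_def h1_error_def)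
 note id = approx_error_integrable[OF a] and id0 = trace_error_integrable[OF a]
 have gr: "(\<integral>\<^sub>+z. ?I z * (norm (gradient (\<phi> k) z))\<^sup>2) \<le> ennreal (2 * S + 2 * d k)" for k
  using approx_energy_bound(1)[OF a, of k] by (simp add: S_def d_def)
 define \<epsilon> where "\<epsilon> k = 3 * d k + 3 * (4 * e\<^sup>2 * (2 * S + 2 * d k)) + 3 * (e * d0 k)" for k
 have le: "(\<integral>\<^sub>+z. indicator {0<..<e} (fst z) * (v0 z - u (snd z))\<^sup>2) \<le> ennreal (\<epsilon> k)" for k
 proof -
  have "(\<integral>\<^sub>+z. ?J z * (v0 z - u (snd z))\<^sup>2) \<le>
   (\<integral>\<^sup>+z. ennreal 3 * ennreal (?E k z) + (ennreal 3 * ennreal (?A k z) + ennreal 3 * ennreal (?B k z)))"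
  proof (rule nn_integral_mono)
   fix z :: "real \<times> (real^'n)"
   have p: "(x + y - w)\<^sup>2 \<le> 3 * x\<^sup>2 + 3 * y\<^sup>2 + 3 * w\<^sup>2" for x y w :: real
    using zero_le_power2[of "x - y"] zero_le_power2[of "y + w"] zero_le_power2[of "x + w"]
    by (simp add: power2_eq_square algebra_simps)
   have "v0 z - u (snd z) = (v0 z - \<phi> k z) + (\<phi> k z - \<phi> k (0, snd z)) - (u (snd z) - \<phi> k (0, snd z))" by simp
   then have "(v0 z - u (snd z))\<^sup>2 \<le> 3 * (v0 z - \<phi> k z)\<^sup>2 + 3 * (\<phi> k z - \<phi> k (0, snd z))\<^sup>2 + 3 * (u (snd z) - \<phi> k (0, snd z))\<^sup>2"
    by (metis p)
   then have "?J z * (v0 z - u (snd z))\<^sup>2 \<le> 3 * ?E k z + (3 * ?A k z + 3 * ?B k z)"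
    by (auto simp: indicator_def mem_half_space h1_error_def intro: order_trans)
   from ennreal_leI[OF this]
   show "ennreal (?J z * (v0 z - u (snd z))\<^sup>2) \<le> ennreal 3 * ennreal (?E k z) + (ennreal 3 * ennreal (?A k z) + ennreal 3 * ennreal (?B k z))"
    by (simp only: ennreal_mult'[symmetric] ennreal_plus[symmetric] mult_nonneg_nonneg add_nonneg_nonneg indicator_pos_le zero_le_power2 zero_le_numeral h1_error_def)
  qed
  also have "\<dots> = ennreal 3 * (\<integral>\<^sub>+z. ?E k z) + (ennreal 3 * (\<integral>\<^sub>+z. ?A k z) + ennreal 3 * (\<integral>\<^sub>+z. ?B k z))"
  proof -
   have gen: "(\<integral>\<^sup>+z. ennreal 3 * F1 z + (ennreal 3 * F2 z + ennreal 3 * F3 z)) = ennreal 3 * (\<integral>\<^sup>+z. F1 z) + (ennreal 3 * (\<integral>\<^sup>+z. F2 z) + ennreal 3 * (\<integral>\<^sup>+z. F3 z))"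
    if "F1 \<in> Borel" "F2 \<in> Borel" "F3 \<in> Borel" for F1 F2 F3 :: "real \<times> (real^'n) \<Rightarrow> ennreal"
    using that by (simp add: nn_integral_add nn_integral_cmult)
   show ?thesis by (rule gen) measurable
  qed
  also have "\<dots> \<le> ennreal 3 * ennreal (d k) + (ennreal 3 * (ennreal (4 * e\<^sup>2) * ennreal (2 * S + 2 * d k)) + ennreal 3 * ennreal (e * d0 k))"
  proof (intro add_mono mult_left_mono)
   show "(\<integral>\<^sub>+z. ?E k z) \<le> ennreal (d k)"
    using id[of k] by (subst nn_integral_eq_integral) (auto simp: d_def h1_error_def)
   show "(\<integral>\<^sub>+z. ?A k z) \<le> ennreal (4 * e\<^sup>2) * ennreal (2 * S + 2 * d k)"
    by (rule order_trans[OF normal_increment_bound[OF \<phi> e] mult_left_mono[OF gr]]) simp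
   have "(\<integral>\<^sub>+z. ?B k z) = (\<integral>\<^sup>+x. \<integral>\<^sup>+y. ennreal (indicator {0<..<e} x * (u y - \<phi> k (0, y))\<^sup>2) \<partial>lborel)"
    by (subst nn_integral_lborel_fst) auto
   also have "\<dots> = (\<integral>\<^sup>+x. indicator {0<..<e} x * (\<integral>\<^sub>+y. (u y - \<phi> k (0, y))\<^sup>2))"
    by (intro nn_integral_cong) (auto simp: indicator_def)
   also have "\<dots> = ennreal e * (\<integral>\<^sub>+y. (u y - \<phi> k (0, y))\<^sup>2)"
    using e by (subst nn_integral_multc) auto
   also have "(\<integral>\<^sub>+y. (u y - \<phi> k (0, y))\<^sup>2) = ennreal (d0 k)"
    using id0[of k] by (subst nn_integral_eq_integral) (auto simp: d0_def)
   finally show "(\<integral>\<^sub>+z. ?B k z) \<le> ennreal (e * d0 k)"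
    using e dk0 by (simp add: ennreal_mult)
  qed auto
  also have "\<dots> = ennreal (3 * d k + (3 * (4 * e\<^sup>2 * (2 * S + 2 * d k)) + 3 * (e * d0 k)))"
   using e S0 dk0[of k] by (simp only: ennreal_mult'[symmetric] ennreal_plus[symmetric] mult_nonneg_nonneg add_nonneg_nonneg zero_le_power2 zero_le_numeral less_imp_le)
  finally show ?thesis by (simp only: \<epsilon>_def add.assoc)
 qed
 have "\<epsilon> \<longlonglongrightarrow> 3 * 0 + 3 * (4 * e\<^sup>2 * (2 * S + 2 * 0)) + 3 * (e * 0)"
  unfolding \<epsilon>_def[abs_def] using lim lim0 by (intro tendsto_intros) (simp_all add: d_def[abs_def] d0_def[abs_def])
 then have "(\<lambda>k. ennreal (\<epsilon> k)) \<longlonglongrightarrow> ennreal (24 * e\<^sup>2 * S)" by (intro tendsto_ennrealI) (simp add: mult.assoc)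
 then show ?thesis unfolding S_def[symmetric] using le by (intro LIMSEQ_le_const) auto
qed

lemma bessel_sym: "bessel q ((0::real, a) - (0, b)) = bessel q ((0::real, b) - (0, a :: real^'n))"
 by (simp add: bessel_def norm_Pair norm_minus_commute)

text \<open>At the boundary the kernel is still integrable along the hyperplane, so its convolution with
 an integrable function is finite almost everywhere.\<close>

lemma layer_finite_AE:
 fixes h k :: "real^'n \<Rightarrow> real"
 assumes q: "q > 0" and [measurable]: "h \<in> Borel" "k \<in> Borel"
  and h: "\<And>y. \<bar>h y\<bar> \<le> C + k y" and k: "\<And>y. 0 \<le> k y" "L1 k" and C: "C \<ge> 0"
 shows "AE y in lborel. (\<integral>\<^sup>+y'. ennreal (bessel q ((0::real, y) - (0, y'))) * ennreal \<bar>h y'\<bar>) < \<infinity>"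
proof -
 let ?b = "\<lambda>(y::real^'n) y'. ennreal (bessel q ((0::real, y) - (0, y')))"
 have bm: "(\<lambda>(y, y'). ?b y y') \<in> borel_measurable (borel \<Otimes>\<^sub>M borel)"
 proof -
  have "(\<lambda>p::(real^'n)\<times>(real^'n). (0::real, fst p) - (0, snd p)) \<in> Borel"
   by (intro borel_measurable_continuous_onI continuous_intros)
  from measurable_compose[OF this bessel_measurable[of q]] show ?thesis by (simp add: borel_prod split_beta')
 qed
 note bm[measurable]
 have fin: "(\<integral>\<^sup>+y. \<integral>\<^sup>+y'. ?b y y' * ennreal (k y') \<partial>lborel) < \<infinity>"
 proof -
  have "(\<integral>\<^sup>+y. \<integral>\<^sup>+y'. ?b y y' * ennreal (k y') \<partial>lborel) = (\<integral>\<^sup>+y'. \<integral>\<^sup>+y. ?b y y' * ennreal (k y') \<partial>lborel)"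
   by (rule lborel_pair.Fubini'[symmetric]) measurable
  also have "\<dots> \<le> (\<integral>\<^sup>+y'. ennreal (slice_mass TYPE('n) q) * ennreal (k y'))"
  proof (rule nn_integral_mono)
   fix y' :: "real^'n"
   have "(\<integral>\<^sup>+y. ?b y y' * ennreal (k y')) = (\<integral>\<^sub>+y. bessel q ((0::real, y') - (0, y))) * ennreal (k y')"
    unfolding bessel_sym[of q _ y'] by (rule nn_integral_multc) measurable
   also have "\<dots> \<le> ennreal (slice_mass TYPE('n) q) * ennreal (k y')" by (intro mult_right_mono bessel_slice_nn q) simp
   finally show "(\<integral>\<^sup>+y. ?b y y' * ennreal (k y')) \<le> ennreal (slice_mass TYPE('n) q) * ennreal (k y')" .
  qed
  also have "\<dots> < \<infinity>" using k by (auto simp: nn_integral_cmult ennreal_mult_less_top integrable_iff_bounded)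
  finally show ?thesis .
 qed
 have "AE y in lborel. (\<integral>\<^sup>+y'. ?b y y' * ennreal (k y')) \<noteq> \<infinity>"
  using fin by (intro nn_integral_PInf_AE) auto
 then show ?thesis
 proof eventually_elim
  case (elim y)
  have "(\<integral>\<^sup>+y'. ?b y y' * ennreal \<bar>h y'\<bar>) \<le> (\<integral>\<^sup>+y'. ?b y y' * ennreal C + ?b y y' * ennreal (k y'))"
  proof (rule nn_integral_mono)
   fix y'
   have "ennreal \<bar>h y'\<bar> \<le> ennreal C + ennreal (k y')" using h[of y'] C k(1)[of y'] by (simp add: ennreal_leI flip: ennreal_plus)
   then show "?b y y' * ennreal \<bar>h y'\<bar> \<le> ?b y y' * ennreal C + ?b y y' * ennreal (k y')"
    by (simp add: distrib_left[symmetric] mult_left_mono)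
  qed
  also have "\<dots> = (\<integral>\<^sup>+y'. ?b y y') * ennreal C + (\<integral>\<^sup>+y'. ?b y y' * ennreal (k y'))"
   by (subst nn_integral_add) (auto simp: nn_integral_multc)
  also have "\<dots> < \<infinity>"
  proof -
   have "(\<integral>\<^sup>+y'. ?b y y') < \<infinity>" using bessel_slice_nn[OF q, of "(0, y)"] by (simp add: order_le_less_trans)
   then show ?thesis using elim by (auto simp: ennreal_mult_less_top less_top)
  qed
  finally show ?case .
 qed
qed

text \<open>The kernel decreases with the distance to the boundary, so its boundary value is a dominating
 function.\<close>

lemma layer_boundary_limit:
 fixes h :: "real^'n \<Rightarrow> real"
 assumes q: "q > 0" and [measurable]: "h \<in> Borel"
  and fin: "(\<integral>\<^sup>+y'. ennreal (bessel q ((0::real, y) - (0, y'))) * ennreal \<bar>h y'\<bar>) < \<infinity>"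
  and X: "X \<longlonglongrightarrow> 0"
 shows "(\<lambda>n. layer (bessel q) h (X n, y)) \<longlonglongrightarrow> layer (bessel q) h (0, y)"
 unfolding layer_def
proof (rule integral_dominated_convergence[where w="\<lambda>y'. bessel q ((0::real, y) - (0, y')) * \<bar>h y'\<bar>"])
 show "L1 (\<lambda>y'. bessel q ((0::real, y) - (0, y')) * \<bar>h y'\<bar>)"
  using fin by (intro integrableI_bounded) (auto simp: abs_mult bessel_nonneg ennreal_mult)
 have ne: "AE y' in lborel. y' \<noteq> y" by (rule AE_lborel_singleton)
 show "AE y' in lborel. (\<lambda>n. bessel q ((X n, y) - (0, y')) * h y') \<longlonglongrightarrow> bessel q ((0::real, y) - (0, y')) * h y'"
  using ne
 proof eventually_elim
  case (elim y')
  have pos: "norm (y - y') > 0" using elim by simp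
  have c: "isCont (theta q (real CARD('n))) ((norm (y - y'))\<^sup>2)"
   using theta_continuous[OF q] pos by (simp add: continuous_on_eq_continuous_at)
  have "(\<lambda>n. (X n)\<^sup>2 + (norm (y - y'))\<^sup>2) \<longlonglongrightarrow> 0\<^sup>2 + (norm (y - y'))\<^sup>2" using X by (intro tendsto_intros)
  then have "(\<lambda>n. theta q (real CARD('n)) ((X n)\<^sup>2 + (norm (y - y'))\<^sup>2)) \<longlonglongrightarrow> theta q (real CARD('n)) ((norm (y - y'))\<^sup>2)"
   using isCont_tendsto_compose[OF c] by simp
  then show ?case unfolding bessel_half by (intro tendsto_mult tendsto_divide tendsto_const) auto
 qed
 show "AE y' in lborel. norm (bessel q ((X n, y) - (0, y')) * h y') \<le> bessel q ((0::real, y) - (0, y')) * \<bar>h y'\<bar>" for n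
  using ne
 proof eventually_elim
  case (elim y')
  have pos: "norm (y - y') > 0" using elim by simp
  have "bessel q ((X n, y) - (0, y')) \<le> bessel q ((0::real, y) - (0, y'))"
   unfolding bessel_half using pos by (intro divide_right_mono theta_mono q) auto
  then show ?case by (simp add: abs_mult bessel_nonneg mult_right_mono)
 qed
qed measurable


text \<open>By the averaged bound there are heights tending to zero at which the slices of the potential
 converge to \<open>u\<close> in \<open>L\<^sup>2\<close>, while they converge pointwise almost everywhere to the boundary value of
 the potential; Fatou's lemma shows that both limits agree.\<close>

lemma trace_eq_layer:
 fixes v0 :: "real \<times> (real^'n) \<Rightarrow> real"
 assumes q: "q > 0" and [measurable]: "v0 \<in> Borel" "u \<in> Borel" "h \<in> Borel" "k \<in> Borel"
  and h: "\<And>y. \<bar>h y\<bar> \<le> C + k y" and k: "\<And>y. 0 \<le> k y" "L1 k" and C: "C \<ge> 0"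
  and rep: "AE z in lborel. z \<in> half_space \<longrightarrow> v0 z = 2 * layer (bessel q) h z"
  and inc: "\<And>e. e > 0 \<Longrightarrow> (\<integral>\<^sub>+z. indicator {0<..<e} (fst z) * (v0 z - u (snd z))\<^sup>2) \<le> ennreal (e\<^sup>2 * S)"
 shows "AE y in lborel. u y = 2 * layer (bessel q) h (0, y)"
proof -
 define V where "V z = 2 * layer (bessel q) h z" for z
 have Vm[measurable]: "V \<in> Borel" unfolding V_def[abs_def] by measurable
 define a where "a x = (\<integral>\<^sub>+y. (V (x, y) - u y)\<^sup>2)" for x
 have ex: "\<exists>x. 0 < x \<and> x < e \<and> a x \<le> ennreal (e * (\<bar>S\<bar> + 1))" if e: "e > 0" for e
 proof (rule ccontr)
  assume neg: "\<not> ?thesis"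
  have "ennreal (e * (\<bar>S\<bar> + 1)) * ennreal e = (\<integral>\<^sup>+x. ennreal (e * (\<bar>S\<bar> + 1)) * indicator {0<..<e} x)"
   using e by (subst nn_integral_cmult_indicator) auto
  also have "\<dots> \<le> (\<integral>\<^sup>+x. \<integral>\<^sup>+y. ennreal (indicator {0<..<e} x * (V (x, y) - u y)\<^sup>2) \<partial>lborel)"
   using neg by (intro nn_integral_mono) (auto simp: indicator_def a_def not_le less_imp_le)
  also have "\<dots> = (\<integral>\<^sub>+z. indicator {0<..<e} (fst z) * (V z - u (snd z))\<^sup>2)"
   by (subst nn_integral_lborel_fst) auto
  also have "\<dots> = (\<integral>\<^sub>+z. indicator {0<..<e} (fst z) * (v0 z - u (snd z))\<^sup>2)"
  proof (rule nn_integral_cong_AE)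
   show "AE z in lborel. ennreal (indicator {0<..<e} (fst z) * (V z - u (snd z))\<^sup>2) = ennreal (indicator {0<..<e} (fst z) * (v0 z - u (snd z))\<^sup>2)"
    using rep by eventually_elim (auto simp: V_def indicator_def mem_half_space)
  qed
  also have "\<dots> \<le> ennreal (e\<^sup>2 * S)" by (rule inc[OF e])
  also have "\<dots> \<le> ennreal (e\<^sup>2 * \<bar>S\<bar>)" by (intro ennreal_leI mult_left_mono) auto
  finally have "ennreal (e\<^sup>2 * \<bar>S\<bar> + e\<^sup>2) \<le> ennreal (e\<^sup>2 * \<bar>S\<bar>)"
   using e by (simp add: ennreal_mult[symmetric] power2_eq_square algebra_simps del: ennreal_plus)
  then show False using e by (subst (asm) ennreal_le_iff) auto
 qed
 define e where "e n = 1 / real (Suc n)" for n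
 have "\<forall>n. \<exists>x. 0 < x \<and> x < e n \<and> a x \<le> ennreal (e n * (\<bar>S\<bar> + 1))" by (intro allI ex) (simp add: e_def)
 then obtain X where X: "\<And>n. 0 < X n" "\<And>n. X n < e n" "\<And>n. a (X n) \<le> ennreal (e n * (\<bar>S\<bar> + 1))" by metis
 have e0: "e \<longlonglongrightarrow> 0" unfolding e_def by real_asymp
 have X0: "X \<longlonglongrightarrow> 0"
  by (rule tendsto_sandwich[OF _ _ tendsto_const e0]) (use X in \<open>auto intro!: always_eventually less_imp_le\<close>)
 have "AE y in lborel. (\<integral>\<^sup>+y'. ennreal (bessel q ((0::real, y) - (0, y'))) * ennreal \<bar>h y'\<bar>) < \<infinity>"
  by (rule layer_finite_AE[OF q _ _ h k C]) measurable
 then have "AE y in lborel. ennreal ((V (0, y) - u y)\<^sup>2) = liminf (\<lambda>n. ennreal ((V (X n, y) - u y)\<^sup>2))"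
 proof eventually_elim
  case (elim y)
  have "(\<lambda>n. ennreal ((V (X n, y) - u y)\<^sup>2)) \<longlonglongrightarrow> ennreal ((V (0, y) - u y)\<^sup>2)"
   unfolding V_def by (intro tendsto_ennrealI tendsto_intros layer_boundary_limit[OF q _ elim X0]) measurable
  from lim_imp_Liminf[OF _ this] show ?case by simp
 qed
 then have "(\<integral>\<^sub>+y. (V (0, y) - u y)\<^sup>2) = (\<integral>\<^sup>+y. liminf (\<lambda>n. ennreal ((V (X n, y) - u y)\<^sup>2)))"
  by (rule nn_integral_cong_AE)
 also have "\<dots> \<le> liminf (\<lambda>n. a (X n))" unfolding a_def by (rule nn_integral_liminf) measurable
 also have "\<dots> \<le> liminf (\<lambda>n. ennreal (e n * (\<bar>S\<bar> + 1)))" by (intro Liminf_mono always_eventually allI X)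
 also have "\<dots> = 0"
 proof -
  have "(\<lambda>n. ennreal (e n * (\<bar>S\<bar> + 1))) \<longlonglongrightarrow> ennreal (0 * (\<bar>S\<bar> + 1))" by (intro tendsto_ennrealI tendsto_intros e0)
  from lim_imp_Liminf[OF _ this] show ?thesis by simp
 qed
 finally have "(\<integral>\<^sub>+y. (V (0, y) - u y)\<^sup>2) = 0" by simp
 then have "AE y in lborel. ennreal ((V (0, y) - u y)\<^sup>2) = 0" by (subst (asm) nn_integral_0_iff_AE) auto
 then show ?thesis by eventually_elim (simp add: V_def)
qed

section \<open>Bootstrapping a linear convolution inequality\<close>

text \<open>Split \<open>H = H1 + H2\<close> at a height \<open>M\<close> so that \<open>H1\<close> is bounded and \<open>H2\<close> has mass at most \<open>1/2\<close>.
 The bound \<open>U \<le> 1 + k\<close> makes \<open>H1 * U\<close> bounded by a constant \<open>K\<close>, and then the excess \<open>Z = max 0 (U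
 - 2 K)\<close> satisfies \<open>Z \<le> H2 * Z\<close>. Since \<open>Z \<le> k\<close> is integrable, integration gives \<open>\<integral>Z \<le> (\<integral>Z) / 2\<close>, so
 \<open>Z\<close> vanishes.\<close>

lemma bounded_of_convolution_inequality:
 fixes H U k :: "'a::euclidean_space \<Rightarrow> real"
 assumes [measurable]: "H \<in> Borel" "U \<in> Borel" "k \<in> Borel"
  and H: "\<And>y. 0 \<le> H y" "L1 H" and U: "\<And>y. 0 \<le> U y" "\<And>y. U y \<le> 1 + k y"
  and k: "\<And>y. 0 \<le> k y" "L1 k"
  and ineq: "AE y in lborel. ennreal (U y) \<le> (\<integral>\<^sub>+y'. H (y - y') * U y')"
 shows "\<exists>K. AE y in lborel. U y \<le> K"
proof -
 let ?T = "\<lambda>n y. indicator {z. H z > real n} y * H y"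
 have tail: "(\<lambda>n. \<integral>y. ?T n y \<partial>lborel) \<longlonglongrightarrow> (\<integral>y. 0 \<partial>(lborel :: 'a measure))"
 proof (rule integral_dominated_convergence[where w=H])
  show "AE y in lborel. (\<lambda>n. ?T n y) \<longlonglongrightarrow> 0"
  proof (rule AE_I2)
   fix y
   obtain n0 :: nat where "H y \<le> real n0" using real_arch_simple by blast
   then have "\<forall>\<^sub>F n in sequentially. ?T n y = 0"
    unfolding eventually_sequentially by (intro exI[of _ n0]) (auto simp: indicator_def)
   then show "(\<lambda>n. ?T n y) \<longlonglongrightarrow> 0" by (rule tendsto_eventually)
  qed
 qed (use H in \<open>auto simp: indicator_def\<close>)
 then have "\<forall>\<^sub>F n in sequentially. (\<integral>y. ?T n y) < 1/2"
  by (intro order_tendstoD(2)[OF tail]) auto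
 then obtain M :: nat where M: "(\<integral>y. ?T M y) < 1/2"
  by (auto simp: eventually_sequentially)
 define H2 where "H2 y = indicator {z. H z > real M} y * H y" for y
 define H1 where "H1 y = indicator {z. H z \<le> real M} y * H y" for y
 have [measurable]: "H1 \<in> Borel" "H2 \<in> Borel" unfolding H1_def[abs_def] H2_def[abs_def] by measurable
 have Hs: "H y = H1 y + H2 y" "0 \<le> H1 y" "0 \<le> H2 y" "H1 y \<le> H y" "H1 y \<le> real M" "H2 y \<le> H y" for y
  using H(1)[of y] by (auto simp: H1_def H2_def indicator_def)
 have iH2: "L1 H2" by (rule Bochner_Integration.integrable_bound[OF H(2)]) (use Hs H in auto)
 have nH2: "(\<integral>\<^sub>+y. H2 (y - y')) \<le> ennreal (1/2)" "(\<integral>\<^sub>+y'. H2 (y - y')) \<le> ennreal (1/2)" for y y'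
 proof -
  have "(\<integral>\<^sub>+y. H2 y) = ennreal (\<integral>y. H2 y)" using iH2 Hs by (intro nn_integral_eq_integral) auto
  also have "\<dots> \<le> ennreal (1/2)" using M by (intro ennreal_leI) (simp add: H2_def)
  finally have *: "(\<integral>\<^sub>+y. H2 y) \<le> ennreal (1/2)" .
  show "(\<integral>\<^sub>+y. H2 (y - y')) \<le> ennreal (1/2)"
   using nn_integral_lborel_translate[of "\<lambda>y. ennreal (H2 y)" "- y'"] * by simp
  show "(\<integral>\<^sub>+y'. H2 (y - y')) \<le> ennreal (1/2)"
   using nn_integral_lborel_reflect[of "\<lambda>y. ennreal (H2 y)" y] * by simp
 qed
 define A where "A = (\<integral>y. H y)"
 define B where "B = (\<integral>y. k y)"
 have AB: "A \<ge> 0" "B \<ge> 0" using H k by (simp_all add: A_def B_def)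
 define K where "K = 1 + A + real M * B"
 have K: "K \<ge> 1" using AB by (simp add: K_def)
 have low: "(\<integral>\<^sub>+y'. H1 (y - y') * U y') \<le> ennreal (A + real M * B)" for y
 proof -
  have "(\<integral>\<^sub>+y'. H1 (y - y') * U y') \<le> (\<integral>\<^sup>+y'. ennreal (H (y - y')) + ennreal (real M) * ennreal (k y'))"
  proof (rule nn_integral_mono)
   fix y'
   have "H1 (y - y') * U y' \<le> H1 (y - y') * (1 + k y')" using Hs U by (intro mult_left_mono) auto
   also have "\<dots> \<le> H (y - y') + real M * k y'" using Hs(4,5)[of "y - y'"] k(1)[of y'] mult_right_mono[of "H1 (y - y')" "real M" "k y'"] by (simp add: distrib_left)
   finally show "ennreal (H1 (y - y') * U y') \<le> ennreal (H (y - y')) + ennreal (real M) * ennreal (k y')"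
    using H(1)[of "y - y'"] k(1)[of y'] by (simp add: ennreal_mult[symmetric] ennreal_leI flip: ennreal_plus)
  qed
  also have "\<dots> = (\<integral>\<^sub>+y'. H (y - y')) + ennreal (real M) * (\<integral>\<^sub>+y'. k y')"
   by (simp add: nn_integral_add nn_integral_cmult)
  also have "(\<integral>\<^sub>+y'. H (y - y')) = (\<integral>\<^sub>+y'. H y')"
   using nn_integral_lborel_reflect[of "\<lambda>y. ennreal (H y)" y] by simp
  also have "\<dots> = ennreal A" using H by (simp add: A_def nn_integral_eq_integral)
  also have "(\<integral>\<^sub>+y'. k y') = ennreal B" using k by (simp add: B_def nn_integral_eq_integral)
  finally show ?thesis using AB by (simp add: ennreal_mult[symmetric] flip: ennreal_plus)
 qed
 (* With U \<le> 2 * K + Z the kernel H2 contributes at most K from the constant, so 2 * K is recovered on the right hand side. *)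
 define Z where "Z y = max 0 (U y - 2 * K)" for y
 have [measurable]: "Z \<in> Borel" unfolding Z_def[abs_def] by measurable
 have Z0: "0 \<le> Z y" for y by (simp add: Z_def)
 have Zk: "Z y \<le> k y" for y using U(2)[of y] k(1)[of y] K by (auto simp: Z_def)
 have UZ: "U y \<le> 2 * K + Z y" for y by (simp add: Z_def)
 let ?Q = "\<lambda>y y'. ennreal (H2 (y - y')) * ennreal (Z y')"
 have Zineq: "AE y in lborel. ennreal (Z y) \<le> (\<integral>\<^sup>+y'. ?Q y y')"
  using ineq
 proof eventually_elim
  case (elim y)
  have "ennreal (U y) \<le> (\<integral>\<^sub>+y'. H (y - y') * U y')" by fact
  also have "\<dots> \<le> (\<integral>\<^sup>+y'. ennreal (H1 (y - y') * U y') + (ennreal (H2 (y - y')) * ennreal (2 * K) + ?Q y y'))"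
  proof (rule nn_integral_mono)
   fix y'
   have "H (y - y') * U y' = H1 (y - y') * U y' + H2 (y - y') * U y'" using Hs(1)[of "y - y'"] by (simp add: distrib_right)
   also have "\<dots> \<le> H1 (y - y') * U y' + H2 (y - y') * (2 * K + Z y')" using Hs UZ by (intro add_left_mono mult_left_mono) auto
   finally have "ennreal (H (y - y') * U y') \<le> ennreal (H1 (y - y') * U y' + (H2 (y - y') * (2 * K) + H2 (y - y') * Z y'))"
    by (intro ennreal_leI) (simp add: distrib_left)
   also have "\<dots> = ennreal (H1 (y - y') * U y') + (ennreal (H2 (y - y')) * ennreal (2 * K) + ?Q y y')"
    using Hs U K Z0 by (simp add: ennreal_mult)
   finally show "ennreal (H (y - y') * U y') \<le> ennreal (H1 (y - y') * U y') + (ennreal (H2 (y - y')) * ennreal (2 * K) + ?Q y y')" .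
  qed
  also have "\<dots> = (\<integral>\<^sub>+y'. H1 (y - y') * U y') + ((\<integral>\<^sub>+y'. H2 (y - y')) * ennreal (2 * K) + (\<integral>\<^sup>+y'. ?Q y y'))"
   by (simp add: nn_integral_add nn_integral_multc)
  also have "\<dots> \<le> ennreal (A + real M * B) + (ennreal (1/2) * ennreal (2 * K) + (\<integral>\<^sup>+y'. ?Q y y'))"
   by (intro add_mono low mult_right_mono nH2) auto
  also have "\<dots> \<le> ennreal (2 * K) + (\<integral>\<^sup>+y'. ?Q y y')"
  proof -
   have "ennreal (A + real M * B) + ennreal (1/2) * ennreal (2 * K) = ennreal (A + real M * B + K)"
    using AB K by (subst ennreal_mult[symmetric]) (auto simp: ennreal_plus[symmetric] simp del: ennreal_plus)
   also have "\<dots> \<le> ennreal (2 * K)" by (intro ennreal_leI) (simp add: K_def)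
   finally show ?thesis by (simp only: add.assoc[symmetric] add_right_mono)
  qed
  finally have *: "ennreal (U y) \<le> ennreal (2 * K) + (\<integral>\<^sup>+y'. ?Q y y')" .
  show ?case
  proof (cases "U y \<le> 2 * K")
   case False
   then have "ennreal (U y) = ennreal (2 * K) + ennreal (Z y)" using K Z0[of y] by (subst ennreal_plus[symmetric]) (auto simp: Z_def)
   then show ?thesis using * by (simp add: ennreal_add_left_cancel_le)
  qed (simp add: Z_def)
 qed
 have ZI: "(\<integral>\<^sub>+y. Z y) \<le> ennreal (1/2) * (\<integral>\<^sub>+y. Z y)"
 proof -
  have "(\<integral>\<^sub>+y. Z y) \<le> (\<integral>\<^sup>+y. \<integral>\<^sup>+y'. ?Q y y' \<partial>lborel)"
   by (rule nn_integral_mono_AE[OF Zineq])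
  also have "\<dots> = (\<integral>\<^sup>+y'. \<integral>\<^sup>+y. ?Q y y' \<partial>lborel)"
   by (rule lborel_pair.Fubini'[symmetric]) measurable
  also have "\<dots> \<le> (\<integral>\<^sup>+y'. ennreal (1/2) * ennreal (Z y'))"
  proof (rule nn_integral_mono)
   fix y'
   have "(\<integral>\<^sup>+y. ?Q y y') = (\<integral>\<^sub>+y. H2 (y - y')) * ennreal (Z y')"
    by (rule nn_integral_multc) measurable
   also have "\<dots> \<le> ennreal (1/2) * ennreal (Z y')" by (intro mult_right_mono nH2) simp
   finally show "(\<integral>\<^sup>+y. ?Q y y') \<le> ennreal (1/2) * ennreal (Z y')" .
  qed
  also have "\<dots> = ennreal (1/2) * (\<integral>\<^sub>+y. Z y)" by (rule nn_integral_cmult) measurable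
  finally show ?thesis .
 qed
 have iZ: "L1 Z" by (rule Bochner_Integration.integrable_bound[OF k(2)]) (use Zk Z0 k in auto)
 have "(\<integral>\<^sub>+y. Z y) = 0"
 proof -
  have e: "(\<integral>\<^sub>+y. Z y) = ennreal (\<integral>y. Z y)" using iZ Z0 by (intro nn_integral_eq_integral) auto
  have n: "0 \<le> (\<integral>y. Z y)" using Z0 by simp
  have "(\<integral>y. Z y) \<le> 1/2 * (\<integral>y. Z y)"
   using ZI n unfolding e by (subst (asm) ennreal_mult[symmetric]) (auto simp del: ennreal_half simp: ennreal_le_iff)
  then have "(\<integral>y. Z y) = 0" using n by simp
  then show ?thesis unfolding e by simp
 qed
 then have "AE y in lborel. ennreal (Z y) = 0" by (subst (asm) nn_integral_0_iff_AE) auto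
 then have "AE y in lborel. U y \<le> 2 * K" by eventually_elim (auto simp: Z_def ennreal_eq_0_iff)
 then show ?thesis by blast
qed

section \<open>Boundedness of the trace\<close>

text \<open>Jensen's inequality for the weight \<open>s\<^bsup>-(1-\<epsilon>)\<^esup> exp (- q s\<^sup>2 / 2)\<close>, which is integrable since
 its exponent exceeds minus one. The power \<open>\<sigma>\<close> of the singular kernel is thereby controlled by a
 kernel of the same family, whose integrability on a \<open>D\<close>-dimensional slice is known.\<close>

lemma theta_powr_le:
 assumes q: "q > 0" and \<sigma>: "\<sigma> \<ge> 1" "\<sigma> * (a - 1) < D"
 shows "\<exists>C>0. \<exists>k. k - D < 1 \<and> (\<forall>r>0. theta q a r powr \<sigma> \<le> C * theta (q / 2) k (\<sigma> * r))"
proof -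
 (* \<epsilon> distributes half of the slack in \<sigma> * (a - 1) < D, and k is the exponent of s that Jensen's inequality produces. *)
 define \<epsilon> where "\<epsilon> = (D - \<sigma> * (a - 1)) / (2 * \<sigma>)"
 have \<epsilon>: "\<epsilon> > 0" using \<sigma> by (simp add: \<epsilon>_def)
 define k where "k = 1 - \<epsilon> + \<sigma> * (a - 1 + \<epsilon>)"
 have k: "k - D < 1"
 proof -
  have "\<sigma> * \<epsilon> = (D - \<sigma> * (a - 1)) / 2" using \<sigma> by (simp add: \<epsilon>_def)
  moreover have "k = 1 - \<epsilon> + \<sigma> * (a - 1) + \<sigma> * \<epsilon>" by (simp add: k_def distrib_left)
  moreover have "(D - \<sigma> * (a - 1)) / 2 > 0" using \<sigma> by simp
  moreover have "(D - \<sigma> * (a - 1)) / 2 = D / 2 - \<sigma> * (a - 1) / 2" by (simp add: diff_divide_distrib)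
  ultimately show ?thesis using \<epsilon> by linarith
 qed
 define A where "A = theta (q / 2) (1 - \<epsilon>) 0 + 1"
 have A: "A > 0" by (simp add: A_def theta_nonneg add_nonneg_pos)
 define C where "C = 2 powr \<sigma> * A powr (\<sigma> - 1)"
 have C: "C > 0" using A by (simp add: C_def)
 have "theta q a r powr \<sigma> \<le> C * theta (q / 2) k (\<sigma> * r)" if r: "r > 0" for r
 proof -
  define w where "w s = theta_ker (q / 2) (1 - \<epsilon>) 0 s" for s
  define g where "g s = indicator {0<..} s * (s powr (1 - \<epsilon> - a) * exp (- (q / 2) * s\<^sup>2 - r / s\<^sup>2))" for s :: real
  have wm[measurable]: "w \<in> Borel" unfolding w_def[abs_def] by measurable
  have gm[measurable]: "g \<in> Borel" unfolding g_def[abs_def] by measurable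
  have wg: "w s * g s = theta_ker q a r s" for s
  proof (cases "s > 0")
   case True
   have "s powr (- (1 - \<epsilon>)) * s powr (1 - \<epsilon> - a) = s powr (- a)" by (simp add: powr_add[symmetric])
   moreover have "exp (- (q / 2) * s\<^sup>2 - 0 / s\<^sup>2) * exp (- (q / 2) * s\<^sup>2 - r / s\<^sup>2) = exp (- q * s\<^sup>2 - r / s\<^sup>2)"
    by (simp add: exp_add[symmetric])
   ultimately show ?thesis using True by (simp add: w_def g_def theta_ker_def mult_ac)
  qed (simp add: w_def g_def theta_ker_def)
  have wgs: "w s * g s powr \<sigma> \<le> theta_ker (q / 2) k (\<sigma> * r) s" for s
  proof (cases "s > 0")
   case s: True
   have "g s powr \<sigma> = s powr (\<sigma> * (1 - \<epsilon> - a)) * exp (\<sigma> * (- (q / 2) * s\<^sup>2 - r / s\<^sup>2))"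
    using s by (simp add: g_def powr_mult powr_powr exp_powr_real mult.commute)
   moreover have "exp (\<sigma> * (- (q / 2) * s\<^sup>2 - r / s\<^sup>2)) \<le> exp (- (\<sigma> * r) / s\<^sup>2)"
    using \<sigma> q by (simp add: algebra_simps)
   ultimately have "w s * g s powr \<sigma> \<le> w s * (s powr (\<sigma> * (1 - \<epsilon> - a)) * exp (- (\<sigma> * r) / s\<^sup>2))"
    by (simp add: w_def theta_ker_nonneg mult_left_mono)
   also have "\<dots> = (s powr (- (1 - \<epsilon>)) * s powr (\<sigma> * (1 - \<epsilon> - a))) * (exp (- (q / 2) * s\<^sup>2) * exp (- (\<sigma> * r) / s\<^sup>2))"
    using s by (simp add: w_def theta_ker_def)
   also have "s powr (- (1 - \<epsilon>)) * s powr (\<sigma> * (1 - \<epsilon> - a)) = s powr (- k)"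
    by (simp add: powr_add[symmetric] k_def algebra_simps)
   also have "exp (- (q / 2) * s\<^sup>2) * exp (- (\<sigma> * r) / s\<^sup>2) = exp (- (q / 2) * s\<^sup>2 - \<sigma> * r / s\<^sup>2)"
    by (simp add: exp_add[symmetric])
   finally show ?thesis using s by (simp add: theta_ker_def)
  qed (simp add: w_def theta_ker_def)
  have "ennreal (theta q a r powr \<sigma>) \<le> ennreal (2 powr \<sigma> * A powr (\<sigma> - 1)) * (\<integral>\<^sub>+s. w s * g s powr \<sigma>)"
  proof (rule nn_integral_weighted_Jensen)
   show "ennreal (theta q a r) \<le> (\<integral>\<^sub>+s. w s * g s)"
    unfolding wg by (simp add: theta_nn[OF theta_ker_integrable[OF q r]])
   have "(\<integral>\<^sub>+s. w s) = ennreal (theta (q / 2) (1 - \<epsilon>) 0)"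
    unfolding w_def using q \<epsilon> by (subst theta_nn) (auto intro!: theta_ker_integrable_0)
   also have "\<dots> \<le> ennreal A" by (intro ennreal_leI) (simp add: A_def)
   finally show "(\<integral>\<^sub>+s. w s) \<le> ennreal A" .
  qed (use A \<sigma> in \<open>auto simp: w_def g_def theta_ker_nonneg theta_nonneg\<close>)
  also have "(\<integral>\<^sub>+s. w s * g s powr \<sigma>) \<le> (\<integral>\<^sub>+s. theta_ker (q / 2) k (\<sigma> * r) s)"
   by (intro nn_integral_mono ennreal_leI wgs)
  also have "\<dots> = ennreal (theta (q / 2) k (\<sigma> * r))" using q r \<sigma> by (subst theta_nn) (auto intro!: theta_ker_integrable)
  finally have "ennreal (theta q a r powr \<sigma>) \<le> ennreal (C * theta (q / 2) k (\<sigma> * r))"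
   using C by (simp add: C_def[symmetric] ennreal_mult theta_nonneg mult_left_mono)
  then show ?thesis using C by (subst (asm) ennreal_le_iff) (auto simp: theta_nonneg)
 qed
 then show ?thesis using C k by blast
qed

text \<open>The convolution kernel on the boundary; the factor two is the one in the representation
 formula.\<close>

definition slice_ker :: "real \<Rightarrow> real^'n \<Rightarrow> real" where
 "slice_ker q y = 2 * bessel q (0 :: real, y)"

lemma slice_ker_nonneg: "0 \<le> slice_ker q y" by (simp add: slice_ker_def bessel_nonneg)

lemma slice_ker_measurable [measurable]: "slice_ker q \<in> Borel"
 unfolding slice_ker_def[abs_def] by measurable

lemma slice_ker_theta: "slice_ker q (y::real^'n) = theta q (real CARD('n)) ((norm y)\<^sup>2) / pi powr ((1 + real CARD('n)) / 2)"
 by (simp add: slice_ker_def bessel_def norm_Pair)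

lemma slice_ker_integrable: "q > 0 \<Longrightarrow> L1 (slice_ker q :: real^'n \<Rightarrow> real)"
 unfolding slice_ker_theta[abs_def] using theta_slice_integrable[of q 1 0 "real CARD('n)", where 'a="real^'n"] by simp

lemma slice_ker_powr_integrable:
 assumes q: "q > 0" and \<sigma>: "\<sigma> \<ge> 1" "\<sigma> * (real CARD('n) - 1) < real CARD('n)"
 shows "L1 (\<lambda>y::real^'n. slice_ker q y powr \<sigma>)"
proof -
 obtain C k where C: "C > 0" "k - real CARD('n) < 1" "\<And>r. r > 0 \<Longrightarrow> theta q (real CARD('n)) r powr \<sigma> \<le> C * theta (q / 2) k (\<sigma> * r)"
  using theta_powr_le[OF q \<sigma>] by blast
 define c where "c = (1 / pi powr ((1 + real CARD('n)) / 2)) powr \<sigma>"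
 have c: "c > 0" by (simp add: c_def)
 have i: "L1 (\<lambda>y::real^'n. theta (q / 2) k (0 + \<sigma> * (norm y)\<^sup>2))"
  using q \<sigma> C(2) by (intro theta_slice_integrable) auto
 show ?thesis
 proof (rule Bochner_Integration.integrable_bound[OF integrable_mult_right[OF i, of "c * C"]])
  show "AE y in lborel. norm (slice_ker q (y::real^'n) powr \<sigma>) \<le> norm (c * C * theta (q / 2) k (0 + \<sigma> * (norm y)\<^sup>2))"
   using AE_lborel_singleton[of "0::real^'n"]
  proof eventually_elim
   case (elim y)
   have "slice_ker q y powr \<sigma> = c * theta q (real CARD('n)) ((norm y)\<^sup>2) powr \<sigma>"
    by (simp add: slice_ker_theta c_def powr_mult[symmetric])
   also have "\<dots> \<le> c * (C * theta (q / 2) k (\<sigma> * (norm y)\<^sup>2))" using C(3)[of "(norm y)\<^sup>2"] elim c by (intro mult_left_mono) auto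
   finally show ?case using c C(1) by (simp add: theta_nonneg mult.assoc)
  qed
 qed measurable
qed

text \<open>The two terms of the growth bound are treated by Jensen's inequality with the same exponent
 \<open>\<sigma>\<close>, for \<open>\<bar>u\<bar>\<close> with the kernel as weight and for \<open>\<bar>u\<bar>\<^sup>p\<close> with the weight \<open>\<bar>u\<bar>\<^sup>Q\<close>. The exponent is
 determined by \<open>Q + (p - Q) \<sigma> = \<sigma>\<close>, which makes both results linear in \<open>\<bar>u\<bar>\<^sup>\<sigma>\<close>.\<close>

theorem trace_bounded:
 fixes u :: "real^'n \<Rightarrow> real"
 assumes N: "CARD('n) \<ge> 2" and q: "q > 0" and um[measurable]: "u \<in> Borel"
  and squ: "L1 (\<lambda>y. (u y)\<^sup>2)"
  and Q: "L1 (\<lambda>y. \<bar>u y\<bar> powr Q)" "real CARD('n) * (p - 1) < Q" and p: "p > 1"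
  and fm[measurable]: "f \<in> Borel"
  and K: "K > 0" "\<And>t. \<bar>f t\<bar> \<le> K * (\<bar>t\<bar> + \<bar>t\<bar> powr p)"
  and rep: "AE y in lborel. u y = 2 * layer (bessel q) (\<lambda>y. f (u y)) (0, y)"
 shows "\<exists>M. AE y in lborel. \<bar>u y\<bar> \<le> M"
proof -
 let ?N = "real CARD('n)"
 have N2: "?N \<ge> 2" using N by simp
 have pq: "p - 1 < Q"
 proof -
  have "1 * (p - 1) \<le> ?N * (p - 1)" using N2 p by (intro mult_right_mono) auto
  from le_less_trans[OF this Q(2)] show ?thesis by simp
 qed
 define \<sigma> where "\<sigma> = Q / (Q - (p - 1))"
 have den: "Q - (p - 1) > 0" using pq by simp
 have \<sigma>1: "\<sigma> \<ge> 1" using den p by (simp add: \<sigma>_def field_simps)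
 have \<sigma>N: "\<sigma> * (?N - 1) < ?N"
 proof -
  have "Q * (?N - 1) < ?N * (Q - (p - 1))" using Q(2) by (simp add: algebra_simps)
  then show ?thesis using den by (simp add: \<sigma>_def field_simps)
 qed
 have \<sigma>2: "\<sigma> \<le> 2"
 proof -
  have "2 * (p - 1) \<le> ?N * (p - 1)" using N2 p by (intro mult_right_mono) auto
  then have "2 * (p - 1) \<le> Q" using Q(2) by linarith
  then show ?thesis using den by (simp add: \<sigma>_def field_simps)
 qed
 let ?G = "slice_ker q :: real^'n \<Rightarrow> real"
 define A1 where "A1 = (\<integral>y. ?G y) + 1"
 define A2 where "A2 = (\<integral>y. \<bar>u y\<bar> powr Q) + 1"
 have A1: "A1 > 0" unfolding A1_def using slice_ker_nonneg[of q] by (intro add_nonneg_pos Bochner_Integration.integral_nonneg) auto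
 have A2: "A2 > 0" unfolding A2_def by (intro add_nonneg_pos Bochner_Integration.integral_nonneg) auto
 have nA1: "(\<integral>\<^sub>+y'. ?G (y - y')) \<le> ennreal A1" for y
 proof -
  have "(\<integral>\<^sub>+y'. ?G (y - y')) = (\<integral>\<^sub>+y'. ?G y')"
   using nn_integral_lborel_reflect[of "\<lambda>y. ennreal (?G y)" y] by simp
  also have "\<dots> = ennreal (\<integral>y. ?G y)" using slice_ker_integrable[OF q] by (intro nn_integral_eq_integral) (auto simp: slice_ker_nonneg)
  also have "\<dots> \<le> ennreal A1" by (intro ennreal_leI) (simp add: A1_def)
  finally show ?thesis .
 qed
 have nA2: "(\<integral>\<^sub>+y. \<bar>u y\<bar> powr Q) \<le> ennreal A2"
  using Q(1) by (subst nn_integral_eq_integral) (auto simp: A2_def)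
 define U where "U y = \<bar>u y\<bar> powr \<sigma>" for y
 define c1 where "c1 = (2 * K) powr \<sigma> * (2 powr \<sigma> * A1 powr (\<sigma> - 1))"
 define c2 where "c2 = (2 * K) powr \<sigma> * (2 powr \<sigma> * A2 powr (\<sigma> - 1))"
 have c: "c1 \<ge> 0" "c2 \<ge> 0" by (simp_all add: c1_def c2_def)
 define H where "H y = c1 * ?G y + c2 * ?G y powr \<sigma>" for y
 have Um[measurable]: "U \<in> Borel" unfolding U_def[abs_def] by measurable
 have Hm[measurable]: "H \<in> Borel" unfolding H_def[abs_def] by measurable
 have "\<exists>M. AE y in lborel. U y \<le> M"
 proof (rule bounded_of_convolution_inequality[where H=H and k="\<lambda>y. (u y)\<^sup>2"])
  show "0 \<le> H y" for y using c by (simp add: H_def slice_ker_nonneg)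
  show "L1 H" unfolding H_def[abs_def]
   by (rule Bochner_Integration.integrable_add; rule integrable_mult_right)
    (rule slice_ker_integrable[OF q] slice_ker_powr_integrable[OF q \<sigma>1 \<sigma>N])+
  show "0 \<le> U y" for y by (simp add: U_def)
  show "U y \<le> 1 + (u y)\<^sup>2" for y
  proof (cases "\<bar>u y\<bar> \<le> 1")
   case True
   then have "\<bar>u y\<bar> powr \<sigma> \<le> 1 powr \<sigma>" using \<sigma>1 by (intro powr_mono2) auto
   then show ?thesis by (simp add: U_def add_increasing2)
  next
   case False
   then have "\<bar>u y\<bar> powr \<sigma> \<le> \<bar>u y\<bar> powr 2" using \<sigma>2 by (intro powr_mono) auto
   also have "\<dots> = (u y)\<^sup>2" using False by simp
   finally show ?thesis by (simp add: U_def)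
  qed
  show "AE y in lborel. ennreal (U y) \<le> (\<integral>\<^sub>+y'. H (y - y') * U y')"
   using rep
  proof eventually_elim
   case (elim y)
   let ?g = "\<lambda>y'. ?G (y - y')"
   let ?S = "\<lambda>y'. ennreal K * ennreal (?g y' * \<bar>u y'\<bar>) + ennreal K * ennreal (?g y' * \<bar>u y'\<bar> powr p)"
   let ?P = "\<lambda>y'. ?g y' * \<bar>u y'\<bar> powr \<sigma>"
   define I1 where "I1 = (\<integral>\<^sub>+y'. ?g y' * \<bar>u y'\<bar>)"
   define I2 where "I2 = (\<integral>\<^sub>+y'. ?g y' * \<bar>u y'\<bar> powr p)"
   have "\<bar>u y\<bar> = norm (\<integral>y'. ?g y' * f (u y'))"
    using elim by (simp add: layer_def slice_ker_def mult.assoc)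
   (* A divergent integral has the value zero by convention, so the bound holds in this case as well. *)
   then have "ennreal \<bar>u y\<bar> \<le> (\<integral>\<^sub>+y'. norm (?g y' * f (u y')))"
   proof (cases "L1 (\<lambda>y'. ?g y' * f (u y'))")
    case True
    then show ?thesis using integral_norm_bound_ennreal[OF True] \<open>\<bar>u y\<bar> = _\<close> by simp
   qed (simp add: not_integrable_integral_eq)
   also have "\<dots> \<le> (\<integral>\<^sup>+y'. ?S y')"
   proof (rule nn_integral_mono)
    fix y'
    have "norm (?g y' * f (u y')) \<le> ?g y' * (K * (\<bar>u y'\<bar> + \<bar>u y'\<bar> powr p))"
     using K(2)[of "u y'"] by (simp add: abs_mult slice_ker_nonneg mult_left_mono)
    also have "\<dots> = K * (?g y' * \<bar>u y'\<bar>) + K * (?g y' * \<bar>u y'\<bar> powr p)" by (simp add: algebra_simps)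
    finally show "ennreal (norm (?g y' * f (u y'))) \<le> ?S y'"
     using K(1) slice_ker_nonneg[of q "y - y'"] by (simp add: ennreal_mult[symmetric] ennreal_leI flip: ennreal_plus)
   qed
   also have "\<dots> = ennreal K * I1 + ennreal K * I2" by (simp add: nn_integral_add nn_integral_cmult I1_def I2_def)
   finally have sum: "ennreal \<bar>u y\<bar> \<le> ennreal K * I1 + ennreal K * I2" .
   (* One of the two terms carries at least half of the sum, and that one alone is raised to the power \<sigma>. *)
   define X where "X = \<bar>u y\<bar> / (2 * K)"
   have X0: "X \<ge> 0" using K by (simp add: X_def)
   have "ennreal X \<le> I1 \<or> ennreal X \<le> I2"
   proof (rule ccontr)
    assume "\<not> (ennreal X \<le> I1 \<or> ennreal X \<le> I2)"
    then have lt: "I1 < ennreal X" "I2 < ennreal X" by auto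
    then obtain i1 i2 where i: "I1 = ennreal i1" "i1 \<ge> 0" "I2 = ennreal i2" "i2 \<ge> 0"
     by (metis ennreal_cases less_top order_less_trans ennreal_less_top)
    then have "i1 < X" "i2 < X" using lt by (auto simp: ennreal_less_iff)
    then have "K * i1 + K * i2 < K * X + K * X" using K by (intro add_strict_mono) auto
    also have "\<dots> = \<bar>u y\<bar>" using K by (simp add: X_def field_simps)
    finally have "K * i1 + K * i2 < \<bar>u y\<bar>" .
    moreover have "\<bar>u y\<bar> \<le> K * i1 + K * i2"
     using sum K i by (simp add: ennreal_mult[symmetric] flip: ennreal_plus)
    ultimately show False by simp
   qed
   moreover have U_X: "U y = (2 * K) powr \<sigma> * X powr \<sigma>"
    using K by (simp add: U_def X_def powr_mult[symmetric])
   have 1: "ennreal (X powr \<sigma>) \<le> ennreal (2 powr \<sigma> * A1 powr (\<sigma> - 1)) * (\<integral>\<^sub>+y'. ?g y' * \<bar>u y'\<bar> powr \<sigma>)" if "ennreal X \<le> I1"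
    using that nA1[of y] A1 X0 \<sigma>1 unfolding I1_def by (intro nn_integral_weighted_Jensen) (auto simp: slice_ker_nonneg)
   have 2: "ennreal (X powr \<sigma>) \<le> ennreal (2 powr \<sigma> * A2 powr (\<sigma> - 1)) * (\<integral>\<^sub>+y'. ?g y' powr \<sigma> * \<bar>u y'\<bar> powr \<sigma>)" if "ennreal X \<le> I2"
   proof -
    have e1: "\<bar>u y'\<bar> powr Q * (?g y' * \<bar>u y'\<bar> powr (p - Q)) = ?g y' * \<bar>u y'\<bar> powr p" for y'
     using powr_add[of "\<bar>u y'\<bar>" Q "p - Q"] by (simp add: mult_ac)
    have exp: "Q + (p - Q) * \<sigma> = \<sigma>"
    proof -
     have "\<sigma> * (Q - (p - 1)) = Q" using den by (simp add: \<sigma>_def)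
     then show ?thesis by (simp add: algebra_simps)
    qed
    have e2: "\<bar>u y'\<bar> powr Q * (?g y' * \<bar>u y'\<bar> powr (p - Q)) powr \<sigma> = ?g y' powr \<sigma> * \<bar>u y'\<bar> powr \<sigma>" for y'
    proof -
     have "(?g y' * \<bar>u y'\<bar> powr (p - Q)) powr \<sigma> = ?g y' powr \<sigma> * \<bar>u y'\<bar> powr ((p - Q) * \<sigma>)"
      by (simp add: powr_mult powr_powr slice_ker_nonneg)
     moreover have "\<bar>u y'\<bar> powr Q * \<bar>u y'\<bar> powr ((p - Q) * \<sigma>) = \<bar>u y'\<bar> powr \<sigma>" by (simp add: powr_add[symmetric] exp)
     ultimately show ?thesis by (simp add: mult_ac)
    qed
    have "ennreal (X powr \<sigma>) \<le> ennreal (2 powr \<sigma> * A2 powr (\<sigma> - 1)) * (\<integral>\<^sub>+y'. \<bar>u y'\<bar> powr Q * (?g y' * \<bar>u y'\<bar> powr (p - Q)) powr \<sigma>)"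
    proof (rule nn_integral_weighted_Jensen)
     show "ennreal X \<le> (\<integral>\<^sub>+y'. \<bar>u y'\<bar> powr Q * (?g y' * \<bar>u y'\<bar> powr (p - Q)))"
      unfolding e1 using that by (simp add: I2_def)
    qed (use nA2 A2 X0 \<sigma>1 in \<open>auto simp: slice_ker_nonneg\<close>)
    then show ?thesis unfolding e2 .
   qed
   have conclude: ?case
    if le: "ennreal (X powr \<sigma>) \<le> ennreal D * (\<integral>\<^sub>+y'. F y')" and D: "D \<ge> 0" and [measurable]: "F \<in> Borel"
     and F: "\<And>y'. (2 * K) powr \<sigma> * D * F y' \<le> H (y - y') * U y'" for D F
   proof -
    have "ennreal (U y) = ennreal ((2 * K) powr \<sigma>) * ennreal (X powr \<sigma>)" unfolding U_X by (simp add: ennreal_mult)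
    also have "\<dots> \<le> ennreal ((2 * K) powr \<sigma>) * (ennreal D * (\<integral>\<^sub>+y'. F y'))" by (intro mult_left_mono le) simp
    also have "\<dots> = (\<integral>\<^sup>+y'. ennreal ((2 * K) powr \<sigma> * D) * ennreal (F y'))"
     using D by (simp add: nn_integral_cmult ennreal_mult mult.assoc)
    also have "\<dots> \<le> (\<integral>\<^sub>+y'. H (y - y') * U y')"
     using D F by (intro nn_integral_mono) (simp add: ennreal_mult'[symmetric] ennreal_leI del: ennreal_mult')
    finally show ?thesis .
   qed
   have HU: "H (y - y') * U y' = c1 * ?P y' + c2 * (?g y' powr \<sigma> * \<bar>u y'\<bar> powr \<sigma>)" for y'
    by (simp add: H_def U_def distrib_right)
   show ?case
    using \<open>ennreal X \<le> I1 \<or> ennreal X \<le> I2\<close>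
   proof
    assume "ennreal X \<le> I1"
    from 1[OF this] show ?thesis
     by (rule conclude) (use c in \<open>auto simp: HU c1_def[symmetric] slice_ker_nonneg\<close>)
   next
    assume "ennreal X \<le> I2"
    from 2[OF this] show ?thesis
     by (rule conclude) (use c in \<open>auto simp: HU c2_def[symmetric] slice_ker_nonneg\<close>)
   qed
  qed
 qed (use squ in \<open>auto\<close>)
 then obtain M where M: "AE y in lborel. U y \<le> M" by blast
 have "AE y in lborel. \<bar>u y\<bar> \<le> max 1 M"
  using M
 proof eventually_elim
  case (elim y)
  show ?case
  proof (cases "\<bar>u y\<bar> \<le> 1")
   case False
   then have "\<bar>u y\<bar> powr 1 \<le> \<bar>u y\<bar> powr \<sigma>" using \<sigma>1 by (intro powr_mono) auto
   then show ?thesis using elim by (simp add: U_def)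
  qed simp
 qed
 then show ?thesis by blast
qed

section \<open>Differentiating the layer potential\<close>

text \<open>For \<open>k = DIM('a) - 1\<close> this is the Bessel kernel up to a constant; \<open>radial1\<close> is its gradient,
 and \<open>radial2 q k b\<close> is the gradient of the component \<open>radial1 q k z \<bullet> b\<close>.\<close>

definition radial :: "real \<Rightarrow> real \<Rightarrow> 'a::euclidean_space \<Rightarrow> real" where
 "radial q k z = theta q k ((norm z)\<^sup>2)"

definition radial1 :: "real \<Rightarrow> real \<Rightarrow> 'a::euclidean_space \<Rightarrow> 'a" where
 "radial1 q k z = (- 2 * radial q (k + 2) z) *\<^sub>R z"

definition radial2 :: "real \<Rightarrow> real \<Rightarrow> 'a \<Rightarrow> 'a::euclidean_space \<Rightarrow> 'a" where
 "radial2 q k b z = (- 2 * radial q (k + 2) z) *\<^sub>R b + (4 * (z \<bullet> b) * radial q (k + 4) z) *\<^sub>R z"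

lemma radial_nonneg: "0 \<le> radial q k z"
 by (simp add: radial_def theta_nonneg)

lemma radial_derivative:
 assumes q: "q > 0" and z: "z \<noteq> 0"
 shows "(radial q k has_derivative (\<lambda>d. radial1 q k z \<bullet> d)) (at z)"
proof -
 have t: "(theta q k has_derivative (*) (- theta q (k + 2) (z \<bullet> z))) (at (z \<bullet> z))"
  using theta_deriv[OF q, of "z \<bullet> z" k] z by (simp add: has_field_derivative_def)
 have "((\<lambda>z. z \<bullet> z) has_derivative (\<lambda>d. 2 * (z \<bullet> d))) (at z)"
  by (auto intro!: derivative_eq_intros simp: inner_commute)
 from has_derivative_compose[OF this t] show ?thesis
  by (simp add: radial_def[abs_def] radial1_def power2_norm_eq_inner mult_ac)
qed

lemma radial1_derivative:
 assumes q: "q > 0" and z: "z \<noteq> 0"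
 shows "((\<lambda>z. radial1 q k z \<bullet> b) has_derivative (\<lambda>d. radial2 q k b z \<bullet> d)) (at z)"
 unfolding radial1_def radial2_def
 using radial_derivative[OF q z, of "k + 2"]
 by (auto intro!: derivative_eq_intros simp: radial1_def inner_add_left inner_commute algebra_simps)

lemma continuous_radial: "q > 0 \<Longrightarrow> continuous_on half_space (radial q k :: real \<times> (real^'n) \<Rightarrow> real)"
 unfolding radial_def
 by (rule continuous_on_compose2[OF theta_continuous]) (auto intro!: continuous_intros simp: mem_half_space zero_prod_def)

text \<open>A kernel of order \<open>k\<close> has at most the singularity \<open>\<bar>z\<bar>\<^bsup>1-k\<^esup>\<close> at the origin (if \<open>k > 1\<close>) and
 decays exponentially. The scale \<open>l\<close> is left free because absorbing powers of \<open>\<bar>z\<bar>\<close> into \<open>theta\<close>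
 shrinks its argument.\<close>

definition kernel_of_order :: "real \<Rightarrow> real \<Rightarrow> (real \<times> (real^'n) \<Rightarrow> 'b::real_normed_vector) \<Rightarrow> bool" where
 "kernel_of_order q k \<kappa> \<longleftrightarrow> continuous_on half_space \<kappa> \<and>
   (\<exists>C\<ge>0. \<exists>l>0. \<forall>z\<in>half_space. norm (\<kappa> z) \<le> C * theta q k (l * (norm z)\<^sup>2))"

lemma half_space_norm: "z \<in> half_space \<Longrightarrow> 0 < norm z"
 by (auto simp: mem_half_space)

lemma kernel_of_orderI:
 assumes q: "q > 0" and cont: "continuous_on half_space \<kappa>" and j: "j \<ge> 0" and C: "C \<ge> 0"
  and le: "\<And>z. z \<in> half_space \<Longrightarrow> norm (\<kappa> z) \<le> C * (norm z powr j * radial q k z)"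
 shows "kernel_of_order q (k - j) \<kappa>"
proof -
 obtain C' where C': "C' > 0" "\<And>k r. r > 0 \<Longrightarrow> r powr (j / 2) * theta q k r \<le> C' * theta q (k - 2 * (j / 2)) (r / 2)"
  using theta_absorb[OF q, of "j / 2"] j by auto
 have "norm (\<kappa> z) \<le> (C * C') * theta q (k - j) (1 / 2 * (norm z)\<^sup>2)" if z: "z \<in> half_space" for z
 proof -
  have n: "norm z > 0" using z by (rule half_space_norm)
  have e: "((norm z)\<^sup>2) powr (j / 2) = norm z powr j"
   using n powr_powr[of "norm z" 2 "j / 2"] by simp
  have "norm z powr j * radial q k z \<le> C' * theta q (k - j) (1 / 2 * (norm z)\<^sup>2)"
   using C'(2)[of "(norm z)\<^sup>2" k] n unfolding e radial_def by simp
  from mult_left_mono[OF this C] le[OF z] show ?thesis by (simp add: mult.assoc)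
 qed
 moreover have "C * C' \<ge> 0" using C C' by simp
 ultimately show ?thesis unfolding kernel_of_order_def using cont by (intro conjI exI[of _ "C * C'"] exI[of _ "1/2"]) auto
qed

lemma kernel_of_order_add:
 assumes q: "q > 0" and "kernel_of_order q k \<kappa>" "kernel_of_order q k \<kappa>'"
 shows "kernel_of_order q k (\<lambda>z. \<kappa> z + \<kappa>' z)"
proof -
 obtain C l where C: "C \<ge> 0" "l > 0" "\<And>z. z \<in> half_space \<Longrightarrow> norm (\<kappa> z) \<le> C * theta q k (l * (norm z)\<^sup>2)"
  using assms(2) by (auto simp: kernel_of_order_def)
 obtain C' l' where C': "C' \<ge> 0" "l' > 0" "\<And>z. z \<in> half_space \<Longrightarrow> norm (\<kappa>' z) \<le> C' * theta q k (l' * (norm z)\<^sup>2)"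
  using assms(3) by (auto simp: kernel_of_order_def)
 have "norm (\<kappa> z + \<kappa>' z) \<le> (C + C') * theta q k (min l l' * (norm z)\<^sup>2)" if z: "z \<in> half_space" for z
 proof -
  have n: "(norm z)\<^sup>2 > 0" using half_space_norm[OF z] by simp
  have m: "theta q k (a * (norm z)\<^sup>2) \<le> theta q k (min l l' * (norm z)\<^sup>2)" if "min l l' \<le> a" for a
   using n C C' that q by (intro theta_mono) (auto intro: mult_right_mono)
  have "norm (\<kappa> z + \<kappa>' z) \<le> C * theta q k (l * (norm z)\<^sup>2) + C' * theta q k (l' * (norm z)\<^sup>2)"
   using C(3)[OF z] C'(3)[OF z] norm_triangle_ineq[of "\<kappa> z" "\<kappa>' z"] by linarith
  also have "\<dots> \<le> C * theta q k (min l l' * (norm z)\<^sup>2) + C' * theta q k (min l l' * (norm z)\<^sup>2)"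
   using C C' by (intro add_mono mult_left_mono m) auto
  finally show ?thesis by (simp add: distrib_right)
 qed
 then show ?thesis using assms(2,3) C C' unfolding kernel_of_order_def
  by (intro conjI exI[of _ "C + C'"] exI[of _ "min l l'"]) (auto intro!: continuous_intros)
qed

lemma kernel_of_order_inner:
 assumes "kernel_of_order q k \<kappa>"
 shows "kernel_of_order q k (\<lambda>z. \<kappa> z \<bullet> b)"
proof -
 obtain C l where C: "C \<ge> 0" "l > 0" "\<And>z. z \<in> half_space \<Longrightarrow> norm (\<kappa> z) \<le> C * theta q k (l * (norm z)\<^sup>2)"
  using assms by (auto simp: kernel_of_order_def)
 have "norm (\<kappa> z \<bullet> b) \<le> (C * norm b) * theta q k (l * (norm z)\<^sup>2)" if z: "z \<in> half_space" for z
  using order_trans[OF Cauchy_Schwarz_ineq2[of "\<kappa> z" b] mult_right_mono[OF C(3)[OF z], of "norm b"]] by (simp add: mult_ac)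
 then show ?thesis using assms C unfolding kernel_of_order_def
  by (intro conjI exI[of _ "C * norm b"] exI[of _ l]) (auto intro!: continuous_intros)
qed

lemma kernel_radial: "q > 0 \<Longrightarrow> kernel_of_order q k (radial q k :: real \<times> (real^'n) \<Rightarrow> real)"
 using kernel_of_orderI[of q "radial q k :: real \<times> (real^'n) \<Rightarrow> real" 0 1 k] half_space_norm
 by (force simp: radial_nonneg continuous_radial)

lemma kernel_radial1:
 assumes q: "q > 0"
 shows "kernel_of_order q (k + 1) (radial1 q k :: real \<times> (real^'n) \<Rightarrow> _)"
proof -
 have "kernel_of_order q ((k + 2) - 1) (radial1 q k :: real \<times> (real^'n) \<Rightarrow> _)"
  unfolding radial1_def[abs_def]
  by (rule kernel_of_orderI[where C=2]) (auto intro!: continuous_intros continuous_radial q simp: abs_mult radial_nonneg)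
 then show ?thesis by (simp add: add.commute)
qed

lemma kernel_radial2:
 assumes q: "q > 0"
 shows "kernel_of_order q (k + 2) (radial2 q k b :: real \<times> (real^'n) \<Rightarrow> _)"
proof -
 have 1: "kernel_of_order q ((k + 2) - 0) (\<lambda>z::real \<times> (real^'n). (- 2 * radial q (k + 2) z) *\<^sub>R b)"
  by (rule kernel_of_orderI[where C="2 * norm b"])
   (use half_space_norm in \<open>auto intro!: continuous_intros continuous_radial q simp: abs_mult radial_nonneg\<close>)
 have 2: "kernel_of_order q ((k + 4) - 2) (\<lambda>z::real \<times> (real^'n). (4 * (z \<bullet> b) * radial q (k + 4) z) *\<^sub>R z)"
 proof (rule kernel_of_orderI[where C="4 * norm b"])
  fix z :: "real \<times> (real^'n)" assume z: "z \<in> half_space"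
  have "norm ((4 * (z \<bullet> b) * radial q (k + 4) z) *\<^sub>R z) = \<bar>z \<bullet> b\<bar> * (4 * radial q (k + 4) z * norm z)"
   by (simp add: abs_mult radial_nonneg)
  also have "\<dots> \<le> (norm z * norm b) * (4 * radial q (k + 4) z * norm z)"
   by (intro mult_right_mono Cauchy_Schwarz_ineq2) (simp add: radial_nonneg)
  also have "\<dots> = 4 * norm b * (norm z powr 2 * radial q (k + 4) z)"
   using half_space_norm[OF z] by (simp add: power2_eq_square mult_ac)
  finally show "norm ((4 * (z \<bullet> b) * radial q (k + 4) z) *\<^sub>R z) \<le> \<dots>" .
 qed (auto intro!: continuous_intros continuous_radial q)
 show ?thesis unfolding radial2_def[abs_def] using kernel_of_order_add[OF q 1] 2 by (simp add: add.commute)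
qed

lemma layer_arg_half: "z \<in> half_space \<Longrightarrow> z - (0, y) \<in> half_space"
 by (simp add: mem_half_space)

lemma kernel_slice_measurable:
 assumes "kernel_of_order q k \<kappa>" "z \<in> half_space"
 shows "(\<lambda>y::real^'n. \<kappa> (z - (0, y))) \<in> Borel"
proof (rule borel_measurable_continuous_onI)
 have "continuous_on half_space \<kappa>" using assms(1) by (simp add: kernel_of_order_def)
 then show "continuous_on UNIV (\<lambda>y. \<kappa> (z - (0, y)))"
  by (rule continuous_on_compose2) (auto intro!: continuous_intros layer_arg_half assms(2))
qed

lemma theta_layer_nn:
 assumes "q > 0" "l > 0" "z \<in> half_space"
 shows "(\<integral>\<^sub>+y. theta q k (l * (norm (z - (0, y::real^'n)))\<^sup>2))
  = ennreal ((pi / l) powr (real CARD('n) / 2) * theta q (k - real CARD('n)) (l * (fst z)\<^sup>2))"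
proof -
 have "(\<integral>\<^sub>+y. theta q k (l * (norm (z - (0, y::real^'n)))\<^sup>2))
   = (\<integral>\<^sub>+y. theta q k (l * (fst z)\<^sup>2 + l * (norm (snd z - (y::real^'n)))\<^sup>2))"
  by (simp add: norm_half distrib_left)
 also have "\<dots> = (\<integral>\<^sub>+y. theta q k (l * (fst z)\<^sup>2 + l * (norm (y::real^'n))\<^sup>2))"
  by (rule nn_integral_lborel_reflect[of "\<lambda>y::real^'n. ennreal (theta q k (l * (fst z)\<^sup>2 + l * (norm y)\<^sup>2))"]) measurable
 also have "\<dots> = ennreal ((pi / l) powr (real CARD('n) / 2) * theta q (k - real CARD('n)) (l * (fst z)\<^sup>2))"
  using assms theta_slice_nn[of q l "l * (fst z)\<^sup>2" k, where 'a="real^'n"] by (simp add: mem_half_space)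
 finally show ?thesis .
qed

lemma theta_layer_integrable:
 assumes "q > 0" "l > 0" "z \<in> half_space"
 shows "L1 (\<lambda>y::real^'n. theta q k (l * (norm (z - (0, y)))\<^sup>2))"
 by (rule integrableI_bounded) (simp_all add: theta_nonneg theta_layer_nn[OF assms])

text \<open>If \<open>z\<close> is close to \<open>z0\<close> compared with the height of \<open>z0\<close>, then its distance to any boundary
 point is at least half that of \<open>z0\<close>. One integrable function thus dominates all kernels near \<open>z0\<close>,
 as differentiation under the integral requires.\<close>

lemma kernel_dominated:
 fixes z0 :: "real \<times> (real^'n)"
 assumes q: "q > 0" and \<kappa>: "kernel_of_order q k \<kappa>" and z0: "z0 \<in> half_space"
 obtains D where "L1 (D :: real^'n \<Rightarrow> real)" "\<And>z y. z \<in> ball z0 (fst z0 / 2) \<Longrightarrow> norm (\<kappa> (z - (0, y))) \<le> D y"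
  "ball z0 (fst z0 / 2) \<subseteq> half_space"
proof -
 obtain C l where C: "C \<ge> 0" "l > 0" "\<And>z. z \<in> half_space \<Longrightarrow> norm (\<kappa> z) \<le> C * theta q k (l * (norm z)\<^sup>2)"
  using \<kappa> by (auto simp: kernel_of_order_def)
 have sub: "ball z0 (fst z0 / 2) \<subseteq> half_space"
 proof
  fix z assume "z \<in> ball z0 (fst z0 / 2)"
  then have "\<bar>fst z0 - fst z\<bar> < fst z0 / 2"
   using dist_fst_le[of z0 z] by (simp add: dist_real_def)
  then show "z \<in> half_space" using z0 unfolding mem_half_space abs_less_iff by linarith
 qed
 show ?thesis
 proof
  show "L1 (\<lambda>y. C * theta q k (l / 4 * (norm (z0 - (0, y)))\<^sup>2))"
   using C by (intro integrable_mult_right theta_layer_integrable q z0) simp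
  fix z y assume z: "z \<in> ball z0 (fst z0 / 2)"
  have zh: "z \<in> half_space" using z sub by blast
  have "fst z0 \<le> norm (z0 - (0, y))"
   using norm_fst_le[of "fst z0" "snd z0 - y"] by (cases z0) auto
  moreover have "norm (z0 - (0, y)) \<le> norm (z - (0, y)) + dist z0 z"
   using dist_triangle[of z0 "(0, y)" z] unfolding dist_norm by linarith
  ultimately have "norm (z0 - (0, y)) / 2 \<le> norm (z - (0, y))" using z by simp
  then have "(norm (z0 - (0, y)) / 2)\<^sup>2 \<le> (norm (z - (0, y)))\<^sup>2" by (intro power_mono) auto
  then have *: "l / 4 * (norm (z0 - (0, y)))\<^sup>2 \<le> l * (norm (z - (0, y)))\<^sup>2"
   using C(2) by (simp add: power_divide field_simps)
  have "norm (\<kappa> (z - (0, y))) \<le> C * theta q k (l * (norm (z - (0, y)))\<^sup>2)" by (intro C layer_arg_half zh)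
  also have "\<dots> \<le> C * theta q k (l / 4 * (norm (z0 - (0, y)))\<^sup>2)"
   using half_space_norm[OF layer_arg_half[OF z0], of y] C by (intro mult_left_mono theta_mono q *) auto
  finally show "norm (\<kappa> (z - (0, y))) \<le> C * theta q k (l / 4 * (norm (z0 - (0, y)))\<^sup>2)" .
 qed (rule sub)
qed

lemma kernel_layer_integrable:
 fixes h :: "real^'n \<Rightarrow> real"
 assumes q: "q > 0" and \<kappa>: "kernel_of_order q k (\<kappa> :: _ \<Rightarrow> 'b::euclidean_space)" and z: "z \<in> half_space"
  and hm[measurable]: "h \<in> Borel" and h: "\<And>y. \<bar>h y\<bar> \<le> M"
 shows "L1 (\<lambda>y. h y *\<^sub>R \<kappa> (z - (0, y)))"
proof -
 obtain D where D: "L1 (D :: real^'n \<Rightarrow> real)" "\<And>z' y. z' \<in> ball z (fst z / 2) \<Longrightarrow> norm (\<kappa> (z' - (0, y))) \<le> D y"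
  by (rule kernel_dominated[OF q \<kappa> z], rule that)
 have zb: "z \<in> ball z (fst z / 2)" using z by (simp add: mem_half_space)
 have [measurable]: "(\<lambda>y. \<kappa> (z - (0, y))) \<in> Borel" by (rule kernel_slice_measurable[OF \<kappa> z])
 show ?thesis
 proof (rule Bochner_Integration.integrable_bound[OF integrable_mult_right[OF D(1), of M]])
  show "AE y in lborel. norm (h y *\<^sub>R \<kappa> (z - (0, y))) \<le> norm (M * D y)"
  proof (rule AE_I2)
   fix y
   have "norm (h y *\<^sub>R \<kappa> (z - (0, y))) \<le> M * D y"
    using h[of y] D(2)[OF zb, of y] by (auto intro!: mult_mono intro: order_trans[OF abs_ge_zero])
   then show "norm (h y *\<^sub>R \<kappa> (z - (0, y))) \<le> norm (M * D y)" by simp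
  qed
 qed measurable
qed

lemma layer_derivative:
 fixes h :: "real^'n \<Rightarrow> real"
 assumes q: "q > 0" and \<kappa>: "kernel_of_order q k \<kappa>" "kernel_of_order q k' \<kappa>'" and z0: "z0 \<in> half_space"
  and der: "\<And>z. z \<in> half_space \<Longrightarrow> (\<kappa> has_derivative (\<lambda>d. \<kappa>' z \<bullet> d)) (at z)"
  and hm[measurable]: "h \<in> Borel" and h: "\<And>y. \<bar>h y\<bar> \<le> M"
 shows "(layer \<kappa> h has_derivative (\<lambda>d. layer (\<lambda>z. \<kappa>' z \<bullet> d) h z0)) (at z0)"
proof -
 let ?U = "ball z0 (fst z0 / 2)"
 obtain D where D: "L1 (D :: real^'n \<Rightarrow> real)" "\<And>z y. z \<in> ?U \<Longrightarrow> norm (\<kappa>' (z - (0, y))) \<le> D y"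
  and sub: "?U \<subseteq> half_space"
  by (rule kernel_dominated[OF q \<kappa>(2) z0], rule that)
 have "((\<lambda>z. \<integral>y. h y *\<^sub>R \<kappa> (z - (0, y)) \<partial>lborel) has_derivative (\<lambda>d. (\<integral>y. h y *\<^sub>R \<kappa>' (z0 - (0, y))) \<bullet> d)) (at z0)"
 proof (rule has_derivative_integral_dominated[where U="?U" and D="\<lambda>y. M * D y" and F'="\<lambda>z y. h y *\<^sub>R \<kappa>' (z - (0, y))"])
  show "z0 \<in> ?U" using z0 by (simp add: mem_half_space)
  show "L1 (\<lambda>y. M * D y)" using D(1) by simp
  show "(\<lambda>y. h y *\<^sub>R \<kappa>' (z0 - (0, y))) \<in> borel_measurable lborel"
   using kernel_layer_integrable[OF q \<kappa>(2) z0 hm h] by (rule borel_measurable_integrable)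
  fix z assume z: "z \<in> ?U"
  show "L1 (\<lambda>y. h y *\<^sub>R \<kappa> (z - (0, y)))"
   by (rule kernel_layer_integrable[OF q \<kappa>(1) _ hm h]) (use z sub in blast)
  fix y
  show "norm (h y *\<^sub>R \<kappa>' (z - (0, y))) \<le> M * D y"
   using h[of y] D(2)[OF z, of y] by (auto intro!: mult_mono intro: order_trans[OF abs_ge_zero])
  have d: "(\<kappa> has_derivative (\<lambda>d. \<kappa>' (z - (0, y)) \<bullet> d)) (at (z - (0, y)))"
   using z sub by (intro der layer_arg_half) auto
  have "((\<lambda>z. z - (0, y)) has_derivative (\<lambda>d. d)) (at z)" by (auto intro!: derivative_eq_intros)
  from has_derivative_scaleR_right[OF has_derivative_compose[OF this d], of "h y"]
  show "((\<lambda>z. h y *\<^sub>R \<kappa> (z - (0, y))) has_derivative (\<lambda>d. (h y *\<^sub>R \<kappa>' (z - (0, y))) \<bullet> d)) (at z)" by simp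
 qed simp
 moreover have "(\<integral>y. h y *\<^sub>R \<kappa>' (z0 - (0, y))) \<bullet> d = layer (\<lambda>z. \<kappa>' z \<bullet> d) h z0" for d
  using kernel_layer_integrable[OF q \<kappa>(2) z0 hm h]
  by (simp add: layer_def integral_inner_left[symmetric] mult.commute)
 ultimately show ?thesis by (simp add: layer_def[abs_def] mult.commute)
qed

lemma layer_continuous:
 fixes h :: "real^'n \<Rightarrow> real"
 assumes q: "q > 0" and \<kappa>: "kernel_of_order q k \<kappa>"
  and hm[measurable]: "h \<in> Borel" and h: "\<And>y. \<bar>h y\<bar> \<le> M"
 shows "continuous_on half_space (layer \<kappa> h)"
proof (intro continuous_at_imp_continuous_on ballI)
 fix z0 :: "real \<times> (real^'n)" assume z0: "z0 \<in> half_space"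
 let ?U = "ball z0 (fst z0 / 2)"
 obtain D where D: "L1 (D :: real^'n \<Rightarrow> real)" "\<And>z y. z \<in> ?U \<Longrightarrow> norm (\<kappa> (z - (0, y))) \<le> D y"
  and sub: "?U \<subseteq> half_space"
  by (rule kernel_dominated[OF q \<kappa> z0], rule that)
 show "isCont (layer \<kappa> h) z0"
  unfolding layer_def[abs_def]
 proof (rule isCont_integral_dominated[where U="?U" and D="\<lambda>y. M * D y"])
  show "z0 \<in> ?U" using z0 by (simp add: mem_half_space)
  show "L1 (\<lambda>y. M * D y)" using D(1) by simp
  show "(\<lambda>y. \<kappa> (z - (0, y)) * h y) \<in> borel_measurable lborel" if "z \<in> ?U" for z
   using kernel_slice_measurable[OF \<kappa>, of z] sub that by auto
  show "isCont (\<lambda>z. \<kappa> (z - (0, y)) * h y) z0" for y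
  proof -
   have "continuous_on half_space \<kappa>" using \<kappa> by (simp add: kernel_of_order_def)
   then have "isCont \<kappa> (z0 - (0, y))" using continuous_on_eq_continuous_at[OF open_half_space] layer_arg_half[OF z0] by blast
   then show ?thesis by (intro continuous_intros isCont_o2[of _ "\<lambda>z. z - (0, y)"]) auto
  qed
  show "\<bar>\<kappa> (z - (0, y)) * h y\<bar> \<le> M * D y" if "z \<in> ?U" for z y
   using h[of y] D(2)[OF that, of y] mult_mono[of "\<bar>h y\<bar>" M "\<bar>\<kappa> (z - (0, y))\<bar>" "D y"] by (simp add: abs_mult mult.commute)
 qed simp
qed

text \<open>If the density vanishes to order \<open>\<beta>\<close> at the foot of \<open>z\<close>, the layer of a kernel of order \<open>k\<close>
 behaves as the kernel of order \<open>k - \<beta>\<close>, and integrating over the \<open>N\<close>-dimensional boundary leaves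
 \<open>theta\<close> of order \<open>k - \<beta> - N\<close> at the squared height.\<close>

lemma layer_bound:
 assumes q: "q > 0" and \<kappa>: "kernel_of_order q k (\<kappa> :: real \<times> (real^'n) \<Rightarrow> real)" and \<beta>: "\<beta> \<ge> 0"
  and e: "e \<ge> 0" "e > k - \<beta> - real CARD('n) - 1"
 shows "\<exists>C\<ge>0. \<forall>h M z. z \<in> half_space \<longrightarrow> M \<ge> 0 \<longrightarrow> (\<forall>y. \<bar>h y\<bar> \<le> M * norm (z - (0, y)) powr \<beta>) \<longrightarrow>
  \<bar>layer \<kappa> h z\<bar> \<le> M * C * fst z powr (- e)"
proof -
 obtain C l where C: "C \<ge> 0" "l > 0" "\<And>z. z \<in> half_space \<Longrightarrow> norm (\<kappa> z) \<le> C * theta q k (l * (norm z)\<^sup>2)"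
  using \<kappa> by (auto simp: kernel_of_order_def)
 obtain A where A: "A > 0" "\<And>k r. r > 0 \<Longrightarrow> r powr (\<beta> / 2) * theta q k r \<le> A * theta q (k - 2 * (\<beta> / 2)) (r / 2)"
  using theta_absorb[OF q, of "\<beta> / 2"] \<beta> by auto
 obtain B where B: "B > 0" "\<And>r. r > 0 \<Longrightarrow> theta q (k - \<beta> - real CARD('n)) r \<le> B * r powr (- (e / 2))"
  using theta_le_powr[OF q, of "e / 2" "k - \<beta> - real CARD('n)"] e by auto
 define P where "P = (pi / (l / 2)) powr (real CARD('n) / 2)"
 define R where "R = C * l powr (- (\<beta> / 2)) * A * P * B * (l / 2) powr (- (e / 2))"
 have R: "R \<ge> 0" using C A B by (simp add: R_def P_def)
 have "\<bar>layer \<kappa> h z\<bar> \<le> M * R * fst z powr (- e)"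
  if z: "z \<in> half_space" and M: "M \<ge> 0" and h: "\<And>y. \<bar>h y\<bar> \<le> M * norm (z - (0, y)) powr \<beta>" for h M z
 proof -
  have x: "fst z > 0" using z by (simp add: mem_half_space)
  define c where "c = M * C * l powr (- (\<beta> / 2)) * A"
  have c: "c \<ge> 0" using M C A by (simp add: c_def)
  let ?T = "\<lambda>y. theta q (k - \<beta>) (l / 2 * (norm (z - (0, y)))\<^sup>2)"
  have le: "norm (\<kappa> (z - (0, y)) * h y) \<le> c * ?T y" for y
  proof -
   let ?n = "norm (z - (0, y))"
   have n: "?n > 0" by (rule half_space_norm[OF layer_arg_half[OF z]])
   have pw: "?n powr \<beta> = l powr (- (\<beta> / 2)) * (l * ?n\<^sup>2) powr (\<beta> / 2)"
    using n C(2) powr_powr[of ?n 2 "\<beta> / 2"] by (simp add: powr_mult powr_minus field_simps)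
   have "norm (\<kappa> (z - (0, y)) * h y) \<le> (C * theta q k (l * ?n\<^sup>2)) * (M * ?n powr \<beta>)"
    unfolding norm_mult using C(3)[OF layer_arg_half[OF z], of y] h[of y] C(1)
    by (intro mult_mono) (auto simp: theta_nonneg)
   also have "\<dots> = M * C * l powr (- (\<beta> / 2)) * ((l * ?n\<^sup>2) powr (\<beta> / 2) * theta q k (l * ?n\<^sup>2))"
    unfolding pw by (simp add: mult_ac)
   also have "\<dots> \<le> M * C * l powr (- (\<beta> / 2)) * (A * theta q (k - 2 * (\<beta> / 2)) (l * ?n\<^sup>2 / 2))"
    using M C n by (intro mult_left_mono A) auto
   finally show ?thesis by (simp add: c_def mult.assoc)
  qed
  have i: "L1 ?T" using C by (intro theta_layer_integrable q z) auto
  have "\<bar>layer \<kappa> h z\<bar> \<le> (\<integral>y. c * ?T y)"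
   unfolding layer_def real_norm_def[symmetric]
   by (rule order_trans[OF integral_norm_bound], rule Bochner_Integration.integral_mono')
    (use i le c in \<open>auto simp: theta_nonneg\<close>)
  also have "\<dots> = c * (P * theta q (k - \<beta> - real CARD('n)) (l / 2 * (fst z)\<^sup>2))"
   using theta_layer_nn[OF q _ z, of "l / 2" "k - \<beta>"] C
   by (simp add: integral_eq_nn_integral theta_nonneg P_def)
  also have "\<dots> \<le> c * (P * (B * (l / 2 * (fst z)\<^sup>2) powr (- (e / 2))))"
   using c C x by (intro mult_left_mono B) (auto simp: P_def)
  also have "(l / 2 * (fst z)\<^sup>2) powr (- (e / 2)) = (l / 2) powr (- (e / 2)) * fst z powr (- e)"
   using x C powr_powr[of "fst z" 2 "- (e / 2)"] by (subst powr_mult) simp_all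
  finally show ?thesis by (simp add: c_def R_def mult_ac)
 qed
 then show ?thesis using R by blast
qed

section \<open>Hoelder continuity from interior derivative bounds\<close>

text \<open>The strips \<open>{z. t \<le> fst z}\<close> are convex.\<close>

lemma half_space_segment:
 assumes "z \<in> half_space" "z' \<in> half_space" "t \<le> fst z" "t \<le> fst z'" "c \<in> closed_segment z z'"
 shows "c \<in> half_space \<and> t \<le> fst c"
proof -
 obtain s where s: "0 \<le> s" "s \<le> 1" "c = (1 - s) *\<^sub>R z + s *\<^sub>R z'" using assms(5) by (auto simp: in_segment)
 define t' where "t' = min (fst z) (fst z')"
 have "t' = (1 - s) * t' + s * t'" by (simp add: algebra_simps)
 also have "\<dots> \<le> (1 - s) * fst z + s * fst z'" using s by (intro add_mono mult_left_mono) (auto simp: t'_def)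
 finally have "t' \<le> fst c" by (simp add: s)
 moreover have "t' > 0" "t \<le> t'" using assms by (auto simp: t'_def mem_half_space)
 ultimately show ?thesis by (simp add: mem_half_space)
qed

lemma half_space_mean_value:
 fixes F :: "real \<times> (real^'n) \<Rightarrow> real"
 assumes z: "z \<in> half_space" "z' \<in> half_space" "t \<le> fst z" "t \<le> fst z'"
  and der: "\<And>z. z \<in> half_space \<Longrightarrow> (F has_derivative F' z) (at z)"
  and B: "\<And>c. c \<in> closed_segment z z' \<Longrightarrow> c \<in> half_space \<Longrightarrow> t \<le> fst c \<Longrightarrow> onorm (F' c) \<le> B"
 shows "\<bar>F z' - F z\<bar> \<le> B * dist z z'"
proof -
 have "norm (F z' - F z) \<le> B * norm (z' - z)"
 proof (rule differentiable_bound[of "closed_segment z z'" F F' B])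
  show "convex (closed_segment z z')" by (rule convex_closed_segment)
  fix c assume c: "c \<in> closed_segment z z'"
  note * = half_space_segment[OF z c]
  show "(F has_derivative F' c) (at c within closed_segment z z')" using * by (auto intro: has_derivative_at_withinI der)
  show "onorm (F' c) \<le> B" using B c * by blast
 qed auto
 then show ?thesis by (simp add: dist_norm norm_minus_commute)
qed

text \<open>The argument of Hardy and Littlewood: join two points at distance \<open>\<rho>\<close> by going up to height at
 least \<open>\<rho>\<close>, across and down. On the vertical parts \<open>s\<^bsup>\<beta>-1\<^esup>\<close> integrates to at most \<open>\<rho>\<^sup>\<beta> / \<beta>\<close>, and on
 the horizontal part the derivative is at most \<open>C \<rho>\<^bsup>\<beta>-1\<^esup>\<close>.\<close>

lemma Hoelder_of_derivative_bound:
 fixes F :: "real \<times> (real^'n) \<Rightarrow> real"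
 assumes \<beta>: "0 < \<beta>" "\<beta> < 1" and C: "C \<ge> 0"
  and der: "\<And>z. z \<in> half_space \<Longrightarrow> (F has_derivative F' z) (at z)"
  and bnd: "\<And>z d. z \<in> half_space \<Longrightarrow> \<bar>F' z d\<bar> \<le> C * fst z powr (\<beta> - 1) * norm d"
  and z: "z \<in> half_space" "z' \<in> half_space"
 shows "\<bar>F z - F z'\<bar> \<le> (2 * C / \<beta> + C) * dist z z' powr \<beta>"
proof (cases "z = z'")
 case False
 define \<rho> where "\<rho> = dist z z'"
 have \<rho>: "\<rho> > 0" using False by (simp add: \<rho>_def)
 let ?e = "\<lambda>z::real \<times> (real^'n). (fst z + \<rho>, snd z)"
 have vert: "\<bar>F (?e z) - F z\<bar> \<le> C / \<beta> * \<rho> powr \<beta>" if z: "z \<in> half_space" for z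
 proof -
  have x: "fst z > 0" using z by (simp add: mem_half_space)
  have "norm (F (fst z + \<rho>, snd z) - F (fst z, snd z)) \<le> C / \<beta> * (fst z + \<rho>) powr \<beta> - C / \<beta> * fst z powr \<beta>"
  proof (rule differentiable_bound_general[of "fst z" "fst z + \<rho>" "\<lambda>s. F (s, snd z)" "\<lambda>s. C / \<beta> * s powr \<beta>" "\<lambda>s. F' (s, snd z) (1, 0)" "\<lambda>s. C * s powr (\<beta> - 1)"])
   have d: "((\<lambda>s. F (s, snd z)) has_vector_derivative F' (s, snd z) (1, 0)) (at s)" if "s > 0" for s
   proof -
    have Fd: "(F has_derivative F' (s, snd z)) (at (s, snd z))" using that by (intro der) (simp add: mem_half_space)
    have "((\<lambda>s. (s, snd z)) has_derivative (\<lambda>h. (h, 0))) (at s)" by (auto intro!: derivative_eq_intros)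
    from has_derivative_compose[OF this Fd] have *: "((\<lambda>s. F (s, snd z)) has_derivative (\<lambda>h. F' (s, snd z) (h, 0))) (at s)" .
    have "F' (s, snd z) (h, 0) = h *\<^sub>R F' (s, snd z) (1, 0)" for h
     unfolding linear_cmul[OF has_derivative_linear[OF Fd], symmetric] by simp
    then have "(\<lambda>h. F' (s, snd z) (h, 0)) = (\<lambda>h. h *\<^sub>R F' (s, snd z) (1, 0))" by (rule ext)
    from *[unfolded this] show ?thesis unfolding has_vector_derivative_def .
   qed
   show "fst z < fst z + \<rho>" using \<rho> by simp
   show "continuous_on {fst z..fst z + \<rho>} (\<lambda>s. F (s, snd z))"
   proof (intro continuous_at_imp_continuous_on ballI)
    fix s assume "s \<in> {fst z..fst z + \<rho>}"
    then have "s > 0" using x by simp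
    from has_vector_derivative_continuous[OF d[OF this]] show "isCont (\<lambda>s. F (s, snd z)) s" .
   qed
   show "continuous_on {fst z..fst z + \<rho>} (\<lambda>s. C / \<beta> * s powr \<beta>)" using x \<beta> by (auto intro!: continuous_intros)
   fix s assume s: "fst z < s" "s < fst z + \<rho>"
   show "((\<lambda>s. F (s, snd z)) has_vector_derivative F' (s, snd z) (1, 0)) (at s)" using d s x by simp
   show "((\<lambda>s. C / \<beta> * s powr \<beta>) has_vector_derivative C * s powr (\<beta> - 1)) (at s)"
    unfolding has_real_derivative_iff_has_vector_derivative[symmetric]
    using s x \<beta> by (auto intro!: derivative_eq_intros)
   show "norm (F' (s, snd z) (1, 0)) \<le> C * s powr (\<beta> - 1)"
    using bnd[of "(s, snd z)" "(1, 0)"] s x by (simp add: mem_half_space norm_Pair)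
  qed
  also have "\<dots> = C / \<beta> * ((fst z + \<rho>) powr \<beta> - fst z powr \<beta>)" by (simp add: algebra_simps)
  also have "\<dots> \<le> C / \<beta> * \<rho> powr \<beta>"
  proof (intro mult_left_mono)
   show "(fst z + \<rho>) powr \<beta> - fst z powr \<beta> \<le> \<rho> powr \<beta>"
   proof -
    define s where "s = fst z + \<rho>"
    have s: "s > 0" using x \<rho> by (simp add: s_def)
    have p: "r / s \<le> (r / s) powr \<beta>" if "0 < r" "r \<le> s" for r
     using powr_mono'[of \<beta> 1 "r / s"] \<beta> that s by simp
    have "1 = fst z / s + \<rho> / s" using s by (simp add: s_def add_divide_distrib[symmetric])
    also have "\<dots> \<le> (fst z / s) powr \<beta> + (\<rho> / s) powr \<beta>" using x \<rho> by (intro add_mono p) (auto simp: s_def)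
    also have "\<dots> = (fst z powr \<beta> + \<rho> powr \<beta>) / s powr \<beta>" using x \<rho> s by (simp add: powr_divide add_divide_distrib)
    finally have "s powr \<beta> \<le> fst z powr \<beta> + \<rho> powr \<beta>" using s by (simp add: field_simps)
    then show ?thesis by (simp add: s_def)
   qed
  qed (use C \<beta> in simp)
  finally show ?thesis by simp
 qed
 have hor: "\<bar>F (?e z') - F (?e z)\<bar> \<le> C * \<rho> powr (\<beta> - 1) * dist (?e z) (?e z')"
 proof (rule half_space_mean_value[where t=\<rho>, OF _ _ _ _ der])
  fix c :: "real \<times> (real^'n)" assume c: "c \<in> half_space" "\<rho> \<le> fst c"
  have le: "fst c powr (\<beta> - 1) \<le> \<rho> powr (\<beta> - 1)" using c \<rho> \<beta> by (intro powr_mono2') auto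
  show "onorm (F' c) \<le> C * \<rho> powr (\<beta> - 1)"
  proof (rule onorm_le)
   fix d
   have "\<bar>F' c d\<bar> \<le> C * fst c powr (\<beta> - 1) * norm d" by (rule bnd[OF c(1)])
   also have "\<dots> \<le> C * \<rho> powr (\<beta> - 1) * norm d" using le C by (intro mult_right_mono mult_left_mono) auto
   finally show "norm (F' c d) \<le> C * \<rho> powr (\<beta> - 1) * norm d" by simp
  qed
 qed (use z \<rho> in \<open>auto simp: mem_half_space\<close>)
 have "dist (?e z) (?e z') = \<rho>" by (cases z; cases z') (simp add: \<rho>_def dist_norm)
 moreover have "\<rho> powr (\<beta> - 1) * \<rho> = \<rho> powr \<beta>" using \<rho> powr_add[of \<rho> "\<beta> - 1" 1] by simp
 ultimately have "\<bar>F (?e z') - F (?e z)\<bar> \<le> C * \<rho> powr \<beta>" using hor by (simp add: mult.assoc)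
 then have "\<bar>F z - F z'\<bar> \<le> 2 * (C / \<beta> * \<rho> powr \<beta>) + C * \<rho> powr \<beta>"
  using vert[OF z(1)] vert[OF z(2)] by linarith
 then show ?thesis by (simp add: \<rho>_def algebra_simps)
qed (use C \<beta> in simp)

lemma closure_half_space: "closure half_space = (closed_half_space :: (real \<times> (real^'n)) set)"
 by (simp add: half_space_def closed_half_space_def closure_Times)

text \<open>A uniformly continuous gradient extends to the closure. The first order Taylor estimate holds
 in the open half space with a constant independent of the position, so it survives the limit in
 which both points are approached from above.\<close>

lemma C1_up_to_boundary:
 fixes u :: "real \<times> (real^'n) \<Rightarrow> real"
 assumes \<alpha>: "0 < \<alpha>" and C: "C \<ge> 0"
  and der: "\<And>z. z \<in> half_space \<Longrightarrow> (u has_derivative (\<lambda>d. G z \<bullet> d)) (at z)"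
  and hol: "\<And>z z'. z \<in> half_space \<Longrightarrow> z' \<in> half_space \<Longrightarrow> norm (G z - G z') \<le> C * dist z z' powr \<alpha>"
  and lim: "\<And>z. z \<in> closed_half_space \<Longrightarrow> ((\<lambda>e. u (z + (e, 0))) \<longlongrightarrow> u z) (at_right 0)"
 obtains g where "C1_gradient_on closed_half_space u g" "\<And>z. z \<in> half_space \<Longrightarrow> g z = G z"
proof -
 have uc: "uniformly_continuous_on half_space G"
  unfolding uniformly_continuous_on_def
 proof (intro allI impI)
  fix e :: real assume e: "e > 0"
  define d where "d = (e / (C + 1)) powr (1 / \<alpha>)"
  have d: "d > 0" using e C by (simp add: d_def)
  have "dist (G z') (G z) < e" if "z \<in> half_space" "z' \<in> half_space" "dist z' z < d" for z z'
  proof -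
   have "dist z' z powr \<alpha> \<le> d powr \<alpha>" using that \<alpha> by (intro powr_mono2) auto
   also have "d powr \<alpha> = e / (C + 1)" using e C \<alpha> by (simp add: d_def powr_powr)
   finally have "C * dist z' z powr \<alpha> \<le> C * (e / (C + 1))" using C by (rule mult_left_mono)
   also have "\<dots> < e" using e C by (simp add: field_simps)
   finally show ?thesis using hol[OF that(2,1)] by (simp add: dist_norm)
  qed
  then show "\<exists>d>0. \<forall>x\<in>half_space. \<forall>x'\<in>half_space. dist x' x < d \<longrightarrow> dist (G x') (G x) < e" using d by blast
 qed
 obtain g where g: "uniformly_continuous_on closed_half_space g" "\<And>z. z \<in> half_space \<Longrightarrow> G z = g z"
  using uniformly_continuous_on_extension_on_closure[OF uc] unfolding closure_half_space by metis
 have gc: "continuous_on closed_half_space g" using g(1) by (rule uniformly_continuous_imp_continuous)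
 have sh: "z + (e, 0) \<in> half_space" if "z \<in> closed_half_space" "e > 0" for z :: "real \<times> (real^'n)" and e
  using that by (auto simp: closed_half_space_def half_space_def)
 have taylor: "\<bar>u z' - u z - G z \<bullet> (z' - z)\<bar> \<le> C * dist z z' powr \<alpha> * dist z z'" if z: "z \<in> half_space" "z' \<in> half_space" for z z'
 proof -
  have "\<bar>(u z' - G z \<bullet> z') - (u z - G z \<bullet> z)\<bar> \<le> C * dist z z' powr \<alpha> * dist z z'"
  proof (rule half_space_mean_value[where t=0 and F'="\<lambda>c d. (G c - G z) \<bullet> d"])
   show "((\<lambda>z'. u z' - G z \<bullet> z') has_derivative (\<lambda>d. (G c - G z) \<bullet> d)) (at c)" if "c \<in> half_space" for c
    using der[OF that] by (auto intro!: derivative_eq_intros simp: inner_diff_left)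
   fix c assume c: "c \<in> closed_segment z z'" "c \<in> half_space"
   have "dist z c \<le> dist z z'" using c(1) dist_in_closed_segment[OF c(1)] by (simp add: dist_commute)
   then have "C * dist c z powr \<alpha> \<le> C * dist z z' powr \<alpha>" using C \<alpha> by (intro mult_left_mono powr_mono2) (auto simp: dist_commute)
   then have "norm (G c - G z) \<le> C * dist z z' powr \<alpha>" using hol[OF c(2) z(1)] by linarith
   then show "onorm (\<lambda>d. (G c - G z) \<bullet> d) \<le> C * dist z z' powr \<alpha>"
    by (intro onorm_le) (simp, rule order_trans[OF Cauchy_Schwarz_ineq2], rule mult_right_mono, auto)
  qed (use z in \<open>auto simp: mem_half_space\<close>)
  then show ?thesis by (simp add: algebra_simps inner_diff_right)
 qed
 have taylor': "\<bar>u z' - u z - g z \<bullet> (z' - z)\<bar> \<le> C * dist z z' powr \<alpha> * dist z z'" if z: "z \<in> closed_half_space" "z' \<in> closed_half_space" for z z'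
 proof -
  have "((\<lambda>e. z + (e, 0)) \<longlongrightarrow> z + (0, 0)) (at_right 0)" by (intro tendsto_intros)
  then have tz: "((\<lambda>e. z + (e, 0)) \<longlongrightarrow> z) (at_right 0)" by (simp only: zero_prod_def[symmetric] add_0_right)
  have "\<forall>\<^sub>F e in at_right (0::real). z + (e, 0) \<in> closed_half_space"
   using eventually_at_right_less[of "0::real"]
  proof eventually_elim
   case (elim e)
   show ?case using sh[OF z(1) elim] closure_subset[of half_space] unfolding closure_half_space by blast
  qed
  from continuous_on_tendsto_compose[OF gc tz z(1) this]
  have lim': "((\<lambda>e. \<bar>u (z' + (e, 0)) - u (z + (e, 0)) - g (z + (e, 0)) \<bullet> (z' - z)\<bar>) \<longlongrightarrow> \<bar>u z' - u z - g z \<bullet> (z' - z)\<bar>) (at_right 0)"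
   by (intro tendsto_intros lim z)
  have ev: "\<forall>\<^sub>F e in at_right 0. \<bar>u (z' + (e, 0)) - u (z + (e, 0)) - g (z + (e, 0)) \<bullet> (z' - z)\<bar> \<le> C * dist z z' powr \<alpha> * dist z z'"
   using eventually_at_right_less[of "0::real"]
  proof eventually_elim
   case (elim e)
   show ?case using taylor[OF sh[OF z(1) elim] sh[OF z(2) elim]] g(2)[OF sh[OF z(1) elim]] by simp
  qed
  from tendsto_upperbound[OF lim' ev] show ?thesis by simp
 qed
 have "(u has_derivative (\<lambda>h. g z \<bullet> h)) (at z within closed_half_space)" if z: "z \<in> closed_half_space" for z
 proof (rule has_derivativeI_sandwich[of 1])
  have "((\<lambda>h. dist h z) \<longlongrightarrow> 0) (at z within closed_half_space)"
   using tendsto_dist[OF tendsto_ident_at tendsto_const, of z z closed_half_space] by simp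
  from tendsto_powr'[OF this tendsto_const[of \<alpha>]] \<alpha>
  have "((\<lambda>h. dist h z powr \<alpha>) \<longlongrightarrow> 0) (at z within closed_half_space)" by simp
  then show "((\<lambda>h. C * dist h z powr \<alpha>) \<longlongrightarrow> 0) (at z within closed_half_space)" by (rule tendsto_mult_right_zero)
  fix y assume y: "y \<in> closed_half_space" "y \<noteq> z"
  show "norm (u y - u z - g z \<bullet> (y - z)) / norm (y - z) \<le> C * dist y z powr \<alpha>"
   using taylor'[OF z y(1)] y(2) by (simp add: dist_norm norm_minus_commute divide_le_eq)
 qed (auto intro: bounded_linear_inner_right)
 then have "C1_gradient_on closed_half_space u g" using gc by (auto simp: C1_gradient_on_def)
 then show ?thesis using that g(2) by metis
qed

section \<open>Regularity of the single layer potential\<close>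

lemma inner_kernels:
 fixes h :: "real^'n \<Rightarrow> real"
 assumes q: "q > 0" and [measurable]: "h \<in> Borel" and h: "\<And>y. \<bar>h y\<bar> \<le> M" and z: "z \<in> half_space"
 shows layer_radial_derivative: "(layer (radial q k) h has_derivative (\<lambda>d. layer (\<lambda>z. radial1 q k z \<bullet> d) h z)) (at z)"
  and layer_radial1_derivative: "(layer (\<lambda>z. radial1 q k z \<bullet> b) h has_derivative (\<lambda>d. layer (\<lambda>z. radial2 q k b z \<bullet> d) h z)) (at z)"
proof -
 show "(layer (radial q k) h has_derivative (\<lambda>d. layer (\<lambda>z. radial1 q k z \<bullet> d) h z)) (at z)"
  by (rule layer_derivative[OF q kernel_radial[OF q] kernel_radial1[OF q] z radial_derivative[OF q] _ h])
   (use half_space_norm in auto)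
 show "(layer (\<lambda>z. radial1 q k z \<bullet> b) h has_derivative (\<lambda>d. layer (\<lambda>z. radial2 q k b z \<bullet> d) h z)) (at z)"
  by (rule layer_derivative[OF q kernel_of_order_inner[OF kernel_radial1[OF q]] kernel_radial2[OF q] z radial1_derivative[OF q] _ h])
   (use half_space_norm in auto)
qed

lemma layer_radial_C2:
 fixes h :: "real^'n \<Rightarrow> real"
 assumes q: "q > 0" and hm[measurable]: "h \<in> Borel" and h: "\<And>y. \<bar>h y\<bar> \<le> M"
 shows "Ck_on 2 (layer (radial q k) h) half_space"
proof -
 have "Ck_on (Suc (Suc 0)) (layer (radial q k) h) half_space"
 proof (rule Ck_on_SucI[OF open_half_space layer_radial_derivative[OF q hm h]])
  fix b
  show "Ck_on (Suc 0) (\<lambda>z. layer (\<lambda>z. radial1 q k z \<bullet> b) h z) half_space"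
  proof (rule Ck_on_SucI[OF open_half_space layer_radial1_derivative[OF q hm h]])
   fix d
   show "Ck_on 0 (\<lambda>z. layer (\<lambda>z. radial2 q k b z \<bullet> d) h z) half_space"
    using layer_continuous[OF q kernel_of_order_inner[OF kernel_radial2[OF q]] hm h] by simp
  qed
 qed
 then show ?thesis by (simp add: numeral_2_eq_2)
qed

text \<open>The trace of the Hessian is the Laplacian; by \<open>theta_recurrence\<close> the kernel is an
 eigenfunction away from the origin.\<close>

lemma radial2_trace:
 fixes z :: "'a::euclidean_space"
 assumes q: "q > 0" and z: "z \<noteq> 0"
 shows "(\<Sum>b\<in>Basis. radial2 q (real DIM('a) - 1) b z \<bullet> b) = 4 * q * radial q (real DIM('a) - 1) z"
proof -
 let ?k = "real DIM('a) - 1"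
 have "(\<Sum>b\<in>Basis. radial2 q ?k b z \<bullet> b) = (\<Sum>b\<in>Basis. - 2 * radial q (?k + 2) z + 4 * radial q (?k + 4) z * ((z \<bullet> b) * (z \<bullet> b)))"
  by (intro sum.cong) (auto simp: radial2_def inner_diff_left inner_add_left inner_Basis algebra_simps)
 also have "\<dots> = real DIM('a) * (- 2 * radial q (?k + 2) z) + 4 * radial q (?k + 4) z * (\<Sum>b\<in>Basis. (z \<bullet> b) * (z \<bullet> b))"
  unfolding sum.distrib sum_distrib_left sum_constant by simp
 also have "(\<Sum>b\<in>Basis. (z \<bullet> b) * (z \<bullet> b)) = (norm z)\<^sup>2" by (simp add: euclidean_inner[symmetric] power2_norm_eq_inner)
 finally show ?thesis
  using theta_recurrence[OF q, of "(norm z)\<^sup>2" "real DIM('a)"] z by (simp add: radial_def algebra_simps)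
qed

lemma layer_radial_laplacian:
 fixes h :: "real^'n \<Rightarrow> real"
 assumes q: "q > 0" and hm[measurable]: "h \<in> Borel" and h: "\<And>y. \<bar>h y\<bar> \<le> M" and z: "z \<in> half_space"
 shows "laplacian (layer (radial q (real CARD('n))) h) z = 4 * q * layer (radial q (real CARD('n))) h z"
proof -
 let ?k = "real CARD('n)"
 let ?F = "layer (radial q ?k) h"
 have "frechet_derivative (\<lambda>z'. frechet_derivative ?F (at z') b) (at z) b = layer (\<lambda>z. radial2 q ?k b z \<bullet> b) h z" for b
 proof -
  have "((\<lambda>z'. frechet_derivative ?F (at z') b) has_derivative (\<lambda>d. layer (\<lambda>z. radial2 q ?k b z \<bullet> d) h z)) (at z)"
  proof (rule has_derivative_transform_within_open[OF layer_radial1_derivative[OF q hm h z] open_half_space z])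
   fix z' assume "z' \<in> (half_space :: (real \<times> (real^'n)) set)"
   from frechet_derivative_at[OF layer_radial_derivative[OF q hm h this, of ?k]]
   show "layer (\<lambda>z. radial1 q ?k z \<bullet> b) h z' = frechet_derivative ?F (at z') b" by metis
  qed
  from frechet_derivative_at[OF this] show ?thesis by metis
 qed
 then have "laplacian ?F z = (\<Sum>b\<in>Basis. layer (\<lambda>z. radial2 q ?k b z \<bullet> b) h z)" by (simp add: laplacian_def)
 also have "\<dots> = (\<integral>y. (\<Sum>b\<in>Basis. (radial2 q ?k b (z - (0, y)) \<bullet> b) * h y))"
  unfolding layer_def
  by (rule Bochner_Integration.integral_sum[symmetric])
   (use kernel_layer_integrable[OF q kernel_of_order_inner[OF kernel_radial2[OF q]] z hm h] in \<open>simp add: mult.commute\<close>)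
 also have "\<dots> = (\<integral>y. 4 * q * (radial q ?k (z - (0, y)) * h y))"
 proof (rule Bochner_Integration.integral_cong[OF refl])
  fix y
  have "z - (0, y) \<noteq> 0" using half_space_norm[OF layer_arg_half[OF z], of y] by auto
  from radial2_trace[OF q this] show "(\<Sum>b\<in>Basis. (radial2 q ?k b (z - (0, y)) \<bullet> b) * h y) = 4 * q * (radial q ?k (z - (0, y)) * h y)"
   by (simp add: sum_distrib_right[symmetric] mult.assoc)
 qed
 also have "\<dots> = 4 * q * ?F z" by (simp add: layer_def)
 finally show ?thesis .
qed

text \<open>The layer of the constant density depends on the height only. Its closed form provides the
 derivatives of the part of the layer that is not improved by subtracting a value of the density.\<close>

lemma layer_radial_one:
 fixes z :: "real \<times> (real^'n)"
 assumes "q > 0" "z \<in> half_space"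
 shows "layer (radial q (real CARD('n))) (\<lambda>_. 1) z = pi powr (real CARD('n) / 2) * theta q 0 ((fst z)\<^sup>2)"
 using theta_layer_nn[of q 1 z "real CARD('n)"] assms
 by (simp add: layer_def radial_def integral_eq_nn_integral theta_nonneg)

text \<open>Differentiating the closed form and the integral gives the same result. In the second
 derivative the singular terms combine by \<open>theta_recurrence\<close> into \<open>theta q 0\<close>, which is bounded up
 to the boundary.\<close>

lemma layer_derivatives_one:
 fixes z :: "real \<times> (real^'n)"
 assumes q: "q > 0" and z: "z \<in> half_space"
 shows layer_radial1_one: "layer (\<lambda>z. radial1 q (real CARD('n)) z \<bullet> b) (\<lambda>_. 1) z
   = - 2 * pi powr (real CARD('n) / 2) * (fst z * theta q 2 ((fst z)\<^sup>2)) * fst b"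
  and layer_radial2_one: "layer (\<lambda>z. radial2 q (real CARD('n)) b z \<bullet> d) (\<lambda>_. 1) z
   = 4 * q * pi powr (real CARD('n) / 2) * theta q 0 ((fst z)\<^sup>2) * fst b * fst d"
proof -
 let ?k = "real CARD('n)"
 define A where "A = pi powr (?k / 2)"
 have one: "(\<lambda>_. 1) \<in> Borel" "\<And>y::real^'n. \<bar>1::real\<bar> \<le> 1" by auto
 have 1: "layer (\<lambda>z. radial1 q ?k z \<bullet> b) (\<lambda>_. 1) z = - 2 * A * (fst z * theta q 2 ((fst z)\<^sup>2)) * fst b"
  if z: "z \<in> half_space" for z :: "real \<times> (real^'n)" and b
 proof -
  have t: "(theta q 0 has_derivative (*) (- theta q 2 ((fst z)\<^sup>2))) (at ((fst z)\<^sup>2))"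
   using theta_deriv[OF q, of "(fst z)\<^sup>2" 0] z by (simp add: has_field_derivative_def mem_half_space)
  have "((\<lambda>z::real \<times> (real^'n). (fst z)\<^sup>2) has_derivative (\<lambda>d. 2 * fst z * fst d)) (at z)" by (auto intro!: derivative_eq_intros)
  from has_derivative_mult_right[OF has_derivative_compose[OF this t], of A]
  have "(layer (radial q ?k) (\<lambda>_. 1) has_derivative (\<lambda>d. A * (- theta q 2 ((fst z)\<^sup>2) * (2 * fst z * fst d)))) (at z)"
   by (rule has_derivative_transform_within_open[OF _ open_half_space z]) (simp add: layer_radial_one[OF q] A_def)
  from fun_cong[OF has_derivative_unique[OF layer_radial_derivative[OF q one z] this], of b]
  show ?thesis by simp
 qed
 show "layer (\<lambda>z. radial1 q ?k z \<bullet> b) (\<lambda>_. 1) z = - 2 * pi powr (?k / 2) * (fst z * theta q 2 ((fst z)\<^sup>2)) * fst b"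
  using 1[OF z] by (simp add: A_def)
 have t: "(theta q 2 has_derivative (*) (- theta q 4 ((fst z)\<^sup>2))) (at ((fst z)\<^sup>2))"
  using theta_deriv[OF q, of "(fst z)\<^sup>2" 2] z by (simp add: has_field_derivative_def mem_half_space)
 have "((\<lambda>z::real \<times> (real^'n). (fst z)\<^sup>2) has_derivative (\<lambda>d. 2 * fst z * fst d)) (at z)" by (auto intro!: derivative_eq_intros)
 note c = has_derivative_compose[OF this t]
 have "((\<lambda>z. - 2 * A * (fst z * theta q 2 ((fst z)\<^sup>2)) * fst b) has_derivative
   (\<lambda>d. - 2 * A * (fst z * (- theta q 4 ((fst z)\<^sup>2) * (2 * fst z * fst d)) + fst d * theta q 2 ((fst z)\<^sup>2)) * fst b)) (at z)"
  by (intro has_derivative_mult_left has_derivative_mult_right has_derivative_mult c has_derivative_fst has_derivative_ident)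
 then have "(layer (\<lambda>z. radial1 q ?k z \<bullet> b) (\<lambda>_. 1) has_derivative
   (\<lambda>d. - 2 * A * (fst z * (- theta q 4 ((fst z)\<^sup>2) * (2 * fst z * fst d)) + fst d * theta q 2 ((fst z)\<^sup>2)) * fst b)) (at z)"
  by (rule has_derivative_transform_within_open[OF _ open_half_space z]) (simp add: 1)
 from has_derivative_unique[OF layer_radial1_derivative[OF q one z] this]
 have "layer (\<lambda>z. radial2 q ?k b z \<bullet> d) (\<lambda>_. 1) z
   = - 2 * A * (fst z * (- theta q 4 ((fst z)\<^sup>2) * (2 * fst z * fst d)) + fst d * theta q 2 ((fst z)\<^sup>2)) * fst b"
  by (rule fun_cong)
 also have "\<dots> = A * fst b * fst d * (2 * (2 * (fst z)\<^sup>2 * theta q 4 ((fst z)\<^sup>2)) - 2 * theta q 2 ((fst z)\<^sup>2))"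
  by (simp add: power2_eq_square algebra_simps)
 also have "2 * (fst z)\<^sup>2 * theta q 4 ((fst z)\<^sup>2) = theta q 2 ((fst z)\<^sup>2) + 2 * q * theta q 0 ((fst z)\<^sup>2)"
  using theta_recurrence[OF q, of "(fst z)\<^sup>2" 1] z by (simp add: mem_half_space)
 finally show "layer (\<lambda>z. radial2 q ?k b z \<bullet> d) (\<lambda>_. 1) z = 4 * q * pi powr (?k / 2) * theta q 0 ((fst z)\<^sup>2) * fst b * fst d"
  by (simp add: A_def algebra_simps)
qed

lemma layer_split:
 fixes h :: "real^'n \<Rightarrow> real"
 assumes q: "q > 0" and \<kappa>: "kernel_of_order q k (\<kappa> :: _ \<Rightarrow> real)" and hm[measurable]: "h \<in> Borel"
  and h: "\<And>y. \<bar>h y\<bar> \<le> M" and z: "z \<in> half_space"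
 shows "layer \<kappa> h z = layer \<kappa> (\<lambda>y. h y - c) z + c * layer \<kappa> (\<lambda>_. 1) z"
proof -
 have b: "\<bar>h y - c\<bar> \<le> M + \<bar>c\<bar>" for y using h[of y] by linarith
 have "L1 (\<lambda>y. \<kappa> (z - (0, y)) * (h y - c))"
  using kernel_layer_integrable[OF q \<kappa> z _ b] by (simp add: mult.commute)
 moreover have "L1 (\<lambda>y. c * (\<kappa> (z - (0, y)) * 1))"
  using kernel_layer_integrable[OF q \<kappa> z, of "\<lambda>_. c" "\<bar>c\<bar>"] by (simp add: mult.commute)
 ultimately have "layer \<kappa> (\<lambda>y. h y - c) z + (\<integral>y. c * (\<kappa> (z - (0, y)) * 1)) = layer \<kappa> h z"
  unfolding layer_def by (subst Bochner_Integration.integral_add[symmetric]) (auto simp: algebra_simps)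
 then show ?thesis by (simp add: layer_def)
qed

lemma Hoelder_of_partial_bounds:
 fixes F :: "real \<times> (real^'n) \<Rightarrow> real"
 assumes \<beta>: "0 < \<beta>" "\<beta> < 1" and der: "\<And>z. z \<in> half_space \<Longrightarrow> (F has_derivative F' z) (at z)"
  and bnd: "\<And>b. b \<in> Basis \<Longrightarrow> \<exists>C\<ge>0. \<forall>z\<in>half_space. \<bar>F' z b\<bar> \<le> C * fst z powr (\<beta> - 1)"
 shows "\<exists>C\<ge>0. \<forall>z\<in>half_space. \<forall>z'\<in>half_space. \<bar>F z - F z'\<bar> \<le> C * dist z z' powr \<beta>"
proof -
 from bnd obtain c where c: "\<And>b. b \<in> Basis \<Longrightarrow> c b \<ge> 0" "\<And>b z. b \<in> Basis \<Longrightarrow> z \<in> half_space \<Longrightarrow> \<bar>F' z b\<bar> \<le> c b * fst z powr (\<beta> - 1)"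
  by metis
 define C where "C = (\<Sum>b\<in>Basis. c b)"
 have C: "C \<ge> 0" using c by (simp add: C_def sum_nonneg)
 have "\<bar>F' z d\<bar> \<le> C * fst z powr (\<beta> - 1) * norm d" if z: "z \<in> half_space" for z d
 proof -
  have "F' z d = F' z (\<Sum>b\<in>Basis. (d \<bullet> b) *\<^sub>R b)" by (simp add: euclidean_representation)
  also have "\<dots> = (\<Sum>b\<in>Basis. (d \<bullet> b) * F' z b)"
   using has_derivative_linear[OF der[OF z]] by (simp add: linear_sum linear_cmul del: euclidean_representation_sum)
  also have "\<bar>\<dots>\<bar> \<le> (\<Sum>b\<in>Basis. norm d * (c b * fst z powr (\<beta> - 1)))"
  proof (intro order_trans[OF sum_abs] sum_mono)
   fix b :: "real \<times> (real^'n)" assume b: "b \<in> Basis"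
   show "\<bar>(d \<bullet> b) * F' z b\<bar> \<le> norm d * (c b * fst z powr (\<beta> - 1))"
    unfolding abs_mult by (intro mult_mono Basis_le_norm b c z) auto
  qed
  finally show ?thesis by (simp add: C_def sum_distrib_left sum_distrib_right mult_ac)
 qed
 from Hoelder_of_derivative_bound[OF \<beta> C der this]
 show ?thesis using C \<beta> by (intro exI[of _ "2 * C / \<beta> + C"]) auto
qed

text \<open>The gradient kernel has order \<open>N + 1\<close>, so for a bounded density the gradient grows slower than
 any negative power of the height.\<close>

lemma layer_radial_Hoelder:
 fixes h :: "real^'n \<Rightarrow> real"
 assumes q: "q > 0" and hm[measurable]: "h \<in> Borel" and h: "\<And>y. \<bar>h y\<bar> \<le> M" and \<beta>: "0 < \<beta>" "\<beta> < 1"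
 shows "\<exists>C\<ge>0. \<forall>z\<in>half_space. \<forall>z'\<in>half_space.
  \<bar>layer (radial q (real CARD('n))) h z - layer (radial q (real CARD('n))) h z'\<bar> \<le> C * dist z z' powr \<beta>"
proof (rule Hoelder_of_partial_bounds[OF \<beta> layer_radial_derivative[OF q hm h]])
 fix b :: "real \<times> (real^'n)"
 obtain C where C: "C \<ge> 0" "\<And>h M z. z \<in> half_space \<Longrightarrow> M \<ge> 0 \<Longrightarrow> (\<And>y. \<bar>h y\<bar> \<le> M * norm (z - (0, y)) powr 0) \<Longrightarrow>
   \<bar>layer (\<lambda>z. radial1 q (real CARD('n)) z \<bullet> b) h z\<bar> \<le> M * C * fst z powr (- (1 - \<beta>))"
  using layer_bound[OF q kernel_of_order_inner[OF kernel_radial1[OF q, of "real CARD('n)"], of b], of 0 "1 - \<beta>"] \<beta> by auto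
 have M: "M \<ge> 0" using h[of 0] by linarith
 have "\<bar>layer (\<lambda>z. radial1 q (real CARD('n)) z \<bullet> b) h z\<bar> \<le> M * C * fst z powr (\<beta> - 1)" if z: "z \<in> half_space" for z
  using C(2)[OF z M, of h] h half_space_norm[OF layer_arg_half[OF z]] by simp
 then show "\<exists>C\<ge>0. \<forall>z\<in>half_space. \<bar>layer (\<lambda>z. radial1 q (real CARD('n)) z \<bullet> b) h z\<bar> \<le> C * fst z powr (\<beta> - 1)"
  using M C by (intro exI[of _ "M * C"]) auto
qed

lemma Hoelder_density_weight:
 fixes h :: "real^'n \<Rightarrow> real"
 assumes "\<And>y y'. \<bar>h y - h y'\<bar> \<le> L * dist y y' powr \<gamma>" "L \<ge> 0" "\<gamma> \<ge> 0"
 shows "\<bar>h y - h (snd z)\<bar> \<le> L * norm (z - (0, y)) powr \<gamma>"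
proof -
 have "dist y (snd z) \<le> norm (z - (0, y))" using norm_snd_le[of "snd z - y" "fst z"] by (cases z) (simp add: dist_norm norm_minus_commute)
 then have "L * dist y (snd z) powr \<gamma> \<le> L * norm (z - (0, y)) powr \<gamma>" using assms by (intro mult_left_mono powr_mono2) auto
 then show ?thesis using assms(1)[of y "snd z"] by linarith
qed

text \<open>The second derivatives have a kernel of order \<open>N + 2\<close>. Subtracting \<open>h\<close> at the foot of \<open>z\<close>
 gains \<open>\<gamma>\<close>, which leaves the growth \<open>x\<^bsup>\<beta>-1\<^esup>\<close> for any \<open>\<beta> < \<gamma>\<close>; the subtracted part is the layer of a
 constant.\<close>

lemma layer_radial1_Hoelder:
 fixes h :: "real^'n \<Rightarrow> real"
 assumes q: "q > 0" and hm[measurable]: "h \<in> Borel" and h: "\<And>y. \<bar>h y\<bar> \<le> M"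
  and \<beta>: "0 < \<beta>" "\<beta> < \<gamma>" "\<gamma> < 1" and L: "L \<ge> 0" "\<And>y y'. \<bar>h y - h y'\<bar> \<le> L * dist y y' powr \<gamma>"
 shows "\<exists>C\<ge>0. \<forall>z\<in>half_space. \<forall>z'\<in>half_space.
  \<bar>layer (\<lambda>z. radial1 q (real CARD('n)) z \<bullet> b) h z - layer (\<lambda>z. radial1 q (real CARD('n)) z \<bullet> b) h z'\<bar> \<le> C * dist z z' powr \<beta>"
proof (rule Hoelder_of_partial_bounds[OF \<beta>(1) _ layer_radial1_derivative[OF q hm h]])
 let ?k = "real CARD('n)"
 show "\<beta> < 1" using \<beta> by simp
 fix d :: "real \<times> (real^'n)"
 let ?\<kappa> = "\<lambda>z. radial2 q ?k b z \<bullet> d"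
 have \<kappa>: "kernel_of_order q (?k + 2) ?\<kappa>" by (rule kernel_of_order_inner[OF kernel_radial2[OF q]])
 obtain C where C: "C \<ge> 0" "\<And>h M z. z \<in> half_space \<Longrightarrow> M \<ge> 0 \<Longrightarrow> (\<And>y. \<bar>h y\<bar> \<le> M * norm (z - (0, y)) powr \<gamma>) \<Longrightarrow>
   \<bar>layer ?\<kappa> h z\<bar> \<le> M * C * fst z powr (- (1 - \<beta>))"
  using layer_bound[OF q \<kappa>, of \<gamma> "1 - \<beta>"] \<beta> by auto
 obtain B where B: "B > 0" "\<And>r. r > 0 \<Longrightarrow> theta q 0 r \<le> B * r powr (- ((1 - \<beta>) / 2))"
  using theta_le_powr[OF q, of "(1 - \<beta>) / 2" 0] \<beta> by auto
 have M: "M \<ge> 0" using h[of 0] by linarith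
 define E where "E = 4 * q * pi powr (?k / 2) * \<bar>fst b\<bar> * \<bar>fst d\<bar>"
 have E: "E \<ge> 0" using q by (simp add: E_def)
 have "\<bar>layer ?\<kappa> h z\<bar> \<le> (L * C + M * (E * B)) * fst z powr (\<beta> - 1)" if z: "z \<in> half_space" for z
 proof -
  have x: "fst z > 0" using z by (simp add: mem_half_space)
  have "\<bar>h y - h (snd z)\<bar> \<le> L * norm (z - (0, y)) powr \<gamma>" for y
   by (rule Hoelder_density_weight[OF L(2,1)]) (use \<beta> in simp)
  from C(2)[OF z L(1) this] have 1: "\<bar>layer ?\<kappa> (\<lambda>y. h y - h (snd z)) z\<bar> \<le> L * C * fst z powr (\<beta> - 1)" by simp
  have "theta q 0 ((fst z)\<^sup>2) \<le> B * fst z powr (\<beta> - 1)"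
  proof -
   have "2 * - ((1 - \<beta>) / 2) = \<beta> - 1" by (simp add: field_simps)
   then have "((fst z)\<^sup>2) powr (- ((1 - \<beta>) / 2)) = fst z powr (\<beta> - 1)"
    using x powr_powr[of "fst z" 2 "- ((1 - \<beta>) / 2)"] by (simp only: powr_numeral)
   then show ?thesis using B(2)[of "(fst z)\<^sup>2"] x by simp
  qed
  then have "E * theta q 0 ((fst z)\<^sup>2) \<le> E * (B * fst z powr (\<beta> - 1))" using E by (rule mult_left_mono)
  moreover have "\<bar>layer ?\<kappa> (\<lambda>_. 1) z\<bar> = E * theta q 0 ((fst z)\<^sup>2)"
   using q by (simp add: layer_radial2_one[OF q z] E_def abs_mult theta_nonneg mult_ac)
  ultimately have "\<bar>h (snd z) * layer ?\<kappa> (\<lambda>_. 1) z\<bar> \<le> M * (E * (B * fst z powr (\<beta> - 1)))"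
   unfolding abs_mult using M by (intro mult_mono h) auto
  with 1 show ?thesis unfolding layer_split[OF q \<kappa> hm h z, of "h (snd z)"] by (simp add: algebra_simps)
 qed
 then show "\<exists>C\<ge>0. \<forall>z\<in>half_space. \<bar>layer ?\<kappa> h z\<bar> \<le> C * fst z powr (\<beta> - 1)"
  using M C E B L by (intro exI[of _ "L * C + M * (E * B)"]) auto
qed

text \<open>The jump relation. For the density \<open>h - h y\<close> the normal derivative at \<open>(x, y)\<close> tends to zero,
 being \<open>x\<close> times a layer that is \<open>O(x\<^bsup>-3/4\<^esup>)\<close>; for the constant density the limit is that of \<open>x *
 theta q 2 (x\<^sup>2)\<close>.\<close>

lemma normal_derivative_limit:
 fixes h :: "real^'n \<Rightarrow> real"
 assumes q: "q > 0" and hm[measurable]: "h \<in> Borel" and h: "\<And>y. \<bar>h y\<bar> \<le> M"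
  and L: "L \<ge> 0" "\<And>y y'. \<bar>h y - h y'\<bar> \<le> L * dist y y' powr (1/2)"
 shows "((\<lambda>x. layer (\<lambda>z. radial1 q (real CARD('n)) z \<bullet> (1, 0)) h (x, y)) \<longlongrightarrow> - (pi powr ((1 + real CARD('n)) / 2)) * h y) (at_right 0)"
proof -
 let ?k = "real CARD('n)"
 let ?\<kappa> = "\<lambda>z::real \<times> (real^'n). radial1 q ?k z \<bullet> (1, 0)"
 define A where "A = pi powr (?k / 2)"
 have \<kappa>: "kernel_of_order q (?k + 1) ?\<kappa>" by (rule kernel_of_order_inner[OF kernel_radial1[OF q]])
 (* The bound needs an exponent above 1/2, and below 1 for the factor x to win. *)
 obtain C where C: "C \<ge> 0" "\<And>h M (z :: real \<times> (real^'n)). z \<in> half_space \<Longrightarrow> M \<ge> 0 \<Longrightarrow> (\<And>y. \<bar>h y\<bar> \<le> M * norm (z - (0, y)) powr (1/2)) \<Longrightarrow>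
   \<bar>layer (radial q (?k + 2)) h z\<bar> \<le> M * C * fst z powr (- (3/4))"
  using layer_bound[OF q kernel_radial[OF q, of "?k + 2", where 'n='n], of "1/2" "3/4"] by auto
 define R where "R x = layer ?\<kappa> (\<lambda>y'. h y' - h y) (x, y)" for x
 have R: "\<bar>R x\<bar> \<le> 2 * L * C * x powr (1/4)" if x: "x > 0" for x
 proof -
  have z: "(x, y) \<in> half_space" using x by (simp add: mem_half_space)
  have "R x = - 2 * x * layer (radial q (?k + 2)) (\<lambda>y'. h y' - h y) (x, y)"
   by (simp add: R_def layer_def radial1_def inner_prod_def mult_ac)
  moreover have "\<bar>layer (radial q (?k + 2)) (\<lambda>y'. h y' - h y) (x, y)\<bar> \<le> L * C * x powr (- (3/4))"
   using C(2)[OF z L(1), of "\<lambda>y'. h y' - h y"] Hoelder_density_weight[OF L(2,1), of _ "(x, y)"] by simp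
  ultimately have "\<bar>R x\<bar> \<le> 2 * x * (L * C * x powr (- (3/4)))" using x by (simp add: abs_mult mult_left_mono)
  also have "\<dots> = 2 * L * C * (x powr 1 * x powr (- (3/4)))" using x by simp
  also have "x powr 1 * x powr (- (3/4)) = x powr (1/4)" by (simp only: powr_add[symmetric]) simp
  finally show ?thesis .
 qed
 have "((\<lambda>x. 2 * L * C * x powr (1/4)) \<longlongrightarrow> 0) (at_right (0::real))" by real_asymp
 then have R0: "(R \<longlongrightarrow> 0) (at_right 0)"
  by (rule Lim_null_comparison[rotated]) (use R in \<open>auto simp: eventually_at_filter intro!: always_eventually\<close>)
 have "((\<lambda>x. R x + h y * (- 2 * A * (x * theta q 2 (x\<^sup>2)))) \<longlongrightarrow> 0 + h y * (- 2 * A * (sqrt pi / 2))) (at_right 0)"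
  by (intro tendsto_intros R0 theta_2_tendsto q)
 moreover have "\<forall>\<^sub>F x in at_right 0. R x + h y * (- 2 * A * (x * theta q 2 (x\<^sup>2))) = layer ?\<kappa> h (x, y)"
  using eventually_at_right_less[of "0::real"]
 proof eventually_elim
  case (elim x)
  then have z: "(x, y) \<in> half_space" by (simp add: mem_half_space)
  show ?case using layer_split[OF q \<kappa> hm h z, of "h y"] layer_radial1_one[OF q z, of "(1, 0)"] by (simp add: R_def A_def)
 qed
 ultimately have "((\<lambda>x. layer ?\<kappa> h (x, y)) \<longlongrightarrow> 0 + h y * (- 2 * A * (sqrt pi / 2))) (at_right 0)"
  by (rule Lim_transform_eventually)
 moreover have "pi powr (?k / 2) * pi powr (1 / 2) = pi powr ((1 + ?k) / 2)"
  unfolding powr_add[symmetric] by (simp add: add_divide_distrib add.commute)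
 then have "A * sqrt pi = pi powr ((1 + ?k) / 2)" by (simp add: A_def powr_half_sqrt)
 ultimately show ?thesis by (simp add: mult_ac)
qed

lemma single_layer_radial:
 fixes h :: "real^'n \<Rightarrow> real"
 shows "2 * layer (bessel q) h z = layer (radial q (real CARD('n))) (\<lambda>y. h y / pi powr ((1 + real CARD('n)) / 2)) z"
 unfolding layer_def by (subst Bochner_Integration.integral_mult_right_zero[symmetric])
  (rule Bochner_Integration.integral_cong, auto simp: bessel_def radial_def)

lemma single_layer_boundary_limit:
 fixes h :: "real^'n \<Rightarrow> real"
 assumes q: "q > 0" and hm[measurable]: "h \<in> Borel" and h: "\<And>y. \<bar>h y\<bar> \<le> M" and z: "z \<in> closed_half_space"
 shows "((\<lambda>e. 2 * layer (bessel q) h (z + (e, 0))) \<longlongrightarrow> 2 * layer (bessel q) h z) (at_right 0)"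
proof (cases "fst z = 0")
 case True
 then obtain y where zy: "z = (0, y)" by (metis prod.collapse)
 have M: "M \<ge> 0" using h[of 0] by linarith
 have "(\<integral>\<^sup>+y'. ennreal (bessel q ((0::real, y) - (0, y'))) * ennreal \<bar>h y'\<bar>)
   \<le> (\<integral>\<^sup>+y'. ennreal M * ennreal (slice_ker q (y - y')))"
 proof (rule nn_integral_mono)
  fix y'
  have "bessel q (0::real, y - y') * \<bar>h y'\<bar> \<le> (2 * bessel q (0::real, y - y')) * M"
   by (intro mult_mono h) (auto simp: bessel_nonneg)
  then show "ennreal (bessel q ((0::real, y) - (0, y'))) * ennreal \<bar>h y'\<bar> \<le> ennreal M * ennreal (slice_ker q (y - y'))"
   using M by (simp add: ennreal_mult[symmetric] bessel_nonneg slice_ker_def ennreal_leI mult.commute)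
 qed
 also have "\<dots> = ennreal M * (\<integral>\<^sub>+y'. slice_ker q (y - y'))" by (rule nn_integral_cmult) measurable
 also have "(\<integral>\<^sub>+y'. slice_ker q (y - y')) = (\<integral>\<^sub>+y'. slice_ker q (y' :: real^'n))"
  by (rule nn_integral_lborel_reflect) measurable
 also have "\<dots> = ennreal (\<integral>y'. slice_ker q (y' :: real^'n))"
  by (rule nn_integral_eq_integral[OF slice_ker_integrable[OF q]]) (simp add: slice_ker_nonneg)
 finally have fin: "(\<integral>\<^sup>+y'. ennreal (bessel q ((0::real, y) - (0, y'))) * ennreal \<bar>h y'\<bar>) < \<infinity>"
  by (rule order.strict_trans1) (simp add: ennreal_mult_less_top)
 have "((\<lambda>e. layer (bessel q) h (e, y)) \<longlongrightarrow> layer (bessel q) h (0, y)) (at_right 0)"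
  unfolding tendsto_at_iff_sequentially comp_def using layer_boundary_limit[OF q hm fin] by blast
 from tendsto_mult_left[OF this, of 2] show ?thesis by (simp add: zy)
next
 case False
 then have zh: "z \<in> half_space" using z by (auto simp: half_space_def closed_half_space_def)
 have b: "\<bar>h y / pi powr ((1 + real CARD('n)) / 2)\<bar> \<le> M / pi powr ((1 + real CARD('n)) / 2)" for y
  using h[of y] by (simp add: divide_right_mono)
 have "continuous_on half_space (layer (radial q (real CARD('n))) (\<lambda>y::real^'n. h y / pi powr ((1 + real CARD('n)) / 2)))"
  by (rule layer_continuous[OF q kernel_radial[OF q] _ b]) measurable
 then have c: "isCont (\<lambda>z. 2 * layer (bessel q) h z) z"
  unfolding single_layer_radial using continuous_on_eq_continuous_at[OF open_half_space] zh by blast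
 have "((\<lambda>e. z + (e, 0)) \<longlongrightarrow> z + (0, 0)) (at_right 0)" by (intro tendsto_intros)
 then have "((\<lambda>e. z + (e, 0)) \<longlongrightarrow> z) (at_right 0)" by (simp only: zero_prod_def[symmetric] add_0_right)
 from isCont_tendsto_compose[OF c this] show ?thesis .
qed

theorem single_layer_Hoelder:
 fixes h :: "real^'n \<Rightarrow> real"
 assumes q: "q > 0" and hm[measurable]: "h \<in> Borel" and h: "\<And>y. \<bar>h y\<bar> \<le> M" and \<beta>: "0 < \<beta>" "\<beta> < 1"
 shows "\<exists>C\<ge>0. \<forall>z\<in>closed_half_space. \<forall>z'\<in>closed_half_space.
  \<bar>2 * layer (bessel q) h z - 2 * layer (bessel q) h z'\<bar> \<le> C * dist z z' powr \<beta>"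
proof -
 have b: "\<bar>h y / pi powr ((1 + real CARD('n)) / 2)\<bar> \<le> M / pi powr ((1 + real CARD('n)) / 2)" for y
  using h[of y] by (simp add: divide_right_mono)
 have gm: "(\<lambda>y. h y / pi powr ((1 + real CARD('n)) / 2)) \<in> Borel" by measurable
 obtain C where C: "C \<ge> 0" "\<And>z z'. z \<in> half_space \<Longrightarrow> z' \<in> half_space \<Longrightarrow>
   \<bar>2 * layer (bessel q) h z - 2 * layer (bessel q) h z'\<bar> \<le> C * dist z z' powr \<beta>"
  unfolding single_layer_radial using layer_radial_Hoelder[OF q gm b \<beta>] by auto
 have "\<bar>2 * layer (bessel q) h z - 2 * layer (bessel q) h z'\<bar> \<le> C * dist z z' powr \<beta>"
  if z: "z \<in> closed_half_space" "z' \<in> closed_half_space" for z z'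
 proof -
  have lim: "((\<lambda>e. \<bar>2 * layer (bessel q) h (z + (e, 0)) - 2 * layer (bessel q) h (z' + (e, 0))\<bar>) \<longlongrightarrow>
    \<bar>2 * layer (bessel q) h z - 2 * layer (bessel q) h z'\<bar>) (at_right 0)"
   by (intro tendsto_intros single_layer_boundary_limit[OF q hm h] z)
  have ev: "\<forall>\<^sub>F e in at_right 0. \<bar>2 * layer (bessel q) h (z + (e, 0)) - 2 * layer (bessel q) h (z' + (e, 0))\<bar> \<le> C * dist z z' powr \<beta>"
   using eventually_at_right_less[of "0::real"]
  proof eventually_elim
   case (elim e)
   then show ?case using C(2)[of "z + (e, 0)" "z' + (e, 0)"] z by (auto simp: half_space_def closed_half_space_def)
  qed
  from tendsto_upperbound[OF lim ev] show ?thesis by simp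
 qed
 then show ?thesis using C(1) by blast
qed

theorem single_layer_C2:
 fixes h :: "real^'n \<Rightarrow> real"
 assumes q: "q > 0" and hm[measurable]: "h \<in> Borel" and h: "\<And>y. \<bar>h y\<bar> \<le> M"
 shows "Ck_on 2 (\<lambda>z. 2 * layer (bessel q) h z) half_space"
  and "z \<in> half_space \<Longrightarrow> laplacian (\<lambda>z. 2 * layer (bessel q) h z) z = 4 * q * (2 * layer (bessel q) h z)"
proof -
 have b: "\<bar>h y / pi powr ((1 + real CARD('n)) / 2)\<bar> \<le> M / pi powr ((1 + real CARD('n)) / 2)" for y
  using h[of y] by (simp add: divide_right_mono)
 show "Ck_on 2 (\<lambda>z. 2 * layer (bessel q) h z) half_space"
  unfolding single_layer_radial by (rule layer_radial_C2[OF q _ b]) measurable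
 show "laplacian (\<lambda>z. 2 * layer (bessel q) h z) z = 4 * q * (2 * layer (bessel q) h z)" if "z \<in> half_space"
  unfolding single_layer_radial by (rule layer_radial_laplacian[OF q _ b that]) measurable
qed

text \<open>The gradient in the open half space extends to the boundary, and the normal derivative of the
 extension is identified by continuity with the limit along the normal. A Hoelder exponent \<open>(1 + \<alpha>)
 / 2\<close> of the density suffices for the exponent \<open>\<alpha>\<close> of the gradient.\<close>

theorem single_layer_C1:
 fixes h :: "real^'n \<Rightarrow> real"
 assumes q: "q > 0" and hm[measurable]: "h \<in> Borel" and h: "\<And>y. \<bar>h y\<bar> \<le> M"
  and hol: "\<And>\<beta>. 0 < \<beta> \<Longrightarrow> \<beta> < 1 \<Longrightarrow> \<exists>L\<ge>0. \<forall>y y'. \<bar>h y - h y'\<bar> \<le> L * dist y y' powr \<beta>"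
 shows "\<forall>\<alpha>\<in>{0<..<1}. C1_holder_on \<alpha> (\<lambda>z. 2 * layer (bessel q) h z) half_space"
  and "\<exists>G. C1_gradient_on closed_half_space (\<lambda>z. 2 * layer (bessel q) h z) G"
  and "((\<lambda>x. 2 * layer (bessel q) h (x, y)) has_real_derivative - h y) (at_right 0)"
proof -
 let ?k = "real CARD('n)"
 define P where "P = pi powr ((1 + ?k) / 2)"
 have P: "P > 0" by (simp add: P_def)
 define g where "g y = h y / P" for y
 have gm: "g \<in> Borel" unfolding g_def[abs_def] by measurable
 have gb: "\<bar>g y\<bar> \<le> M / P" for y using h[of y] P by (simp add: g_def divide_right_mono)
 have ghol: "\<exists>L\<ge>0. \<forall>y y'. \<bar>g y - g y'\<bar> \<le> L * dist y y' powr \<beta>" if "0 < \<beta>" "\<beta> < 1" for \<beta>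
 proof -
  obtain L where L: "L \<ge> 0" "\<And>y y'. \<bar>h y - h y'\<bar> \<le> L * dist y y' powr \<beta>" using hol[OF \<open>0 < \<beta>\<close> \<open>\<beta> < 1\<close>] by blast
  have "\<bar>g y - g y'\<bar> \<le> (L / P) * dist y y' powr \<beta>" for y y'
   using divide_right_mono[OF L(2)[of y y'], of P] P by (simp add: g_def diff_divide_distrib[symmetric])
  then show ?thesis using L(1) P by (intro exI[of _ "L / P"]) auto
 qed
 define w where "w z = 2 * layer (bessel q) h z" for z
 have w: "w z = layer (radial q ?k) g z" for z by (simp add: w_def single_layer_radial g_def[abs_def] P_def)
 define G where "G = gradient w"
 have G: "G z \<bullet> b = layer (\<lambda>z. radial1 q ?k z \<bullet> b) g z" if "z \<in> half_space" for z b
  unfolding G_def w[abs_def] by (rule gradient_inner[OF layer_radial_derivative[OF q gm gb that]])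
 have der: "(w has_derivative (\<lambda>d. G z \<bullet> d)) (at z)" if "z \<in> half_space" for z
  using layer_radial_derivative[OF q gm gb that, of ?k] unfolding G[OF that] w[abs_def] .
 have GH: "\<exists>C\<ge>0. \<forall>z\<in>half_space. \<forall>z'\<in>half_space. norm (G z - G z') \<le> C * dist z z' powr \<alpha>" if \<alpha>: "0 < \<alpha>" "\<alpha> < 1" for \<alpha>
 proof -
  obtain L where L: "L \<ge> 0" "\<And>y y'. \<bar>g y - g y'\<bar> \<le> L * dist y y' powr ((1 + \<alpha>) / 2)" using ghol[of "(1 + \<alpha>) / 2"] \<alpha> by auto
  have "\<forall>b. \<exists>C\<ge>0. \<forall>z\<in>half_space. \<forall>z'\<in>half_space. \<bar>G z \<bullet> b - G z' \<bullet> b\<bar> \<le> C * dist z z' powr \<alpha>"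
   using layer_radial1_Hoelder[OF q gm gb \<alpha>(1) _ _ L] \<alpha> by (simp add: G)
  then obtain c where c: "\<And>b. c b \<ge> 0" "\<And>b z z'. z \<in> half_space \<Longrightarrow> z' \<in> half_space \<Longrightarrow> \<bar>G z \<bullet> b - G z' \<bullet> b\<bar> \<le> c b * dist z z' powr \<alpha>"
   by metis
  have "norm (G z - G z') \<le> (\<Sum>b\<in>Basis. c b) * dist z z' powr \<alpha>" if "z \<in> half_space" "z' \<in> half_space" for z z'
  proof -
   have "norm (G z - G z') \<le> (\<Sum>b\<in>Basis. \<bar>(G z - G z') \<bullet> b\<bar>)" by (rule norm_le_l1)
   also have "\<dots> \<le> (\<Sum>b\<in>Basis. c b * dist z z' powr \<alpha>)" by (intro sum_mono) (simp add: inner_diff_left c(2) that)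
   finally show ?thesis by (simp add: sum_distrib_right)
  qed
  then show ?thesis using c(1) by (intro exI[of _ "\<Sum>b\<in>Basis. c b"]) (auto intro: sum_nonneg)
 qed
 obtain C where C: "C \<ge> 0" "\<And>z z'. z \<in> half_space \<Longrightarrow> z' \<in> half_space \<Longrightarrow> norm (G z - G z') \<le> C * dist z z' powr (1/2)"
  using GH[of "1/2"] by auto
 have lim: "((\<lambda>e. w (z + (e, 0))) \<longlongrightarrow> w z) (at_right 0)" if "z \<in> closed_half_space" for z
  unfolding w_def by (rule single_layer_boundary_limit[OF q hm h that])
 obtain g' where g': "C1_gradient_on closed_half_space w g'" "\<And>z. z \<in> half_space \<Longrightarrow> g' z = G z"
  by (rule C1_up_to_boundary[OF _ C(1) der C(2) lim]) (auto intro: that)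
 then show "\<exists>G. C1_gradient_on closed_half_space (\<lambda>z. 2 * layer (bessel q) h z) G" unfolding w_def[abs_def] by blast
 have gd: "(w has_derivative (\<lambda>d. g' z \<bullet> d)) (at z within closed_half_space)" if "z \<in> closed_half_space" for z
  using g'(1) that by (simp add: C1_gradient_on_def)
 have gc: "continuous_on closed_half_space g'" using g'(1) by (simp add: C1_gradient_on_def)
 have sub: "half_space \<subseteq> (closed_half_space :: (real \<times> (real^'n)) set)" by (auto simp: half_space_def closed_half_space_def)
 have "C1_gradient_on half_space w G"
  unfolding C1_gradient_on_def
 proof (intro conjI ballI)
  show "continuous_on half_space G" using continuous_on_subset[OF gc sub] g'(2) by (simp cong: continuous_on_cong)
  show "(w has_derivative (\<lambda>d. G z \<bullet> d)) (at z within half_space)" if "z \<in> half_space" for z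
   by (rule has_derivative_at_withinI[OF der[OF that]])
 qed
 then show "\<forall>\<alpha>\<in>{0<..<1}. C1_holder_on \<alpha> (\<lambda>z. 2 * layer (bessel q) h z) half_space"
  using GH unfolding C1_holder_on_def w_def[abs_def] by fastforce
 have y: "(0, y) \<in> (closed_half_space :: (real \<times> (real^'n)) set)" by (simp add: closed_half_space_def)
 have t: "((\<lambda>x. (x, y)) \<longlongrightarrow> (0, y)) (at_right 0)" by (intro tendsto_intros)
 have ev: "\<forall>\<^sub>F x in at_right 0. (x, y) \<in> half_space" by (simp add: mem_half_space eventually_at_right_less)
 have "((\<lambda>x. g' (x, y) \<bullet> (1, 0)) \<longlongrightarrow> g' (0, y) \<bullet> (1, 0)) (at_right 0)"
  by (intro tendsto_intros continuous_on_tendsto_compose[OF gc t y] eventually_mono[OF ev]) (use sub in blast)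
 moreover obtain L where L: "L \<ge> 0" "\<And>y y'. \<bar>g y - g y'\<bar> \<le> L * dist y y' powr (1 / 2)" using ghol[of "1/2"] by auto
 have "((\<lambda>x. g' (x, y) \<bullet> (1, 0)) \<longlongrightarrow> - P * g y) (at_right 0)"
 proof (rule Lim_transform_eventually)
  show "((\<lambda>x. layer (\<lambda>z. radial1 q ?k z \<bullet> (1, 0)) g (x, y)) \<longlongrightarrow> - P * g y) (at_right 0)"
   unfolding P_def by (rule normal_derivative_limit[OF q gm gb L])
  show "\<forall>\<^sub>F x in at_right 0. layer (\<lambda>z. radial1 q ?k z \<bullet> (1, 0)) g (x, y) = g' (x, y) \<bullet> (1, 0)"
   using ev by eventually_elim (simp add: g'(2) G)
 qed
 ultimately have n: "g' (0, y) \<bullet> (1, 0) = - h y"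
  using tendsto_unique[OF trivial_limit_at_right_real] P by (fastforce simp: g_def)
 have "((\<lambda>x. (x, y)) has_derivative (\<lambda>t. (t, 0))) (at_right (0::real))" by (auto intro!: derivative_eq_intros)
 moreover have "(w has_derivative (\<lambda>d. g' (0, y) \<bullet> d)) (at (0, y) within (\<lambda>x. (x, y)) ` {0<..})"
  by (rule has_derivative_subset[OF gd[OF y]]) (auto simp: closed_half_space_def)
 ultimately have "((\<lambda>x. w (x, y)) has_derivative (\<lambda>t. g' (0, y) \<bullet> (t, 0))) (at_right 0)"
  by (rule has_derivative_in_compose)
 moreover have "(\<lambda>t. g' (0, y) \<bullet> (t, 0)) = (*) (- h y)"
  using n by (simp add: inner_prod_def fun_eq_iff)
 ultimately show "((\<lambda>x. 2 * layer (bessel q) h (x, y)) has_real_derivative - h y) (at_right 0)"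
  by (simp only: has_field_derivative_def w_def)
qed

section \<open>From bounded traces to classical solutions\<close>

lemma continuous_bounded_on_interval:
 fixes f :: "real \<Rightarrow> real"
 assumes "continuous_on UNIV f"
 obtains B where "B \<ge> 0" "\<And>t. t \<in> {a..b} \<Longrightarrow> \<bar>f t\<bar> \<le> B"
proof -
 have "bounded (f ` {a..b})" by (intro compact_imp_bounded compact_continuous_image continuous_on_subset[OF assms]) auto
 then obtain B where "B > 0" "\<And>t. t \<in> {a..b} \<Longrightarrow> \<bar>f t\<bar> \<le> B" unfolding bounded_pos by force
 then show ?thesis by (intro that[of B]) auto
qed

text \<open>Near zero and near infinity the two limits give the bounds \<open>\<bar>t\<bar>\<close> and \<open>\<bar>t\<bar>\<^sup>p\<close>; on the compact
 interval between, a bound by a constant is a bound by a multiple of \<open>\<bar>t\<bar>\<close>.\<close>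

lemma nonlinearity_growth:
 fixes f :: "real \<Rightarrow> real"
 assumes cont: "continuous_on UNIV f" and neg: "\<And>t. t < 0 \<Longrightarrow> f t = 0"
  and zero: "((\<lambda>t. f t / t) \<longlongrightarrow> 0) (at 0)" and infinity: "((\<lambda>t. f t / t powr p) \<longlongrightarrow> 0) at_top"
 shows "\<exists>K>0. \<forall>t. \<bar>f t\<bar> \<le> K * (\<bar>t\<bar> + \<bar>t\<bar> powr p)"
proof -
 have f0: "f 0 = 0"
 proof -
  have "(f \<longlongrightarrow> f 0) (at_left 0)" using cont by (simp add: continuous_on_eq_continuous_at continuous_at_imp_continuous_at_within continuous_within[symmetric])
  moreover have "(f \<longlongrightarrow> 0) (at_left 0)"
   by (rule Lim_transform_eventually[OF tendsto_const]) (use neg in \<open>auto simp: eventually_at_filter\<close>)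
  ultimately show ?thesis using tendsto_unique[OF trivial_limit_at_left_real] by blast
 qed
 have "\<forall>\<^sub>F t in at 0. \<bar>f t / t\<bar> < 1" using tendstoD[OF zero, of 1] by simp
 then obtain d where d: "d > 0" "\<And>t. t \<noteq> 0 \<Longrightarrow> \<bar>t\<bar> < d \<Longrightarrow> \<bar>f t / t\<bar> < 1" by (auto simp: eventually_at)
 have "\<forall>\<^sub>F t in at_top. \<bar>f t / t powr p\<bar> < 1" using tendstoD[OF infinity, of 1] by simp
 then obtain T where T: "\<And>t. t \<ge> T \<Longrightarrow> \<bar>f t / t powr p\<bar> < 1" by (auto simp: eventually_at_top_linorder)
 obtain B where B: "B \<ge> 0" "\<And>t. t \<in> {d..max d T} \<Longrightarrow> \<bar>f t\<bar> \<le> B"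
  by (rule continuous_bounded_on_interval[OF cont], rule that)
 define K where "K = 1 + B / d"
 have K: "K \<ge> 1" using B(1) d by (simp add: K_def)
 have "\<bar>f t\<bar> \<le> K * (\<bar>t\<bar> + \<bar>t\<bar> powr p)" for t
 proof -
  have "\<bar>f t\<bar> \<le> K * \<bar>t\<bar> \<or> \<bar>f t\<bar> \<le> 1 * \<bar>t\<bar> powr p"
  proof (cases "t \<le> 0 \<or> t < d")
   case True
   then consider "t \<le> 0" | "0 < t" "t < d" by fastforce
   then show ?thesis
   proof cases
    case 1
    then have "f t = 0" using neg f0 by (cases "t = 0") auto
    then show ?thesis using K by simp
   next
    case 2
    then have "\<bar>f t\<bar> \<le> 1 * \<bar>t\<bar>" using d(2)[of t] by (simp add: abs_divide)
    also have "\<dots> \<le> K * \<bar>t\<bar>" using K by (intro mult_right_mono) auto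
    finally show ?thesis by simp
   qed
  next
   case False
   then have t: "t > 0" "d \<le> t" using d by auto
   show ?thesis
   proof (cases "t \<le> max d T")
    case True
    have "\<bar>f t\<bar> \<le> (B / d) * d" using B(2)[of t] True t d by auto
    also have "\<dots> \<le> (B / d) * t" using B(1) d t by (intro mult_left_mono) auto
    also have "\<dots> \<le> K * \<bar>t\<bar>" using t by (simp add: K_def distrib_right)
    finally show ?thesis by simp
   next
    case False
    then have "T \<le> t" by simp
    from T[OF this] t show ?thesis by (simp add: abs_divide less_imp_le)
   qed
  qed
  moreover have "1 * \<bar>t\<bar> powr p \<le> K * \<bar>t\<bar> powr p" "0 \<le> K * \<bar>t\<bar>" "0 \<le> K * \<bar>t\<bar> powr p"
   using K mult_right_mono[of 1 K "\<bar>t\<bar> powr p"] by auto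
  ultimately show ?thesis by (auto simp: distrib_left)
 qed
 then show ?thesis using K by (intro exI[of _ K]) auto
qed

text \<open>The derivative is bounded on the compact interval.\<close>

lemma C1_Lipschitz_on_bounded:
 fixes f :: "real \<Rightarrow> real"
 assumes "f C1_differentiable_on UNIV"
 obtains L where "L \<ge> 0" "\<And>s t. \<bar>s\<bar> \<le> M \<Longrightarrow> \<bar>t\<bar> \<le> M \<Longrightarrow> \<bar>f s - f t\<bar> \<le> L * \<bar>s - t\<bar>"
proof -
 obtain D where D: "\<And>x. (f has_vector_derivative D x) (at x)" "continuous_on UNIV D"
  using assms unfolding C1_differentiable_on_def by auto
 obtain L where L: "L \<ge> 0" "\<And>t. t \<in> {-M..M} \<Longrightarrow> \<bar>D t\<bar> \<le> L"
  by (rule continuous_bounded_on_interval[OF D(2)], rule that)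
 have "\<bar>f s - f t\<bar> \<le> L * \<bar>s - t\<bar>" if st: "\<bar>s\<bar> \<le> M" "\<bar>t\<bar> \<le> M" for s t
 proof -
  have "norm (f s - f t) \<le> L * norm (s - t)"
  proof (rule field_differentiable_bound[of "{-M..M}" f D])
   show "(f has_field_derivative D x) (at x within {-M..M})" for x
    using D(1)[of x] by (simp add: has_real_derivative_iff_has_vector_derivative has_vector_derivative_at_within)
   show "norm (D x) \<le> L" if "x \<in> {-M..M}" for x using L(2)[OF that] by simp
  qed (use st in auto)
  then show ?thesis by simp
 qed
 then show ?thesis using that[of L] L(1) by simp
qed

lemma layer_cong_AE:
 fixes h :: "real^'n \<Rightarrow> real"
 assumes [measurable]: "h \<in> Borel" "h' \<in> Borel" and e: "AE y in lborel. h y = h' y"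
 shows "layer (bessel q) h z = layer (bessel q) h' z"
 unfolding layer_def by (intro Bochner_Integration.integral_cong_AE) (use e in \<open>auto\<close>)

lemma single_layer_trace_bound:
 fixes h :: "real^'n \<Rightarrow> real"
 assumes q: "q > 0" and [measurable]: "h \<in> Borel" and h: "\<And>y. \<bar>h y\<bar> \<le> M"
 shows "\<bar>2 * layer (bessel q) h (0, y)\<bar> \<le> M * (\<integral>y. slice_ker q (y :: real^'n))"
proof -
 have i: "L1 (\<lambda>y'. slice_ker q (y - y'))" using slice_ker_integrable[OF q] by (simp add: integrable_lborel_reflect)
 have M: "M \<ge> 0" using h[of 0] by linarith
 have "\<bar>2 * layer (bessel q) h (0, y)\<bar> = norm (\<integral>y'. slice_ker q (y - y') * h y')"
  by (simp add: layer_def slice_ker_def mult.assoc)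
 also have "\<dots> \<le> (\<integral>y'. norm (slice_ker q (y - y') * h y'))" by (rule integral_norm_bound)
 also have "\<dots> \<le> (\<integral>y'. M * slice_ker q (y - y'))"
 proof (rule Bochner_Integration.integral_mono')
  fix y'
  show "norm (slice_ker q (y - y') * h y') \<le> M * slice_ker q (y - y')"
   using mult_left_mono[OF h[of y'] slice_ker_nonneg[of q "y - y'"]] by (simp add: abs_mult slice_ker_nonneg mult.commute)
 qed (use i M in \<open>auto simp: slice_ker_nonneg\<close>)
 also have "\<dots> = M * (\<integral>y. slice_ker q (y :: real^'n))"
  by (simp add: integral_lborel_reflect[of "slice_ker q"])
 finally show ?thesis .
qed

text \<open>Changing the density on a null set leaves the potential unchanged. The density is replaced
 twice: first by a truncation that is bounded everywhere, which makes \<open>w\<close> Hoelder continuous up to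
 the boundary, and then by \<open>f\<close> of the boundary values of \<open>w\<close>, which is therefore Hoelder
 continuous. The boundary condition then holds at every point.\<close>

theorem regularity_of_bounded_trace:
 fixes u :: "real^'n \<Rightarrow> real"
 assumes q: "q > 0" "4 * q = m\<^sup>2" and C1: "f C1_differentiable_on UNIV" and um[measurable]: "u \<in> Borel"
  and M: "AE y in lborel. \<bar>u y\<bar> \<le> M" and rep: "AE y in lborel. u y = 2 * layer (bessel q) (\<lambda>y. f (u y)) (0, y)"
 defines "w \<equiv> \<lambda>z. 2 * layer (bessel q) (\<lambda>y. f (u y)) z"
 shows "\<forall>\<alpha>\<in>{0<..<1}. C1_holder_on \<alpha> w half_space" "Ck_on 2 w half_space" "classical_solution m f w"
proof -
 have fc: "continuous_on UNIV f" using C1_differentiable_imp_continuous_on[OF C1] .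
 have fm[measurable]: "f \<in> Borel" using fc by (rule borel_measurable_continuous_onI)
 obtain B where B: "B \<ge> 0" "\<And>t. t \<in> {-\<bar>M\<bar>..\<bar>M\<bar>} \<Longrightarrow> \<bar>f t\<bar> \<le> B"
  by (rule continuous_bounded_on_interval[OF fc], rule that)
 define h1 where "h1 y = f (max (-\<bar>M\<bar>) (min \<bar>M\<bar> (u y)))" for y
 have h1m[measurable]: "h1 \<in> Borel" unfolding h1_def[abs_def] by measurable
 have h1b: "\<bar>h1 y\<bar> \<le> B" for y unfolding h1_def by (rule B(2)) auto
 have "AE y in lborel. f (u y) = h1 y"
  using M
 proof eventually_elim
  case (elim y)
  then have "max (-\<bar>M\<bar>) (min \<bar>M\<bar> (u y)) = u y" by linarith
  then show ?case by (simp add: h1_def)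
 qed
 then have w1: "w = (\<lambda>z. 2 * layer (bessel q) h1 z)" unfolding w_def by (intro ext arg_cong[where f="(*) 2"] layer_cong_AE) measurable
 define u2 where "u2 y = w (0, y)" for y
 define h2 where "h2 y = f (u2 y)" for y
 define M2 where "M2 = B * (\<integral>y. slice_ker q (y :: real^'n))"
 have u2b: "\<bar>u2 y\<bar> \<le> M2" for y unfolding u2_def w1 M2_def by (rule single_layer_trace_bound[OF q(1) h1m h1b])
 have wm: "w \<in> Borel" unfolding w1 by measurable
 then have u2m[measurable]: "u2 \<in> Borel" unfolding u2_def[abs_def] by measurable
 have h2m[measurable]: "h2 \<in> Borel" unfolding h2_def[abs_def] by measurable
 have "AE y in lborel. f (u y) = h2 y" using rep by eventually_elim (simp add: h2_def u2_def w_def)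
 then have w2: "w = (\<lambda>z. 2 * layer (bessel q) h2 z)" unfolding w_def by (intro ext arg_cong[where f="(*) 2"] layer_cong_AE) measurable
 obtain B2 where B2: "B2 \<ge> 0" "\<And>t. t \<in> {-M2..M2} \<Longrightarrow> \<bar>f t\<bar> \<le> B2"
  by (rule continuous_bounded_on_interval[OF fc], rule that)
 have h2b: "\<bar>h2 y\<bar> \<le> B2" for y unfolding h2_def by (rule B2(2)) (use u2b[of y] in auto)
 obtain L where L: "L \<ge> 0" "\<And>s t. \<bar>s\<bar> \<le> M2 \<Longrightarrow> \<bar>t\<bar> \<le> M2 \<Longrightarrow> \<bar>f s - f t\<bar> \<le> L * \<bar>s - t\<bar>"
  by (rule C1_Lipschitz_on_bounded[OF C1, of M2], rule that)
 have hol: "\<exists>L\<ge>0. \<forall>y y'. \<bar>h2 y - h2 y'\<bar> \<le> L * dist y y' powr \<beta>" if \<beta>: "0 < \<beta>" "\<beta> < 1" for \<beta>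
 proof -
  obtain C where C: "C \<ge> 0" "\<And>z z'. z \<in> closed_half_space \<Longrightarrow> z' \<in> closed_half_space \<Longrightarrow> \<bar>w z - w z'\<bar> \<le> C * dist z z' powr \<beta>"
   using single_layer_Hoelder[OF q(1) h1m h1b \<beta>] unfolding w1 by blast
  have "\<bar>h2 y - h2 y'\<bar> \<le> (L * C) * dist y y' powr \<beta>" for y y'
  proof -
   have "\<bar>u2 y - u2 y'\<bar> \<le> C * dist y y' powr \<beta>"
    using C(2)[of "(0, y)" "(0, y')"] by (simp add: u2_def closed_half_space_def dist_Pair_Pair)
   from mult_left_mono[OF this L(1)] L(2)[OF u2b u2b, of y y'] show ?thesis by (simp add: h2_def mult.assoc)
  qed
  then show ?thesis using L(1) C(1) by (intro exI[of _ "L * C"]) auto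
 qed
 note C1' = single_layer_C1[OF q(1) h2m h2b hol]
 note C2 = single_layer_C2[OF q(1) h2m h2b]
 show "\<forall>\<alpha>\<in>{0<..<1}. C1_holder_on \<alpha> w half_space" unfolding w2 by (rule C1'(1))
 show k2: "Ck_on 2 w half_space" unfolding w2 by (rule C2(1))
 show "classical_solution m f w"
  unfolding classical_solution_def
 proof (intro conjI ballI allI k2)
  show "\<exists>G. C1_gradient_on closed_half_space w G" unfolding w2 by (rule C1'(2))
  show "- laplacian w z + m\<^sup>2 * w z = 0" if "z \<in> half_space" for z
   using C2(2)[OF that] q(2) unfolding w2 by simp
  show "((\<lambda>x. w (x, y)) has_real_derivative - f (w (0, y))) (at_right 0)" for y
  proof -
   have "((\<lambda>x. w (x, y)) has_real_derivative - h2 y) (at_right 0)" unfolding w2 by (rule C1'(3))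
   then show ?thesis by (simp add: h2_def u2_def)
  qed
 qed
qed

text \<open>The conditions ask for \<open>2 r\<close> below the critical exponent \<open>2 N / (N - 1)\<close> and not below \<open>2\<close>,
 \<open>p\<close> and \<open>N (p - 1)\<close>; all three are subcritical, the last one precisely because \<open>p < (N + 1) / (N -
 1)\<close>.\<close>

lemma integrability_exponent:
 assumes N: "N \<ge> (2::real)" and p: "1 < p" "p < (N + 1) / (N - 1)"
 obtains r where "1 \<le> r" "r * (N - 1) < N" "p \<le> 2 * r" "N * (p - 1) < 2 * r"
proof -
 define X where "X = max (max 2 p) (N * (p - 1))"
 have pN: "p * (N - 1) < N + 1" using p N by (simp add: pos_less_divide_eq)
 have "X * (N - 1) < 2 * N"
 proof -
  have "N * (p * (N - 1) - (N - 1)) < N * 2" using pN N by (intro mult_strict_left_mono) auto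
  then have "N * (p - 1) * (N - 1) < 2 * N" by (simp add: algebra_simps)
  moreover have "p * (N - 1) < 2 * N" using pN N by linarith
  ultimately show ?thesis using N by (auto simp: X_def max_def)
 qed
 then have X: "X < 2 * N / (N - 1)" using N by (simp add: pos_less_divide_eq)
 define r where "r = (X + 2 * N / (N - 1)) / 4"
 have r: "X < 2 * r" "2 * r < 2 * N / (N - 1)" using X by (simp_all add: r_def)
 have "2 \<le> X" "p \<le> X" "N * (p - 1) \<le> X" by (simp_all add: X_def)
 moreover have "r * (N - 1) < N" using r(2) N by (simp add: pos_less_divide_eq)
 ultimately show ?thesis using r(1) by (intro that[of r]) linarith+
qed

text \<open>The growth bound and \<open>p \<le> 2 r\<close> give \<open>\<bar>f(u)\<bar> \<le> 2 K + 2 K \<bar>u\<bar>\<^bsup>2r\<^esup>\<close>, whose second summand is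
 integrable. The convolution of the kernel with the even reflection of a test function is
 admissible in the weak formulation and leads to the representation formula.\<close>

theorem weak_solution_regularity:
 fixes v :: "real \<times> (real ^ 'n) \<Rightarrow> real"
 assumes N: "CARD('n) \<ge> 2" and m: "m > 0" and C1: "f C1_differentiable_on UNIV"
  and p: "1 < p" "p < (real CARD('n) + 1) / (real CARD('n) - 1)"
  and K: "K > 0" "\<And>t. \<bar>f t\<bar> \<le> K * (\<bar>t\<bar> + \<bar>t\<bar> powr p)" and v: "weak_solution m f v"
 shows "\<exists>w. (AE z in lebesgue_on half_space. w z = v z) \<and> (\<forall>\<alpha>\<in>{0<..<1}. C1_holder_on \<alpha> w half_space) \<and>
      Ck_on 2 w half_space \<and> classical_solution m f w"
proof -
 define q where "q = m\<^sup>2 / 4"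
 have q: "q > 0" "4 * q = m\<^sup>2" using m by (simp_all add: q_def)
 have fc: "continuous_on UNIV f" using C1_differentiable_imp_continuous_on[OF C1] .
 have fm[measurable]: "f \<in> Borel" using fc by (rule borel_measurable_continuous_onI)
 obtain v0 G0 u \<phi> where
  a: "H1_approx v0 G0 u \<phi>" and vv0: "AE z in lebesgue_on half_space. v z = v0 z"
  and weak: "\<And>w. H1_gradient half_space w (gradient w) \<Longrightarrow> has_trace w (\<lambda>y. w (0, y)) \<Longrightarrow>
    w \<in> Borel \<Longrightarrow> gradient w \<in> Borel \<Longrightarrow>
    (\<integral>z. indicator half_space z * (G0 z \<bullet> gradient w z + m\<^sup>2 * v0 z * w z)) = (\<integral>y. f (u y) * w (0, y))"
  by (rule weak_solution_borel[OF v fc], rule that)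
 note bm = H1_approxD(1-3)[OF a] and sq = H1_approxD(4,5)[OF a] and squ = H1_approxD(6)[OF a]
 note [measurable] = bm
 obtain r where r: "1 \<le> r" "r * (real CARD('n) - 1) < real CARD('n)" "p \<le> 2 * r" "real CARD('n) * (p - 1) < 2 * r"
  by (rule integrability_exponent[OF _ p], use N in simp, rule that)
 have Q: "L1 (\<lambda>y. \<bar>u y\<bar> powr (2 * r))"
  by (rule trace_integrability[OF a r(1,2)])
 define h where "h y = f (u y)" for y
 have hm: "h \<in> Borel" unfolding h_def[abs_def] by measurable
 define k where "k y = 2 * K * \<bar>u y\<bar> powr (2 * r)" for y
 have km: "k \<in> Borel" unfolding k_def[abs_def] by measurable
 have k: "0 \<le> k y" "L1 k" for y using K Q by (simp_all add: k_def[abs_def])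
 have hb: "\<bar>h y\<bar> \<le> 2 * K + k y" for y
 proof -
  have *: "\<bar>u y\<bar> powr s \<le> 1 + \<bar>u y\<bar> powr (2 * r)" if "0 \<le> s" "s \<le> 2 * r" for s
  proof (cases "\<bar>u y\<bar> \<le> 1")
   case True
   then have "\<bar>u y\<bar> powr s \<le> 1" using that by (intro powr_le1) auto
   then show ?thesis by (simp add: add_increasing2)
  next
   case False
   then have "\<bar>u y\<bar> powr s \<le> \<bar>u y\<bar> powr (2 * r)" using that by (intro powr_mono) auto
   then show ?thesis by simp
  qed
  have "\<bar>u y\<bar> + \<bar>u y\<bar> powr p \<le> 2 * (1 + \<bar>u y\<bar> powr (2 * r))" using *[of 1] *[of p] r p by simp
  from mult_left_mono[OF this, of K] K(2)[of "u y"] K(1) show ?thesis by (simp add: h_def k_def algebra_simps)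
 qed
 have K2: "0 \<le> 2 * K" using K by simp
 have rep: "AE z in lborel. z \<in> half_space \<longrightarrow> v0 z = 2 * layer (bessel q) h z"
 proof (rule single_layer_representation[OF q(1) bm(1) hm km sq(1) hb k K2])
  fix \<psi> :: "real \<times> (real^'n) \<Rightarrow> real" assume \<psi>: "test_function half_space \<psi>"
  note e = even_ext_test[OF \<psi>]
  let ?w = "bessel_conv q (even_ext \<psi>)"
  have Cw: "Ck_on k ?w UNIV" for k by (rule Ck_on_bessel_conv[OF q(1) e])
  have wm: "?w \<in> Borel" using Cw[of 0] by (simp add: borel_measurable_continuous_onI)
  have gwm: "gradient ?w \<in> Borel" unfolding gradient_def[abs_def]
   using Cw[of 1] by (intro borel_measurable_continuous_onI continuous_intros) auto
  show "(\<integral>z. indicator half_space z * (v0 z * \<psi> z)) = (\<integral>y. h y * ?w (0, y))"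
   using weak[OF bessel_conv_H1_trace[OF q(1) e] wm gwm] weak_limit_identity[OF q(1) \<psi> a]
   by (simp add: h_def q(2))
 qed
 have tr: "AE y in lborel. u y = 2 * layer (bessel q) h (0, y)"
 proof (rule trace_eq_layer[OF q(1) bm(1,3) hm km hb k K2 rep])
  fix e :: real assume e: "e > 0"
  show "(\<integral>\<^sub>+z. indicator {0<..<e} (fst z) * (v0 z - u (snd z))\<^sup>2)
    \<le> ennreal (e\<^sup>2 * (24 * (\<integral>z. indicator half_space z * (norm (G0 z))\<^sup>2)))"
   using trace_increment_bound[OF a e] by (simp add: mult_ac)
 qed
 obtain M where M: "AE y in lborel. \<bar>u y\<bar> \<le> M"
  using trace_bounded[OF N q(1) bm(3) squ Q r(4) p(1) fm K tr[unfolded h_def[abs_def]]] by blast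
 note reg = regularity_of_bounded_trace[OF q C1 bm(3) M tr[unfolded h_def[abs_def]]]
 have "AE z in lebesgue_on half_space. v0 z = 2 * layer (bessel q) (\<lambda>y. f (u y)) z"
  unfolding AE_lebesgue_on[OF half_space_borel] using rep by (simp add: h_def[abs_def])
 with vv0 have "AE z in lebesgue_on half_space. 2 * layer (bessel q) (\<lambda>y. f (u y)) z = v z"
  by eventually_elim simp
 with reg show ?thesis by (intro exI[of _ "\<lambda>z. 2 * layer (bessel q) (\<lambda>y. f (u y)) z"] conjI)
qed

theorem theorem2:
 fixes f :: "real \<Rightarrow> real" and m p :: real and v :: "real \<times> (real ^ 'n) \<Rightarrow> real"
 assumes "CARD('n) \<ge> 2"
  and "m > 0"
  and "f C1_differentiable_on UNIV"
  and "\<And>t. t < 0 \<Longrightarrow> f t = 0"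
  and "((\<lambda>t. f t / t) \<longlongrightarrow> 0) (at 0)"
  and "1 < p" and "p < (real CARD('n) + 1) / (real CARD('n) - 1)"
  and "((\<lambda>t. f t / t powr p) \<longlongrightarrow> 0) at_top"
  and "weak_solution m f v"
 shows "\<exists>w. (AE z in lebesgue_on half_space. w z = v z) \<and>
      (\<forall>\<alpha>\<in>{0<..<1}. C1_holder_on \<alpha> w half_space) \<and>
      Ck_on 2 w half_space \<and>
      classical_solution m f w"
proof -
 have "continuous_on UNIV f" using assms(3) by (rule C1_differentiable_imp_continuous_on)
 from nonlinearity_growth[OF this assms(4,5,8)]
 obtain K where "K > 0" "\<And>t. \<bar>f t\<bar> \<le> K * (\<bar>t\<bar> + \<bar>t\<bar> powr p)" by blast
 from weak_solution_regularity[OF assms(1-3,6,7) this assms(9)] show ?thesis .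
qed

end
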